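(* Let $\mathcal{F}=\{F_1,\ldots,F_s\}\subset\mathbb{K}[x,y,z]$, $s\ge 2$, be such that its zero set $\mathcal{C}\subset\mathbb{F}^3$ is an irreducible (over $\mathbb{F}$), real, non-planar affine space curve, and assume: (i) $\mathrm{card}(\mathcal{C}^\infty)=\deg(\mathcal{C})$; (ii) $\pi_z:\mathcal{C}\to\pi_z(\mathcal{C})^*$ is birational and $\deg(\mathcal{C})=\deg(\pi_z(\mathcal{C})^* )$; (iii) $(1:0:\lambda:0),(0:1:\mu:0),(0:0:1:0)\notin\mathcal{C}^\infty$ for all $\lambda,\mu\in\mathbb{F}$; (iv) if $(1:\lambda:\mu:0),(1:\lambda:\mu^*:0)\in\mathcal{C}^\infty$ then $\mu=\mu^*$; (v) the coefficient of $z^{\mathrm{tdeg}(F_1)}$ in $F_1$ is a non-zero constant. Let $\mathcal{D}\subset\mathbb{F}^2$ be the rational plane curve given by a rational parametrization $\mathcal{Q}(t)=\left(\frac{p_1(t)}{q(t)},\frac{p_2(t)}{q(t)}\right)$, $p_1,p_2,q\in\mathbb{K}[t]$, such that $\deg(\mathcal{D})=\deg(\pi_z(\mathcal{C})^* )$, $\mathcal{D}^\infty=\pi_z(\mathcal{C})^\infty$, $\deg(p_i)\le\deg(q)=\deg(\mathcal{D})$ and $\gcd(p_i,q)=1$ for $i=1,2$, and such that every point of $\mathcal{D}^\infty$ is of the form $(p_1(t_0):p_2(t_0):q(t_0))$ for some $t_0\in\mathbb{F}$. Let $\overline{\mathcal{C}}$ be the output space curve, i.e. the curve parametrized by $\mathcal{P}(t)=\left(\frac{p_1(t)}{q(t)},\frac{p_2(t)}{q(t)},\frac{p_3(t)}{q(t)}\right)$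 with $p_3$ the interpolating polynomial described in the context. Then $$\mathrm{H}(\mathcal{C}\cap\mathbb{R}^3,\overline{\mathcal{C}}\cap\mathbb{R}^3)<\infty.$$
   Context: $\mathbb{K}$ is a computable subfield of $\mathbb{R}$ and $\mathbb{F}\subset\mathbb{C}$ is its algebraic closure. For $\mathcal{A}\subset\mathbb{F}^n$ ($n=2,3$), $\mathcal{A}^*$ denotes its Zariski closure, $\mathcal{A}^h$ the projective closure of $\mathcal{A}^*$ in $\mathbb{P}^n(\mathbb{F})$, and $\mathcal{A}^\infty$ the intersection of $\mathcal{A}^h$ with the hyperplane $w=0$; projective coordinates are $(x:y:z:w)$ in $\mathbb{P}^3(\mathbb{F})$ and $(x:y:w)$ in $\mathbb{P}^2(\mathbb{F})$. $\pi_z:\mathbb{F}^3\to\mathbb{F}^2$ is $(x,y,z)\mapsto(x,y)$. $\mathrm{tdeg}$ is the total degree. A curve is real if it has infinitely many real points; it is planar if it is contained in a plane. The curve given by a rational parametrization is the Zariski closure of its image. For the real parts, the curves are regarded in $\mathbb{C}^3$ via the same defining polynomials: $\mathcal{C}\cap\mathbb{R}^3$ and $\overline{\mathcal{C}}\cap\mathbb{R}^3$ are the sets of points of $\mathbb{R}^3$ satisfying the defining equations of $\mathcal{C}$ and $\overline{\mathcal{C}}$. Construction of the output curve. Let $d=\deg(\mathcal{C})$. The hypotheses imply that $\deg(q)=d$, that $q$ is square-free with roots $\xi_1,\ldots,\xi_d\in\mathbb{F}$, that $p_1(\xi_i)\neq 0$, and that $\mathcal{D}^\infty=\{(1:p_2(\xi_i)/p_1(\xi_i):0)\}_{i=1,\ldots,d}$.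 For each $i$ there is a unique $\chi_i\in\mathbb{F}$ with $(1:p_2(\xi_i)/p_1(\xi_i):\chi_i:0)\in\mathcal{C}^\infty$. Then $p_3(t)$ is the unique polynomial of degree less than $d$ such that $p_3(\xi_i)=p_1(\xi_i)\chi_i$ for $i=1,\ldots,d$. Hausdorff distance. With $\mathrm{d}$ the Euclidean distance on $\mathbb{R}^3$, for non-empty $B\subset\mathbb{R}^3$ and $a\in\mathbb{R}^3$ put $\mathrm{d}(a,B)=\inf_{b\in B}\mathrm{d}(a,b)$. For non-empty $A,B$ put $\mathrm{H}(A,B)=\max\{\sup_{a\in A}\mathrm{d}(a,B),\sup_{b\in B}\mathrm{d}(b,A)\}$; by convention $\mathrm{H}(\emptyset,\emptyset)=0$ and $\mathrm{H}(A,\emptyset)=\infty$ for $A\neq\emptyset$. *)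

theory Defs
  imports
    "HOL-Analysis.Analysis"
    "HOL-Library.Poly_Mapping"
    "HOL-Library.Extended_Nat"
    "HOL-Computational_Algebra.Polynomial"
begin

section \<open>Computable subfields and algebraic closures\<close>

text \<open>
  Total recursive functions of a given arity, closed under minimization of regular functions.
  A function of arity \<open>n\<close> only matters on lists of length \<open>n\<close>.
\<close>

inductive recursive_fun :: "nat \<Rightarrow> (nat list \<Rightarrow> nat) \<Rightarrow> bool" where
  zero: "recursive_fun n (\<lambda>_. 0)"
| succ: "recursive_fun 1 (\<lambda>xs. Suc (xs ! 0))"
| proj: "i < n \<Longrightarrow> recursive_fun n (\<lambda>xs. xs ! i)"
| comp: "recursive_fun (length gs) f \<Longrightarrow> \<forall>g\<in>set gs. recursive_fun n g
    \<Longrightarrow> recursive_fun n (\<lambda>xs. f (map (\<lambda>g. g xs) gs))"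
| prim_rec: "recursive_fun n f \<Longrightarrow> recursive_fun (Suc (Suc n)) g
    \<Longrightarrow> recursive_fun (Suc n) (\<lambda>xs. rec_nat (f (tl xs)) (\<lambda>k r. g (k # r # tl xs)) (hd xs))"
| minimize: "recursive_fun (Suc n) f \<Longrightarrow> \<forall>xs. length xs = n \<longrightarrow> (\<exists>k. f (k # xs) = 0)
    \<Longrightarrow> recursive_fun n (\<lambda>xs. LEAST k. f (k # xs) = 0)"

definition is_subfield :: "'a::field set \<Rightarrow> bool" where
  "is_subfield K \<longleftrightarrow> 0 \<in> K \<and> 1 \<in> K \<and>
    (\<forall>x\<in>K. \<forall>y\<in>K. x + y \<in> K \<and> x * y \<in> K) \<and> (\<forall>x\<in>K. - x \<in> K \<and> inverse x \<in> K)"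

text \<open>
  Computability in the sense of Rabin: an injective coding by natural numbers with recursive
  image under which addition and multiplication are recursive. Negation and inversion are then
  recursive by search.
\<close>

definition computable_subfield :: "'a::field set \<Rightarrow> bool" where
  "computable_subfield K \<longleftrightarrow> is_subfield K \<and>
    (\<exists>code. inj_on code K \<and>
       (\<exists>f. recursive_fun 1 f \<and> (\<forall>n. f [n] = (if n \<in> code ` K then 1 else 0))) \<and>
       (\<exists>f. recursive_fun 2 f \<and> (\<forall>x\<in>K. \<forall>y\<in>K. f [code x, code y] = code (x + y))) \<and>
       (\<exists>f. recursive_fun 2 f \<and> (\<forall>x\<in>K. \<forall>y\<in>K. f [code x, code y] = code (x * y))))"

definition upolys_over :: "'a::zero set \<Rightarrow> 'a poly set" where
  "upolys_over K = {p. \<forall>i. coeff p i \<in> K}"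

definition alg_closure :: "complex set \<Rightarrow> complex set" where
  "alg_closure K = {z. \<exists>p\<in>upolys_over K. p \<noteq> 0 \<and> poly p z = 0}"


section \<open>Multivariate polynomials\<close>

text \<open>Exponent vectors are finitely supported functions, and so are coefficient families.\<close>

type_synonym 'v cmpoly = "('v \<Rightarrow>\<^sub>0 nat) \<Rightarrow>\<^sub>0 complex"

definition monom_deg :: "('v \<Rightarrow>\<^sub>0 nat) \<Rightarrow> nat" where
  "monom_deg m = (\<Sum>i\<in>Poly_Mapping.keys m. Poly_Mapping.lookup m i)"

definition monom_eval :: "('v \<Rightarrow>\<^sub>0 nat) \<Rightarrow> ('v \<Rightarrow> complex) \<Rightarrow> complex" where
  "monom_eval m x = (\<Prod>i\<in>Poly_Mapping.keys m. x i ^ Poly_Mapping.lookup m i)"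

definition mpoly_eval :: "'v cmpoly \<Rightarrow> ('v \<Rightarrow> complex) \<Rightarrow> complex" where
  "mpoly_eval P x = (\<Sum>m\<in>Poly_Mapping.keys P. Poly_Mapping.lookup P m * monom_eval m x)"

definition tdeg :: "'v cmpoly \<Rightarrow> nat" where
  "tdeg P = Max (insert 0 (monom_deg ` Poly_Mapping.keys P))"

text \<open>The value at \<open>(x : w)\<close> of the homogenization of \<open>P\<close> by the additional variable \<open>w\<close>.\<close>

definition hom_eval :: "'v cmpoly \<Rightarrow> ('v \<Rightarrow> complex) \<Rightarrow> complex \<Rightarrow> complex" where
  "hom_eval P x w = (\<Sum>m\<in>Poly_Mapping.keys P.
     Poly_Mapping.lookup P m * monom_eval m x * w ^ (tdeg P - monom_deg m))"

definition mpolys_over :: "complex set \<Rightarrow> 'v cmpoly set" where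
  "mpolys_over K = {P. \<forall>m. Poly_Mapping.lookup P m \<in> K}"


section \<open>Affine algebraic sets\<close>

text \<open>Throughout, \<open>\<FF>\<close> is an algebraically closed subfield of the complex numbers.\<close>

definition affine_space :: "complex set \<Rightarrow> (complex ^ 'n) set" where
  "affine_space \<FF> = {v. \<forall>i. v $ i \<in> \<FF>}"

definition zero_set :: "complex set \<Rightarrow> 'n::finite cmpoly set \<Rightarrow> (complex ^ 'n) set" where
  "zero_set \<FF> S = {v \<in> affine_space \<FF>. \<forall>P\<in>S. mpoly_eval P (($) v) = 0}"

definition vanishing_ideal :: "complex set \<Rightarrow> (complex ^ 'n) set \<Rightarrow> 'n::finite cmpoly set" where
  "vanishing_ideal \<FF> A = {P \<in> mpolys_over \<FF>. \<forall>v\<in>A. mpoly_eval P (($) v) = 0}"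

definition zariski_closed :: "complex set \<Rightarrow> (complex ^ 'n::finite) set \<Rightarrow> bool" where
  "zariski_closed \<FF> V \<longleftrightarrow> (\<exists>S \<subseteq> mpolys_over \<FF>. V = zero_set \<FF> S)"

definition zariski_closure :: "complex set \<Rightarrow> (complex ^ 'n::finite) set \<Rightarrow> (complex ^ 'n) set" where
  "zariski_closure \<FF> A = zero_set \<FF> (vanishing_ideal \<FF> A)"

definition zariski_irreducible :: "complex set \<Rightarrow> (complex ^ 'n::finite) set \<Rightarrow> bool" where
  "zariski_irreducible \<FF> V \<longleftrightarrow> zariski_closed \<FF> V \<and> V \<noteq> {} \<and>
     (\<forall>V1 V2. zariski_closed \<FF> V1 \<and> zariski_closed \<FF> V2 \<and> V = V1 \<union> V2 \<longrightarrow> V = V1 \<or> V = V2)"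

definition zariski_dim :: "complex set \<Rightarrow> (complex ^ 'n::finite) set \<Rightarrow> enat" where
  "zariski_dim \<FF> V = Sup {enat n | n. \<exists>W :: nat \<Rightarrow> (complex ^ 'n) set.
     (\<forall>i\<le>n. zariski_irreducible \<FF> (W i) \<and> W i \<subseteq> V) \<and> (\<forall>i<n. W i \<subset> W (Suc i))}"

definition irreducible_curve :: "complex set \<Rightarrow> (complex ^ 'n::finite) set \<Rightarrow> bool" where
  "irreducible_curve \<FF> V \<longleftrightarrow> zariski_irreducible \<FF> V \<and> zariski_dim \<FF> V = 1"

definition planar :: "complex set \<Rightarrow> (complex ^ 3) set \<Rightarrow> bool" where
  "planar \<FF> A \<longleftrightarrow> (\<exists>a\<in>affine_space \<FF>. \<exists>b\<in>\<FF>. a \<noteq> 0 \<and> (\<forall>v\<in>A. (\<Sum>i\<in>UNIV. a $ i * v $ i) + b = 0))"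

text \<open>
  A polynomial map \<open>\<phi> : V \<rightarrow> W\<close> between irreducible algebraic sets is birational if there is a
  rational map \<open>\<psi> : W \<rightarrow> V\<close>, with coordinates \<open>num i / den i\<close>, such that both composites are
  defined on a dense open set and equal to the identity there. By irreducibility, dense just
  means non-empty.
\<close>

definition birational_onto :: "complex set \<Rightarrow> (complex ^ 'm \<Rightarrow> complex ^ 'n)
    \<Rightarrow> (complex ^ 'm::finite) set \<Rightarrow> (complex ^ 'n::finite) set \<Rightarrow> bool" where
  "birational_onto \<FF> \<phi> V W \<longleftrightarrow> \<phi> ` V \<subseteq> W \<and>
    (\<exists>num den :: 'm \<Rightarrow> 'n cmpoly.
       let dom = {u. \<forall>i. mpoly_eval (den i) (($) u) \<noteq> 0};
           \<psi> = (\<lambda>u. \<chi> i. mpoly_eval (num i) (($) u) / mpoly_eval (den i) (($) u))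
       in (\<forall>i. num i \<in> mpolys_over \<FF> \<and> den i \<in> mpolys_over \<FF>) \<and>
          W \<inter> dom \<noteq> {} \<and> (\<forall>u \<in> W \<inter> dom. \<psi> u \<in> V \<and> \<phi> (\<psi> u) = u) \<and>
          V \<inter> \<phi> -` dom \<noteq> {} \<and> (\<forall>v \<in> V \<inter> \<phi> -` dom. \<psi> (\<phi> v) = v))"

definition \<pi>\<^sub>z :: "complex ^ 3 \<Rightarrow> complex ^ 2" where
  "\<pi>\<^sub>z v = vector [v $ 1, v $ 2]"


section \<open>Projective closure, points at infinity, degree\<close>

text \<open>
  The point \<open>(v : w)\<close> of projective space, as the class of its homogeneous coordinate vectors;
  \<open>w\<close> is the homogenizing coordinate. It is a projective point only if \<open>(v, w)\<close> is non-zero,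
  and the class of \<open>(0, 0)\<close> is different from all projective points.
\<close>

definition proj_pt :: "complex set \<Rightarrow> complex ^ 'n \<Rightarrow> complex \<Rightarrow> ((complex ^ 'n) \<times> complex) set" where
  "proj_pt \<FF> v w = {(c *s v, c * w) | c. c \<in> \<FF> \<and> c \<noteq> 0}"

definition proj_closure :: "complex set \<Rightarrow> (complex ^ 'n::finite) set
    \<Rightarrow> ((complex ^ 'n) \<times> complex) set set" where
  "proj_closure \<FF> A = {proj_pt \<FF> v w | v w. v \<in> affine_space \<FF> \<and> w \<in> \<FF> \<and> (v, w) \<noteq> (0, 0) \<and>
     (\<forall>P \<in> vanishing_ideal \<FF> (zariski_closure \<FF> A). hom_eval P (($) v) w = 0)}"

definition proj_hyperplane :: "complex set \<Rightarrow> complex ^ 'n::finite \<Rightarrow> complex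
    \<Rightarrow> ((complex ^ 'n) \<times> complex) set set" where
  "proj_hyperplane \<FF> a b = {proj_pt \<FF> v w | v w. v \<in> affine_space \<FF> \<and> w \<in> \<FF> \<and> (v, w) \<noteq> (0, 0) \<and>
     (\<Sum>i\<in>UNIV. a $ i * v $ i) + b * w = 0}"

definition pts_at_infinity :: "complex set \<Rightarrow> (complex ^ 'n::finite) set
    \<Rightarrow> ((complex ^ 'n) \<times> complex) set set" where
  "pts_at_infinity \<FF> A = proj_closure \<FF> A \<inter> proj_hyperplane \<FF> 0 1"

text \<open>
  The degree of a curve is the number of intersection points of its projective closure with a
  generic hyperplane \<open>a \<bullet> x + b w = 0\<close>, where generic means outside the zero set of some non-zero
  polynomial \<open>G\<close> in the coefficients \<open>(a, b)\<close>; the variable \<open>None\<close> of \<open>G\<close> stands for \<open>b\<close>.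
\<close>

definition curve_degree :: "complex set \<Rightarrow> (complex ^ 'n::finite) set \<Rightarrow> nat" where
  "curve_degree \<FF> A = (THE d. \<exists>G :: 'n option cmpoly. G \<in> mpolys_over \<FF> \<and> G \<noteq> 0 \<and>
     (\<forall>a\<in>affine_space \<FF>. \<forall>b\<in>\<FF>. mpoly_eval G (case_option b (($) a)) \<noteq> 0 \<longrightarrow>
        finite (proj_closure \<FF> A \<inter> proj_hyperplane \<FF> a b) \<and>
        card (proj_closure \<FF> A \<inter> proj_hyperplane \<FF> a b) = d))"


section \<open>Rational curves and the output curve\<close>

definition param_curve :: "complex set \<Rightarrow> complex poly ^ 'n::finite \<Rightarrow> complex poly \<Rightarrow> (complex ^ 'n) set" where
  "param_curve \<FF> p q =
     zariski_closure \<FF> {\<chi> i. poly (p $ i) t / poly q t | t. t \<in> \<FF> \<and> poly q t \<noteq> 0}"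

text \<open>
  The points at infinity of the plane curve are \<open>(1 : p2 \<xi> / p1 \<xi> : 0)\<close> for the roots \<open>\<xi>\<close> of \<open>q\<close>.
  Each lifts to a unique point \<open>(1 : p2 \<xi> / p1 \<xi> : \<zeta> : 0)\<close> of \<open>C\<close> at infinity, and the numerator of
  the third coordinate interpolates \<open>p1 \<xi> * \<zeta>\<close> at \<open>\<xi>\<close>. Existence and uniqueness of \<open>\<zeta>\<close> and of the
  interpolating polynomial depend on the hypotheses on \<open>C\<close>, \<open>p1\<close>, \<open>p2\<close>, \<open>q\<close>.
\<close>

definition lift_coord :: "complex set \<Rightarrow> (complex ^ 3) set \<Rightarrow> complex poly \<Rightarrow> complex poly
    \<Rightarrow> complex \<Rightarrow> complex" where
  "lift_coord \<FF> C p1 p2 \<xi> = (THE \<zeta>. \<zeta> \<in> \<FF> \<and>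
     proj_pt \<FF> (vector [1, poly p2 \<xi> / poly p1 \<xi>, \<zeta>]) 0 \<in> pts_at_infinity \<FF> C)"

definition interp_numerator :: "complex set \<Rightarrow> (complex ^ 3) set \<Rightarrow> complex poly \<Rightarrow> complex poly
    \<Rightarrow> complex poly \<Rightarrow> complex poly" where
  "interp_numerator \<FF> C p1 p2 q = (THE p3. p3 \<in> upolys_over \<FF> \<and> degree p3 < curve_degree \<FF> C \<and>
     (\<forall>\<xi>\<in>\<FF>. poly q \<xi> = 0 \<longrightarrow> poly p3 \<xi> = poly p1 \<xi> * lift_coord \<FF> C p1 p2 \<xi>))"

definition output_curve :: "complex set \<Rightarrow> (complex ^ 3) set \<Rightarrow> complex poly \<Rightarrow> complex poly
    \<Rightarrow> complex poly \<Rightarrow> (complex ^ 3) set" where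
  "output_curve \<FF> C p1 p2 q = param_curve \<FF> (vector [p1, p2, interp_numerator \<FF> C p1 p2 q]) q"


section \<open>Real parts and Hausdorff distance\<close>

text \<open>
  The coordinates of a real point need not lie in \<open>\<FF>\<close>, so real parts are taken with respect to
  sets of defining polynomials rather than as subsets of affine space over \<open>\<FF>\<close>.
\<close>

definition real_zeros :: "'n::finite cmpoly set \<Rightarrow> (real ^ 'n) set" where
  "real_zeros S = {x. \<forall>P\<in>S. mpoly_eval P (\<lambda>i. complex_of_real (x $ i)) = 0}"

definition hausdorff_dist :: "'a::metric_space set \<Rightarrow> 'a set \<Rightarrow> ereal" where
  "hausdorff_dist A B =
    (if A = {} \<and> B = {} then 0
     else if A = {} \<or> B = {} then \<infinity>
     else max (SUP a\<in>A. ereal (infdist a B)) (SUP b\<in>B. ereal (infdist b A)))"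

end

theory Submission
  imports
    Defs
    "Jordan_Normal_Form.Determinant"
    "HOL-Computational_Algebra.Fundamental_Theorem_Algebra"
begin

text \<open>
  Both real curves stay within bounded distance of the same finite set of real lines, and run along
  each of these lines in both senses; two such sets have finite Hausdorff distance
  (\<open>hausdorff_dist_finite\<close>). The work is to find the lines.

  The directions. Let \<open>N = deg q\<close>, which is also the degree of \<open>C\<close>. The curve \<open>C\<close> has \<open>N\<close> points at
  infinity \<open>(1 : l : m : 0)\<close>, with distinct \<open>l\<close>. They project to points at infinity of the plane curve
  \<open>\<pi>\<^sub>z(C)\<close>, and each of those is a value of the parametrization \<open>(p\<^sub>1/q, p\<^sub>2/q)\<close> at a root of \<open>q\<close>. As
  \<open>q\<close> has at most \<open>N\<close> roots, these are bijections, and all roots are simple (\<open>infinity_count\<close>).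

  The curve \<open>C\<close>. The projection has an equation \<open>f\<close> that is monic in \<open>y\<close> and of total degree equal to
  its \<open>y\<close>-degree (\<open>plane_equation_exists\<close>), and this degree is \<open>N\<close>, because it is the number of points
  on a generic line (\<open>curve_degree_plane\<close>). So the leading form of \<open>f\<close> is a product of \<open>N\<close> distinct
  linear forms \<open>y - l x\<close>, and for large \<open>|x|\<close> the \<open>N\<close> roots of \<open>f(x, y)\<close> lie one by one within bounded
  distance of the values \<open>l x\<close> (\<open>near_asymptote\<close>, \<open>unique_root_near_asymptote\<close>). Birationality gives
  \<open>z = h(x, y) / R(x)\<close> with \<open>deg\<^sub>y h < N\<close> (\<open>third_coordinate\<close>). The power of \<open>z\<close> in \<open>F\<^sub>1\<close> makes \<open>z\<close> grow at
  most linearly in \<open>x\<close>; this bounds the total degree of \<open>h\<close> and yields \<open>z = m x + O(1)\<close> along each branch,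
  where \<open>m\<close> is the third coordinate of the corresponding point at infinity (\<open>branches\<close>). A branch with a
  direction that is not real has bounded real part. On a branch with real direction the point over a
  real \<open>x\<close> is unique, so it equals its conjugate and is real (\<open>real_curve_follows_lines\<close>).

  The output curve. Every point of its closure, real or complex, is a value of its parametrization
  \<open>P = (p\<^sub>1/q, p\<^sub>2/q, p\<^sub>3/q)\<close> or the value of \<open>P\<close> at infinity (\<open>rational_curve_closure\<close>). Since \<open>p\<^sub>3\<close> interpolates \<open>p\<^sub>1(\<xi>) \<chi>\<close> at the
  roots \<open>\<xi>\<close> of \<open>q\<close>, the functions \<open>p\<^sub>2/q - l p\<^sub>1/q\<close> and \<open>p\<^sub>3/q - \<chi> p\<^sub>1/q\<close> with \<open>l = p\<^sub>2(\<xi>)/p\<^sub>1(\<xi>)\<close> have no pole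
  at \<open>\<xi>\<close> and are bounded where \<open>\<xi>\<close> is the nearest root. So \<open>P(t)\<close> is close to the line of direction
  \<open>(1, l, \<chi>)\<close> there, and as the poles are simple, the values of \<open>P\<close> near a real root run along the whole
  line (\<open>output_follows_lines\<close>).

  The curves are given over the algebraic closure \<open>\<FF>\<close> of \<open>K\<close>, while the asymptotic arguments concern all
  complex points. The two are connected by a form of the Nullstellensatz (\<open>specialization\<close>): a
  polynomial over \<open>\<FF>\<close> that vanishes on the \<open>\<FF>\<close>-points of \<open>C\<close> vanishes at all of its complex points.
\<close>

no_notation Matrix.vec_index (infixl \<open>$\<close> 100)

section \<open>Polynomials over subrings\<close>

definition subring_set :: "'a::comm_ring_1 set \<Rightarrow> bool" where
  "subring_set A \<longleftrightarrow> 0 \<in> A \<and> 1 \<in> A \<and> (\<forall>x\<in>A. \<forall>y\<in>A. x + y \<in> A \<and> x * y \<in> A) \<and> (\<forall>x\<in>A. - x \<in> A)"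

lemma subring_setD:
  assumes "subring_set A"
  shows "0 \<in> A" "1 \<in> A" "x \<in> A \<Longrightarrow> y \<in> A \<Longrightarrow> x + y \<in> A" "x \<in> A \<Longrightarrow> y \<in> A \<Longrightarrow> x * y \<in> A"
    "x \<in> A \<Longrightarrow> - x \<in> A" "x \<in> A \<Longrightarrow> y \<in> A \<Longrightarrow> x - y \<in> A"
  using assms unfolding subring_set_def by (auto, metis add_uminus_conv_diff)

lemma subring_set_power: "subring_set A \<Longrightarrow> x \<in> A \<Longrightarrow> x ^ k \<in> A"
  by (induction k) (auto simp: subring_setD)

lemma subring_set_sum: "subring_set A \<Longrightarrow> (\<And>i. i \<in> I \<Longrightarrow> f i \<in> A) \<Longrightarrow> sum f I \<in> A"
  by (induction I rule: infinite_finite_induct) (auto simp: subring_setD)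

lemma subring_set_prod: "subring_set A \<Longrightarrow> (\<And>i. i \<in> I \<Longrightarrow> f i \<in> A) \<Longrightarrow> prod f I \<in> A"
  by (induction I rule: infinite_finite_induct) (auto simp: subring_setD)

lemma subring_set_of_nat: "subring_set A \<Longrightarrow> of_nat n \<in> A"
  by (induction n) (auto simp: subring_setD)

lemma upolys_overI: "(\<And>i. coeff p i \<in> A) \<Longrightarrow> p \<in> upolys_over A"
  by (simp add: upolys_over_def)

lemma upolys_overD: "p \<in> upolys_over A \<Longrightarrow> coeff p i \<in> A"
  by (simp add: upolys_over_def)

lemma subring_upolys_over:
  assumes "subring_set A"
  shows "subring_set (upolys_over A)"
proof -
  have "p * q \<in> upolys_over A" if "p \<in> upolys_over A" "q \<in> upolys_over A" for p q
    using that assms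
    by (auto intro!: upolys_overI subring_set_sum simp: coeff_mult subring_setD upolys_overD)
  then show ?thesis
    using assms unfolding subring_set_def[of "upolys_over A"]
    by (auto simp: upolys_over_def subring_setD coeff_pCons one_pCons split: nat.splits)
qed

lemma upolys_over_const: "subring_set A \<Longrightarrow> c \<in> A \<Longrightarrow> [:c:] \<in> upolys_over A"
  by (auto intro!: upolys_overI simp: coeff_pCons subring_setD split: nat.splits)

lemma upolys_over_pCons: "c \<in> A \<Longrightarrow> p \<in> upolys_over A \<Longrightarrow> pCons c p \<in> upolys_over A"
  by (auto intro!: upolys_overI simp: coeff_pCons upolys_overD split: nat.splits)

lemma upolys_over_0: "subring_set A \<Longrightarrow> 0 \<in> upolys_over A"
  by (auto intro!: upolys_overI simp: subring_setD)

lemma upolys_over_monom: "subring_set A \<Longrightarrow> c \<in> A \<Longrightarrow> monom c n \<in> upolys_over A"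
  by (auto intro!: upolys_overI simp: coeff_monom subring_setD)

lemma upolys_over_smult: "subring_set A \<Longrightarrow> c \<in> A \<Longrightarrow> p \<in> upolys_over A \<Longrightarrow> Polynomial.smult c p \<in> upolys_over A"
  by (auto intro!: upolys_overI simp: subring_setD upolys_overD)

lemma poly_in_subring: "subring_set A \<Longrightarrow> p \<in> upolys_over A \<Longrightarrow> x \<in> A \<Longrightarrow> poly p x \<in> A"
  by (auto simp: poly_altdef intro!: subring_set_sum subring_setD subring_set_power upolys_overD)

text \<open>
  Division with remainder without leaving the coefficient ring. The multiplier is a power of the
  leading coefficient, so a ring homomorphism that does not kill the leading coefficient does not
  kill the multiplier.
\<close>

lemma pseudo_division:
  fixes f h :: "'a::idom poly"
  assumes A: "subring_set A" and f: "f \<in> upolys_over A" and h: "h \<in> upolys_over A" and "h \<noteq> 0"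
  shows "\<exists>k. \<exists>w\<in>upolys_over A. \<exists>r\<in>upolys_over A.
    Polynomial.smult (lead_coeff h ^ k) f = h * w + r \<and> (r = 0 \<or> degree r < degree h)"
  using f
proof (induction "length (coeffs f)" arbitrary: f rule: less_induct)
  case less
  have U: "subring_set (upolys_over A)" using A by (rule subring_upolys_over)
  show ?case
  proof (cases "f = 0 \<or> degree f < degree h")
    case True
    then show ?thesis
      using less.prems U by (intro exI[of _ 0] bexI[of _ 0] bexI[of _ f]) (auto simp: subring_setD)
  next
    case False
    then have f0: "f \<noteq> 0" and deg: "degree h \<le> degree f" by auto
    define m where "m = monom (lead_coeff f) (degree f - degree h)"
    define f' where "f' = Polynomial.smult (lead_coeff h) f - m * h"
    have m: "m \<in> upolys_over A"
      using A less.prems by (auto simp: m_def intro: upolys_over_monom upolys_overD)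
    have f'U: "f' \<in> upolys_over A"
      unfolding f'_def using A U less.prems h m
      by (auto intro!: subring_setD(4,6)[OF U] upolys_over_smult upolys_overD)
    have dm: "degree (m * h) = degree f" "coeff (m * h) (degree f) = lead_coeff f * lead_coeff h"
    proof -
      have "m \<noteq> 0" using f0 by (simp add: m_def)
      then show 1: "degree (m * h) = degree f"
        using \<open>h \<noteq> 0\<close> deg f0 by (simp add: degree_mult_eq m_def degree_monom_eq)
      have "lead_coeff (m * h) = lead_coeff f * lead_coeff h"
        unfolding lead_coeff_mult using f0 by (simp add: m_def degree_monom_eq)
      then show "coeff (m * h) (degree f) = lead_coeff f * lead_coeff h" using 1 by metis
    qed
    have "length (coeffs f') < length (coeffs f)"
    proof (cases "f' = 0")
      case True
      then show ?thesis using f0 by (simp add: length_coeffs)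
    next
      case F: False
      have "degree f' \<le> degree f"
        unfolding f'_def by (intro degree_diff_le) (auto simp: dm)
      moreover have "coeff f' (degree f) = 0"
        by (simp only: f'_def coeff_diff coeff_smult dm(2) mult.commute[of "lead_coeff h"] diff_self)
      ultimately have "degree f' < degree f"
        using F by (metis leading_coeff_0_iff le_neq_implies_less)
      then show ?thesis using F f0 by (simp add: length_coeffs)
    qed
    from less.hyps[OF this f'U] obtain k w r where w: "w \<in> upolys_over A" and r: "r \<in> upolys_over A"
      and eq: "Polynomial.smult (lead_coeff h ^ k) f' = h * w + r" "r = 0 \<or> degree r < degree h" by blast
    have "Polynomial.smult (lead_coeff h ^ Suc k) f
        = Polynomial.smult (lead_coeff h ^ k) f' + h * Polynomial.smult (lead_coeff h ^ k) m"
      by (simp add: f'_def smult_diff_right mult.commute)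
    also have "\<dots> = h * (w + Polynomial.smult (lead_coeff h ^ k) m) + r"
      by (simp add: eq algebra_simps)
    finally show ?thesis
      using eq(2) w r m h A
      by (intro exI[of _ "Suc k"] bexI[of _ "w + Polynomial.smult (lead_coeff h ^ k) m"] bexI[of _ r])
        (auto intro!: subring_setD(3)[OF U] upolys_over_smult subring_set_power upolys_overD)
  qed
qed

text \<open>
  A prime ideal \<open>I\<close> of \<open>A[T]\<close> that meets \<open>A\<close> only in zero is principal up to multipliers from \<open>A\<close>:
  it becomes the ideal of an irreducible polynomial over the field of fractions of \<open>A\<close>.
\<close>

locale contracted_prime =
  fixes A :: "'a::idom set" and I :: "'a poly set" and f :: "'a poly"
  assumes A: "subring_set A"
    and I_sub: "I \<subseteq> upolys_over A"
    and I_add: "g \<in> I \<Longrightarrow> h \<in> I \<Longrightarrow> g + h \<in> I"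
    and I_mult: "g \<in> I \<Longrightarrow> h \<in> upolys_over A \<Longrightarrow> h * g \<in> I"
    and I_prime: "g \<in> upolys_over A \<Longrightarrow> h \<in> upolys_over A \<Longrightarrow> g * h \<in> I \<Longrightarrow> g \<in> I \<or> h \<in> I"
    and I_contr: "c \<in> A \<Longrightarrow> [:c:] \<in> I \<Longrightarrow> c = 0"
    and f: "f \<in> I" "f \<noteq> 0"
    and f_min: "g \<in> I \<Longrightarrow> g \<noteq> 0 \<Longrightarrow> degree f \<le> degree g"
begin

lemma fU: "f \<in> upolys_over A" using f I_sub by auto

lemma degree_pos: "degree f > 0"
proof (rule ccontr)
  assume "\<not> ?thesis"
  then obtain c where c: "f = [:c:]" by (metis degree_eq_zeroE gr0I)
  then have "c \<in> A" using upolys_overD[OF fU, of 0] by simp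
  then show False using I_contr[of c] f c by auto
qed

lemma ideal_multiple:
  assumes "g \<in> I"
  shows "\<exists>k. \<exists>w\<in>upolys_over A. Polynomial.smult (lead_coeff f ^ k) g = f * w"
proof -
  have U: "subring_set (upolys_over A)" using A by (rule subring_upolys_over)
  obtain k w r where w: "w \<in> upolys_over A" and r: "r \<in> upolys_over A"
    and eq: "Polynomial.smult (lead_coeff f ^ k) g = f * w + r" "r = 0 \<or> degree r < degree f"
    using pseudo_division[OF A _ fU f(2), of g] assms I_sub by blast
  have "r = [:lead_coeff f ^ k:] * g + (- w) * f" using eq by (simp add: algebra_simps)
  also have "\<dots> \<in> I"
    using assms f A fU w
    by (intro I_add I_mult upolys_over_const subring_set_power subring_setD(5)[OF U]) (auto intro: upolys_overD)
  finally have "r = 0" using f_min[of r] eq(2) by force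
  then show ?thesis using eq w by auto
qed

text \<open>
  An element \<open>h\<close> of least degree in the ideal of \<open>f\<close> and \<open>g\<close> divides both up to multipliers from \<open>A\<close>. It
  is not in \<open>I\<close>, because \<open>g\<close> is not; so the cofactor of \<open>f\<close> is in \<open>I\<close>, and by minimality of \<open>deg f\<close> it has
  the whole degree of \<open>f\<close>.
\<close>

lemma bezout_off_ideal:
  assumes g: "g \<in> upolys_over A" "g \<notin> I"
  shows "\<exists>u\<in>upolys_over A. \<exists>v\<in>upolys_over A. \<exists>R\<in>A. R \<noteq> 0 \<and> u * f + v * g = [:R:]"
proof -
  have U: "subring_set (upolys_over A)" using A by (rule subring_upolys_over)
  define J where "J = {u * f + v * g | u v. u \<in> upolys_over A \<and> v \<in> upolys_over A}"
  have fJ: "f \<in> J" unfolding J_def by (rule CollectI, rule exI[of _ 1], rule exI[of _ 0]) (auto simp: subring_setD U)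
  have gJ: "g \<in> J" unfolding J_def by (rule CollectI, rule exI[of _ 0], rule exI[of _ 1]) (auto simp: subring_setD U)
  have J_U: "J \<subseteq> upolys_over A" unfolding J_def using g fU U by (auto intro!: subring_setD(3,4)[OF U])
  have J_lin: "a * x - b * y \<in> J" if xy: "x \<in> J" "y \<in> J" and ab: "a \<in> upolys_over A" "b \<in> upolys_over A" for a b x y
  proof -
    from xy obtain u v u' v' where x: "x = u * f + v * g" and y: "y = u' * f + v' * g"
      and uv: "u \<in> upolys_over A" "v \<in> upolys_over A" "u' \<in> upolys_over A" "v' \<in> upolys_over A"
      unfolding J_def by blast
    have "a * x - b * y = (a * u - b * u') * f + (a * v - b * v') * g"
      by (simp add: x y algebra_simps)
    then show ?thesis unfolding J_def using uv ab U
      by (intro CollectI exI[of _ "a * u - b * u'"] exI[of _ "a * v - b * v'"]) (auto simp: subring_setD)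
  qed
  obtain h where h: "h \<in> J" "h \<noteq> 0" and h_min: "\<And>x. x \<in> J \<Longrightarrow> x \<noteq> 0 \<Longrightarrow> degree h \<le> degree x"
    using ex_has_least_nat[of "\<lambda>h. h \<in> J \<and> h \<noteq> 0" f degree] fJ f(2) by blast
  have hU: "h \<in> upolys_over A" using h J_U by auto
  have lc: "[:lead_coeff h ^ k:] \<in> upolys_over A" for k
    using A hU by (intro upolys_over_const subring_set_power) (auto intro: upolys_overD)
  have multiple: "\<exists>k. \<exists>w\<in>upolys_over A. [:lead_coeff h ^ k:] * x = h * w" if x: "x \<in> J" for x
  proof -
    obtain k w r where w: "w \<in> upolys_over A"
      and eq: "Polynomial.smult (lead_coeff h ^ k) x = h * w + r" "r = 0 \<or> degree r < degree h"
      using pseudo_division[OF A _ hU h(2), of x] x J_U by blast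
    have "r = [:lead_coeff h ^ k:] * x - w * h" using eq by (simp add: algebra_simps)
    then have "r \<in> J" using J_lin[OF x h(1) lc w] by simp
    then have "r = 0" using h_min[of r] eq(2) by force
    then show ?thesis using eq w by auto
  qed
  have lc_notin: "[:lead_coeff h ^ k:] \<notin> I" for k
    using I_contr[of "lead_coeff h ^ k"] h(2) A hU by (auto intro: subring_set_power upolys_overD)
  from multiple[OF fJ] obtain k w where w: "w \<in> upolys_over A" "[:lead_coeff h ^ k:] * f = h * w" by blast
  from multiple[OF gJ] obtain k' w' where w': "w' \<in> upolys_over A" "[:lead_coeff h ^ k':] * g = h * w'" by blast
  have "h \<notin> I"
  proof
    assume "h \<in> I"
    then have "[:lead_coeff h ^ k':] * g \<in> I" using I_mult[of h w'] w' by (simp add: mult.commute)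
    then show False using I_prime[OF lc g(1)] lc_notin g(2) by blast
  qed
  moreover have "h * w \<in> I" using I_mult[OF f(1) lc[of k]] w by simp
  ultimately have "w \<in> I" using I_prime[OF hU w(1)] by blast
  have "[:lead_coeff h ^ k:] * f \<noteq> 0" using h f by simp
  then have "w \<noteq> 0" using w by auto
  have "degree f = degree ([:lead_coeff h ^ k:] * f)" using h by simp
  also have "\<dots> = degree h + degree w" using w \<open>w \<noteq> 0\<close> h by (simp add: degree_mult_eq)
  finally have "degree h = 0" using f_min[OF \<open>w \<in> I\<close> \<open>w \<noteq> 0\<close>] by simp
  then obtain R where R: "h = [:R:]" by (metis degree_eq_zeroE)
  then have "R \<in> A" "R \<noteq> 0" using upolys_overD[OF hU, of 0] h by auto
  then show ?thesis using h(1) R unfolding J_def by blast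
qed

end

section \<open>Algebraically closed subfields of the complex numbers\<close>

definition root_closed_subfield :: "complex set \<Rightarrow> bool" where
  "root_closed_subfield \<FF> \<longleftrightarrow> is_subfield \<FF> \<and>
     (\<forall>p\<in>upolys_over \<FF>. p \<noteq> 0 \<longrightarrow> (\<forall>z. poly p z = 0 \<longrightarrow> z \<in> \<FF>))"

lemma is_subfield_subring: "is_subfield K \<Longrightarrow> subring_set K"
  unfolding is_subfield_def subring_set_def by auto

lemma is_subfield_divide: "is_subfield K \<Longrightarrow> x \<in> K \<Longrightarrow> y \<in> K \<Longrightarrow> x / y \<in> K"
  unfolding is_subfield_def divide_inverse by auto

lemma root_closed_subring: "root_closed_subfield \<FF> \<Longrightarrow> subring_set \<FF>"
  unfolding root_closed_subfield_def by (blast intro: is_subfield_subring)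

lemma root_closed_divide: "root_closed_subfield \<FF> \<Longrightarrow> x \<in> \<FF> \<Longrightarrow> y \<in> \<FF> \<Longrightarrow> x / y \<in> \<FF>"
  unfolding root_closed_subfield_def by (blast intro: is_subfield_divide)

lemma root_closed_root: "root_closed_subfield \<FF> \<Longrightarrow> p \<in> upolys_over \<FF> \<Longrightarrow> p \<noteq> 0 \<Longrightarrow> poly p z = 0 \<Longrightarrow> z \<in> \<FF>"
  unfolding root_closed_subfield_def by blast

lemma infinite_subring:
  fixes A :: "'a::{comm_ring_1,ring_char_0} set"
  assumes "subring_set A"
  shows "infinite A"
proof -
  have "infinite (range (of_nat :: nat \<Rightarrow> 'a))" by (simp add: range_inj_infinite)
  moreover have "range (of_nat :: nat \<Rightarrow> 'a) \<subseteq> A" using subring_set_of_nat[OF assms] by blast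
  ultimately show ?thesis by (rule infinite_super[rotated])
qed

text \<open>
  More vectors than the dimension of the space they lie in are linearly dependent; stated for
  coordinate families, because the scalars form a subset of the complex numbers and not a type.
\<close>

lemma linear_dependence:
  fixes M :: "'j \<Rightarrow> 'i \<Rightarrow> complex"
  assumes K: "is_subfield K"
  shows "finite I \<Longrightarrow> finite J \<Longrightarrow> card I < card J \<Longrightarrow> (\<forall>j\<in>J. \<forall>i\<in>I. M j i \<in> K) \<Longrightarrow>
    \<exists>c. (\<forall>j\<in>J. c j \<in> K) \<and> (\<exists>j\<in>J. c j \<noteq> 0) \<and> (\<forall>i\<in>I. (\<Sum>j\<in>J. c j * M j i) = 0)"
proof (induction I arbitrary: J M rule: finite_induct)
  case empty
  then have "J \<noteq> {}" by auto
  then show ?case using K by (intro exI[of _ "\<lambda>_. 1"]) (auto simp: is_subfield_def)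
next
  case (insert a I)
  have R: "subring_set K" using K by (rule is_subfield_subring)
  show ?case
  proof (cases "\<forall>j\<in>J. M j a = 0")
    case True
    obtain c where "(\<forall>j\<in>J. c j \<in> K) \<and> (\<exists>j\<in>J. c j \<noteq> 0) \<and> (\<forall>i\<in>I. (\<Sum>j\<in>J. c j * M j i) = 0)"
      using insert.IH[of J M] insert.prems insert.hyps by auto
    then show ?thesis using True by (intro exI[of _ c]) auto
  next
    case False
    then obtain p where p: "p \<in> J" "M p a \<noteq> 0" by blast
    define J' where "J' = J - {p}"
    define M' where "M' j i = M j i - (M j a / M p a) * M p i" for j i
    have J': "finite J'" "J = Set.insert p J'" "p \<notin> J'" using insert.prems p by (auto simp: J'_def)
    have "card I < card J'" using insert.prems insert.hyps J' by auto
    moreover have "\<forall>j\<in>J'. \<forall>i\<in>I. M' j i \<in> K"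
      unfolding M'_def using insert.prems p J' K
      by (auto intro!: subring_setD(4,6)[OF R] is_subfield_divide[OF K])
    ultimately obtain c where c: "\<forall>j\<in>J'. c j \<in> K" "\<exists>j\<in>J'. c j \<noteq> 0" "\<forall>i\<in>I. (\<Sum>j\<in>J'. c j * M' j i) = 0"
      using insert.IH[of J' M'] J' by blast
    define s where "s = (\<Sum>j\<in>J'. c j * (M j a / M p a))"
    define c' where "c' j = (if j = p then - s else c j)" for j
    have "(\<Sum>j\<in>J. c' j * M j i) = (\<Sum>j\<in>J'. c j * M' j i)" for i
    proof -
      have "(\<Sum>j\<in>J. c' j * M j i) = - s * M p i + (\<Sum>j\<in>J'. c' j * M j i)"
        using J' by (simp add: c'_def)
      also have "(\<Sum>j\<in>J'. c' j * M j i) = (\<Sum>j\<in>J'. c j * M j i)"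
        using J' by (intro sum.cong) (auto simp: c'_def)
      also have "- s * M p i + (\<Sum>j\<in>J'. c j * M j i) = (\<Sum>j\<in>J'. c j * M' j i)"
        by (simp add: s_def M'_def sum_distrib_right right_diff_distrib sum_subtractf mult.assoc)
      finally show ?thesis .
    qed
    moreover have "(\<Sum>j\<in>J'. c j * M' j a) = 0" using p(2) by (simp add: M'_def)
    moreover have "\<forall>j\<in>J. c' j \<in> K"
      unfolding c'_def s_def using c J' insert.prems p K
      by (auto intro!: subring_setD(4,5)[OF R] subring_set_sum[OF R] is_subfield_divide[OF K])
    moreover have "\<exists>j\<in>J. c' j \<noteq> 0" using c J' by (auto simp: c'_def)
    ultimately show ?thesis using c by (intro exI[of _ c']) auto
  qed
qed

definition adjoin :: "complex set \<Rightarrow> complex \<Rightarrow> complex set" where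
  "adjoin A b = {poly p b | p. p \<in> upolys_over A}"

lemma adjoin_superset: "subring_set A \<Longrightarrow> A \<subseteq> adjoin A b"
  unfolding adjoin_def by (auto intro!: exI[of _ "[:_:]"] upolys_over_const)

lemma adjoin_generator: "subring_set A \<Longrightarrow> b \<in> adjoin A b"
  unfolding adjoin_def
  by (auto intro!: exI[of _ "[:0, 1:]"] upolys_over_pCons upolys_over_const simp: subring_setD upolys_over_0)

lemma subring_adjoin:
  assumes "subring_set A"
  shows "subring_set (adjoin A b)"
proof -
  have U: "subring_set (upolys_over A)" using assms by (rule subring_upolys_over)
  have "\<exists>r. poly p b + poly q b = poly r b \<and> r \<in> upolys_over A"
    "\<exists>r. poly p b * poly q b = poly r b \<and> r \<in> upolys_over A"
    "\<exists>r. - poly p b = poly r b \<and> r \<in> upolys_over A"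
    if "p \<in> upolys_over A" "q \<in> upolys_over A" for p q
    using that U by (metis poly_add poly_mult poly_minus subring_setD(3-5))+
  moreover have "0 = poly 0 b" "1 = poly 1 b" by auto
  ultimately show ?thesis
    unfolding subring_set_def adjoin_def using subring_setD(1,2)[OF U] by blast
qed

text \<open>
  A subring of finite dimension over \<open>K\<close> consists of algebraic elements, and adjoining to it a root
  of a monic polynomial keeps the dimension finite. All closure properties of the algebraic closure
  follow from these two facts.
\<close>

definition finite_span :: "complex set \<Rightarrow> complex set \<Rightarrow> complex set" where
  "finite_span K E = {\<Sum>e\<in>E. c e * e | c. \<forall>e\<in>E. c e \<in> K}"

definition finite_extension :: "complex set \<Rightarrow> complex set \<Rightarrow> bool" where
  "finite_extension K L \<longleftrightarrow> subring_set L \<and> K \<subseteq> L \<and> (\<exists>E. finite E \<and> L \<subseteq> finite_span K E)"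

lemma finite_span_sum:
  assumes K: "subring_set K" and E: "finite E" and c: "\<And>i. i \<in> I \<Longrightarrow> c i \<in> K \<and> x i \<in> E"
  shows "(\<Sum>i\<in>I. c i * x i) \<in> finite_span K E"
  using c
proof (induction I rule: infinite_finite_induct)
  case (insert i I)
  then obtain c' where c': "\<forall>e\<in>E. c' e \<in> K" "(\<Sum>i\<in>I. c i * x i) = (\<Sum>e\<in>E. c' e * e)"
    unfolding finite_span_def by auto
  define d where "d e = (if e = x i then c i + c' e else c' e)" for e
  have "(\<Sum>e\<in>E. d e * e) = (\<Sum>e\<in>E. c' e * e + (if e = x i then c i * e else 0))"
    by (intro sum.cong) (auto simp: d_def algebra_simps)
  also have "\<dots> = (\<Sum>e\<in>E. c' e * e) + c i * x i"
    using insert.prems E by (simp add: sum.distrib)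
  finally have "(\<Sum>i\<in>Set.insert i I. c i * x i) = (\<Sum>e\<in>E. d e * e)"
    using insert c' by simp
  moreover have "\<forall>e\<in>E. d e \<in> K" using c' insert.prems K by (auto simp: d_def subring_setD)
  ultimately show ?case unfolding finite_span_def by blast
qed (use K in \<open>auto simp: finite_span_def subring_setD intro!: exI[of _ "\<lambda>_. 0"]\<close>)

lemma finite_extension_algebraic:
  assumes K: "is_subfield K" and L: "finite_extension K L" and x: "x \<in> L"
  shows "x \<in> alg_closure K"
proof -
  obtain E where E: "finite E" "L \<subseteq> finite_span K E" and RL: "subring_set L"
    using L unfolding finite_extension_def by blast
  have "\<forall>j. \<exists>c. (\<forall>e\<in>E. c e \<in> K) \<and> x ^ j = (\<Sum>e\<in>E. c e * e)"
  proof
    fix j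
    have "x ^ j \<in> finite_span K E" using E RL x by (auto intro: subring_set_power)
    then show "\<exists>c. (\<forall>e\<in>E. c e \<in> K) \<and> x ^ j = (\<Sum>e\<in>E. c e * e)"
      unfolding finite_span_def by blast
  qed
  then obtain M where M: "\<And>j. \<forall>e\<in>E. M j e \<in> K" "\<And>j. x ^ j = (\<Sum>e\<in>E. M j e * e)" by metis
  obtain c :: "nat \<Rightarrow> complex" where c: "\<forall>j\<in>{..card E}. c j \<in> K" "\<exists>j\<in>{..card E}. c j \<noteq> 0"
    "\<forall>e\<in>E. (\<Sum>j\<in>{..card E}. c j * M j e) = 0"
    using linear_dependence[OF K E(1), of "{..card E}" M] M(1) by auto
  define p where "p = (\<Sum>j\<le>card E. monom (c j) j)"
  have coeff_p: "coeff p j = (if j \<le> card E then c j else 0)" for j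
    by (simp add: p_def coeff_sum coeff_monom)
  have "p \<in> upolys_over K" using c(1) is_subfield_subring[OF K] by (auto intro!: upolys_overI simp: coeff_p subring_setD)
  moreover have "p \<noteq> 0" using c(2) coeff_p by (metis atMost_iff coeff_0)
  moreover have "poly p x = (\<Sum>j\<le>card E. \<Sum>e\<in>E. c j * M j e * e)"
    by (simp add: p_def poly_sum poly_monom M(2)[symmetric] sum_distrib_left[symmetric] mult.assoc)
  then have "poly p x = (\<Sum>e\<in>E. (\<Sum>j\<le>card E. c j * M j e) * e)"
    by (simp add: sum.swap[of _ E] sum_distrib_right)
  then have "poly p x = 0" using c(3) by simp
  ultimately show ?thesis unfolding alg_closure_def by blast
qed

lemma finite_extension_adjoin:
  assumes K: "is_subfield K" and L: "finite_extension K L"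
    and p: "p \<in> upolys_over L" "lead_coeff p = 1" "poly p z = 0"
  shows "finite_extension K (adjoin L z)"
proof -
  have RK: "subring_set K" using K by (rule is_subfield_subring)
  obtain E where E: "finite E" "L \<subseteq> finite_span K E" and RL: "subring_set L" and KL: "K \<subseteq> L"
    using L unfolding finite_extension_def by blast
  define E' where "E' = (\<lambda>(e, k). e * z ^ k) ` (E \<times> {..degree p})"
  have "adjoin L z \<subseteq> finite_span K E'"
  proof
    fix x assume "x \<in> adjoin L z"
    then obtain g where g: "g \<in> upolys_over L" "x = poly g z" unfolding adjoin_def by blast
    have "p \<noteq> 0" using p by auto
    then obtain w r where r: "r \<in> upolys_over L" "g = p * w + r" "r = 0 \<or> degree r < degree p"
      using pseudo_division[OF RL g(1) p(1)] p(2) by auto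
    have x: "x = (\<Sum>k\<le>degree p. coeff r k * z ^ k)"
    proof -
      have "x = poly r z" using g r p by simp
      also have "\<dots> = (\<Sum>k\<le>degree r. coeff r k * z ^ k)" by (simp add: poly_altdef)
      also have "\<dots> = (\<Sum>k\<le>degree p. coeff r k * z ^ k)"
        using r(3) by (intro sum.mono_neutral_left) (auto simp: coeff_eq_0)
      finally show ?thesis .
    qed
    have "\<forall>k. \<exists>c. (\<forall>e\<in>E. c e \<in> K) \<and> coeff r k = (\<Sum>e\<in>E. c e * e)"
      using E(2) upolys_overD[OF r(1)] unfolding finite_span_def by blast
    then obtain c where c: "\<And>k. \<forall>e\<in>E. c k e \<in> K" "\<And>k. coeff r k = (\<Sum>e\<in>E. c k e * e)" by metis
    have "x = (\<Sum>k\<le>degree p. \<Sum>e\<in>E. c k e * (e * z ^ k))"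
      unfolding x c(2) by (simp add: sum_distrib_right mult.assoc)
    also have "\<dots> = (\<Sum>(e, k)\<in>E \<times> {..degree p}. c k e * (e * z ^ k))"
      by (simp add: sum.swap[of _ E] sum.cartesian_product)
    also have "\<dots> = (\<Sum>i\<in>E \<times> {..degree p}. c (snd i) (fst i) * (fst i * z ^ snd i))"
      by (simp add: case_prod_beta)
    also have "\<dots> \<in> finite_span K E'"
      using c(1) E(1) by (intro finite_span_sum[OF RK]) (force simp: E'_def)+
    finally show "x \<in> finite_span K E'" .
  qed
  moreover have "finite E'" using E by (simp add: E'_def)
  ultimately show ?thesis
    unfolding finite_extension_def using subring_adjoin[OF RL] adjoin_superset[OF RL] KL by blast
qed

lemma finite_extension_algebraic_elem:
  assumes K: "is_subfield K" and L: "finite_extension K L" and x: "x \<in> alg_closure K"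
  shows "\<exists>L'. finite_extension K L' \<and> L \<subseteq> L' \<and> x \<in> L'"
proof -
  have RL: "subring_set L" "K \<subseteq> L" using L unfolding finite_extension_def by auto
  obtain p where p: "p \<in> upolys_over K" "p \<noteq> 0" "poly p x = 0"
    using x unfolding alg_closure_def by blast
  define p' where "p' = Polynomial.smult (inverse (lead_coeff p)) p"
  have "p' \<in> upolys_over K"
    unfolding p'_def using p K
    by (intro upolys_over_smult is_subfield_subring) (auto simp: is_subfield_def upolys_over_def)
  then have "p' \<in> upolys_over L" using RL by (auto simp: upolys_over_def)
  moreover have "lead_coeff p' = 1" "poly p' x = 0" using p by (auto simp: p'_def)
  ultimately have "finite_extension K (adjoin L x)" by (rule finite_extension_adjoin[OF K L])
  then show ?thesis using adjoin_superset[OF RL(1)] adjoin_generator[OF RL(1)] by blast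
qed

lemma finite_extension_base: "is_subfield K \<Longrightarrow> finite_extension K K"
  unfolding finite_extension_def finite_span_def
  by (auto intro!: is_subfield_subring exI[of _ "{1}"] exI[of _ "\<lambda>_. _"])

lemma alg_closure_superset:
  assumes "is_subfield K" shows "K \<subseteq> alg_closure K"
  using finite_extension_algebraic[OF assms finite_extension_base[OF assms]] by blast

lemma finite_extension_algebraic_family:
  fixes a :: "nat \<Rightarrow> complex"
  assumes K: "is_subfield K" and a: "\<And>i. a i \<in> alg_closure K"
  shows "\<exists>L. finite_extension K L \<and> (\<forall>i<n. a i \<in> L)"
proof (induction n)
  case 0
  then show ?case using finite_extension_base[OF K] by blast
next
  case (Suc n)
  then obtain L where L: "finite_extension K L" "\<forall>i<n. a i \<in> L" by blast
  obtain L' where "finite_extension K L'" "L \<subseteq> L'" "a n \<in> L'"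
    using finite_extension_algebraic_elem[OF K L(1) a] by blast
  then show ?case using L(2) by (metis in_mono less_Suc_eq)
qed

lemma is_subfield_alg_closure:
  assumes K: "is_subfield K"
  shows "is_subfield (alg_closure K)"
proof -
  have ext: "\<exists>L. finite_extension K L \<and> x \<in> L \<and> y \<in> L" if "x \<in> alg_closure K" "y \<in> alg_closure K" for x y
    using finite_extension_algebraic_elem[OF K finite_extension_base[OF K] that(1)]
      finite_extension_algebraic_elem[OF K _ that(2)] by blast
  have "x + y \<in> alg_closure K \<and> x * y \<in> alg_closure K \<and> - x \<in> alg_closure K"
    if "x \<in> alg_closure K" "y \<in> alg_closure K" for x y
  proof -
    obtain L where L: "finite_extension K L" "x \<in> L" "y \<in> L" using ext[OF \<open>x \<in> _\<close> \<open>y \<in> _\<close>] by blast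
    then have "subring_set L" by (simp add: finite_extension_def)
    then show ?thesis using finite_extension_algebraic[OF K L(1)] L by (auto simp: subring_setD)
  qed
  moreover have "inverse x \<in> alg_closure K" if x: "x \<in> alg_closure K" for x
  proof (cases "x = 0")
    case False
    from x obtain p where p: "p \<in> upolys_over K" "p \<noteq> 0" "poly p x = 0" unfolding alg_closure_def by blast
    have "poly (reflect_poly p) (inverse x) = 0"
      using False p by (simp add: poly_reflect_poly_nz)
    moreover have "reflect_poly p \<in> upolys_over K"
      using p is_subfield_subring[OF K] by (auto simp: upolys_over_def coeff_reflect_poly subring_setD)
    moreover have "reflect_poly p \<noteq> 0" using p by simp
    ultimately show ?thesis unfolding alg_closure_def by blast
  qed (use x in simp)
  moreover have "0 \<in> alg_closure K" "1 \<in> alg_closure K"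
    using alg_closure_superset[OF K] K by (auto simp: is_subfield_def)
  ultimately show ?thesis unfolding is_subfield_def by blast
qed

lemma root_closed_alg_closure:
  assumes K: "is_subfield K"
  shows "root_closed_subfield (alg_closure K)"
  unfolding root_closed_subfield_def
proof (intro conjI ballI impI allI)
  show sub: "is_subfield (alg_closure K)" using K by (rule is_subfield_alg_closure)
  fix p z assume p: "p \<in> upolys_over (alg_closure K)" "p \<noteq> 0" "poly p z = 0"
  define p' where "p' = Polynomial.smult (inverse (lead_coeff p)) p"
  have p': "p' \<in> upolys_over (alg_closure K)" "lead_coeff p' = 1" "poly p' z = 0"
  proof -
    show "p' \<in> upolys_over (alg_closure K)" unfolding p'_def using p sub
      by (intro upolys_over_smult is_subfield_subring) (auto simp: is_subfield_def upolys_over_def)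
  qed (use p in \<open>auto simp: p'_def\<close>)
  obtain L where L: "finite_extension K L" "\<forall>i<Suc (degree p'). coeff p' i \<in> L"
    using finite_extension_algebraic_family[OF K, of "coeff p'"] upolys_overD[OF p'(1)] by blast
  have RL: "subring_set L" using L(1) by (simp add: finite_extension_def)
  have "coeff p' i \<in> L" for i
    using L(2) RL by (cases "i < Suc (degree p')") (auto simp: coeff_eq_0 subring_setD)
  then have "finite_extension K (adjoin L z)"
    using finite_extension_adjoin[OF K L(1) _ p'(2,3)] by (auto simp: upolys_over_def)
  then show "z \<in> alg_closure K"
    using finite_extension_algebraic[OF K] adjoin_generator[OF RL] by blast
qed

lemma alg_closure_cnj:
  assumes "K \<subseteq> \<real>" "z \<in> alg_closure K"
  shows "cnj z \<in> alg_closure K"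
proof -
  obtain p where p: "p \<in> upolys_over K" "p \<noteq> 0" "poly p z = 0" using assms unfolding alg_closure_def by blast
  have "cnj (coeff p i) = coeff p i" for i
    using p(1) assms(1) by (metis Reals_cnj_iff subsetD upolys_overD)
  then have "poly p (cnj z) = cnj (poly p z)" by (simp add: poly_altdef)
  then show ?thesis using p unfolding alg_closure_def by auto
qed

section \<open>Specialization of complex points\<close>

definition hom_into :: "complex set \<Rightarrow> complex set \<Rightarrow> (complex \<Rightarrow> complex) \<Rightarrow> bool" where
  "hom_into A \<FF> \<sigma> \<longleftrightarrow> \<sigma> 0 = 0 \<and> \<sigma> 1 = 1 \<and>
     (\<forall>x\<in>A. \<forall>y\<in>A. \<sigma> (x + y) = \<sigma> x + \<sigma> y \<and> \<sigma> (x * y) = \<sigma> x * \<sigma> y) \<and> \<sigma> ` A \<subseteq> \<FF>"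

lemma hom_into_sum:
  assumes "hom_into A \<FF> \<sigma>" "subring_set A" "\<And>i. i \<in> I \<Longrightarrow> f i \<in> A"
  shows "\<sigma> (sum f I) = (\<Sum>i\<in>I. \<sigma> (f i))"
  using assms(3)
proof (induction I rule: infinite_finite_induct)
  case (insert i I)
  then have "sum f I \<in> A" using assms(2) by (auto intro: subring_set_sum)
  then show ?case using insert assms(1) unfolding hom_into_def by simp
qed (use assms in \<open>auto simp: hom_into_def\<close>)

lemma hom_into_prod:
  assumes "hom_into A \<FF> \<sigma>" "subring_set A" "\<And>i. i \<in> I \<Longrightarrow> f i \<in> A"
  shows "\<sigma> (prod f I) = (\<Prod>i\<in>I. \<sigma> (f i))"
  using assms(3)
proof (induction I rule: infinite_finite_induct)
  case (insert i I)
  then have "prod f I \<in> A" using assms(2) by (auto intro: subring_set_prod)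
  then show ?case using insert assms(1) unfolding hom_into_def by simp
qed (use assms in \<open>auto simp: hom_into_def\<close>)

lemma hom_into_power:
  assumes "hom_into A \<FF> \<sigma>" "subring_set A" "x \<in> A"
  shows "\<sigma> (x ^ k) = \<sigma> x ^ k"
proof (induction k)
  case (Suc k)
  have "x ^ k \<in> A" using assms by (simp add: subring_set_power)
  then show ?case using Suc assms unfolding hom_into_def by simp
qed (use assms in \<open>auto simp: hom_into_def\<close>)

lemma hom_into_map_poly:
  assumes s: "hom_into A \<FF> \<sigma>" and A: "subring_set A" and p: "p \<in> upolys_over A" and q: "q \<in> upolys_over A"
  shows "map_poly \<sigma> (p + q) = map_poly \<sigma> p + map_poly \<sigma> q"
    and "map_poly \<sigma> (p * q) = map_poly \<sigma> p * map_poly \<sigma> q"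
proof -
  have s0: "\<sigma> 0 = 0" using s by (simp add: hom_into_def)
  have st: "\<sigma> (x + y) = \<sigma> x + \<sigma> y" "\<sigma> (x * y) = \<sigma> x * \<sigma> y" if "x \<in> A" "y \<in> A" for x y
    using that s by (auto simp: hom_into_def)
  show "map_poly \<sigma> (p + q) = map_poly \<sigma> p + map_poly \<sigma> q"
    using p q by (intro poly_eqI) (simp add: coeff_map_poly s0 st upolys_overD)
  show "map_poly \<sigma> (p * q) = map_poly \<sigma> p * map_poly \<sigma> q"
  proof (rule poly_eqI)
    fix n
    have "\<sigma> (\<Sum>i\<le>n. coeff p i * coeff q (n - i)) = (\<Sum>i\<le>n. \<sigma> (coeff p i * coeff q (n - i)))"
      using p q A by (intro hom_into_sum[OF s A]) (auto intro: subring_setD upolys_overD)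
    then show "coeff (map_poly \<sigma> (p * q)) n = coeff (map_poly \<sigma> p * map_poly \<sigma> q) n"
      using p q by (simp add: coeff_map_poly s0 coeff_mult st upolys_overD)
  qed
qed

lemma hom_into_map_poly_over:
  "hom_into A \<FF> \<sigma> \<Longrightarrow> p \<in> upolys_over A \<Longrightarrow> map_poly \<sigma> p \<in> upolys_over \<FF>"
  by (intro upolys_overI) (auto simp: coeff_map_poly hom_into_def upolys_overD)

lemma hom_into_adjoin:
  assumes s: "hom_into A \<FF> \<sigma>" and A: "subring_set A" and F: "subring_set \<FF>" and \<beta>: "\<beta> \<in> \<FF>"
    and ker: "\<And>h. h \<in> upolys_over A \<Longrightarrow> poly h b = 0 \<Longrightarrow> poly (map_poly \<sigma> h) \<beta> = 0"
  shows "\<exists>\<sigma>'. hom_into (adjoin A b) \<FF> \<sigma>' \<and> (\<forall>p\<in>upolys_over A. \<sigma>' (poly p b) = poly (map_poly \<sigma> p) \<beta>)"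
proof -
  have U: "subring_set (upolys_over A)" using A by (rule subring_upolys_over)
  define \<sigma>' where "\<sigma>' x = poly (map_poly \<sigma> (SOME p. p \<in> upolys_over A \<and> poly p b = x)) \<beta>" for x
  have eq: "\<sigma>' (poly p b) = poly (map_poly \<sigma> p) \<beta>" if p: "p \<in> upolys_over A" for p
  proof -
    define p' where "p' = (SOME p'. p' \<in> upolys_over A \<and> poly p' b = poly p b)"
    have p': "p' \<in> upolys_over A \<and> poly p' b = poly p b"
      unfolding p'_def by (rule someI_ex) (use p in blast)
    have "poly (map_poly \<sigma> (p' - p)) \<beta> = 0" using p p' U by (intro ker) (auto intro: subring_setD)
    moreover have "map_poly \<sigma> p' = map_poly \<sigma> (p' - p) + map_poly \<sigma> p"
      using hom_into_map_poly(1)[OF s A, of "p' - p" p] p p' U by (auto intro: subring_setD)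
    ultimately show ?thesis by (simp add: \<sigma>'_def p'_def)
  qed
  have "hom_into (adjoin A b) \<FF> \<sigma>'"
    unfolding hom_into_def
  proof (intro conjI ballI)
    show "\<sigma>' 0 = 0" using eq[of 0] U by (simp add: subring_setD)
    have "map_poly \<sigma> 1 = 1" using s by (simp add: map_poly_1' hom_into_def)
    then show "\<sigma>' 1 = 1" using eq[of 1] U by (simp add: subring_setD)
    show "\<sigma>' ` adjoin A b \<subseteq> \<FF>"
      unfolding adjoin_def using F \<beta> hom_into_map_poly_over[OF s] by (auto simp: eq intro!: poly_in_subring)
    fix x y assume "x \<in> adjoin A b" "y \<in> adjoin A b"
    then obtain p q where pq: "p \<in> upolys_over A" "q \<in> upolys_over A" and xy: "x = poly p b" "y = poly q b"
      unfolding adjoin_def by blast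
    have "p + q \<in> upolys_over A" "p * q \<in> upolys_over A" using pq U by (auto intro: subring_setD)
    from eq[OF this(1)] eq[OF this(2)]
    show "\<sigma>' (x + y) = \<sigma>' x + \<sigma>' y" "\<sigma>' (x * y) = \<sigma>' x * \<sigma>' y"
      by (simp_all add: xy eq pq hom_into_map_poly[OF s A pq])
  qed
  then show ?thesis using eq by blast
qed

text \<open>
  Homomorphisms into an algebraically closed field extend to one more generator, as long as one
  prescribed element does not become zero. If the generator is transcendental over \<open>A\<close>, its image
  only has to avoid the roots of one polynomial. Otherwise its image is a root of the image of its
  minimal polynomial, and Bezout's identity controls where the prescribed element vanishes.
\<close>

lemma hom_into_extend:
  assumes F: "root_closed_subfield \<FF>" and A: "subring_set A" and c: "c \<in> adjoin A b" "c \<noteq> 0"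
  shows "\<exists>\<alpha>\<in>A. \<alpha> \<noteq> 0 \<and> (\<forall>\<sigma>. hom_into A \<FF> \<sigma> \<and> \<sigma> \<alpha> \<noteq> 0 \<longrightarrow>
    (\<exists>\<sigma>'. hom_into (adjoin A b) \<FF> \<sigma>' \<and> (\<forall>x\<in>A. \<sigma>' x = \<sigma> x) \<and> \<sigma>' c \<noteq> 0))"
proof -
  have RF: "subring_set \<FF>" using F by (rule root_closed_subring)
  have U: "subring_set (upolys_over A)" using A by (rule subring_upolys_over)
  obtain g where g: "g \<in> upolys_over A" "c = poly g b" using c unfolding adjoin_def by blast
  define I where "I = {h \<in> upolys_over A. poly h b = 0}"
  have suff: "\<exists>\<sigma>'. hom_into (adjoin A b) \<FF> \<sigma>' \<and> (\<forall>x\<in>A. \<sigma>' x = \<sigma> x) \<and> \<sigma>' c \<noteq> 0"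
    if s: "hom_into A \<FF> \<sigma>" and \<beta>: "\<beta> \<in> \<FF>" "\<And>h. h \<in> I \<Longrightarrow> poly (map_poly \<sigma> h) \<beta> = 0"
      "poly (map_poly \<sigma> g) \<beta> \<noteq> 0" for \<sigma> \<beta>
  proof -
    obtain \<sigma>' where \<sigma>': "hom_into (adjoin A b) \<FF> \<sigma>'"
      "\<And>p. p\<in>upolys_over A \<Longrightarrow> \<sigma>' (poly p b) = poly (map_poly \<sigma> p) \<beta>"
      using hom_into_adjoin[OF s A RF \<beta>(1), of b] \<beta>(2) unfolding I_def by blast
    have "\<sigma>' x = \<sigma> x" if "x \<in> A" for x
      using \<sigma>'(2)[OF upolys_over_const[OF A that]] s by (simp add: map_poly_pCons hom_into_def)
    moreover have "\<sigma>' c \<noteq> 0" using \<sigma>'(2)[OF g(1)] g(2) \<beta>(3) by simp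
    ultimately show ?thesis using \<sigma>'(1) by blast
  qed
  show ?thesis
  proof (cases "I \<subseteq> {0}")
    case True
    have g0: "g \<noteq> 0" using g c by auto
    have "\<exists>\<sigma>'. hom_into (adjoin A b) \<FF> \<sigma>' \<and> (\<forall>x\<in>A. \<sigma>' x = \<sigma> x) \<and> \<sigma>' c \<noteq> 0"
      if s: "hom_into A \<FF> \<sigma>" and lc: "\<sigma> (lead_coeff g) \<noteq> 0" for \<sigma>
    proof -
      have "coeff (map_poly \<sigma> g) (degree g) \<noteq> 0" using s lc by (simp add: coeff_map_poly hom_into_def)
      then have "map_poly \<sigma> g \<noteq> 0" by auto
      then have "finite {x. poly (map_poly \<sigma> g) x = 0}" by (rule poly_roots_finite)
      then have "\<not> \<FF> \<subseteq> {x. poly (map_poly \<sigma> g) x = 0}" using infinite_subring[OF RF] finite_subset by blast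
      then obtain \<beta> where "\<beta> \<in> \<FF>" "poly (map_poly \<sigma> g) \<beta> \<noteq> 0" by blast
      then show ?thesis using suff[OF s] True by force
    qed
    then show ?thesis using g0 upolys_overD[OF g(1)] by (intro bexI[of _ "lead_coeff g"]) auto
  next
    case False
    then obtain f0 where "f0 \<in> I \<and> f0 \<noteq> 0" by blast
    then obtain f where f: "f \<in> I" "f \<noteq> 0" "\<And>h. h \<in> I \<Longrightarrow> h \<noteq> 0 \<Longrightarrow> degree f \<le> degree h"
      using ex_has_least_nat[of "\<lambda>h. h \<in> I \<and> h \<noteq> 0" f0 degree] by blast
    interpret contracted_prime A I f
      by unfold_locales (use A U f in \<open>auto simp: I_def subring_setD\<close>)
    have "g \<notin> I" using g c by (auto simp: I_def)
    then obtain u v R where uv: "u \<in> upolys_over A" "v \<in> upolys_over A" "R \<in> A" "R \<noteq> 0"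
      "u * f + v * g = [:R:]" using bezout_off_ideal[OF g(1)] by blast
    have lcA: "lead_coeff f \<in> A" using fU by (rule upolys_overD)
    have "\<exists>\<sigma>'. hom_into (adjoin A b) \<FF> \<sigma>' \<and> (\<forall>x\<in>A. \<sigma>' x = \<sigma> x) \<and> \<sigma>' c \<noteq> 0"
      if s: "hom_into A \<FF> \<sigma>" and n0: "\<sigma> (lead_coeff f * R) \<noteq> 0" for \<sigma>
    proof -
      have s0: "\<sigma> 0 = 0" using s by (simp add: hom_into_def)
      have n: "\<sigma> (lead_coeff f) \<noteq> 0" "\<sigma> R \<noteq> 0" using n0 s lcA uv(3) by (auto simp: hom_into_def)
      have "degree (map_poly \<sigma> f) = degree f" using n(1) by (simp add: map_poly_degree_eq)
      then have "degree (map_poly \<sigma> f) > 0" using degree_pos by simp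
      then obtain \<beta> where \<beta>: "poly (map_poly \<sigma> f) \<beta> = 0"
        using fundamental_theorem_of_algebra constant_degree by (metis less_numeral_extra(3))
      have "map_poly \<sigma> f \<noteq> 0" using \<open>degree (map_poly \<sigma> f) > 0\<close> by auto
      then have \<beta>F: "\<beta> \<in> \<FF>" using root_closed_root[OF F hom_into_map_poly_over[OF s fU] _ \<beta>] by blast
      have "poly (map_poly \<sigma> h) \<beta> = 0" if h: "h \<in> I" for h
      proof -
        obtain k w where w: "w \<in> upolys_over A" "Polynomial.smult (lead_coeff f ^ k) h = f * w"
          using ideal_multiple[OF h] by blast
        have hU: "h \<in> upolys_over A" using h by (auto simp: I_def)
        have kA: "lead_coeff f ^ k \<in> A" using lcA A by (simp add: subring_set_power)
        have "map_poly \<sigma> ([:lead_coeff f ^ k:] * h) = map_poly \<sigma> (f * w)" using w(2) by simp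
        then have "map_poly \<sigma> [:lead_coeff f ^ k:] * map_poly \<sigma> h = map_poly \<sigma> f * map_poly \<sigma> w"
          by (simp only: hom_into_map_poly(2)[OF s A upolys_over_const[OF A kA] hU]
            hom_into_map_poly(2)[OF s A fU w(1)])
        then have "Polynomial.smult (\<sigma> (lead_coeff f) ^ k) (map_poly \<sigma> h) = map_poly \<sigma> f * map_poly \<sigma> w"
          using hom_into_power[OF s A lcA] s0 by (simp add: map_poly_pCons)
        then have "\<sigma> (lead_coeff f) ^ k * poly (map_poly \<sigma> h) \<beta> = 0"
          using \<beta> by (metis poly_smult poly_mult mult_zero_left)
        then show ?thesis using n(1) by simp
      qed
      moreover have "poly (map_poly \<sigma> g) \<beta> \<noteq> 0"
      proof
        assume z: "poly (map_poly \<sigma> g) \<beta> = 0"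
        have "map_poly \<sigma> (u * f + v * g) = map_poly \<sigma> u * map_poly \<sigma> f + map_poly \<sigma> v * map_poly \<sigma> g"
          by (simp only: hom_into_map_poly(1)[OF s A subring_setD(4)[OF U uv(1) fU] subring_setD(4)[OF U uv(2) g(1)]]
            hom_into_map_poly(2)[OF s A uv(1) fU] hom_into_map_poly(2)[OF s A uv(2) g(1)])
        then have "[:\<sigma> R:] = map_poly \<sigma> u * map_poly \<sigma> f + map_poly \<sigma> v * map_poly \<sigma> g"
          using uv(5) s0 by (simp add: map_poly_pCons)
        then have "poly [:\<sigma> R:] \<beta> = 0" using \<beta> z by simp
        then show False using n(2) by simp
      qed
      ultimately show ?thesis using suff[OF s \<beta>F] by blast
    qed
    then show ?thesis using uv lcA f(2) A
      by (intro bexI[of _ "lead_coeff f * R"]) (auto simp: subring_setD)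
  qed
qed

lemma hom_into_extend_list:
  assumes F: "root_closed_subfield \<FF>"
  shows "subring_set A \<Longrightarrow> c \<in> fold (\<lambda>b A. adjoin A b) bs A \<Longrightarrow> c \<noteq> 0 \<Longrightarrow>
    \<exists>\<alpha>\<in>A. \<alpha> \<noteq> 0 \<and> (\<forall>\<sigma>. hom_into A \<FF> \<sigma> \<and> \<sigma> \<alpha> \<noteq> 0 \<longrightarrow>
      (\<exists>\<sigma>'. hom_into (fold (\<lambda>b A. adjoin A b) bs A) \<FF> \<sigma>' \<and> (\<forall>x\<in>A. \<sigma>' x = \<sigma> x) \<and> \<sigma>' c \<noteq> 0))"
proof (induction bs arbitrary: A)
  case Nil
  then show ?case by auto
next
  case (Cons b bs)
  have "subring_set (adjoin A b)" using Cons.prems by (simp add: subring_adjoin)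
  from Cons.IH[OF this] Cons.prems obtain \<alpha>' where \<alpha>': "\<alpha>' \<in> adjoin A b" "\<alpha>' \<noteq> 0"
    "\<And>\<sigma>. hom_into (adjoin A b) \<FF> \<sigma> \<Longrightarrow> \<sigma> \<alpha>' \<noteq> 0 \<Longrightarrow>
      (\<exists>\<sigma>'. hom_into (fold (\<lambda>b A. adjoin A b) (b # bs) A) \<FF> \<sigma>' \<and> (\<forall>x\<in>adjoin A b. \<sigma>' x = \<sigma> x) \<and> \<sigma>' c \<noteq> 0)"
    by auto
  obtain \<alpha> where \<alpha>: "\<alpha> \<in> A" "\<alpha> \<noteq> 0" "\<And>\<sigma>. hom_into A \<FF> \<sigma> \<Longrightarrow> \<sigma> \<alpha> \<noteq> 0 \<Longrightarrow>
    (\<exists>\<sigma>'. hom_into (adjoin A b) \<FF> \<sigma>' \<and> (\<forall>x\<in>A. \<sigma>' x = \<sigma> x) \<and> \<sigma>' \<alpha>' \<noteq> 0)"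
    using hom_into_extend[OF F Cons.prems(1) \<alpha>'(1,2)] by blast
  show ?case
  proof (intro bexI[OF _ \<alpha>(1)] conjI \<alpha>(2) allI impI, elim conjE)
    fix \<sigma> assume "hom_into A \<FF> \<sigma>" "\<sigma> \<alpha> \<noteq> 0"
    from \<alpha>(3)[OF this] obtain \<sigma>1 where s1: "hom_into (adjoin A b) \<FF> \<sigma>1" "\<forall>x\<in>A. \<sigma>1 x = \<sigma> x" "\<sigma>1 \<alpha>' \<noteq> 0" by blast
    from \<alpha>'(3)[OF s1(1,3)] obtain \<sigma>2 where "hom_into (fold (\<lambda>b A. adjoin A b) (b # bs) A) \<FF> \<sigma>2"
      "\<forall>x\<in>adjoin A b. \<sigma>2 x = \<sigma>1 x" "\<sigma>2 c \<noteq> 0" by blast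
    then show "\<exists>\<sigma>'. hom_into (fold (\<lambda>b A. adjoin A b) (b # bs) A) \<FF> \<sigma>' \<and> (\<forall>x\<in>A. \<sigma>' x = \<sigma> x) \<and> \<sigma>' c \<noteq> 0"
      using s1(2) adjoin_superset[OF Cons.prems(1), of b] by (intro exI[of _ \<sigma>2]) auto
  qed
qed

lemma fold_adjoin:
  "subring_set A \<Longrightarrow> subring_set (fold (\<lambda>b A. adjoin A b) bs A) \<and> A \<subseteq> fold (\<lambda>b A. adjoin A b) bs A
    \<and> set bs \<subseteq> fold (\<lambda>b A. adjoin A b) bs A"
proof (induction bs arbitrary: A)
  case (Cons b bs)
  then show ?case
    using Cons.IH[OF subring_adjoin[OF Cons.prems, of b]] adjoin_superset[OF Cons.prems, of b]
      adjoin_generator[OF Cons.prems, of b] by auto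
qed auto

lemma mpoly_eval_in_subring:
  assumes A: "subring_set A" and P: "P \<in> mpolys_over A" and a: "\<And>i. a i \<in> A"
  shows "mpoly_eval P a \<in> A" "monom_eval m a \<in> A"
proof -
  show m: "monom_eval m a \<in> A" for m
    unfolding monom_eval_def using A a by (intro subring_set_prod subring_set_power)
  show "mpoly_eval P a \<in> A"
    unfolding mpoly_eval_def using A P m
    by (intro subring_set_sum subring_setD(4)) (auto simp: mpolys_over_def)
qed

lemma hom_into_mpoly_eval:
  assumes s: "hom_into A \<FF>' \<sigma>" and A: "subring_set A" and F: "\<FF> \<subseteq> A" "\<And>x. x \<in> \<FF> \<Longrightarrow> \<sigma> x = x"
    and P: "P \<in> mpolys_over \<FF>" and a: "\<And>i. a i \<in> A"
  shows "\<sigma> (mpoly_eval P a) = mpoly_eval P (\<lambda>i. \<sigma> (a i))"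
proof -
  have PA: "Poly_Mapping.lookup P m \<in> A" "Poly_Mapping.lookup P m \<in> \<FF>" for m using P F by (auto simp: mpolys_over_def)
  have pow: "a i ^ k \<in> A" for i k using A a by (rule subring_set_power)
  have m: "\<sigma> (monom_eval m a) = monom_eval m (\<lambda>i. \<sigma> (a i))" "monom_eval m a \<in> A" for m
    unfolding monom_eval_def using pow a
    by (simp_all add: hom_into_prod[OF s A] hom_into_power[OF s A] subring_set_prod[OF A])
  have "\<sigma> (mpoly_eval P a) = (\<Sum>m\<in>Poly_Mapping.keys P. \<sigma> (Poly_Mapping.lookup P m * monom_eval m a))"
    unfolding mpoly_eval_def using PA m A by (intro hom_into_sum[OF s A] subring_setD(4)) auto
  also have "\<dots> = (\<Sum>m\<in>Poly_Mapping.keys P. Poly_Mapping.lookup P m * monom_eval m (\<lambda>i. \<sigma> (a i)))"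
  proof (rule sum.cong)
    fix k
    have "\<sigma> (Poly_Mapping.lookup P k * monom_eval k a) = \<sigma> (Poly_Mapping.lookup P k) * \<sigma> (monom_eval k a)"
      using s PA(1) m(2) by (simp add: hom_into_def)
    then show "\<sigma> (Poly_Mapping.lookup P k * monom_eval k a) = Poly_Mapping.lookup P k * monom_eval k (\<lambda>i. \<sigma> (a i))"
      using m F(2) PA(2) by simp
  qed simp
  finally show ?thesis by (simp add: mpoly_eval_def)
qed

text \<open>
  A form of Hilbert's Nullstellensatz. The point \<open>b\<close> is the image of \<open>a\<close> under a ring homomorphism to
  \<open>\<FF>\<close> that fixes \<open>\<FF>\<close>: the coordinates of \<open>a\<close> are adjoined to \<open>\<FF>\<close> one by one, and the identity of \<open>\<FF>\<close> is
  extended along this tower without letting \<open>g(a)\<close> become zero.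
\<close>

theorem specialization:
  fixes a :: "'v::finite \<Rightarrow> complex"
  assumes F: "root_closed_subfield \<FF>" and g: "g \<in> mpolys_over \<FF>" "mpoly_eval g a \<noteq> 0"
  shows "\<exists>b. (\<forall>i. b i \<in> \<FF>) \<and> mpoly_eval g b \<noteq> 0 \<and> (\<forall>P\<in>mpolys_over \<FF>. mpoly_eval P a = 0 \<longrightarrow> mpoly_eval P b = 0)"
proof -
  have RF: "subring_set \<FF>" using F by (rule root_closed_subring)
  obtain vs :: "'v list" where vs: "set vs = UNIV" using finite_list[of "UNIV :: 'v set"] by auto
  define B where "B = fold (\<lambda>b A. adjoin A b) (map a vs) \<FF>"
  have B: "subring_set B" "\<FF> \<subseteq> B" "a i \<in> B" for i
    using fold_adjoin[OF RF, of "map a vs"] vs by (auto simp: B_def)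
  have "g \<in> mpolys_over B" using g(1) B(2) by (auto simp: mpolys_over_def)
  then have "mpoly_eval g a \<in> B" using mpoly_eval_in_subring(1)[OF B(1)] B(3) by blast
  then obtain \<alpha> where \<alpha>: "\<alpha> \<noteq> 0" "\<And>\<sigma>. hom_into \<FF> \<FF> \<sigma> \<and> \<sigma> \<alpha> \<noteq> 0 \<Longrightarrow>
      (\<exists>\<sigma>'. hom_into B \<FF> \<sigma>' \<and> (\<forall>x\<in>\<FF>. \<sigma>' x = \<sigma> x) \<and> \<sigma>' (mpoly_eval g a) \<noteq> 0)"
    using hom_into_extend_list[OF F RF _ g(2), of "map a vs"] unfolding B_def by blast
  have "hom_into \<FF> \<FF> id" by (simp add: hom_into_def)
  then obtain \<sigma> where \<sigma>: "hom_into B \<FF> \<sigma>" "\<And>x. x \<in> \<FF> \<Longrightarrow> \<sigma> x = x" "\<sigma> (mpoly_eval g a) \<noteq> 0"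
    using \<alpha>(2)[of id] \<alpha>(1) by auto
  have eq: "\<sigma> (mpoly_eval P a) = mpoly_eval P (\<lambda>i. \<sigma> (a i))" if "P \<in> mpolys_over \<FF>" for P
    using hom_into_mpoly_eval[OF \<sigma>(1) B(1,2) \<sigma>(2) that B(3)] .
  have "\<sigma> 0 = 0" "\<And>i. \<sigma> (a i) \<in> \<FF>" using \<sigma>(1) B(3) by (auto simp: hom_into_def)
  then show ?thesis using eq g(1) \<sigma>(3) by (intro exI[of _ "\<lambda>i. \<sigma> (a i)"]) (metis (no_types, lifting))
qed

section \<open>Homogenization and polynomial functions\<close>

text \<open>
  Homogenization to a prescribed degree \<open>k\<close>. For \<open>k = tdeg P\<close> it is \<open>hom_eval\<close>; unlike the latter, it is
  additive in \<open>P\<close>.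
\<close>

definition hom_at :: "nat \<Rightarrow> 'v cmpoly \<Rightarrow> ('v \<Rightarrow> complex) \<Rightarrow> complex \<Rightarrow> complex" where
  "hom_at k P v w = (\<Sum>m\<in>Poly_Mapping.keys P. Poly_Mapping.lookup P m * monom_eval m v * w ^ (k - monom_deg m))"

lemma hom_eval_hom_at: "hom_eval P v w = hom_at (tdeg P) P v w"
  by (simp add: hom_eval_def hom_at_def)

lemma mpoly_eval_hom_at: "mpoly_eval P v = hom_at k P v 1"
  by (simp add: mpoly_eval_def hom_at_def)

lemma hom_at_superset:
  "finite S \<Longrightarrow> Poly_Mapping.keys P \<subseteq> S \<Longrightarrow>
    hom_at k P v w = (\<Sum>m\<in>S. Poly_Mapping.lookup P m * monom_eval m v * w ^ (k - monom_deg m))"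
  unfolding hom_at_def by (rule sum.mono_neutral_left) (auto simp: in_keys_iff)

lemma hom_at_add: "hom_at k (P + Q) v w = hom_at k P v w + hom_at k Q v w"
proof -
  define S where "S = Poly_Mapping.keys P \<union> Poly_Mapping.keys Q"
  have S: "finite S" "Poly_Mapping.keys P \<subseteq> S" "Poly_Mapping.keys Q \<subseteq> S" "Poly_Mapping.keys (P + Q) \<subseteq> S"
    unfolding S_def using Poly_Mapping.keys_add[of P Q] by auto
  show ?thesis
    by (simp add: hom_at_superset[OF S(1,2)] hom_at_superset[OF S(1,3)] hom_at_superset[OF S(1,4)]
        lookup_add sum.distrib[symmetric] algebra_simps)
qed

lemma hom_at_0 [simp]: "hom_at k 0 v w = 0"
  by (simp add: hom_at_def)

lemma hom_at_sum: "hom_at k (\<Sum>i\<in>I. P i) v w = (\<Sum>i\<in>I. hom_at k (P i) v w)"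
  by (induction I rule: infinite_finite_induct) (auto simp: hom_at_add)

lemma hom_at_single: "hom_at k (Poly_Mapping.single m c) v w = c * monom_eval m v * w ^ (k - monom_deg m)"
  by (cases "c = 0") (simp_all add: hom_at_def)

lemma monom_deg_le_tdeg: "m \<in> Poly_Mapping.keys P \<Longrightarrow> monom_deg m \<le> tdeg P"
  unfolding tdeg_def by (auto intro: Max_ge)

lemma tdeg_leI: "(\<And>m. m \<in> Poly_Mapping.keys P \<Longrightarrow> monom_deg m \<le> k) \<Longrightarrow> tdeg P \<le> k"
  unfolding tdeg_def by (subst Max_le_iff) auto

lemma monom_eval_scale: "monom_eval m (\<lambda>i. c * v i) = c ^ monom_deg m * monom_eval m v"
  unfolding monom_eval_def monom_deg_def
  by (simp add: power_mult_distrib prod.distrib power_sum)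

lemma hom_at_scale:
  assumes "tdeg P \<le> k"
  shows "hom_at k P (\<lambda>i. c * v i) (c * w) = c ^ k * hom_at k P v w"
  unfolding hom_at_def sum_distrib_left
proof (rule sum.cong)
  fix m assume "m \<in> Poly_Mapping.keys P"
  then have "monom_deg m \<le> k" using assms monom_deg_le_tdeg[of m P] by simp
  then have "c ^ k = c ^ monom_deg m * c ^ (k - monom_deg m)" by (simp flip: power_add)
  then show "Poly_Mapping.lookup P m * monom_eval m (\<lambda>i. c * v i) * (c * w) ^ (k - monom_deg m)
    = c ^ k * (Poly_Mapping.lookup P m * monom_eval m v * w ^ (k - monom_deg m))"
    by (simp add: monom_eval_scale power_mult_distrib)
qed simp

lemma hom_at_above_tdeg: "tdeg P < k \<Longrightarrow> hom_at k P v 0 = 0"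
  unfolding hom_at_def by (rule sum.neutral) (use monom_deg_le_tdeg[of _ P] in force)

lemma hom_at_tendsto:
  assumes "\<And>i. ((\<lambda>t. v t i) \<longlongrightarrow> v0 i) T" "(w \<longlongrightarrow> w0) T"
  shows "((\<lambda>t. hom_at k P (v t) (w t)) \<longlongrightarrow> hom_at k P v0 w0) T"
  unfolding hom_at_def monom_eval_def using assms by (auto intro!: tendsto_intros)

lemma monom_eval_add: "monom_eval (m + m') x = monom_eval m x * monom_eval m' x"
proof -
  define S where "S = Poly_Mapping.keys m \<union> Poly_Mapping.keys m'"
  have *: "monom_eval e x = (\<Prod>i\<in>S. x i ^ Poly_Mapping.lookup e i)" if "Poly_Mapping.keys e \<subseteq> S" for e
    unfolding monom_eval_def using that
    by (intro prod.mono_neutral_left) (auto simp: S_def in_keys_iff)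
  have "Poly_Mapping.keys (m + m') \<subseteq> S" using Poly_Mapping.keys_add[of m m'] by (auto simp: S_def)
  then show ?thesis
    using *[of m] *[of m'] *[of "m + m'"] by (simp add: S_def lookup_add power_add prod.distrib)
qed

lemma monom_eval_single [simp]: "monom_eval (Poly_Mapping.single i k) x = x i ^ k"
  by (cases "k = 0") (simp_all add: monom_eval_def)

lemma monom_deg_single [simp]: "monom_deg (Poly_Mapping.single i k) = k"
  by (cases "k = 0") (simp_all add: monom_deg_def)

lemma monom_deg_add: "monom_deg (m + m') = monom_deg m + monom_deg m'"
proof -
  define S where "S = Poly_Mapping.keys m \<union> Poly_Mapping.keys m'"
  have *: "monom_deg e = (\<Sum>i\<in>S. Poly_Mapping.lookup e i)" if "Poly_Mapping.keys e \<subseteq> S" for e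
    unfolding monom_deg_def using that
    by (intro sum.mono_neutral_left) (auto simp: S_def in_keys_iff)
  have "Poly_Mapping.keys (m + m') \<subseteq> S" using Poly_Mapping.keys_add[of m m'] by (auto simp: S_def)
  then show ?thesis
    using *[of m] *[of m'] *[of "m + m'"] by (simp add: S_def lookup_add sum.distrib)
qed

lemma mpoly_eval_sum: "mpoly_eval (\<Sum>i\<in>I. P i) v = (\<Sum>i\<in>I. mpoly_eval (P i) v)"
  by (simp add: mpoly_eval_hom_at[of _ _ 0] hom_at_sum)

lemma mpoly_eval_single: "mpoly_eval (Poly_Mapping.single m c) v = c * monom_eval m v"
  by (simp add: mpoly_eval_hom_at[of _ _ 0] hom_at_single)

lemma mpolys_over_single: "subring_set A \<Longrightarrow> c \<in> A \<Longrightarrow> Poly_Mapping.single m c \<in> mpolys_over A"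
  by (auto simp: mpolys_over_def lookup_single when_def subring_setD)

lemma lookup_sum_apply: "Poly_Mapping.lookup (\<Sum>i\<in>I. P i) m = (\<Sum>i\<in>I. Poly_Mapping.lookup (P i) m)"
  by (induction I rule: infinite_finite_induct) (auto simp: lookup_add)

lemma mpolys_over_sum: "subring_set A \<Longrightarrow> (\<And>i. i \<in> I \<Longrightarrow> P i \<in> mpolys_over A) \<Longrightarrow> (\<Sum>i\<in>I. P i) \<in> mpolys_over A"
  by (auto simp: mpolys_over_def lookup_sum_apply intro!: subring_set_sum)

text \<open>
  Polynomial functions with coefficients in \<open>A\<close>. Conditions built from values, coefficients and
  determinants are seen to be polynomial by closure properties, without naming the polynomial.
\<close>

definition polyfun :: "complex set \<Rightarrow> (('v \<Rightarrow> complex) \<Rightarrow> complex) \<Rightarrow> bool" where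
  "polyfun A h \<longleftrightarrow> (\<exists>P\<in>mpolys_over A. \<forall>x. mpoly_eval P x = h x)"

lemma polyfun_mpoly_eval: "P \<in> mpolys_over A \<Longrightarrow> polyfun A (mpoly_eval P)"
  unfolding polyfun_def by blast

lemma polyfun_const: "subring_set A \<Longrightarrow> c \<in> A \<Longrightarrow> polyfun A (\<lambda>x. c)"
  unfolding polyfun_def
  by (rule bexI[of _ "Poly_Mapping.single 0 c"]) (auto simp: mpoly_eval_single mpolys_over_single monom_eval_def)

lemma polyfun_var: "subring_set A \<Longrightarrow> polyfun A (\<lambda>x. x i)"
  unfolding polyfun_def
  by (rule bexI[of _ "Poly_Mapping.single (Poly_Mapping.single i 1) 1"])
    (auto simp: mpoly_eval_single mpolys_over_single subring_setD)

lemma polyfun_add: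
  assumes A: "subring_set A" and "polyfun A g" "polyfun A h"
  shows "polyfun A (\<lambda>x. g x + h x)"
proof -
  from assms obtain P Q where "P \<in> mpolys_over A" "Q \<in> mpolys_over A" "\<forall>x. mpoly_eval P x = g x" "\<forall>x. mpoly_eval Q x = h x"
    unfolding polyfun_def by blast
  then show ?thesis unfolding polyfun_def using A
    by (intro bexI[of _ "P + Q"]) (auto simp: mpoly_eval_hom_at[of _ _ 0] hom_at_add mpolys_over_def lookup_add subring_setD)
qed

lemma polyfun_mult:
  assumes A: "subring_set A" and "polyfun A g" "polyfun A h"
  shows "polyfun A (\<lambda>x. g x * h x)"
proof -
  from assms obtain P Q where P: "P \<in> mpolys_over A" "Q \<in> mpolys_over A" and eq: "\<forall>x. mpoly_eval P x = g x" "\<forall>x. mpoly_eval Q x = h x"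
    unfolding polyfun_def by blast
  define S where "S = (\<Sum>m\<in>Poly_Mapping.keys P. \<Sum>m'\<in>Poly_Mapping.keys Q.
    Poly_Mapping.single (m + m') (Poly_Mapping.lookup P m * Poly_Mapping.lookup Q m'))"
  have "S \<in> mpolys_over A"
    unfolding S_def using P A
    by (intro mpolys_over_sum mpolys_over_single subring_setD(4)) (auto simp: mpolys_over_def)
  moreover have "mpoly_eval S x = g x * h x" for x
  proof -
    have "mpoly_eval S x = (\<Sum>m\<in>Poly_Mapping.keys P. \<Sum>m'\<in>Poly_Mapping.keys Q.
        Poly_Mapping.lookup P m * Poly_Mapping.lookup Q m' * (monom_eval m x * monom_eval m' x))"
      by (simp add: S_def mpoly_eval_sum mpoly_eval_single monom_eval_add)
    also have "\<dots> = mpoly_eval P x * mpoly_eval Q x"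
      by (simp add: mpoly_eval_def sum_product mult_ac)
    finally show ?thesis using eq by simp
  qed
  ultimately show ?thesis unfolding polyfun_def by blast
qed

lemma polyfun_sum:
  "subring_set A \<Longrightarrow> (\<And>i. i \<in> I \<Longrightarrow> polyfun A (h i)) \<Longrightarrow> polyfun A (\<lambda>x. \<Sum>i\<in>I. h i x)"
  by (induction I rule: infinite_finite_induct) (auto intro: polyfun_const polyfun_add subring_setD)

lemma polyfun_prod:
  "subring_set A \<Longrightarrow> (\<And>i. i \<in> I \<Longrightarrow> polyfun A (h i)) \<Longrightarrow> polyfun A (\<lambda>x. \<Prod>i\<in>I. h i x)"
  by (induction I rule: infinite_finite_induct) (auto intro: polyfun_const polyfun_mult subring_setD)

lemma polyfun_power: "subring_set A \<Longrightarrow> polyfun A h \<Longrightarrow> polyfun A (\<lambda>x. h x ^ k)"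
  by (induction k) (auto intro: polyfun_const polyfun_mult subring_setD)

lemma polyfun_cmult: "subring_set A \<Longrightarrow> c \<in> A \<Longrightarrow> polyfun A h \<Longrightarrow> polyfun A (\<lambda>x. c * h x)"
  by (intro polyfun_mult polyfun_const)

lemma polyfun_diff: "subring_set A \<Longrightarrow> polyfun A g \<Longrightarrow> polyfun A h \<Longrightarrow> polyfun A (\<lambda>x. g x - h x)"
  using polyfun_add[of A g "\<lambda>x. -1 * h x"] polyfun_cmult[of A "-1" h] by (simp add: subring_setD)

section \<open>Common roots and the Sylvester determinant\<close>

text \<open>
  The matrix of \<open>(u, v) \<mapsto> u p + v q\<close>, with \<open>deg u < n\<close> and \<open>deg v < m\<close>, in the monomial bases; it is
  the Sylvester matrix of \<open>p\<close> and \<open>q\<close>, taken as polynomials of formal degrees \<open>m\<close> and \<open>n\<close>.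
\<close>

definition sylvester :: "nat \<Rightarrow> nat \<Rightarrow> complex poly \<Rightarrow> complex poly \<Rightarrow> complex mat" where
  "sylvester m n p q = Matrix.mat (m + n) (m + n)
     (\<lambda>(j, i). if i < n then coeff (monom 1 i * p) j else coeff (monom 1 (i - n) * q) j)"

lemma dvd_of_no_common_root:
  fixes p q v :: "complex poly"
  assumes "p \<noteq> 0" "\<And>t. poly p t = 0 \<Longrightarrow> poly q t \<noteq> 0" "p dvd v * q"
  shows "p dvd v"
  using assms
proof (induction "degree p" arbitrary: p v)
  case 0
  then obtain c where "p = [:c:]" by (metis degree_eq_zeroE)
  then have "is_unit p" using 0 by (simp add: is_unit_const_poly_iff dvd_field_iff)
  then show ?case by (rule unit_imp_dvd)
next
  case (Suc k)
  then obtain t where t: "poly p t = 0"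
    using fundamental_theorem_of_algebra constant_degree by (metis nat.distinct(1))
  define l where "l = [:-t, 1:]"
  have l: "l \<noteq> 0" "degree l = 1" by (simp_all add: l_def)
  obtain p' where p': "p = l * p'" using t unfolding l_def by (metis poly_eq_0_iff_dvd dvdE)
  have "poly (v * q) t = 0" using Suc.prems(3) t by (metis dvdE mult_zero_left poly_mult)
  then have "poly v t = 0" using Suc.prems(2)[OF t] by simp
  then obtain v' where v': "v = l * v'" unfolding l_def by (metis poly_eq_0_iff_dvd dvdE)
  have "l * p' dvd l * (v' * q)" using Suc.prems(3) by (simp add: p' v' mult.assoc)
  then have "p' dvd v' * q" using l(1) by simp
  moreover have "p' \<noteq> 0" using p' Suc.prems(1) by auto
  moreover have "degree p = Suc (degree p')" using l \<open>p' \<noteq> 0\<close> by (simp add: p' degree_mult_eq)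
  then have "k = degree p'" using Suc.hyps(2) by simp
  moreover have "poly q t' \<noteq> 0" if "poly p' t' = 0" for t' using Suc.prems(2)[of t'] that p' by simp
  ultimately have "p' dvd v'" using Suc.hyps(1)[of p' v'] by blast
  then show ?case unfolding p' v' by (rule mult_dvd_mono[OF dvd_refl])
qed

lemma det_sylvester_common_root:
  assumes p: "degree p \<le> m" and q: "degree q \<le> n" and mn: "m + n > 0" and t: "poly p t = 0" "poly q t = 0"
  shows "Determinant.det (sylvester m n p q) = 0"
proof -
  let ?S = "sylvester m n p q"
  have S: "?S \<in> carrier_mat (m + n) (m + n)" by (simp add: sylvester_def)
  have deg_p: "degree (monom 1 i * p) < m + n" if "i < n" for i
    using that p le_less_trans[OF degree_mult_le[of "monom 1 i" p]] by (simp add: degree_monom_eq)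
  have deg_q: "degree (monom 1 i * q) < m + n" if "i < m" for i
    using that q le_less_trans[OF degree_mult_le[of "monom 1 i" q]] by (simp add: degree_monom_eq)
  define v where "v = Matrix.vec (m + n) (\<lambda>j. t ^ j)"
  have ev: "(\<Sum>j<m + n. coeff r j * t ^ j) = poly r t" if "degree r < m + n" for r
    unfolding poly_altdef by (intro sum.mono_neutral_right) (use that in \<open>auto simp: coeff_eq_0\<close>)
  have "transpose_mat ?S *\<^sub>v v = 0\<^sub>v (m + n)"
  proof (rule eq_vecI)
    fix i assume "i < dim_vec (0\<^sub>v (m + n) :: complex Matrix.vec)"
    then have i: "i < m + n" by simp
    have "vec_index (transpose_mat ?S *\<^sub>v v) i
      = (\<Sum>j<m + n. coeff (if i < n then monom 1 i * p else monom 1 (i - n) * q) j * t ^ j)"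
      using i by (simp add: sylvester_def v_def scalar_prod_def atLeast0LessThan if_distrib[of "\<lambda>r. coeff r _"])
    also have "\<dots> = 0"
      using i t deg_p[of i] deg_q[of "i - n"] by (subst ev) auto
    finally show "vec_index (transpose_mat ?S *\<^sub>v v) i = vec_index (0\<^sub>v (m + n)) i" using i by simp
  qed (simp add: sylvester_def)
  moreover have "v \<in> carrier_vec (m + n)" by (simp add: v_def)
  moreover have "vec_index v 0 \<noteq> vec_index (0\<^sub>v (m + n)) 0" using mn by (simp add: v_def)
  then have "v \<noteq> 0\<^sub>v (m + n)" by metis
  ultimately have "Determinant.det (transpose_mat ?S) = 0"
    using S by (subst det_0_iff_vec_prod_zero[of _ "m + n"]) (auto intro!: exI[of _ v])
  then show "Determinant.det ?S = 0" using det_transpose[OF S] by simp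
qed

text \<open>
  A vector in the kernel is a relation \<open>u p + v q = 0\<close> with \<open>deg v < deg p\<close>. Without a common root \<open>p\<close>
  would divide \<open>v\<close>. Only \<open>p\<close> has to attain its formal degree.
\<close>

lemma det_sylvester_eq_0_iff:
  assumes p: "degree p = m" "m > 0" and q: "degree q \<le> n"
  shows "Determinant.det (sylvester m n p q) = 0 \<longleftrightarrow> (\<exists>t. poly p t = 0 \<and> poly q t = 0)"
proof
  assume "\<exists>t. poly p t = 0 \<and> poly q t = 0"
  then show "Determinant.det (sylvester m n p q) = 0"
    using det_sylvester_common_root[of p m q n] p q by auto
next
  let ?S = "sylvester m n p q"
  have S: "?S \<in> carrier_mat (m + n) (m + n)" by (simp add: sylvester_def)
  have deg_p: "degree (monom 1 i * p) < m + n" if "i < n" for i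
    using that p le_less_trans[OF degree_mult_le[of "monom 1 i" p]] by (simp add: degree_monom_eq)
  have deg_q: "degree (monom 1 i * q) < m + n" if "i < m" for i
    using that q le_less_trans[OF degree_mult_le[of "monom 1 i" q]] by (simp add: degree_monom_eq)
  assume "Determinant.det ?S = 0"
  then obtain x where x: "x \<in> carrier_vec (m + n)" "x \<noteq> 0\<^sub>v (m + n)" "?S *\<^sub>v x = 0\<^sub>v (m + n)"
    using det_0_iff_vec_prod_zero[OF S] by blast
  define u where "u = (\<Sum>i<n. monom (vec_index x i) i)"
  define v where "v = (\<Sum>i<m. monom (vec_index x (n + i)) i)"
  have cu: "coeff u i = (if i < n then vec_index x i else 0)" for i
    by (simp add: u_def coeff_sum coeff_monom)
  have cv: "coeff v i = (if i < m then vec_index x (n + i) else 0)" for i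
    by (simp add: v_def coeff_sum coeff_monom)
  have uv: "u * p + v * q = (\<Sum>i<n. Polynomial.smult (vec_index x i) (monom 1 i * p))
      + (\<Sum>i<m. Polynomial.smult (vec_index x (n + i)) (monom 1 i * q))"
    by (simp add: u_def v_def sum_distrib_right smult_monom flip: mult_smult_left)
  have "u * p + v * q = 0"
  proof (rule poly_eqI)
    fix j
    have split: "(\<Sum>i<m + n. g i) = (\<Sum>i<n. g i) + (\<Sum>i<m. g (n + i))" for g :: "nat \<Rightarrow> complex"
      by (induction m) (auto simp: add.commute[of _ n] add.assoc)
    show "coeff (u * p + v * q) j = coeff 0 j"
    proof (cases "j < m + n")
      case True
      have "coeff (u * p + v * q) j = vec_index (?S *\<^sub>v x) j"
        using True x(1) unfolding uv
        by (simp add: sylvester_def scalar_prod_def atLeast0LessThan coeff_sum split mult.commute)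
      then show ?thesis using x(3) True by simp
    next
      case False
      have "coeff (monom 1 i * p) j = 0" if "i < n" for i
        using deg_p[OF that] False by (intro coeff_eq_0) linarith
      moreover have "coeff (monom 1 i * q) j = 0" if "i < m" for i
        using deg_q[OF that] False by (intro coeff_eq_0) linarith
      ultimately show ?thesis unfolding uv by (simp add: coeff_sum)
    qed
  qed
  show "\<exists>t. poly p t = 0 \<and> poly q t = 0"
  proof (rule ccontr)
    assume no: "\<nexists>t. poly p t = 0 \<and> poly q t = 0"
    have p0: "p \<noteq> 0" using p by auto
    have "- (u * p) = v * q" using \<open>u * p + v * q = 0\<close> by (rule minus_unique)
    then have "v * q = p * (- u)" by (simp add: mult.commute)
    then have "p dvd v * q" by (rule dvdI)
    then have "p dvd v" using no p0 by (intro dvd_of_no_common_root[of p q v]) auto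
    moreover have "degree v < m" if "v \<noteq> 0"
      using that cv[of "degree v"] by (cases "degree v < m") auto
    ultimately have v: "v = 0" using p(1) dvd_imp_degree_le[of p v] by (cases "v = 0") auto
    then have u: "u = 0" using \<open>u * p + v * q = 0\<close> p0 by simp
    have "vec_index x i = 0" if "i < m + n" for i
      using cu[of i] cv[of "i - n"] u v that by (cases "i < n") (auto simp: less_diff_conv2)
    then have "x = 0\<^sub>v (m + n)" using x(1) by (intro eq_vecI) auto
    then show False using x(2) by simp
  qed
qed

lemma polyfun_det_sylvester:
  assumes A: "subring_set A" and p: "\<And>i. polyfun A (\<lambda>x. coeff (p x) i)" and q: "\<And>i. polyfun A (\<lambda>x. coeff (q x) i)"
  shows "polyfun A (\<lambda>x. Determinant.det (sylvester m n (p x) (q x)))"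
proof -
  have shift: "polyfun A (\<lambda>x. coeff (monom 1 i * r x) j)" if "\<And>i. polyfun A (\<lambda>x. coeff (r x) i)"
    for i j and r :: "('v \<Rightarrow> complex) \<Rightarrow> complex poly"
    using that polyfun_const[OF A subring_setD(1)[OF A]] by (cases "i \<le> j") (simp_all add: coeff_monom_mult)
  have entry: "polyfun A (\<lambda>x. sylvester m n (p x) (q x) $$ (j, i))" if "i < m + n" "j < m + n" for i j
    using that shift[OF p] shift[OF q] by (cases "i < n") (simp_all add: sylvester_def)
  have dims: "dim_row (sylvester m n (p x) (q x)) = m + n" "dim_col (sylvester m n (p x) (q x)) = m + n" for x
    by (simp_all add: sylvester_def)
  have sg: "signof s \<in> A" for s :: "nat \<Rightarrow> nat"
    using subring_setD(2)[OF A] subring_setD(5)[OF A subring_setD(2)[OF A]] by (simp add: sign_def)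
  have "Determinant.det (sylvester m n (p x) (q x)) = (\<Sum>s | s permutes {0..<m + n}.
      signof s * (\<Prod>i = 0..<m + n. sylvester m n (p x) (q x) $$ (i, s i)))" for x
    by (simp only: Determinant.det_def dims simp_thms if_True)
  moreover have "polyfun A (\<lambda>x. \<Sum>s | s permutes {0..<m + n}.
      signof s * (\<Prod>i = 0..<m + n. sylvester m n (p x) (q x) $$ (i, s i)))"
  proof (intro polyfun_sum[OF A] polyfun_cmult[OF A sg] polyfun_prod[OF A] entry)
    fix s i assume "s \<in> {s. s permutes {0..<m + n}}" "i \<in> {0..<m + n}"
    then show "s i < m + n" "i < m + n" using permutes_in_image[of s "{0..<m + n}" i] by auto
  qed
  ultimately show ?thesis by simp
qed

section \<open>Polynomials in two variables\<close>

text \<open>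
  A polynomial in \<open>x\<close> and \<open>y\<close> is an element of \<open>\<complex>[x][y]\<close>: the outer variable is \<open>y\<close>, and
  \<open>coeff (coeff g j) i\<close> belongs to \<open>x\<^sup>i y\<^sup>j\<close>.
\<close>

abbreviation bipolys :: "complex set \<Rightarrow> complex poly poly set" where
  "bipolys A \<equiv> upolys_over (upolys_over A)"

definition ev :: "complex poly poly \<Rightarrow> complex \<Rightarrow> complex \<Rightarrow> complex" where
  "ev g x y = poly (poly g [:y:]) x"

definition slice :: "complex poly poly \<Rightarrow> complex \<Rightarrow> complex poly" where
  "slice g x = map_poly (\<lambda>u. poly u x) g"

lemma coeff_slice [simp]: "coeff (slice g x) j = poly (coeff g j) x"
  by (simp add: slice_def coeff_map_poly)

lemma ev_simps [simp]:
  "ev (g + h) x y = ev g x y + ev h x y" "ev (g - h) x y = ev g x y - ev h x y"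
  "ev (g * h) x y = ev g x y * ev h x y" "ev (- g) x y = - ev g x y" "ev [:u:] x y = poly u x"
  "ev 0 x y = 0" "ev 1 x y = 1" "ev (Polynomial.smult u g) x y = poly u x * ev g x y"
  by (simp_all add: ev_def)

lemma ev_expand: "ev g x y = (\<Sum>j\<le>degree g. poly (coeff g j) x * y ^ j)"
proof -
  have "[:y:] ^ j = [:y ^ j:]" for j by (induction j) (simp_all add: pCons_one)
  then show ?thesis by (simp add: ev_def poly_altdef[of g] poly_sum mult.commute)
qed

lemma poly_slice: "poly (slice g x) y = ev g x y"
proof -
  have "degree (slice g x) \<le> degree g" by (rule degree_le) (simp add: coeff_eq_0)
  have "poly (slice g x) y = (\<Sum>j\<le>degree g. coeff (slice g x) j * y ^ j)"
    unfolding poly_altdef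
    by (rule sum.mono_neutral_left) (use \<open>degree (slice g x) \<le> degree g\<close> in \<open>auto simp: coeff_eq_0 simp del: coeff_slice\<close>)
  then show ?thesis by (simp add: ev_expand)
qed

lemma slice_mult: "slice (g * h) x = slice g x * slice h x"
  by (rule poly_ext) (simp add: poly_slice)

lemma slice_eq_0_iff: "slice g x = 0 \<longleftrightarrow> (\<forall>j. poly (coeff g j) x = 0)"
  by (auto simp: poly_eq_iff)

subsection \<open>Total degree\<close>

definition tdeg_le :: "complex poly poly \<Rightarrow> nat \<Rightarrow> bool" where
  "tdeg_le g k \<longleftrightarrow> (\<forall>i j. coeff (coeff g j) i \<noteq> 0 \<longrightarrow> i + j \<le> k)"

text \<open>The form of degree \<open>k\<close> in \<open>g\<close>, dehomogenized at \<open>x = 1\<close>.\<close>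

definition form_part :: "complex poly poly \<Rightarrow> nat \<Rightarrow> complex poly" where
  "form_part g k = (\<Sum>j\<le>k. monom (coeff (coeff g j) (k - j)) j)"

lemma coeff_form_part: "coeff (form_part g k) j = (if j \<le> k then coeff (coeff g j) (k - j) else 0)"
  by (simp add: form_part_def coeff_sum coeff_monom)

lemma degree_form_part: "degree (form_part g k) \<le> k"
  by (rule degree_le) (simp add: coeff_form_part)

lemma tdeg_leD: "tdeg_le g k \<Longrightarrow> k < i + j \<Longrightarrow> coeff (coeff g j) i = 0"
  unfolding tdeg_le_def by (meson leD)

lemma tdeg_le_mono: "tdeg_le g k \<Longrightarrow> k \<le> l \<Longrightarrow> tdeg_le g l"
  unfolding tdeg_le_def by (meson le_trans)

lemma tdeg_le_exists: "\<exists>k. tdeg_le g k"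
proof -
  define k where "k = degree g + (\<Sum>j\<le>degree g. degree (coeff g j))"
  have "i + j \<le> k" if nz: "coeff (coeff g j) i \<noteq> 0" for i j
  proof -
    have j: "j \<le> degree g" using nz by (cases "j \<le> degree g") (auto simp: coeff_eq_0)
    then have "degree (coeff g j) \<le> (\<Sum>j\<le>degree g. degree (coeff g j))"
      by (intro member_le_sum) auto
    then show ?thesis using j le_degree[OF nz] by (simp add: k_def)
  qed
  then have "tdeg_le g k" by (simp add: tdeg_le_def)
  then show ?thesis ..
qed

lemma tdeg_le_iff_form_part: "tdeg_le g K \<Longrightarrow> tdeg_le g k \<longleftrightarrow> (\<forall>l>k. form_part g l = 0)"
proof
  assume "tdeg_le g k"
  then show "\<forall>l>k. form_part g l = 0"
    by (intro allI impI poly_eqI) (simp add: coeff_form_part tdeg_leD)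
next
  assume *: "\<forall>l>k. form_part g l = 0"
  show "tdeg_le g k" unfolding tdeg_le_def
  proof (intro allI impI)
    fix i j assume nz: "coeff (coeff g j) i \<noteq> 0"
    have "coeff (form_part g (i + j)) j \<noteq> 0" using nz by (simp add: coeff_form_part)
    then have "form_part g (i + j) \<noteq> 0" by auto
    then show "i + j \<le> k" using * by (cases "i + j \<le> k") auto
  qed
qed

lemma ev_form_parts:
  assumes "tdeg_le g K"
  shows "ev g x (l * x) = (\<Sum>k\<le>K. poly (form_part g k) l * x ^ k)"
proof -
  let ?a = "\<lambda>i j. coeff (coeff g j) i"
  have inner: "poly (coeff g j) x = (\<Sum>i\<le>K. ?a i j * x ^ i)" for j
  proof -
    have "coeff (coeff g j) i = 0" if "i \<in> {..degree (coeff g j)} - {..K}" for i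
      using that by (intro tdeg_leD[OF assms]) auto
    then show ?thesis unfolding poly_altdef by (intro sum.mono_neutral_cong) (simp_all add: coeff_eq_0)
  qed
  have "ev g x (l * x) = (\<Sum>j\<le>K. poly (coeff g j) x * (l * x) ^ j)"
    unfolding ev_expand
  proof (intro sum.mono_neutral_cong)
    fix j assume "j \<in> {..degree g} - {..K}"
    then have "coeff g j = 0" by (auto intro!: poly_eqI tdeg_leD[OF assms])
    then show "poly (coeff g j) x * (l * x) ^ j = 0" by simp
  qed (auto simp: coeff_eq_0)
  also have "\<dots> = (\<Sum>j\<le>K. \<Sum>i\<le>K. ?a i j * l ^ j * x ^ (i + j))"
    unfolding inner sum_distrib_right by (simp add: power_mult_distrib power_add mult_ac)
  also have "\<dots> = (\<Sum>(j, i)\<in>{..K} \<times> {..K}. ?a i j * l ^ j * x ^ (i + j))"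
    by (simp add: sum.cartesian_product)
  also have "\<dots> = (\<Sum>(j, i)\<in>{(j, i). j + i \<le> K}. ?a i j * l ^ j * x ^ (i + j))"
  proof (rule sum.mono_neutral_right)
    show "\<forall>p\<in>{..K} \<times> {..K} - {(j, i). j + i \<le> K}. (case p of (j, i) \<Rightarrow> ?a i j * l ^ j * x ^ (i + j)) = 0"
    proof
      fix p assume p: "p \<in> {..K} \<times> {..K} - {(j, i). j + i \<le> K}"
      obtain j i where ji: "p = (j, i)" by (cases p)
      have "?a i j = 0" using p ji by (intro tdeg_leD[OF assms]) simp
      then show "(case p of (j, i) \<Rightarrow> ?a i j * l ^ j * x ^ (i + j)) = 0" using ji by simp
    qed
  qed auto
  also have "\<dots> = (\<Sum>k\<le>K. \<Sum>j\<le>k. ?a (k - j) j * l ^ j * x ^ k)"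
    by (subst sum.triangle_reindex_eq) auto
  also have "\<dots> = (\<Sum>k\<le>K. poly (form_part g k) l * x ^ k)"
    by (simp add: form_part_def poly_sum poly_monom sum_distrib_right)
  finally show ?thesis .
qed

lemma form_part_mult:
  assumes g: "tdeg_le g a" and h: "tdeg_le h b"
  shows "tdeg_le (g * h) (a + b)" "form_part (g * h) (a + b) = form_part g a * form_part h b"
proof -
  define D where "D g K l = (\<Sum>k\<le>K. monom (poly (form_part g k) l) k)" for g K l
  have coeff_D: "coeff (D g K l) k = (if k \<le> K then poly (form_part g k) l else 0)" for g K l k
    by (simp add: D_def coeff_sum coeff_monom)
  have poly_D: "poly (D g K l) x = ev g x (l * x)" if "tdeg_le g K" for g K l x
    by (simp add: D_def poly_sum poly_monom ev_form_parts[OF that])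
  have deg_D: "degree (D g K l) \<le> K" for g K l by (rule degree_le) (simp add: coeff_D)
  obtain M0 where "tdeg_le (g * h) M0" using tdeg_le_exists by blast
  define M where "M = M0 + a + b"
  have M: "tdeg_le (g * h) M" "a + b \<le> M"
    using tdeg_le_mono[OF \<open>tdeg_le (g * h) M0\<close>, of M] by (simp_all add: M_def)
  have eq: "D (g * h) M l = D g a l * D h b l" for l
    by (rule poly_ext) (simp add: poly_D g h M)
  have "poly (form_part (g * h) k) l = 0" if "k > a + b" for k l
  proof (cases "k \<le> M")
    case True
    have "degree (D (g * h) M l) \<le> a + b"
      unfolding eq using degree_mult_le[of "D g a l" "D h b l"] deg_D[of g a l] deg_D[of h b l] by linarith
    then show ?thesis using True that coeff_D[of "g * h" M l k] by (simp add: coeff_eq_0)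
  next
    case False
    then show ?thesis using tdeg_le_iff_form_part[OF M(1), of M] M(1) by (simp add: not_le)
  qed
  then have "\<forall>k>a + b. form_part (g * h) k = 0" by (auto intro!: poly_ext)
  then show "tdeg_le (g * h) (a + b)" using tdeg_le_iff_form_part[OF M(1), of "a + b"] by simp
  have "coeff (D g a l * D h b l) (a + b) = coeff (D g a l) a * coeff (D h b l) b" for l
  proof -
    have "coeff (D g a l * D h b l) (a + b) = (\<Sum>i\<le>a + b. coeff (D g a l) i * coeff (D h b l) (a + b - i))"
      by (simp add: coeff_mult)
    also have "\<dots> = (\<Sum>i\<in>{a}. coeff (D g a l) i * coeff (D h b l) (a + b - i))"
      by (rule sum.mono_neutral_right) (auto simp: coeff_D)
    finally show ?thesis by simp
  qed
  then show "form_part (g * h) (a + b) = form_part g a * form_part h b"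
    using M(2) by (intro poly_ext) (simp flip: eq add: coeff_D)
qed

lemma least_tdeg:
  assumes "g \<noteq> 0"
  shows "\<exists>k. tdeg_le g k \<and> form_part g k \<noteq> 0 \<and> degree g \<le> k"
proof -
  define k where "k = (LEAST k. tdeg_le g k)"
  have k: "tdeg_le g k" unfolding k_def using tdeg_le_exists by (rule LeastI_ex)
  define j i where "j = degree g" and "i = degree (lead_coeff g)"
  have ji: "coeff (coeff g j) i \<noteq> 0" using assms by (simp add: i_def j_def)
  have "form_part g k \<noteq> 0"
  proof
    assume z: "form_part g k = 0"
    show False
    proof (cases k)
      case 0
      then have "i = 0" "j = 0" using ji k by (auto simp: tdeg_le_def)
      then have "coeff (form_part g k) 0 \<noteq> 0" using ji 0 by (simp add: coeff_form_part)
      then show False using z by simp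
    next
      case (Suc k')
      have "form_part g l = 0" if "l > k'" for l
        using that z tdeg_le_iff_form_part[OF k, of k] k Suc by (cases "l = k") auto
      then have "tdeg_le g k'" using tdeg_le_iff_form_part[OF k] by blast
      then have "k \<le> k'" unfolding k_def by (rule Least_le)
      then show False using Suc by simp
    qed
  qed
  moreover have "degree g \<le> k"
    using tdeg_leD[OF k, of i j] ji by (cases "degree g \<le> k") (auto simp: j_def)
  ultimately show ?thesis using k by blast
qed

text \<open>
  Total degrees and \<open>y\<close>-degrees both add up in a product, and the total degree is never the smaller
  one. So if they agree for the product, they agree for each factor.
\<close>

lemma factor_tdeg:
  assumes p: "g * h = p" "p \<noteq> 0" "tdeg_le p m" "degree p = m"
  shows "tdeg_le g (degree g)"
proof -
  have nz: "g \<noteq> 0" "h \<noteq> 0" using p by auto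
  obtain a b where ab: "tdeg_le g a" "form_part g a \<noteq> 0" "degree g \<le> a"
    "tdeg_le h b" "form_part h b \<noteq> 0" "degree h \<le> b"
    using least_tdeg[OF nz(1)] least_tdeg[OF nz(2)] by blast
  have "form_part p (a + b) \<noteq> 0" using form_part_mult(2)[OF ab(1,4)] ab(2,5) p(1) by simp
  then have "a + b \<le> m" using p(3) tdeg_le_iff_form_part[OF p(3), of m] by (meson not_le)
  moreover have "degree g + degree h = m" using p nz by (metis degree_mult_eq)
  ultimately have "a = degree g" using ab by linarith
  then show ?thesis using ab by simp
qed

subsection \<open>Gauss's lemma over an algebraically closed field\<close>

lemma linear_factor_over:
  fixes p :: "'a::idom poly"
  assumes A: "subring_set A" and p: "p \<in> upolys_over A" and c: "c \<in> A" "poly p c = 0"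
  shows "synthetic_div p c \<in> upolys_over A" "p = [:-c, 1:] * synthetic_div p c"
proof -
  show eq: "p = [:-c, 1:] * synthetic_div p c" using synthetic_div_correct'[of c p] c by simp
  have l: "[:-c, 1:] \<in> upolys_over A" using A c by (intro upolys_over_pCons upolys_over_0) (auto simp: subring_setD)
  obtain w r where w: "w \<in> upolys_over A" and wr: "p = [:-c, 1:] * w + r" "r = 0 \<or> degree r < 1"
    using pseudo_division[OF A p l] by auto
  have "poly r c = 0" using arg_cong[OF wr(1), of "\<lambda>p. poly p c"] c by simp
  moreover obtain d where "r = [:d:]" using wr(2) by (cases "r = 0") (auto elim: degree_eq_zeroE)
  ultimately have "r = 0" by simp
  then have "[:-c, 1:] * synthetic_div p c = [:-c, 1:] * w" using wr(1) eq by simp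
  then have "synthetic_div p c = w" by (simp only: mult_cancel_left pCons_eq_0_iff) simp
  then show "synthetic_div p c \<in> upolys_over A" using w by simp
qed

lemma vertical_factor:
  assumes A: "subring_set A" and g: "g \<in> bipolys A" and c: "c \<in> A" "slice g c = 0"
  shows "\<exists>g'\<in>bipolys A. g = Polynomial.smult [:-c, 1:] g'"
proof -
  have z: "poly (coeff g j) c = 0" for j using c(2) by (simp add: slice_eq_0_iff)
  define g' where "g' = map_poly (\<lambda>u. synthetic_div u c) g"
  have cg': "coeff g' j = synthetic_div (coeff g j) c" for j by (simp add: g'_def coeff_map_poly)
  have "g' \<in> bipolys A"
    using linear_factor_over(1)[OF A upolys_overD[OF g] c(1) z] by (auto intro!: upolys_overI simp: cg' upolys_overD)
  moreover have "g = Polynomial.smult [:-c, 1:] g'"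
    using linear_factor_over(2)[OF A upolys_overD[OF g] c(1) z] by (intro poly_eqI) (simp only: coeff_smult cg')
  ultimately show ?thesis by blast
qed

text \<open>
  Over an algebraically closed field the multiplier splits into linear factors \<open>x - c\<close>. As \<open>f\<close> does not
  vanish on the line \<open>x = c\<close>, the cofactor \<open>w\<close> does, and \<open>x - c\<close> cancels.
\<close>

lemma gauss_cancel:
  assumes F: "root_closed_subfield \<FF>"
    and f: "f \<in> bipolys \<FF>" "\<And>c. c \<in> \<FF> \<Longrightarrow> slice f c \<noteq> 0"
  shows "L \<in> upolys_over \<FF> \<Longrightarrow> L \<noteq> 0 \<Longrightarrow> w \<in> bipolys \<FF> \<Longrightarrow> Polynomial.smult L g = f * w \<Longrightarrow>
    \<exists>w\<in>bipolys \<FF>. g = f * w"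
proof (induction "degree L" arbitrary: L w)
  case 0
  then obtain c where L: "L = [:c:]" by (metis degree_eq_zeroE)
  have A: "subring_set \<FF>" using F by (rule root_closed_subring)
  have c: "c \<noteq> 0" "c \<in> \<FF>" using 0 L upolys_overD[of L \<FF> 0] by auto
  then have c': "1 / c \<in> \<FF>" using F A by (auto intro: root_closed_divide simp: subring_setD)
  have "g = Polynomial.smult [:1 / c:] (Polynomial.smult L g)" using c by (simp add: L pCons_one)
  then have "g = f * Polynomial.smult [:1 / c:] w" using 0 by simp
  moreover have "Polynomial.smult [:1 / c:] w \<in> bipolys \<FF>"
    using 0 c' A by (intro upolys_over_smult subring_upolys_over upolys_over_const)
  ultimately show ?case by blast
next
  case (Suc k)
  have A: "subring_set \<FF>" using F by (rule root_closed_subring)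
  obtain c where c: "poly L c = 0"
    using Suc.hyps(2) fundamental_theorem_of_algebra constant_degree by (metis nat.distinct(1))
  have cF: "c \<in> \<FF>" using root_closed_root[OF F Suc.prems(1,2) c] .
  define L' where "L' = synthetic_div L c"
  have L': "L' \<in> upolys_over \<FF>" "L = [:-c, 1:] * L'"
    using linear_factor_over[OF A Suc.prems(1) cF c] by (simp_all add: L'_def)
  have "slice (f * w) c = slice (Polynomial.smult L g) c" using Suc.prems(4) by simp
  also have "\<dots> = 0" using c by (simp add: slice_eq_0_iff)
  finally have "slice w c = 0" using f(2)[OF cF] by (simp add: slice_mult)
  then obtain w' where w': "w' \<in> bipolys \<FF>" "w = Polynomial.smult [:-c, 1:] w'"
    using vertical_factor[OF A Suc.prems(3) cF] by blast
  have "Polynomial.smult [:-c, 1:] (Polynomial.smult L' g) = Polynomial.smult [:-c, 1:] (f * w')"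
    using Suc.prems(4) unfolding L'(2) w'(2) by (simp only: smult_smult mult_smult_right)
  then have "Polynomial.smult [:-c, 1:] (Polynomial.smult L' g - f * w') = 0"
    by (simp only: smult_diff_right diff_self)
  then have "Polynomial.smult L' g = f * w'" by (simp only: smult_eq_0_iff) simp
  moreover have "L' \<noteq> 0" using L' Suc.prems(2) by auto
  moreover have "degree L = Suc (degree L')" unfolding L'(2) using \<open>L' \<noteq> 0\<close> by (subst degree_mult_eq) auto
  then have "k = degree L'" using Suc.hyps(2) by simp
  ultimately show ?case using Suc.hyps(1)[OF _ L'(1) _ w'(1)] by blast
qed

section \<open>The equation of an irreducible plane curve\<close>

definition vanishes_on :: "complex poly poly \<Rightarrow> (complex \<times> complex) set \<Rightarrow> bool" where
  "vanishes_on g Z \<longleftrightarrow> (\<forall>(x, y)\<in>Z. ev g x y = 0)"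

text \<open>
  The last two clauses express that the ideal of \<open>Z\<close> is generated by \<open>f\<close>, and that modulo \<open>f\<close> every
  polynomial outside this ideal divides a non-zero polynomial in \<open>x\<close> alone.
\<close>

definition plane_equation :: "complex set \<Rightarrow> (complex \<times> complex) set \<Rightarrow> complex poly poly \<Rightarrow> bool" where
  "plane_equation \<FF> Z f \<longleftrightarrow> f \<in> bipolys \<FF> \<and> lead_coeff f = 1 \<and> degree f > 0 \<and> tdeg_le f (degree f) \<and>
     vanishes_on f Z \<and>
     (\<forall>g\<in>bipolys \<FF>. vanishes_on g Z \<longrightarrow> (\<exists>w\<in>bipolys \<FF>. g = f * w)) \<and>
     (\<forall>g\<in>bipolys \<FF>. \<not> vanishes_on g Z \<longrightarrow>
        (\<exists>u\<in>bipolys \<FF>. \<exists>v\<in>bipolys \<FF>. \<exists>R\<in>upolys_over \<FF>. R \<noteq> 0 \<and> u * f + v * g = [:R:]))"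

text \<open>
  An irreducible plane curve, not a vertical line and not passing through \<open>(0 : 1 : 0)\<close>, has an
  equation that is monic in \<open>y\<close> and whose total degree is its \<open>y\<close>-degree. A polynomial of the ideal
  that does not vanish at \<open>(0 : 1 : 0)\<close> is a multiple of the equation, and this forces both
  properties on the equation.
\<close>

lemma plane_equation_exists:
  assumes F: "root_closed_subfield \<FF>" and Z: "Z \<subseteq> \<FF> \<times> \<FF>" "Z \<noteq> {}"
    and prime: "\<And>g h. g \<in> bipolys \<FF> \<Longrightarrow> h \<in> bipolys \<FF> \<Longrightarrow> vanishes_on (g * h) Z \<Longrightarrow> vanishes_on g Z \<or> vanishes_on h Z"
    and not_vertical: "\<And>c. c \<in> \<FF> \<Longrightarrow> \<exists>p\<in>Z. fst p \<noteq> c"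
    and P: "P \<in> bipolys \<FF>" "vanishes_on P Z" "tdeg_le P m" "coeff (coeff P m) 0 \<noteq> 0"
  shows "\<exists>f. plane_equation \<FF> Z f"
proof -
  have SR: "subring_set \<FF>" using F by (rule root_closed_subring)
  have U: "subring_set (upolys_over \<FF>)" using SR by (rule subring_upolys_over)
  have U2: "subring_set (bipolys \<FF>)" using U by (rule subring_upolys_over)
  define I where "I = {g \<in> bipolys \<FF>. vanishes_on g Z}"
  have contr: "u = 0" if "u \<in> upolys_over \<FF>" "[:u:] \<in> I" for u
    using that
  proof (induction "degree u" arbitrary: u)
    case 0
    then obtain c where c: "u = [:c:]" by (metis degree_eq_zeroE)
    obtain x y where "(x, y) \<in> Z" using Z(2) by auto
    then have "ev [:u:] x y = 0" using 0 by (auto simp: I_def vanishes_on_def)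
    then show ?case using c by simp
  next
    case (Suc k)
    obtain c where c: "poly u c = 0"
      using Suc.hyps(2) fundamental_theorem_of_algebra constant_degree by (metis nat.distinct(1))
    have u0: "u \<noteq> 0" using Suc.hyps(2) by auto
    have cF: "c \<in> \<FF>" using root_closed_root[OF F Suc.prems(1) u0 c] .
    define u' where "u' = synthetic_div u c"
    have u': "u' \<in> upolys_over \<FF>" "u = [:-c, 1:] * u'"
      using linear_factor_over[OF SR Suc.prems(1) cF c] by (simp_all add: u'_def)
    have l: "[:-c, 1:] \<in> upolys_over \<FF>" using SR cF by (intro upolys_over_pCons upolys_over_0) (auto simp: subring_setD)
    have "[:[:-c, 1:]:] * [:u':] = [:u:]" using u'(2) by simp
    then have "vanishes_on ([:[:-c, 1:]:] * [:u':]) Z" using Suc.prems(2) by (simp add: I_def)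
    then have "vanishes_on [:[:-c, 1:]:] Z \<or> vanishes_on [:u':] Z"
      by (intro prime upolys_over_const[OF U]) (use l u' in auto)
    moreover have "\<not> vanishes_on [:[:-c, 1:]:] Z"
      using not_vertical[OF cF] by (auto simp: vanishes_on_def)
    ultimately have "[:u':] \<in> I" using upolys_over_const[OF U u'(1)] by (simp add: I_def)
    moreover have "u' \<noteq> 0" using u' u0 by auto
    then have "degree u = Suc (degree u')" unfolding u'(2) by (subst degree_mult_eq) auto
    ultimately have "u' = 0" using Suc.hyps(1)[OF _ u'(1)] Suc.hyps(2) by simp
    then show ?case using u'(2) by simp
  qed
  have P0: "P \<noteq> 0" using P(4) by auto
  \<comment> \<open>Least \<open>y\<close>-degree makes \<open>f\<^sub>0\<close> a generator up to multipliers from \<open>\<FF>[x]\<close>; a leading coefficient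
      of least degree makes it primitive, so that the multipliers cancel.\<close>
  define d where "d = (LEAST d. \<exists>g\<in>I. g \<noteq> 0 \<and> degree g = d)"
  have "\<exists>g\<in>I. g \<noteq> 0 \<and> degree g = d"
    unfolding d_def by (rule LeastI_ex) (use P P0 in \<open>auto simp: I_def\<close>)
  then obtain g0 where "g0 \<in> I \<and> g0 \<noteq> 0 \<and> degree g0 = d" by blast
  then obtain f0 where f0: "f0 \<in> I" "f0 \<noteq> 0" "degree f0 = d"
    and f0_min: "\<And>g. g \<in> I \<Longrightarrow> g \<noteq> 0 \<Longrightarrow> degree g = d \<Longrightarrow> degree (lead_coeff f0) \<le> degree (lead_coeff g)"
    using ex_has_least_nat[of "\<lambda>g. g \<in> I \<and> g \<noteq> 0 \<and> degree g = d" g0 "\<lambda>g. degree (lead_coeff g)"] by blast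
  have d_min: "d \<le> degree g" if "g \<in> I" "g \<noteq> 0" for g
    unfolding d_def by (rule Least_le) (use that in blast)
  interpret contracted_prime "upolys_over \<FF>" I f0
  proof
    show "g + h \<in> I" if "g \<in> I" "h \<in> I" for g h
      using that subring_setD(3)[OF U2] by (fastforce simp: I_def vanishes_on_def)
    show "h * g \<in> I" if "g \<in> I" "h \<in> bipolys \<FF>" for g h
      using that subring_setD(4)[OF U2] by (fastforce simp: I_def vanishes_on_def)
    show "g \<in> I \<or> h \<in> I" if "g \<in> bipolys \<FF>" "h \<in> bipolys \<FF>" "g * h \<in> I" for g h
      using that prime by (auto simp: I_def)
  qed (use U contr f0 d_min in \<open>auto simp: I_def\<close>)
  have slice0: "slice f0 c \<noteq> 0" if c: "c \<in> \<FF>" for c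
  proof
    assume "slice f0 c = 0"
    then obtain f' where f': "f' \<in> bipolys \<FF>" "f0 = Polynomial.smult [:-c, 1:] f'"
      using vertical_factor[OF SR fU c] by blast
    have l: "[:-c, 1:] \<in> upolys_over \<FF>" using SR c by (intro upolys_over_pCons upolys_over_0) (auto simp: subring_setD)
    have nz: "f' \<noteq> 0" using f' f0 by auto
    have "[:[:-c, 1:]:] * f' \<in> I" using f0(1) f'(2) by simp
    moreover have "[:[:-c, 1:]:] \<notin> I" using contr[OF l] by auto
    ultimately have "f' \<in> I" using I_prime[OF upolys_over_const[OF U l] f'(1)] by blast
    moreover have "degree f' = d" using f0(3) unfolding f'(2) by simp
    ultimately have "degree (lead_coeff f0) \<le> degree (lead_coeff f')" using f0_min nz by blast
    moreover have "lead_coeff f0 = [:-c, 1:] * lead_coeff f'" unfolding f'(2) by simp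
    then have "degree (lead_coeff f0) = Suc (degree (lead_coeff f'))" using nz
      by (simp only:) (subst degree_mult_eq, auto)
    ultimately show False by simp
  qed
  have multiple0: "\<exists>w\<in>bipolys \<FF>. g = f0 * w" if g: "g \<in> I" for g
  proof -
    obtain k w where w: "w \<in> bipolys \<FF>" "Polynomial.smult (lead_coeff f0 ^ k) g = f0 * w"
      using ideal_multiple[OF g] by blast
    have "lead_coeff f0 ^ k \<in> upolys_over \<FF>" using U fU by (intro subring_set_power) (auto intro: upolys_overD)
    then show ?thesis using gauss_cancel[OF F fU slice0 _ _ w] f0(2) by simp
  qed
  obtain w where w: "w \<in> bipolys \<FF>" "P = f0 * w" using multiple0[of P] P by (auto simp: I_def)
  have degP: "degree P = m"
  proof (rule antisym)
    show "degree P \<le> m" using P(3) by (auto intro!: degree_le poly_eqI tdeg_leD)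
    have "coeff P m \<noteq> 0" using P(4) by auto
    then show "m \<le> degree P" by (rule le_degree)
  qed
  have "coeff P m = [:coeff (coeff P m) 0:]"
    using P(3) by (intro poly_eqI) (auto simp: coeff_pCons split: nat.splits intro: tdeg_leD)
  then have "degree (lead_coeff f0 * lead_coeff w) = 0"
    using w(2) degP by (metis degree_pCons_0 lead_coeff_mult)
  moreover have "lead_coeff f0 \<noteq> 0" "lead_coeff w \<noteq> 0" using w(2) P0 by auto
  ultimately have "degree (lead_coeff f0) = 0" by (simp add: degree_mult_eq)
  then obtain c where c: "lead_coeff f0 = [:c:]" by (metis degree_eq_zeroE)
  have c0: "c \<noteq> 0" using c f0(2) by auto
  have "c \<in> \<FF>" using upolys_overD[OF upolys_overD[OF fU, of "degree f0"], of 0] c by simp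
  then have c': "1 / c \<in> \<FF>" "c \<in> \<FF>" using F SR by (auto intro: root_closed_divide simp: subring_setD)
  have cU: "[:1 / c:] \<in> upolys_over \<FF>" "[:c:] \<in> upolys_over \<FF>" using c' SR by (auto intro: upolys_over_const)
  define f where "f = Polynomial.smult [:1 / c:] f0"
  have f_f0: "f0 = Polynomial.smult [:c:] f" using c0 by (simp add: f_def pCons_one)
  have fB: "f \<in> bipolys \<FF>" unfolding f_def using U cU(1) fU by (rule upolys_over_smult)
  have deg: "degree f = degree f0" using c0 by (simp add: f_def)
  have "tdeg_le f (degree f)"
    using factor_tdeg[of f "Polynomial.smult [:c:] w" P m] w(2) P0 P(3) degP f_f0 by simp
  moreover have "lead_coeff f = 1" using c c0 by (simp add: f_def pCons_one)
  moreover have "vanishes_on f Z" using f0(1) by (auto simp: I_def vanishes_on_def f_def)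
  moreover have "\<exists>w\<in>bipolys \<FF>. g = f * w" if g: "g \<in> bipolys \<FF>" "vanishes_on g Z" for g
  proof -
    obtain w where "w \<in> bipolys \<FF>" "g = f0 * w" using multiple0[of g] g by (auto simp: I_def)
    then show ?thesis using f_f0 upolys_over_smult[OF U cU(2)] by (intro bexI[of _ "Polynomial.smult [:c:] w"]) auto
  qed
  moreover have "\<exists>u\<in>bipolys \<FF>. \<exists>v\<in>bipolys \<FF>. \<exists>R\<in>upolys_over \<FF>. R \<noteq> 0 \<and> u * f + v * g = [:R:]"
    if g: "g \<in> bipolys \<FF>" "\<not> vanishes_on g Z" for g
  proof -
    obtain u v R where uv: "u \<in> bipolys \<FF>" "v \<in> bipolys \<FF>" "R \<in> upolys_over \<FF>" "R \<noteq> 0" "u * f0 + v * g = [:R:]"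
      using bezout_off_ideal[of g] g by (auto simp: I_def)
    then have "Polynomial.smult [:c:] u * f + v * g = [:R:]" using f_f0 by simp
    then show ?thesis using uv upolys_over_smult[OF U cU(2) uv(1)] by blast
  qed
  ultimately show ?thesis
    unfolding plane_equation_def using fB deg degree_pos by (intro exI[of _ f]) auto
qed

section \<open>Conversion between the two representations of polynomials\<close>

definition to_mpoly :: "'v \<Rightarrow> 'v \<Rightarrow> complex poly poly \<Rightarrow> 'v cmpoly" where
  "to_mpoly a b f = (\<Sum>j\<le>degree f. \<Sum>i\<le>degree (coeff f j).
     Poly_Mapping.single (Poly_Mapping.single a i + Poly_Mapping.single b j) (coeff (coeff f j) i))"

lemma to_mpoly_over: "subring_set A \<Longrightarrow> f \<in> bipolys A \<Longrightarrow> to_mpoly a b f \<in> mpolys_over A"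
  unfolding to_mpoly_def by (intro mpolys_over_sum mpolys_over_single upolys_overD)

lemma hom_at_to_mpoly:
  "hom_at k (to_mpoly a b f) v w =
    (\<Sum>j\<le>degree f. \<Sum>i\<le>degree (coeff f j). coeff (coeff f j) i * (v a ^ i * v b ^ j) * w ^ (k - (i + j)))"
  by (simp add: to_mpoly_def hom_at_sum hom_at_single monom_eval_add monom_deg_add)

lemma mpoly_eval_to_mpoly: "mpoly_eval (to_mpoly a b f) v = ev f (v a) (v b)"
proof -
  have "mpoly_eval (to_mpoly a b f) v =
    (\<Sum>j\<le>degree f. \<Sum>i\<le>degree (coeff f j). coeff (coeff f j) i * (v a ^ i * v b ^ j))"
    unfolding mpoly_eval_hom_at[of _ _ 0] hom_at_to_mpoly by simp
  also have "\<dots> = (\<Sum>j\<le>degree f. poly (coeff f j) (v a) * v b ^ j)"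
    by (simp add: poly_altdef sum_distrib_right mult.assoc)
  finally show ?thesis by (simp add: ev_expand)
qed

lemma tdeg_to_mpoly_le:
  assumes "tdeg_le f k"
  shows "tdeg (to_mpoly a b f) \<le> k"
proof (rule tdeg_leI)
  fix m assume "m \<in> Poly_Mapping.keys (to_mpoly a b f)"
  then have "(\<Sum>j\<le>degree f. \<Sum>i\<le>degree (coeff f j). Poly_Mapping.lookup
      (Poly_Mapping.single (Poly_Mapping.single a i + Poly_Mapping.single b j) (coeff (coeff f j) i)) m) \<noteq> 0"
    by (simp add: to_mpoly_def in_keys_iff lookup_sum_apply)
  then obtain j where "(\<Sum>i\<le>degree (coeff f j). Poly_Mapping.lookup
      (Poly_Mapping.single (Poly_Mapping.single a i + Poly_Mapping.single b j) (coeff (coeff f j) i)) m) \<noteq> 0"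
    by (rule sum.not_neutral_contains_not_neutral)
  then obtain i where "Poly_Mapping.lookup
      (Poly_Mapping.single (Poly_Mapping.single a i + Poly_Mapping.single b j) (coeff (coeff f j) i)) m \<noteq> 0"
    by (rule sum.not_neutral_contains_not_neutral)
  then have "m = Poly_Mapping.single a i + Poly_Mapping.single b j" "coeff (coeff f j) i \<noteq> 0"
    by (auto simp: lookup_single when_def split: if_splits)
  then show "monom_deg m \<le> k" using assms by (simp add: monom_deg_add tdeg_le_def)
qed

lemma hom_at_to_mpoly_infinity:
  assumes "tdeg_le f k"
  shows "hom_at k (to_mpoly a b f) v 0 = (\<Sum>j\<le>k. coeff (form_part f k) j * (v a ^ (k - j) * v b ^ j))"
proof -
  have inner: "(\<Sum>i\<le>degree (coeff f j). coeff (coeff f j) i * (v a ^ i * v b ^ j) * 0 ^ (k - (i + j)))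
      = (if j \<le> k then coeff (coeff f j) (k - j) * (v a ^ (k - j) * v b ^ j) else 0)" (is "sum ?g _ = ?r") for j
  proof -
    have zero: "?g i = 0" if "i \<noteq> k - j \<or> k < j" for i
      using that tdeg_leD[OF assms, of i j] by (cases "i + j \<le> k") (auto simp: power_0_left)
    show ?thesis
    proof (cases "j \<le> k")
      case True
      have "sum ?g {..degree (coeff f j)} = sum ?g ({..degree (coeff f j)} \<inter> {k - j})"
        using zero by (intro sum.mono_neutral_right) auto
      also have "\<dots> = ?r" using True by (cases "k - j \<le> degree (coeff f j)") (auto simp: coeff_eq_0 not_le)
      finally show ?thesis .
    next
      case False
      then show ?thesis using zero by (simp add: sum.neutral)
    qed
  qed
  have "hom_at k (to_mpoly a b f) v 0
    = (\<Sum>j\<le>degree f. if j \<le> k then coeff (coeff f j) (k - j) * (v a ^ (k - j) * v b ^ j) else 0)"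
    unfolding hom_at_to_mpoly inner ..
  also have "\<dots> = (\<Sum>j\<le>k. coeff (form_part f k) j * (v a ^ (k - j) * v b ^ j))"
    by (rule sum.mono_neutral_cong) (auto simp: coeff_form_part coeff_eq_0)
  finally show ?thesis .
qed

lemma hom_at_to_mpoly_slope:
  assumes "tdeg_le f k" "v a = 1"
  shows "hom_at k (to_mpoly a b f) v 0 = poly (form_part f k) (v b)"
proof -
  have "poly (form_part f k) (v b) = (\<Sum>j\<le>k. coeff (form_part f k) j * v b ^ j)"
    unfolding poly_altdef using degree_form_part[of f k]
    by (intro sum.mono_neutral_left) (auto simp: coeff_eq_0)
  then show ?thesis using assms by (simp add: hom_at_to_mpoly_infinity)
qed

definition of_mpoly :: "2 cmpoly \<Rightarrow> complex poly poly" where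
  "of_mpoly P = (\<Sum>m\<in>Poly_Mapping.keys P.
     monom (monom (Poly_Mapping.lookup P m) (Poly_Mapping.lookup m 1)) (Poly_Mapping.lookup m 2))"

lemma monom_eval_2: "monom_eval m (x :: 2 \<Rightarrow> complex) = x 1 ^ Poly_Mapping.lookup m 1 * x 2 ^ Poly_Mapping.lookup m 2"
proof -
  have "monom_eval m x = (\<Prod>i\<in>UNIV. x i ^ Poly_Mapping.lookup m i)"
    unfolding monom_eval_def by (rule prod.mono_neutral_left) (auto simp: in_keys_iff)
  then show ?thesis by (simp add: UNIV_2)
qed

lemma monom_deg_2: "monom_deg (m :: 2 \<Rightarrow>\<^sub>0 nat) = Poly_Mapping.lookup m 1 + Poly_Mapping.lookup m 2"
proof -
  have "monom_deg m = (\<Sum>i\<in>UNIV. Poly_Mapping.lookup m i)"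
    unfolding monom_deg_def by (rule sum.mono_neutral_left) (auto simp: in_keys_iff)
  then show ?thesis by (simp add: UNIV_2)
qed

lemma ev_monom: "ev (monom u k) x y = poly u x * y ^ k"
proof -
  have "[:y:] ^ k = [:y ^ k:]" by (induction k) (simp_all add: pCons_one)
  then show ?thesis by (simp add: ev_def poly_monom)
qed

lemma ev_sum: "ev (sum g I) x y = (\<Sum>i\<in>I. ev (g i) x y)"
  by (simp add: ev_def poly_sum)

lemma ev_of_mpoly: "ev (of_mpoly P) (v 1) (v 2) = mpoly_eval P v"
  by (simp add: of_mpoly_def ev_sum ev_monom poly_monom mpoly_eval_def monom_eval_2 mult.assoc)

lemma of_mpoly_over: "subring_set A \<Longrightarrow> P \<in> mpolys_over A \<Longrightarrow> of_mpoly P \<in> bipolys A"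
  unfolding of_mpoly_def
  by (intro subring_set_sum subring_upolys_over upolys_over_monom) (auto simp: mpolys_over_def)

lemma coeff_of_mpoly: "coeff (coeff (of_mpoly P) j) i =
  (\<Sum>m\<in>Poly_Mapping.keys P. if Poly_Mapping.lookup m 1 = i \<and> Poly_Mapping.lookup m 2 = j then Poly_Mapping.lookup P m else 0)"
  by (auto simp: of_mpoly_def coeff_sum coeff_monom intro!: sum.cong)

lemma tdeg_le_of_mpoly: "tdeg_le (of_mpoly P) (tdeg P)"
  unfolding tdeg_le_def
proof (intro allI impI)
  fix i j assume "coeff (coeff (of_mpoly P) j) i \<noteq> 0"
  then obtain m where "m \<in> Poly_Mapping.keys P" "Poly_Mapping.lookup m 1 = i" "Poly_Mapping.lookup m 2 = j"
    unfolding coeff_of_mpoly by (rule sum.not_neutral_contains_not_neutral) (auto split: if_splits)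
  then show "i + j \<le> tdeg P" using monom_deg_le_tdeg[of m P] by (simp add: monom_deg_2)
qed

lemma hom_eval_vertical_direction:
  fixes P :: "2 cmpoly"
  assumes "v 1 = 0" "v 2 = 1"
  shows "hom_eval P v 0 = coeff (coeff (of_mpoly P) (tdeg P)) 0"
  unfolding hom_eval_def coeff_of_mpoly
proof (rule sum.cong)
  fix m assume "m \<in> Poly_Mapping.keys P"
  then have "Poly_Mapping.lookup m 1 + Poly_Mapping.lookup m 2 \<le> tdeg P"
    using monom_deg_le_tdeg[of m P] by (simp add: monom_deg_2)
  then show "Poly_Mapping.lookup P m * monom_eval m v * 0 ^ (tdeg P - monom_deg m) =
      (if Poly_Mapping.lookup m 1 = 0 \<and> Poly_Mapping.lookup m 2 = tdeg P then Poly_Mapping.lookup P m else 0)"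
    using assms by (auto simp: monom_eval_2 monom_deg_2 power_0_left)
qed simp

section \<open>Projective points\<close>

lemma proj_pt_self: "1 \<in> \<FF> \<Longrightarrow> (v, w) \<in> proj_pt \<FF> v w"
  unfolding proj_pt_def by (auto intro!: exI[of _ 1])

lemma proj_pt_eqD:
  assumes "1 \<in> \<FF>" "proj_pt \<FF> v w = proj_pt \<FF> v' w'"
  shows "\<exists>c\<in>\<FF>. c \<noteq> 0 \<and> v' = c *s v \<and> w' = c * w"
proof -
  have "(v', w') \<in> proj_pt \<FF> v w" using proj_pt_self[OF assms(1), of v' w'] assms(2) by simp
  then show ?thesis unfolding proj_pt_def by blast
qed

lemma proj_pt_scale:
  assumes F: "root_closed_subfield \<FF>" and c: "c \<in> \<FF>" "c \<noteq> 0"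
  shows "proj_pt \<FF> (c *s v) (c * w) = proj_pt \<FF> v w"
proof -
  have R: "subring_set \<FF>" using F by (rule root_closed_subring)
  have sub: "proj_pt \<FF> (c *s v) (c * w) \<subseteq> proj_pt \<FF> v w" if "c \<in> \<FF>" "c \<noteq> 0" for c v w
  proof
    fix X assume "X \<in> proj_pt \<FF> (c *s v) (c * w)"
    then obtain d where "X = (d *s (c *s v), d * (c * w))" "d \<in> \<FF>" "d \<noteq> 0" unfolding proj_pt_def by blast
    then have "X = ((d * c) *s v, (d * c) * w)" "d * c \<in> \<FF>" "d * c \<noteq> 0"
      using that R by (auto simp: vector_smult_assoc subring_setD)
    then show "X \<in> proj_pt \<FF> v w" unfolding proj_pt_def by blast
  qed
  have "1 / c \<in> \<FF>" "1 / c \<noteq> 0" using F c R by (auto intro: root_closed_divide simp: subring_setD)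
  from sub[OF this, of "c *s v" "c * w"] have "proj_pt \<FF> v w \<subseteq> proj_pt \<FF> (c *s v) (c * w)"
    using c(2) by (simp add: vector_smult_assoc)
  then show ?thesis using sub[OF c] by blast
qed

lemma hom_eval_scale: "hom_eval P (($) (c *s v)) (c * w) = c ^ tdeg P * hom_eval P (($) v) w"
proof -
  have "($) (c *s v) = (\<lambda>i. c * v $ i)" by (simp add: fun_eq_iff)
  then show ?thesis by (simp add: hom_eval_hom_at hom_at_scale)
qed

lemma zariski_closure_superset: "A \<subseteq> affine_space \<FF> \<Longrightarrow> A \<subseteq> zariski_closure \<FF> A"
  unfolding zariski_closure_def zero_set_def vanishing_ideal_def by auto

lemma vanishing_ideal_closure:
  assumes "A \<subseteq> affine_space \<FF>"
  shows "vanishing_ideal \<FF> (zariski_closure \<FF> A) = vanishing_ideal \<FF> A"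
  using zariski_closure_superset[OF assms]
  unfolding vanishing_ideal_def by (auto simp: zariski_closure_def zero_set_def vanishing_ideal_def)

lemma zariski_closure_subset_affine: "zariski_closure \<FF> A \<subseteq> affine_space \<FF>"
  unfolding zariski_closure_def zero_set_def by auto

lemma proj_pt_in_proj_closure_iff:
  assumes F: "subring_set \<FF>" and v: "v \<in> affine_space \<FF>" "w \<in> \<FF>" "(v, w) \<noteq> (0, 0)"
  shows "proj_pt \<FF> v w \<in> proj_closure \<FF> A \<longleftrightarrow>
    (\<forall>P\<in>vanishing_ideal \<FF> (zariski_closure \<FF> A). hom_eval P (($) v) w = 0)"
proof
  assume "proj_pt \<FF> v w \<in> proj_closure \<FF> A"
  then obtain v' w' where eq: "proj_pt \<FF> v' w' = proj_pt \<FF> v w"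
    and z: "\<forall>P\<in>vanishing_ideal \<FF> (zariski_closure \<FF> A). hom_eval P (($) v') w' = 0"
    unfolding proj_closure_def by auto
  obtain c where "v = c *s v'" "w = c * w'" using proj_pt_eqD[OF subring_setD(2)[OF F] eq] by blast
  then show "\<forall>P\<in>vanishing_ideal \<FF> (zariski_closure \<FF> A). hom_eval P (($) v) w = 0"
    using z by (simp add: hom_eval_scale)
qed (use v in \<open>auto simp: proj_closure_def\<close>)

lemma proj_pt_in_proj_hyperplane_iff:
  assumes F: "subring_set \<FF>" and v: "v \<in> affine_space \<FF>" "w \<in> \<FF>" "(v, w) \<noteq> (0, 0)"
  shows "proj_pt \<FF> v w \<in> proj_hyperplane \<FF> a b \<longleftrightarrow> (\<Sum>i\<in>UNIV. a $ i * v $ i) + b * w = 0"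
proof
  assume "proj_pt \<FF> v w \<in> proj_hyperplane \<FF> a b"
  then obtain v' w' where eq: "proj_pt \<FF> v' w' = proj_pt \<FF> v w"
    and z: "(\<Sum>i\<in>UNIV. a $ i * v' $ i) + b * w' = 0"
    unfolding proj_hyperplane_def by auto
  obtain c where c: "v = c *s v'" "w = c * w'" using proj_pt_eqD[OF subring_setD(2)[OF F] eq] by blast
  have "(\<Sum>i\<in>UNIV. a $ i * v $ i) + b * w = c * ((\<Sum>i\<in>UNIV. a $ i * v' $ i) + b * w')"
    by (simp add: c sum_distrib_left distrib_left mult_ac)
  then show "(\<Sum>i\<in>UNIV. a $ i * v $ i) + b * w = 0" using z by simp
qed (use v in \<open>auto simp: proj_hyperplane_def\<close>)

lemma proj_closure_cases:
  assumes "X \<in> proj_closure \<FF> A"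
  shows "\<exists>v w. X = proj_pt \<FF> v w \<and> v \<in> affine_space \<FF> \<and> w \<in> \<FF> \<and> (v, w) \<noteq> (0, 0)"
  using assms unfolding proj_closure_def by blast

lemma pts_at_infinity_iff:
  assumes "subring_set \<FF>" "v \<in> affine_space \<FF>" "v \<noteq> 0"
  shows "proj_pt \<FF> v 0 \<in> pts_at_infinity \<FF> A \<longleftrightarrow>
    (\<forall>P\<in>vanishing_ideal \<FF> (zariski_closure \<FF> A). hom_eval P (($) v) 0 = 0)"
  using assms unfolding pts_at_infinity_def
  by (simp add: proj_pt_in_proj_closure_iff proj_pt_in_proj_hyperplane_iff subring_setD)

lemma pts_at_infinity_cases:
  assumes F: "subring_set \<FF>" and X: "X \<in> pts_at_infinity \<FF> A"
  shows "\<exists>v\<in>affine_space \<FF>. v \<noteq> 0 \<and> X = proj_pt \<FF> v 0"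
proof -
  obtain v w where v: "X = proj_pt \<FF> v w" "v \<in> affine_space \<FF>" "w \<in> \<FF>" "(v, w) \<noteq> (0, 0)"
    using X proj_closure_cases unfolding pts_at_infinity_def by blast
  have "w = 0" using X proj_pt_in_proj_hyperplane_iff[OF F v(2-4), of 0 1] by (simp add: pts_at_infinity_def v(1))
  then show ?thesis using v by auto
qed

section \<open>The degree of a plane curve\<close>

text \<open>
  Induction on the number of variables: by the induction hypothesis some coefficient of the last
  variable does not vanish at a suitable choice of the others. Exponents are plain functions here, so
  that one coordinate can be reset.
\<close>

lemma monomial_sum_nonvanishing:
  fixes c :: "('v \<Rightarrow> nat) \<Rightarrow> complex"
  assumes F: "subring_set \<FF>" and V: "finite V"
  shows "finite S \<Longrightarrow> (\<forall>m\<in>S. \<forall>i. i \<notin> V \<longrightarrow> m i = 0) \<Longrightarrow> \<exists>m\<in>S. c m \<noteq> 0 \<Longrightarrow>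
    \<exists>x. (\<forall>i. x i \<in> \<FF>) \<and> (\<Sum>m\<in>S. c m * (\<Prod>i\<in>V. x i ^ m i)) \<noteq> 0"
  using V
proof (induction V arbitrary: S c rule: finite_induct)
  case empty
  have "m = (\<lambda>_. 0)" if "m \<in> S" for m using empty that by (auto simp: fun_eq_iff)
  then have "S = {\<lambda>_. 0}" using empty by blast
  then show ?case using empty subring_setD(1)[OF F] by (intro exI[of _ "\<lambda>_. 0"]) auto
next
  case (insert v V)
  obtain m0 where m0: "m0 \<in> S" "c m0 \<noteq> 0" using insert.prems by blast
  define S' where "S' = (\<lambda>m. m(v := 0)) ` {m\<in>S. m v = m0 v}"
  have "\<exists>x. (\<forall>i. x i \<in> \<FF>) \<and> (\<Sum>m\<in>S'. c (m(v := m0 v)) * (\<Prod>i\<in>V. x i ^ m i)) \<noteq> 0"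
  proof (rule insert.IH)
    show "finite S'" using insert.prems by (simp add: S'_def)
    show "\<forall>m\<in>S'. \<forall>i. i \<notin> V \<longrightarrow> m i = 0" using insert.prems by (auto simp: S'_def)
    show "\<exists>m\<in>S'. c (m(v := m0 v)) \<noteq> 0" using m0 by (intro bexI[of _ "m0(v := 0)"]) (auto simp: S'_def)
  qed
  then obtain x where x: "\<forall>i. x i \<in> \<FF>" "(\<Sum>m\<in>S'. c (m(v := m0 v)) * (\<Prod>i\<in>V. x i ^ m i)) \<noteq> 0" by blast
  define r where "r = (\<Sum>m\<in>S. monom (c m * (\<Prod>i\<in>V. x i ^ m i)) (m v))"
  have inj: "inj_on (\<lambda>m. m(v := 0)) {m\<in>S. m v = m0 v}"
    by (rule inj_onI) (metis (mono_tags, lifting) fun_upd_triv fun_upd_upd mem_Collect_eq)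
  have "coeff r (m0 v) = (\<Sum>m\<in>{m\<in>S. m v = m0 v}. c m * (\<Prod>i\<in>V. x i ^ m i))"
    unfolding r_def using insert.prems by (simp add: coeff_sum coeff_monom sum.inter_filter)
  also have "\<dots> = (\<Sum>m\<in>S'. c (m(v := m0 v)) * (\<Prod>i\<in>V. x i ^ m i))"
    unfolding S'_def sum.reindex[OF inj] using insert.hyps
    by (intro sum.cong) (auto intro!: arg_cong2[where f = "(*)"] prod.cong arg_cong[where f = c])
  finally have "r \<noteq> 0" using x(2) by auto
  then have "\<not> \<FF> \<subseteq> {t. poly r t = 0}"
    using poly_roots_finite[of r] infinite_subring[OF F] finite_subset by blast
  then obtain t where t: "t \<in> \<FF>" "poly r t \<noteq> 0" by blast
  have "(\<Prod>i\<in>Set.insert v V. (x(v := t)) i ^ m i) = (\<Prod>i\<in>V. x i ^ m i) * t ^ m v" for m :: "'v \<Rightarrow> nat"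
  proof -
    have "(\<Prod>i\<in>V. (x(v := t)) i ^ m i) = (\<Prod>i\<in>V. x i ^ m i)" using insert.hyps by (intro prod.cong) auto
    then show ?thesis using insert.hyps by simp
  qed
  then have "(\<Sum>m\<in>S. c m * (\<Prod>i\<in>Set.insert v V. (x(v := t)) i ^ m i)) = poly r t"
    by (simp add: r_def poly_sum poly_monom mult.assoc)
  then show ?case using t x(1) by (intro exI[of _ "x(v := t)"]) auto
qed

lemma mpoly_nonvanishing:
  fixes P :: "'v::finite cmpoly"
  assumes F: "subring_set \<FF>" and P: "P \<noteq> 0"
  shows "\<exists>x. (\<forall>i. x i \<in> \<FF>) \<and> mpoly_eval P x \<noteq> 0"
proof -
  define S where "S = Poly_Mapping.lookup ` Poly_Mapping.keys P"
  define c where "c m = Poly_Mapping.lookup P (Abs_poly_mapping m)" for m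
  obtain m where "m \<in> Poly_Mapping.keys P" using P by (metis all_not_in_conv keys_eq_empty)
  then have "\<exists>m\<in>S. c m \<noteq> 0" by (auto simp: S_def c_def in_keys_iff intro!: bexI[of _ m])
  then obtain x where x: "\<forall>i. x i \<in> \<FF>" "(\<Sum>m\<in>S. c m * (\<Prod>i\<in>UNIV. x i ^ m i)) \<noteq> 0"
    using monomial_sum_nonvanishing[OF F finite[of UNIV], of S c] by (auto simp: S_def)
  have "inj_on Poly_Mapping.lookup (Poly_Mapping.keys P)" by (rule inj_onI) (simp add: poly_mapping_eqI)
  moreover have "monom_eval m x = (\<Prod>i\<in>UNIV. x i ^ Poly_Mapping.lookup m i)" for m
    unfolding monom_eval_def by (rule prod.mono_neutral_left) (auto simp: in_keys_iff)
  ultimately have "mpoly_eval P x = (\<Sum>m\<in>S. c m * (\<Prod>i\<in>UNIV. x i ^ m i))"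
    by (simp add: S_def sum.reindex mpoly_eval_def c_def)
  then show ?thesis using x by (intro exI[of _ x]) simp
qed

lemma mpoly_on_line: "\<exists>r. \<forall>t. poly r t = mpoly_eval P (\<lambda>i. p i + t * d i)"
proof -
  define r where "r = (\<Sum>m\<in>Poly_Mapping.keys P. Polynomial.smult (Poly_Mapping.lookup P m)
    (\<Prod>i\<in>Poly_Mapping.keys m. [:p i, d i:] ^ Poly_Mapping.lookup m i))"
  have "poly r t = mpoly_eval P (\<lambda>i. p i + t * d i)" for t
    by (simp add: r_def poly_sum poly_prod mpoly_eval_def monom_eval_def)
  then show ?thesis by blast
qed

lemma common_nonvanishing:
  fixes P Q :: "'v::finite cmpoly"
  assumes F: "subring_set \<FF>" and PQ: "P \<noteq> 0" "Q \<noteq> 0"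
  shows "\<exists>x. (\<forall>i. x i \<in> \<FF>) \<and> mpoly_eval P x \<noteq> 0 \<and> mpoly_eval Q x \<noteq> 0"
proof -
  obtain a b where a: "\<forall>i. a i \<in> \<FF>" "mpoly_eval P a \<noteq> 0" and b: "\<forall>i. b i \<in> \<FF>" "mpoly_eval Q b \<noteq> 0"
    using mpoly_nonvanishing[OF F PQ(1)] mpoly_nonvanishing[OF F PQ(2)] by blast
  obtain r s where r: "\<And>t. poly r t = mpoly_eval P (\<lambda>i. a i + t * (b i - a i))"
    and s: "\<And>t. poly s t = mpoly_eval Q (\<lambda>i. a i + t * (b i - a i))"
    using mpoly_on_line[of P a "\<lambda>i. b i - a i"] mpoly_on_line[of Q a "\<lambda>i. b i - a i"] by blast
  have "poly r 0 \<noteq> 0" "poly s 1 \<noteq> 0" unfolding r s using a(2) b(2) by simp_all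
  then have "r * s \<noteq> 0" by auto
  then have "\<not> \<FF> \<subseteq> {t. poly (r * s) t = 0}"
    using poly_roots_finite[of "r * s"] infinite_subring[OF F] finite_subset by blast
  then obtain t where "t \<in> \<FF>" "poly r t \<noteq> 0" "poly s t \<noteq> 0" by auto
  then show ?thesis
    using a(1) b(1) F by (intro exI[of _ "\<lambda>i. a i + t * (b i - a i)"]) (auto simp: r s subring_setD)
qed

text \<open>
  Any generic count determines the degree: two non-zero genericity conditions are met by a common
  hyperplane.
\<close>

lemma curve_degree_eqI:
  fixes A :: "(complex ^ 'n::finite) set"
  assumes F: "subring_set \<FF>" and G: "G \<in> mpolys_over \<FF>" "G \<noteq> 0"
    and count: "\<And>a b. a \<in> affine_space \<FF> \<Longrightarrow> b \<in> \<FF> \<Longrightarrow> mpoly_eval G (case_option b (($) a)) \<noteq> 0 \<Longrightarrow>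
      finite (proj_closure \<FF> A \<inter> proj_hyperplane \<FF> a b) \<and> card (proj_closure \<FF> A \<inter> proj_hyperplane \<FF> a b) = d"
  shows "curve_degree \<FF> A = d"
  unfolding curve_degree_def
proof (rule the_equality)
  fix e
  assume "\<exists>G :: 'n option cmpoly. G \<in> mpolys_over \<FF> \<and> G \<noteq> 0 \<and>
     (\<forall>a\<in>affine_space \<FF>. \<forall>b\<in>\<FF>. mpoly_eval G (case_option b (($) a)) \<noteq> 0 \<longrightarrow>
        finite (proj_closure \<FF> A \<inter> proj_hyperplane \<FF> a b) \<and>
        card (proj_closure \<FF> A \<inter> proj_hyperplane \<FF> a b) = e)"
  then obtain G' :: "'n option cmpoly" where G': "G' \<noteq> 0"
    "\<And>a b. a \<in> affine_space \<FF> \<Longrightarrow> b \<in> \<FF> \<Longrightarrow> mpoly_eval G' (case_option b (($) a)) \<noteq> 0 \<Longrightarrow>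
        card (proj_closure \<FF> A \<inter> proj_hyperplane \<FF> a b) = e" by blast
  obtain x where x: "\<forall>i. x i \<in> \<FF>" "mpoly_eval G x \<noteq> 0" "mpoly_eval G' x \<noteq> 0"
    using common_nonvanishing[OF F G(2) G'(1)] by blast
  define a :: "complex ^ 'n" where "a = (\<chi> i. x (Some i))"
  have "case_option (x None) (($) a) = x" by (auto simp: a_def fun_eq_iff split: option.split)
  moreover have "a \<in> affine_space \<FF>" using x(1) by (simp add: a_def affine_space_def)
  ultimately show "e = d" using count[of a "x None"] G'(2)[of a "x None"] x by simp
qed (use assms in blast)

lemma card_roots_squarefree:
  fixes p :: "complex poly"
  assumes "p \<noteq> 0" "\<nexists>t. poly p t = 0 \<and> poly (pderiv p) t = 0"
  shows "card {t. poly p t = 0} = degree p"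
proof -
  have "rsquarefree p" using assms by (simp add: rsquarefree_roots)
  then have "Polynomial.smult (lead_coeff p) (\<Prod>z|poly p z = 0. [:-z, 1:]) = p"
    by (rule complex_poly_decompose_rsquarefree)
  then have "degree p = degree (\<Prod>z|poly p z = 0. [:-z, 1:])"
    using assms(1) by (metis degree_smult_eq leading_coeff_0_iff)
  also have "\<dots> = (\<Sum>z|poly p z = 0. degree [:-z, 1:])" by (rule degree_prod_eq_sum_degree) simp
  finally show ?thesis by simp
qed

lemma ev_expand_tdeg:
  assumes "tdeg_le f n"
  shows "ev f x y = (\<Sum>j\<le>n. \<Sum>i\<le>n. coeff (coeff f j) i * x ^ i * y ^ j)"
proof -
  have inner: "poly (coeff f j) x = (\<Sum>i\<le>n. coeff (coeff f j) i * x ^ i)" for j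
  proof -
    have "coeff (coeff f j) i = 0" if "i \<in> {..degree (coeff f j)} - {..n}" for i
      using that by (intro tdeg_leD[OF assms]) auto
    then show ?thesis unfolding poly_altdef by (intro sum.mono_neutral_cong) (simp_all add: coeff_eq_0)
  qed
  have "ev f x y = (\<Sum>j\<le>n. poly (coeff f j) x * y ^ j)"
    unfolding ev_expand
  proof (intro sum.mono_neutral_cong)
    fix j assume "j \<in> {..degree f} - {..n}"
    then have "coeff f j = 0" by (auto intro!: poly_eqI tdeg_leD[OF assms])
    then show "poly (coeff f j) x * y ^ j = 0" by simp
  qed (auto simp: coeff_eq_0)
  then show ?thesis by (simp add: inner sum_distrib_right)
qed

text \<open>
  The restriction of \<open>f\<close> to the line \<open>a\<^sub>1 x + a\<^sub>2 y + b = 0\<close>, parametrized by \<open>y\<close> and with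
  denominators cleared, as a function of the coefficients of the line.
\<close>

definition on_line :: "nat \<Rightarrow> complex poly poly \<Rightarrow> (2 option \<Rightarrow> complex) \<Rightarrow> complex poly" where
  "on_line n f l = (\<Sum>j\<le>n. \<Sum>i\<le>n. Polynomial.smult (coeff (coeff f j) i * l (Some 1) ^ (n - i))
     ([:- l None, - l (Some 2):] ^ i * monom 1 j))"

lemma poly_on_line:
  assumes "tdeg_le f n" "l (Some 1) \<noteq> 0"
  shows "poly (on_line n f l) y = l (Some 1) ^ n * ev f (- (l (Some 2) * y + l None) / l (Some 1)) y"
proof -
  let ?a = "l (Some 1)" and ?u = "- (l (Some 2) * y + l None)"
  have "?a ^ (n - i) * ?u ^ i = ?a ^ n * (?u / ?a) ^ i" if "i \<le> n" for i
    using assms(2) that by (simp add: power_divide power_diff)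
  moreover have lin: "poly [:- l None, - l (Some 2):] y = ?u" by (simp add: algebra_simps)
  ultimately have "(\<Sum>j\<le>n. \<Sum>i\<le>n. coeff (coeff f j) i * ?a ^ (n - i) * (?u ^ i * y ^ j))
      = (\<Sum>j\<le>n. \<Sum>i\<le>n. ?a ^ n * (coeff (coeff f j) i * (?u / ?a) ^ i * y ^ j))"
    by (intro sum.cong refl) (simp add: mult_ac)
  moreover have "poly (on_line n f l) y = (\<Sum>j\<le>n. \<Sum>i\<le>n. coeff (coeff f j) i * ?a ^ (n - i) * (?u ^ i * y ^ j))"
    by (simp add: on_line_def poly_sum poly_monom lin del: poly_pCons)
  ultimately show ?thesis by (simp add: ev_expand_tdeg[OF assms(1)] sum_distrib_left)
qed

lemma coeff_mult_monom: "coeff (p * monom (1 :: complex) j) k = (if j \<le> k then coeff p (k - j) else 0)"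
  by (simp add: mult.commute[of p] coeff_monom_mult)

lemma coeff_linear_power_binomial:
  "coeff ([:a, b:] ^ n) i = of_nat (n choose i) * b ^ i * (a :: complex) ^ (n - i)"
proof (cases "i \<le> n")
  case False
  then have "degree ([:a, b:] ^ n) < i"
    using degree_power_le[of "[:a, b:]" n] by (cases "b = 0") auto
  then show ?thesis using False by (simp add: coeff_eq_0)
qed (rule coeff_linear_poly_power)

lemma coeff_on_line: "coeff (on_line n f l) k = (\<Sum>j\<le>n. \<Sum>i\<le>n. coeff (coeff f j) i * l (Some 1) ^ (n - i) *
  (if j \<le> k then of_nat (i choose (k - j)) * (- l (Some 2)) ^ (k - j) * (- l None) ^ (i - (k - j)) else 0))"
  unfolding on_line_def coeff_sum coeff_smult coeff_mult_monom
  by (intro sum.cong refl) (simp add: coeff_linear_power_binomial)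

lemma polyfun_coeff_on_line:
  assumes A: "subring_set A" and f: "f \<in> bipolys A"
  shows "polyfun A (\<lambda>l. coeff (on_line n f l) k)"
proof -
  have neg: "polyfun A (\<lambda>l. - l v)" for v :: "2 option"
    using polyfun_diff[OF A polyfun_const[OF A subring_setD(1)[OF A]] polyfun_var[OF A, of v]] by simp
  have "polyfun A (\<lambda>l :: 2 option \<Rightarrow> complex. if j \<le> k then of_nat (i choose (k - j)) * (- l (Some 2)) ^ (k - j) * (- l None) ^ (i - (k - j)) else 0)"
    for i j
  proof (cases "j \<le> k")
    case True
    note p1 = polyfun_power[OF A neg[of "Some 2"], of "k - j"] and p2 = polyfun_power[OF A neg[of None], of "i - (k - j)"]
    have "polyfun A (\<lambda>l :: 2 option \<Rightarrow> complex. of_nat (i choose (k - j)) * (- l (Some 2)) ^ (k - j) * (- l None) ^ (i - (k - j)))"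
      using polyfun_mult[OF A polyfun_mult[OF A polyfun_const[OF A subring_set_of_nat[OF A, of "i choose (k - j)"]] p1] p2] .
    then show ?thesis using True by simp
  qed (simp add: polyfun_const[OF A] subring_setD(1)[OF A])
  then show ?thesis
    unfolding coeff_on_line using f
    by (intro polyfun_sum[OF A] polyfun_mult[OF A] polyfun_power[OF A] polyfun_var[OF A] polyfun_const[OF A] upolys_overD)
qed

lemma coeff_on_line_top:
  assumes f: "tdeg_le f n"
  shows "coeff (on_line n f l) n = (\<Sum>j\<le>n. coeff (form_part f n) j * ((- l (Some 2)) ^ (n - j) * l (Some 1) ^ j))"
  unfolding coeff_on_line
proof (rule sum.cong)
  fix j assume j: "j \<in> {..n}"
  have "coeff (coeff f j) i * l (Some 1) ^ (n - i) *
      (if j \<le> n then of_nat (i choose (n - j)) * (- l (Some 2)) ^ (n - j) * (- l None) ^ (i - (n - j)) else 0)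
    = (if i = n - j then coeff (coeff f j) i * l (Some 1) ^ (n - i) * (- l (Some 2)) ^ (n - j) else 0)" for i
  proof -
    consider "i = n - j" | "i < n - j" | "n < i + j" using j by fastforce
    then show ?thesis by cases (use j tdeg_leD[OF f, of i j] in auto)
  qed
  then show "(\<Sum>i\<le>n. coeff (coeff f j) i * l (Some 1) ^ (n - i) *
      (if j \<le> n then of_nat (i choose (n - j)) * (- l (Some 2)) ^ (n - j) * (- l None) ^ (i - (n - j)) else 0))
    = coeff (form_part f n) j * ((- l (Some 2)) ^ (n - j) * l (Some 1) ^ j)"
    using j by (simp add: coeff_form_part)
qed simp

lemma degree_on_line_le:
  assumes f: "tdeg_le f n"
  shows "degree (on_line n f l) \<le> n"
proof (rule degree_le, intro allI impI)
  fix k assume k: "n < k"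
  have "coeff (coeff f j) i * l (Some 1) ^ (n - i) *
    (if j \<le> k then of_nat (i choose (k - j)) * (- l (Some 2)) ^ (k - j) * (- l None) ^ (i - (k - j)) else 0) = 0" for i j
    using k tdeg_leD[OF f, of i j] by (cases "n < i + j") auto
  then show "coeff (on_line n f l) k = 0" unfolding coeff_on_line by (intro sum.neutral ballI)
qed

lemma tdeg_to_mpoly_eq:
  assumes f: "tdeg_le f n" "lead_coeff f = 1" "degree f = n" and ab: "a \<noteq> b"
  shows "tdeg (to_mpoly a b f) = n"
proof (rule ccontr)
  assume "tdeg (to_mpoly a b f) \<noteq> n"
  then have "tdeg (to_mpoly a b f) < n" using tdeg_to_mpoly_le[OF f(1), of a b] by simp
  then have "hom_at n (to_mpoly a b f) (\<lambda>i. if i = b then 1 else 0) 0 = 0" by (rule hom_at_above_tdeg)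
  moreover have "hom_at n (to_mpoly a b f) (\<lambda>i. if i = b then 1 else 0) 0
    = (\<Sum>j\<le>n. if j = n then coeff (form_part f n) j else 0)"
    unfolding hom_at_to_mpoly_infinity[OF f(1)] using ab by (intro sum.cong) auto
  moreover have "coeff (form_part f n) n = 1" using f(2,3) by (simp add: coeff_form_part)
  ultimately show False by simp
qed

text \<open>
  A line is generic if the restriction of the equation to it keeps its degree and has no multiple
  root. Both conditions are polynomial in the line. Vertical lines satisfy the first one because the
  equation is monic, and almost all of them satisfy the second one, because the equation and its
  derivative have only finitely many common zeros.
\<close>

theorem curve_degree_plane:
  fixes B :: "(complex ^ 2) set"
  assumes F: "root_closed_subfield \<FF>" and B: "B \<subseteq> affine_space \<FF>"
    and f: "plane_equation \<FF> ((\<lambda>v. (v $ 1, v $ 2)) ` B) f"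
  shows "curve_degree \<FF> (zariski_closure \<FF> B) = degree f"
proof -
  define n where "n = degree f"
  define Z where "Z = (\<lambda>v. (v $ 1, v $ 2)) ` B"
  have A: "subring_set \<FF>" using F by (rule root_closed_subring)
  have fB: "f \<in> bipolys \<FF>" and f1: "coeff f n = 1" and n: "n > 0" and td: "tdeg_le f n" and fZ: "vanishes_on f Z"
    and mult: "\<And>g. g \<in> bipolys \<FF> \<Longrightarrow> vanishes_on g Z \<Longrightarrow> \<exists>w\<in>bipolys \<FF>. g = f * w"
    and bez: "\<And>g. g \<in> bipolys \<FF> \<Longrightarrow> \<not> vanishes_on g Z \<Longrightarrow>
      \<exists>u\<in>bipolys \<FF>. \<exists>v\<in>bipolys \<FF>. \<exists>R\<in>upolys_over \<FF>. R \<noteq> 0 \<and> u * f + v * g = [:R:]"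
    using f unfolding plane_equation_def n_def Z_def by auto
  have ideal: "vanishing_ideal \<FF> (zariski_closure \<FF> (zariski_closure \<FF> B)) = vanishing_ideal \<FF> B"
    using vanishing_ideal_closure[OF zariski_closure_subset_affine, of \<FF> B] vanishing_ideal_closure[OF B] by simp
  have idealD: "mpoly_eval P v = 0" if P: "P \<in> vanishing_ideal \<FF> B" and v: "ev f (v 1) (v 2) = 0" for P v
  proof -
    have "vanishes_on (of_mpoly P) Z"
      using P ev_of_mpoly[of P "($) _"] by (auto simp: vanishes_on_def Z_def vanishing_ideal_def)
    moreover have "of_mpoly P \<in> bipolys \<FF>" using P A by (intro of_mpoly_over) (auto simp: vanishing_ideal_def)
    ultimately obtain w where "of_mpoly P = f * w" using mult by blast
    then show ?thesis using v ev_of_mpoly[of P v] by simp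
  qed
  define Pf where "Pf = to_mpoly (1::2) 2 f"
  have Pf: "Pf \<in> vanishing_ideal \<FF> B"
    using fZ to_mpoly_over[OF A fB] by (auto simp: vanishing_ideal_def Pf_def mpoly_eval_to_mpoly vanishes_on_def Z_def)
  have tPf: "tdeg Pf = n" unfolding Pf_def using td f1 by (intro tdeg_to_mpoly_eq) (auto simp: n_def)
  \<comment> \<open>\<open>G l \<noteq> 0\<close> means that \<open>y\<close> is a parameter on the line, that the restriction of \<open>f\<close> to it has degree
      \<open>n\<close>, and that the restriction has no multiple root.\<close>
  define G where "G l = l (Some 1) * coeff (on_line n f l) n *
    Determinant.det (sylvester n (n - 1) (on_line n f l) (pderiv (on_line n f l)))" for l
  have "polyfun \<FF> G"
    unfolding G_def using polyfun_coeff_on_line[OF A fB]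
    by (intro polyfun_mult[OF A] polyfun_var[OF A] polyfun_det_sylvester[OF A])
      (auto simp: coeff_pderiv simp del: of_nat_Suc intro!: polyfun_cmult[OF A] subring_set_of_nat[OF A])
  then obtain PG where PG: "PG \<in> mpolys_over \<FF>" "\<And>l. mpoly_eval PG l = G l" unfolding polyfun_def by blast
  have G: "degree (on_line n f l) = n" "\<nexists>t. poly (on_line n f l) t = 0 \<and> poly (pderiv (on_line n f l)) t = 0"
    if "G l \<noteq> 0" for l
  proof -
    have "coeff (on_line n f l) n \<noteq> 0" using that by (auto simp: G_def)
    then show d: "degree (on_line n f l) = n" using degree_on_line_le[OF td, of l] by (simp add: le_antisym le_degree)
    then have "degree (pderiv (on_line n f l)) \<le> n - 1" by (simp add: degree_pderiv)
    from det_sylvester_eq_0_iff[OF d n this]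
    show "\<nexists>t. poly (on_line n f l) t = 0 \<and> poly (pderiv (on_line n f l)) t = 0" using that by (auto simp: G_def)
  qed
  \<comment> \<open>On the line \<open>x = c\<close> the restriction is \<open>f(c, y)\<close>. It is monic, and it is square-free unless \<open>c\<close> is a
      root of the polynomial \<open>R(x)\<close> in the ideal of \<open>f\<close> and its \<open>y\<close>-derivative.\<close>
  have "\<exists>l. (\<forall>i. l i \<in> \<FF>) \<and> G l \<noteq> 0"
  proof -
    have "pderiv f \<noteq> 0" using n by (simp add: n_def pderiv_eq_0_iff)
    have pB: "pderiv f \<in> bipolys \<FF>"
      using fB subring_upolys_over[OF A]
      by (auto simp: upolys_over_def[of "upolys_over \<FF>"] coeff_pderiv simp del: of_nat_Suc intro!: subring_setD(4) subring_set_of_nat)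
    have "\<not> vanishes_on (pderiv f) Z"
    proof
      assume "vanishes_on (pderiv f) Z"
      then obtain w where "pderiv f = f * w" using mult[OF pB] by blast
      then have "f dvd pderiv f" by (rule dvdI)
      then have "degree f \<le> degree (pderiv f)" using \<open>pderiv f \<noteq> 0\<close> by (rule dvd_imp_degree_le)
      then show False using n by (simp add: degree_pderiv n_def)
    qed
    then obtain u v R where R: "R \<noteq> 0" "u * f + v * pderiv f = [:R:]" using bez[OF pB] by blast
    have "\<not> \<FF> \<subseteq> {c. poly R c = 0}" using poly_roots_finite[OF R(1)] infinite_subring[OF A] finite_subset by blast
    then obtain c where c: "c \<in> \<FF>" "poly R c \<noteq> 0" by blast
    define l where "l = case_option (- c) (\<lambda>i. if i = (1::2) then 1 else 0)"
    have l: "l (Some 1) = 1" "l (Some 2) = 0" "l None = - c" by (simp_all add: l_def)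
    have pl: "on_line n f l = slice f c"
      by (rule poly_ext) (simp add: poly_on_line[OF td] l poly_slice)
    have pdl: "pderiv (slice f c) = slice (pderiv f) c"
      by (rule poly_eqI) (simp add: coeff_pderiv)
    have cn: "coeff (slice f c) n = 1" using f1 by simp
    then have d: "degree (on_line n f l) = n" using degree_on_line_le[OF td, of l] by (simp add: pl le_antisym le_degree)
    have "\<nexists>t. poly (on_line n f l) t = 0 \<and> poly (pderiv (on_line n f l)) t = 0"
    proof
      assume "\<exists>t. poly (on_line n f l) t = 0 \<and> poly (pderiv (on_line n f l)) t = 0"
      then obtain t where "ev f c t = 0" "ev (pderiv f) c t = 0" by (auto simp: pl pdl poly_slice)
      then have "ev (u * f + v * pderiv f) c t = 0" by simp
      then show False using c(2) R(2) by simp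
    qed
    moreover have "degree (pderiv (on_line n f l)) \<le> n - 1" using d by (simp add: degree_pderiv)
    ultimately have "G l \<noteq> 0"
      using det_sylvester_eq_0_iff[OF d n] l cn by (auto simp: G_def pl)
    moreover have "\<forall>i. l i \<in> \<FF>" using c(1) A by (auto simp: l_def subring_setD split: option.split)
    ultimately show ?thesis by blast
  qed
  then have PG0: "PG \<noteq> 0" using PG(2) by (auto simp: mpoly_eval_def)
  \<comment> \<open>On such a line the points of the curve correspond to the roots of the restricted equation.\<close>
  have "finite (proj_closure \<FF> (zariski_closure \<FF> B) \<inter> proj_hyperplane \<FF> a b) \<and>
      card (proj_closure \<FF> (zariski_closure \<FF> B) \<inter> proj_hyperplane \<FF> a b) = n"
    if a: "a \<in> affine_space \<FF>" and b: "b \<in> \<FF>" and g: "mpoly_eval PG (case_option b (($) a)) \<noteq> 0" for a b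
  proof -
    define l where "l = case_option b (($) a)"
    have l: "l (Some 1) = a $ 1" "l (Some 2) = a $ 2" "l None = b" by (simp_all add: l_def)
    have aF: "a $ 1 \<in> \<FF>" "a $ 2 \<in> \<FF>" using a by (auto simp: affine_space_def)
    have gl: "G l \<noteq> 0" using g by (simp add: PG l_def)
    then have a1: "a $ 1 \<noteq> 0" and top: "coeff (on_line n f l) n \<noteq> 0" by (auto simp: G_def l)
    define Rt where "Rt = {t. poly (on_line n f l) t = 0}"
    have p0: "on_line n f l \<noteq> 0" using top by auto
    have Rt: "finite Rt" "card Rt = n"
      using poly_roots_finite[OF p0] card_roots_squarefree[OF p0 G(2)[OF gl]] G(1)[OF gl] by (simp_all add: Rt_def)
    have lF: "- l None \<in> \<FF>" "- l (Some 2) \<in> \<FF>" "l (Some 1) \<in> \<FF>"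
      using aF b A by (simp_all add: l subring_setD)
    have U: "subring_set (upolys_over \<FF>)" using A by (rule subring_upolys_over)
    have "on_line n f l \<in> upolys_over \<FF>"
      unfolding on_line_def using fB lF
      by (intro subring_set_sum[OF U] upolys_over_smult[OF A] subring_setD(4)[OF A] subring_setD(4)[OF U]
          subring_set_power[OF U] subring_set_power[OF A] upolys_over_monom[OF A] upolys_over_pCons
          upolys_over_0[OF A] subring_setD(2)[OF A] upolys_overD)
    then have RtF: "Rt \<subseteq> \<FF>" using root_closed_root[OF F _ p0] by (auto simp: Rt_def)
    define \<phi> where "\<phi> t = (vector [- (a $ 2 * t + b) / a $ 1, t] :: complex ^ 2)" for t
    have \<phi>: "\<phi> t $ 1 = - (a $ 2 * t + b) / a $ 1" "\<phi> t $ 2 = t" for t by (simp_all add: \<phi>_def)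
    have \<phi>F: "\<phi> t \<in> affine_space \<FF>" if "t \<in> \<FF>" for t
      using that aF b A F by (auto simp: affine_space_def forall_2 \<phi> intro!: root_closed_divide subring_setD)
    have ev_\<phi>: "ev f (\<phi> t $ 1) (\<phi> t $ 2) = 0 \<longleftrightarrow> t \<in> Rt" for t
      using a1 by (simp add: Rt_def poly_on_line[OF td] l \<phi>)
    have "proj_closure \<FF> (zariski_closure \<FF> B) \<inter> proj_hyperplane \<FF> a b = (\<lambda>t. proj_pt \<FF> (\<phi> t) 1) ` Rt"
    proof (intro equalityI subsetI)
      fix X assume "X \<in> (\<lambda>t. proj_pt \<FF> (\<phi> t) 1) ` Rt"
      then obtain t where t: "t \<in> Rt" "X = proj_pt \<FF> (\<phi> t) 1" by blast
      have cond: "\<phi> t \<in> affine_space \<FF>" "1 \<in> \<FF>" "(\<phi> t, 1) \<noteq> (0, 0 :: complex)"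
        using \<phi>F t RtF A by (auto simp: subring_setD)
      have "hom_eval P (($) (\<phi> t)) 1 = 0" if "P \<in> vanishing_ideal \<FF> B" for P
        using idealD[OF that] ev_\<phi>[of t] t(1) by (simp add: hom_eval_hom_at flip: mpoly_eval_hom_at)
      then have "X \<in> proj_closure \<FF> (zariski_closure \<FF> B)"
        unfolding t(2) proj_pt_in_proj_closure_iff[OF A cond] ideal by blast
      moreover have "X \<in> proj_hyperplane \<FF> a b"
        unfolding t(2) proj_pt_in_proj_hyperplane_iff[OF A cond] using a1 by (simp add: sum_2 \<phi>)
      ultimately show "X \<in> proj_closure \<FF> (zariski_closure \<FF> B) \<inter> proj_hyperplane \<FF> a b" by blast
    next
      fix X assume X: "X \<in> proj_closure \<FF> (zariski_closure \<FF> B) \<inter> proj_hyperplane \<FF> a b"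
      then obtain v w where v: "X = proj_pt \<FF> v w" "v \<in> affine_space \<FF>" "w \<in> \<FF>" "(v, w) \<noteq> (0, 0)"
        using proj_closure_cases by blast
      have cl: "hom_eval P (($) v) w = 0" if "P \<in> vanishing_ideal \<FF> B" for P
        using X that unfolding v(1) Int_iff proj_pt_in_proj_closure_iff[OF A v(2-4)] ideal by blast
      have hyp: "a $ 1 * v $ 1 + a $ 2 * v $ 2 + b * w = 0"
        using X unfolding v(1) Int_iff proj_pt_in_proj_hyperplane_iff[OF A v(2-4)] by (simp add: sum_2)
      have "w \<noteq> 0"
      proof
        assume w: "w = 0"
        define k where "k = v $ 2 / a $ 1"
        have v1: "v $ 1 = k * - (a $ 2)" and v2: "v $ 2 = k * a $ 1"
          using hyp w a1 by (simp_all add: k_def field_simps) (simp add: eq_neg_iff_add_eq_0 algebra_simps)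
        have "hom_eval Pf (($) v) 0 = (\<Sum>j\<le>n. coeff (form_part f n) j * ((v $ 1) ^ (n - j) * (v $ 2) ^ j))"
          unfolding hom_eval_hom_at tPf unfolding Pf_def by (rule hom_at_to_mpoly_infinity[OF td])
        also have "\<dots> = (\<Sum>j\<le>n. k ^ n * (coeff (form_part f n) j * ((- (a $ 2)) ^ (n - j) * (a $ 1) ^ j)))"
        proof (rule sum.cong)
          fix j assume "j \<in> {..n}"
          then have "k ^ n = k ^ (n - j) * k ^ j" by (simp flip: power_add)
          then show "coeff (form_part f n) j * ((v $ 1) ^ (n - j) * (v $ 2) ^ j)
            = k ^ n * (coeff (form_part f n) j * ((- (a $ 2)) ^ (n - j) * (a $ 1) ^ j))"
            unfolding v1 v2 power_mult_distrib by simp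
        qed simp
        also have "\<dots> = k ^ n * coeff (on_line n f l) n"
          by (simp add: coeff_on_line_top[OF td] l sum_distrib_left)
        finally have "k ^ n * coeff (on_line n f l) n = 0" using cl[OF Pf] w by simp
        then have "k = 0" using top by simp
        then have "v = 0" using v1 v2 by (simp add: Finite_Cartesian_Product.vec_eq_iff forall_2)
        then show False using v(4) w by simp
      qed
      define t where "t = v $ 2 / w"
      have "v $ 1 / w = - (a $ 2 * t + b) / a $ 1"
        using hyp \<open>w \<noteq> 0\<close> a1 by (simp add: t_def field_simps) (simp add: eq_neg_iff_add_eq_0 algebra_simps)
      then have vt: "(1 / w) *s v = \<phi> t" by (simp add: Finite_Cartesian_Product.vec_eq_iff forall_2 \<phi> t_def)
      have w1: "1 / w \<in> \<FF>" "1 / w \<noteq> 0" using \<open>w \<noteq> 0\<close> v(3) F A by (auto intro: root_closed_divide simp: subring_setD)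
      have Xt: "X = proj_pt \<FF> (\<phi> t) 1"
        using proj_pt_scale[OF F w1, of v w] \<open>w \<noteq> 0\<close> by (simp add: v(1) vt)
      have "hom_eval Pf (($) (\<phi> t)) 1 = 0"
        using hom_eval_scale[of Pf "1 / w" v w] cl[OF Pf] \<open>w \<noteq> 0\<close> by (simp add: vt)
      then have "ev f (\<phi> t $ 1) (\<phi> t $ 2) = 0"
        by (simp add: Pf_def mpoly_eval_to_mpoly hom_eval_hom_at flip: mpoly_eval_hom_at)
      then show "X \<in> (\<lambda>t. proj_pt \<FF> (\<phi> t) 1) ` Rt" using ev_\<phi> Xt by blast
    qed
    moreover have "inj_on (\<lambda>t. proj_pt \<FF> (\<phi> t) 1) Rt"
    proof (rule inj_onI)
      fix s t assume "proj_pt \<FF> (\<phi> s) 1 = proj_pt \<FF> (\<phi> t) 1"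
      then obtain c where "\<phi> t = c *s \<phi> s" "1 = c * 1" using proj_pt_eqD[OF subring_setD(2)[OF A]] by blast
      then have "\<phi> t = \<phi> s" by simp
      then show "s = t" by (metis \<phi>(2))
    qed
    ultimately show ?thesis using Rt by (simp add: card_image)
  qed
  from curve_degree_eqI[OF A PG(1) PG0 this] show ?thesis by (simp add: n_def)
qed

section \<open>Points far away on a plane curve with distinct directions at infinity\<close>

lemma poly_growth:
  fixes p :: "complex poly"
  assumes "degree p \<le> k" "1 \<le> norm x"
  shows "norm (poly p x) \<le> (\<Sum>i\<le>degree p. norm (coeff p i)) * norm x ^ k"
proof -
  have "norm (poly p x) \<le> (\<Sum>i\<le>degree p. norm (coeff p i * x ^ i))"
    unfolding poly_altdef by (rule norm_sum)
  also have "\<dots> \<le> (\<Sum>i\<le>degree p. norm (coeff p i) * norm x ^ k)"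
    using assms by (intro sum_mono) (auto simp: norm_mult norm_power intro!: mult_left_mono power_increasing)
  finally show ?thesis by (simp add: sum_distrib_right)
qed

lemma poly_growth_all:
  fixes p :: "complex poly"
  assumes "degree p \<le> k"
  shows "norm (poly p x) \<le> (\<Sum>i\<le>degree p. norm (coeff p i)) * (1 + norm x) ^ k"
proof -
  have "norm (poly p x) \<le> (\<Sum>i\<le>degree p. norm (coeff p i * x ^ i))"
    unfolding poly_altdef by (rule norm_sum)
  also have "\<dots> \<le> (\<Sum>i\<le>degree p. norm (coeff p i) * (1 + norm x) ^ k)"
  proof (rule sum_mono)
    fix i assume "i \<in> {..degree p}"
    then have "norm x ^ i \<le> (1 + norm x) ^ i" "(1 + norm x) ^ i \<le> (1 + norm x) ^ k"
      using assms by (auto intro!: power_mono power_increasing)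
    then have "norm x ^ i \<le> (1 + norm x) ^ k" by linarith
    then show "norm (coeff p i * x ^ i) \<le> norm (coeff p i) * (1 + norm x) ^ k"
      by (simp add: norm_mult norm_power mult_left_mono)
  qed
  finally show ?thesis by (simp add: sum_distrib_right)
qed

lemma poly_leading_growth:
  fixes p :: "complex poly"
  shows "\<exists>C\<ge>0. \<forall>x. 1 \<le> norm x \<longrightarrow>
    norm (poly p x - lead_coeff p * x ^ degree p) * norm x \<le> C * norm x ^ degree p"
proof -
  define q where "q = p - monom (lead_coeff p) (degree p)"
  have cq: "coeff q i = (if i = degree p then 0 else coeff p i)" for i by (simp add: q_def coeff_monom)
  have "poly p x - lead_coeff p * x ^ degree p = poly q x" for x by (simp add: q_def poly_monom)
  moreover have "norm (poly q x) * norm x \<le> (\<Sum>i\<le>degree q. norm (coeff q i)) * norm x ^ degree p"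
    if x: "1 \<le> norm x" for x
  proof (cases "degree p = 0")
    case True
    then have "q = 0" by (intro poly_eqI) (auto simp: cq coeff_eq_0)
    then show ?thesis by simp
  next
    case False
    then have "degree q \<le> degree p - 1" by (intro degree_le) (auto simp: cq coeff_eq_0)
    moreover have "norm x ^ (degree p - 1) * norm x = norm x ^ degree p" using False by (intro power_minus_mult) simp
    ultimately show ?thesis
      using mult_right_mono[OF poly_growth[OF _ x, of q "degree p - 1"], of "norm x"] by (simp only: mult.assoc norm_ge_zero)
  qed
  ultimately show ?thesis by (intro exI[of _ "\<Sum>i\<le>degree q. norm (coeff q i)"]) (auto intro: sum_nonneg)
qed

lemma ev_leading_form:
  assumes g: "tdeg_le g k"
  shows "\<exists>C\<ge>0. \<forall>x l. 1 \<le> norm x \<longrightarrow> norm l \<le> B \<longrightarrow>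
    norm (ev g x (l * x) - poly (form_part g k) l * x ^ k) * norm x \<le> C * norm x ^ k"
proof -
  have "\<forall>j. \<exists>m>0. \<forall>l. norm l \<le> B \<longrightarrow> norm (poly (form_part g j) l) \<le> m" using poly_bound_exists by blast
  then obtain m where m: "\<And>j. m j > 0" "\<And>j l. norm l \<le> B \<Longrightarrow> norm (poly (form_part g j) l) \<le> m j" by metis
  have "norm (ev g x (l * x) - poly (form_part g k) l * x ^ k) * norm x \<le> (\<Sum>j<k. m j) * norm x ^ k"
    if x: "1 \<le> norm x" and l: "norm l \<le> B" for x l
  proof -
    have "ev g x (l * x) - poly (form_part g k) l * x ^ k = (\<Sum>j<k. poly (form_part g j) l * x ^ j)"
      unfolding ev_form_parts[OF g] by (simp add: lessThan_Suc_atMost[symmetric])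
    also have "norm \<dots> * norm x \<le> (\<Sum>j<k. norm (poly (form_part g j) l * x ^ j)) * norm x"
      by (intro mult_right_mono norm_sum) auto
    also have "\<dots> = (\<Sum>j<k. norm (poly (form_part g j) l) * norm x ^ Suc j)"
      unfolding sum_distrib_right by (intro sum.cong refl) (simp add: norm_mult norm_power)
    also have "\<dots> \<le> (\<Sum>j<k. m j * norm x ^ k)"
      using x l m by (intro sum_mono mult_mono power_increasing) (auto simp: less_imp_le)
    finally show ?thesis by (simp add: sum_distrib_right)
  qed
  moreover have "(\<Sum>j<k. m j) \<ge> 0" using m(1) by (intro sum_nonneg) (auto simp: less_imp_le)
  ultimately show ?thesis by blast
qed

lemma separated:
  fixes S :: "complex set"
  assumes "finite S"
  shows "\<exists>s>0. \<forall>a\<in>S. \<forall>b\<in>S. a \<noteq> b \<longrightarrow> 2 * s \<le> norm (a - b)"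
proof -
  define T where "T = Set.insert 1 ((\<lambda>(a, b). norm (a - b)) ` {(a, b). a \<in> S \<and> b \<in> S \<and> a \<noteq> b})"
  have fin: "finite T" "T \<noteq> {}"
    using finite_subset[of "{(a, b). a \<in> S \<and> b \<in> S \<and> a \<noteq> b}" "S \<times> S"] assms by (auto simp: T_def)
  have "\<forall>t\<in>T. t > 0" by (auto simp: T_def)
  then have "Min T > 0" using fin by simp
  moreover have "Min T \<le> norm (a - b)" if "a \<in> S" "b \<in> S" "a \<noteq> b" for a b
    using that fin by (intro Min_le) (auto simp: T_def)
  ultimately show ?thesis by (intro exI[of _ "Min T / 2"]) auto
qed

lemma nearest_exists:
  fixes S :: "complex set"
  assumes "finite S" "S \<noteq> {}"
  shows "\<exists>a\<in>S. \<forall>b\<in>S. norm (t - a) \<le> norm (t - b)"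
  using ex_is_arg_min_if_finite[OF assms, of "\<lambda>a. norm (t - a)"] by (auto simp: is_arg_min_linorder)

lemma separated_half:
  assumes "norm (t - a) \<le> norm (t - b)" "2 * s \<le> norm (a - b)"
  shows "s \<le> norm (t - b)"
  using assms norm_triangle_ineq4[of "t - b" "t - a"] by simp

lemma monic_poly_eq_prod_roots:
  fixes p :: "complex poly"
  assumes "finite S" "card S = n" "degree p \<le> n" "coeff p n = 1" "\<And>a. a \<in> S \<Longrightarrow> poly p a = 0"
  shows "p = (\<Prod>a\<in>S. [:-a, 1:])"
proof (rule ccontr)
  assume ne: "p \<noteq> (\<Prod>a\<in>S. [:-a, 1:])"
  define r where "r = p - (\<Prod>a\<in>S. [:-a, 1:])"
  have d: "degree (\<Prod>a\<in>S. [:-a, 1:]) = n" using assms(2) by (subst degree_prod_eq_sum_degree) auto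
  have "lead_coeff (\<Prod>a\<in>S. [:-a, 1:]) = 1" by (simp add: lead_coeff_prod)
  then have "coeff r n = 0" using d assms(4) by (simp add: r_def)
  moreover have "degree r \<le> n" unfolding r_def using assms(3) d by (intro degree_diff_le) auto
  moreover have r0: "r \<noteq> 0" using ne by (simp add: r_def)
  ultimately have "degree r < n" by (metis leading_coeff_0_iff le_neq_implies_less)
  moreover have "S \<subseteq> {a. poly r a = 0}" using assms(1,5) by (auto simp: r_def poly_prod intro!: prod_zero)
  then have "n \<le> card {a. poly r a = 0}" using assms(2) poly_roots_finite[OF r0] by (metis card_mono)
  ultimately show False using card_poly_roots_bound[OF r0] by simp
qed

text \<open>
  \<open>\<Lambda>\<close> is the set of slopes of the asymptotic directions of the curve \<open>f = 0\<close>: the leading form of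
  \<open>f\<close> is the product of the distinct linear forms \<open>y - \<lambda> x\<close>.
\<close>

locale distinct_directions =
  fixes f :: "complex poly poly" and \<Lambda> :: "complex set" and n :: nat
  assumes td: "tdeg_le f n" and monic: "coeff f n = 1" and deg: "degree f = n" and n_pos: "n > 0"
    and fin: "finite \<Lambda>" and card: "card \<Lambda> = n" and slopes: "\<And>a. a \<in> \<Lambda> \<Longrightarrow> poly (form_part f n) a = 0"
begin

lemma leading_form: "poly (form_part f n) l = (\<Prod>a\<in>\<Lambda>. l - a)"
proof -
  have "form_part f n = (\<Prod>a\<in>\<Lambda>. [:-a, 1:])"
    using fin card degree_form_part[of f n] monic slopes
    by (intro monic_poly_eq_prod_roots) (auto simp: coeff_form_part)
  then show ?thesis by (simp add: poly_prod)
qed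

lemma nonempty: "\<Lambda> \<noteq> {}" using card n_pos by auto

text \<open>
  The equation is monic in \<open>y\<close> and the coefficient of \<open>y\<^sup>j\<close> has degree at most \<open>n - j\<close>; where
  \<open>|y| > 1 + |x|\<close>, all lower terms are \<open>O((1 + |x|) |y|\<^bsup>n-1\<^esup>)\<close>.
\<close>

lemma slope_bounded: "\<exists>B\<ge>1. \<forall>x y. ev f x y = 0 \<longrightarrow> norm y \<le> B * (1 + norm x)"
proof -
  define c where "c j = (\<Sum>i\<le>degree (coeff f j). norm (coeff (coeff f j) i))" for j
  have c: "norm (poly (coeff f j) x) \<le> c j * (1 + norm x) ^ (n - j)" if "j \<le> n" for x j
    unfolding c_def using that tdeg_leD[OF td] by (intro poly_growth_all degree_le) auto
  define B where "B = 1 + (\<Sum>j<n. c j)"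
  have c0: "c j \<ge> 0" for j by (auto simp: c_def intro: sum_nonneg)
  then have B1: "B \<ge> 1" unfolding B_def by (simp add: sum_nonneg)
  have "norm y \<le> B * (1 + norm x)" if z: "ev f x y = 0" for x y
  proof (cases "norm y \<le> 1 + norm x")
    case True
    also have "1 + norm x \<le> B * (1 + norm x)" using B1 mult_right_mono[of 1 B "1 + norm x"] by simp
    finally show ?thesis .
  next
    case False
    have y0: "norm y > 0" using False norm_ge_zero[of x] by linarith
    have "0 = (\<Sum>j\<le>n. poly (coeff f j) x * y ^ j)" using z by (simp add: ev_expand deg)
    also have "\<dots> = y ^ n + (\<Sum>j<n. poly (coeff f j) x * y ^ j)"
      by (simp add: monic lessThan_Suc_atMost[symmetric])
    finally have "y ^ n = - (\<Sum>j<n. poly (coeff f j) x * y ^ j)" by (simp add: eq_neg_iff_add_eq_0)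
    then have "norm (y ^ n) = norm (\<Sum>j<n. poly (coeff f j) x * y ^ j)" by (simp only: norm_minus_cancel)
    also have "\<dots> \<le> (\<Sum>j<n. norm (poly (coeff f j) x * y ^ j))" by (rule norm_sum)
    also have "\<dots> \<le> (\<Sum>j<n. c j * ((1 + norm x) * norm y ^ (n - 1)))"
    proof (rule sum_mono)
      fix j assume j: "j \<in> {..<n}"
      have "norm (poly (coeff f j) x * y ^ j) \<le> c j * (1 + norm x) ^ (n - j) * norm y ^ j"
        using c[of j x] j by (simp add: norm_mult norm_power mult_right_mono)
      also have "(1 + norm x) ^ (n - j) = (1 + norm x) * (1 + norm x) ^ (n - 1 - j)" using j by (simp flip: power_Suc add: Suc_diff_Suc)
      also have "c j * ((1 + norm x) * (1 + norm x) ^ (n - 1 - j)) * norm y ^ j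
          \<le> c j * ((1 + norm x) * norm y ^ (n - 1 - j)) * norm y ^ j"
        using False c0 by (intro mult_right_mono mult_left_mono power_mono) auto
      also have "\<dots> = c j * ((1 + norm x) * norm y ^ (n - 1))"
        using j by (simp flip: power_add)
      finally show "norm (poly (coeff f j) x * y ^ j) \<le> c j * ((1 + norm x) * norm y ^ (n - 1))" .
    qed
    also have "\<dots> = (\<Sum>j<n. c j) * (1 + norm x) * norm y ^ (n - 1)"
      unfolding sum_distrib_right by (intro sum.cong refl) (simp add: mult_ac)
    also have "norm (y ^ n) = norm y * norm y ^ (n - 1)"
      using power_minus_mult[OF n_pos, of "norm y"] by (simp add: norm_power mult.commute)
    finally have "norm y * norm y ^ (n - 1) \<le> ((\<Sum>j<n. c j) * (1 + norm x)) * norm y ^ (n - 1)" .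
    then have "norm y \<le> (\<Sum>j<n. c j) * (1 + norm x)" using y0 by (simp add: mult_le_cancel_right)
    also have "\<dots> \<le> B * (1 + norm x)" by (intro mult_right_mono) (auto simp: B_def)
    finally show ?thesis .
  qed
  then show ?thesis using B1 by blast
qed

text \<open>
  The leading form of \<open>f\<close> is \<open>O(|x|\<^bsup>n-1\<^esup>)\<close> on the curve, while all of its factors but one are
  comparable to \<open>|x|\<close> because the directions are distinct; the remaining factor is bounded.
\<close>

lemma near_asymptote: "\<exists>M\<ge>0. \<forall>x y. 1 \<le> norm x \<longrightarrow> ev f x y = 0 \<longrightarrow> (\<exists>a\<in>\<Lambda>. norm (y - a * x) \<le> M)"
proof -
  obtain B' where B': "B' \<ge> 1" "\<And>x y. ev f x y = 0 \<Longrightarrow> norm y \<le> B' * (1 + norm x)" using slope_bounded by blast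
  define B where "B = 2 * B'"
  have B: "norm y \<le> B * norm x" if "1 \<le> norm x" "ev f x y = 0" for x y
  proof -
    have "B' * (1 + norm x) \<le> B' * (2 * norm x)" using that(1) B'(1) by (intro mult_left_mono) auto
    then show ?thesis using B'(2)[OF that(2)] by (simp add: B_def)
  qed
  obtain C where C: "C \<ge> 0" "\<And>x l. 1 \<le> norm x \<Longrightarrow> norm l \<le> B \<Longrightarrow>
    norm (ev f x (l * x) - poly (form_part f n) l * x ^ n) * norm x \<le> C * norm x ^ n"
    using ev_leading_form[OF td, of B] by blast
  obtain s where s: "s > 0" "\<And>a b. a \<in> \<Lambda> \<Longrightarrow> b \<in> \<Lambda> \<Longrightarrow> a \<noteq> b \<Longrightarrow> 2 * s \<le> norm (a - b)"
    using separated[OF fin] by blast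
  define M where "M = C / s ^ (n - 1)"
  have "\<exists>a\<in>\<Lambda>. norm (y - a * x) \<le> M" if x: "1 \<le> norm x" and z: "ev f x y = 0" for x y
  proof -
    have x0: "norm x > 0" "x \<noteq> 0" using x by auto
    define l where "l = y / x"
    have y: "y = l * x" using x0 by (simp add: l_def)
    have "norm l * norm x \<le> B * norm x" using B[OF x z] by (simp add: y norm_mult)
    then have "norm l \<le> B" using x0(1) by (simp add: mult_le_cancel_right)
    then have "norm (poly (form_part f n) l) * norm x ^ n * norm x \<le> C * norm x ^ n"
      using C(2)[OF x, of l] z by (simp add: y norm_mult norm_power)
    then have 1: "norm (poly (form_part f n) l) * norm x \<le> C" using x0(1) by (simp add: mult_ac)
    obtain a where a: "a \<in> \<Lambda>" "\<And>b. b \<in> \<Lambda> \<Longrightarrow> norm (l - a) \<le> norm (l - b)"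
      using nearest_exists[OF fin nonempty] by blast
    have "norm (l - a) * s ^ (n - 1) = norm (l - a) * (\<Prod>b\<in>\<Lambda> - {a}. s)"
      using fin card a(1) by simp
    also have "\<dots> \<le> norm (l - a) * (\<Prod>b\<in>\<Lambda> - {a}. norm (l - b))"
    proof (intro mult_left_mono prod_mono conjI)
      fix b assume "b \<in> \<Lambda> - {a}"
      then have "norm (l - a) \<le> norm (l - b)" "2 * s \<le> norm (a - b)" using s(2)[of a b] a by auto
      then show "s \<le> norm (l - b)" by (rule separated_half)
    qed (use s(1) in auto)
    also have "\<dots> = norm (poly (form_part f n) l)"
      unfolding leading_form using fin a(1) by (simp add: prod.remove[of \<Lambda> a] norm_mult prod_norm)
    finally have "norm (l - a) * s ^ (n - 1) * norm x \<le> norm (poly (form_part f n) l) * norm x"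
      by (rule mult_right_mono) simp
    then have "norm ((l - a) * x) * s ^ (n - 1) \<le> C" using 1 by (simp add: norm_mult mult_ac)
    then have "norm (y - a * x) \<le> M"
      using s(1) by (simp add: M_def pos_le_divide_eq y left_diff_distrib)
    then show ?thesis using a(1) by blast
  qed
  moreover have "M \<ge> 0" using C(1) s(1) by (simp add: M_def)
  ultimately show ?thesis by blast
qed

lemma norm_poly_prod_ge:
  fixes t :: complex
  assumes "0 \<le> c"
  shows "(\<forall>r\<in>#A. c \<le> norm (t - r)) \<Longrightarrow> c ^ size A \<le> norm (poly (\<Prod>r\<in>#A. [:-r, 1:]) t)"
proof (induction A)
  case (add r A)
  define p where "p = (\<Prod>r\<in>#A. [:-r, 1:])"
  have "c \<le> norm (t - r)" using add.prems by simp
  moreover have "c ^ size A \<le> norm (poly p t)" unfolding p_def using add by simp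
  ultimately have "c * c ^ size A \<le> norm (t - r) * norm (poly p t)"
    using assms by (intro mult_mono) simp_all
  also have "\<dots> = norm (poly ([:-r, 1:] * p) t)"
    by (simp only: poly_mult norm_mult) simp
  finally show ?case by (simp only: size_add_mset power_Suc image_mset_add_mset prod_mset.add_mset p_def)
qed simp

text \<open>
  Each asymptotic direction is approached by a root: otherwise \<open>f(x, a x) = \<Prod>(a x - y\<^sub>k)\<close> would be
  of order \<open>|x|\<^sup>n\<close>, but the leading form vanishes at \<open>a\<close>. As there are as many roots as
  directions, the root is unique.
\<close>

lemma unique_root_near_asymptote:
  assumes M: "M \<ge> 0" "\<And>x y. 1 \<le> norm x \<Longrightarrow> ev f x y = 0 \<Longrightarrow> \<exists>a\<in>\<Lambda>. norm (y - a * x) \<le> M"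
  shows "\<exists>X\<ge>1. \<forall>x a. X \<le> norm x \<longrightarrow> a \<in> \<Lambda> \<longrightarrow> (\<exists>!y. ev f x y = 0 \<and> norm (y - a * x) \<le> M)"
proof -
  obtain s where s: "s > 0" "\<And>a b. a \<in> \<Lambda> \<Longrightarrow> b \<in> \<Lambda> \<Longrightarrow> a \<noteq> b \<Longrightarrow> 2 * s \<le> norm (a - b)"
    using separated[OF fin] by blast
  define B where "B = (\<Sum>a\<in>\<Lambda>. norm a)"
  have B: "norm a \<le> B" if "a \<in> \<Lambda>" for a unfolding B_def using that fin by (intro member_le_sum) auto
  obtain C where C: "C \<ge> 0" "\<And>x l. 1 \<le> norm x \<Longrightarrow> norm l \<le> B \<Longrightarrow>
    norm (ev f x (l * x) - poly (form_part f n) l * x ^ n) * norm x \<le> C * norm x ^ n"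
    using ev_leading_form[OF td, of B] by blast
  define X where "X = 1 + M / s + C / s ^ n"
  have X: "X \<ge> 1" "M < s * norm x" "C < s ^ n * norm x" if "X \<le> norm x" for x
  proof -
    have "M / s \<ge> 0" "C / s ^ n \<ge> 0" using M C s by auto
    then have "X \<ge> 1" "M / s < norm x" "C / s ^ n < norm x" using that by (auto simp: X_def)
    then show "X \<ge> 1" "M < s * norm x" "C < s ^ n * norm x"
      using s by (auto simp: pos_divide_less_eq mult.commute)
  qed
  have apart: "a = b" if x: "X \<le> norm x" and ab: "a \<in> \<Lambda>" "b \<in> \<Lambda>" "norm (y - a * x) \<le> M" "norm (y - b * x) \<le> M" for x y a b
  proof (rule ccontr)
    assume "a \<noteq> b"
    then have "2 * s * norm x \<le> norm (a - b) * norm x" using s(2) ab by (intro mult_right_mono) auto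
    also have "\<dots> = norm ((y - b * x) - (y - a * x))" by (simp flip: norm_mult add: algebra_simps)
    also have "\<dots> \<le> 2 * M" using norm_triangle_ineq4[of "y - b * x" "y - a * x"] ab by linarith
    finally show False using X(2)[OF x] by simp
  qed
  have ex: "\<exists>y. ev f x y = 0 \<and> norm (y - a * x) \<le> M" if x: "X \<le> norm x" and a: "a \<in> \<Lambda>" for x a
  proof (rule ccontr)
    assume no: "\<nexists>y. ev f x y = 0 \<and> norm (y - a * x) \<le> M"
    have x1: "1 \<le> norm x" using X(1)[OF x] x by linarith
    have sl: "slice f x \<noteq> 0" "degree (slice f x) = n" "lead_coeff (slice f x) = 1"
    proof -
      have c: "coeff (slice f x) n = 1" using monic by simp
      then show "slice f x \<noteq> 0" by (metis coeff_0 zero_neq_one)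
      have "degree (slice f x) \<le> n" by (rule degree_le) (simp add: deg coeff_eq_0)
      then show d: "degree (slice f x) = n" using c le_degree[of "slice f x" n] by simp
      show "lead_coeff (slice f x) = 1" unfolding d by (rule c)
    qed
    obtain A where A: "size A = n" "slice f x = (\<Prod>r\<in>#A. [:-r, 1:])"
      using alg_closed_imp_factorization[OF sl(1)] sl by auto
    have "s * norm x \<le> norm (a * x - r)" if r: "r \<in># A" for r
    proof -
      have "poly (slice f x) r = 0" unfolding A(2) using r by (induction A) auto
      then have z: "ev f x r = 0" by (simp add: poly_slice)
      obtain b where b: "b \<in> \<Lambda>" "norm (r - b * x) \<le> M" using M(2)[OF x1 z] by blast
      then have "a \<noteq> b" using no z by auto
      then have "2 * s * norm x \<le> norm (a - b) * norm x" using s(2) a b by (intro mult_right_mono) auto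
      also have "\<dots> = norm ((a * x - r) + (r - b * x))" by (simp flip: norm_mult add: algebra_simps)
      also have "\<dots> \<le> norm (a * x - r) + norm (r - b * x)" by (rule norm_triangle_ineq)
      finally show ?thesis using b(2) X(2)[OF x] by linarith
    qed
    then have "(s * norm x) ^ n \<le> norm (ev f x (a * x))"
      using norm_poly_prod_ge[of "s * norm x" A "a * x"] s(1) A by (simp add: poly_slice[symmetric])
    then have "(s * norm x) ^ n * norm x \<le> norm (ev f x (a * x)) * norm x"
      by (intro mult_right_mono) auto
    also have "\<dots> \<le> C * norm x ^ n" using C(2)[OF x1 B[OF a]] slopes[OF a] by simp
    finally have "(s * norm x) ^ n * norm x \<le> C * norm x ^ n" .
    then have "(s ^ n * norm x) * norm x ^ n \<le> C * norm x ^ n" by (simp add: power_mult_distrib mult_ac)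
    moreover have "norm x ^ n > 0" using x1 by (intro zero_less_power) linarith
    ultimately show False using X(3)[OF x] by (simp add: mult_le_cancel_right)
  qed
  have "y = y'" if x: "X \<le> norm x" and a: "a \<in> \<Lambda>" and y: "ev f x y = 0" "norm (y - a * x) \<le> M"
    "ev f x y' = 0" "norm (y' - a * x) \<le> M" for x a y y'
  proof -
    have "\<forall>b\<in>\<Lambda>. \<exists>y. ev f x y = 0 \<and> norm (y - b * x) \<le> M" using ex[OF x] by blast
    from bchoice[OF this] obtain \<rho> where \<rho>: "\<And>b. b \<in> \<Lambda> \<Longrightarrow> ev f x (\<rho> b) = 0 \<and> norm (\<rho> b - b * x) \<le> M"
      by blast
    have "coeff (slice f x) n = 1" using monic by simp
    then have p0: "slice f x \<noteq> 0" by (metis coeff_0 zero_neq_one)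
    have dl: "degree (slice f x) \<le> n" by (rule degree_le) (simp add: deg coeff_eq_0)
    define Rt where "Rt = {t. poly (slice f x) t = 0}"
    have Rt: "finite Rt" "card Rt \<le> n"
      using poly_roots_finite[OF p0] card_poly_roots_bound[OF p0] dl by (auto simp: Rt_def)
    have "inj_on \<rho> \<Lambda>"
    proof (rule inj_onI)
      fix b c assume "b \<in> \<Lambda>" "c \<in> \<Lambda>" "\<rho> b = \<rho> c"
      then show "b = c" using apart[OF x, of b c "\<rho> b"] \<rho>[of b] \<rho>[of c] by simp
    qed
    then have "card (\<rho> ` \<Lambda>) = n" using card by (simp add: card_image)
    moreover have "\<rho> ` \<Lambda> \<subseteq> Rt" using \<rho> by (auto simp: Rt_def poly_slice)
    ultimately have eq: "\<rho> ` \<Lambda> = Rt" using Rt by (intro card_seteq) auto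
    have "y = \<rho> a" if "ev f x y = 0" "norm (y - a * x) \<le> M" for y
    proof -
      have "y \<in> Rt" using that(1) by (simp add: Rt_def poly_slice)
      then have "y \<in> \<rho> ` \<Lambda>" by (simp only: eq)
      then obtain b where "b \<in> \<Lambda>" "y = \<rho> b" by blast
      then show ?thesis using apart[OF x a, of b y] \<rho>[of b] that by blast
    qed
    from this[OF y(1,2)] this[OF y(3,4)] show ?thesis by simp
  qed
  then have "\<exists>!y. ev f x y = 0 \<and> norm (y - a * x) \<le> M" if "X \<le> norm x" "a \<in> \<Lambda>" for x a
    using ex[OF that] that by blast
  moreover have "X \<ge> 1" using M C s by (simp add: X_def)
  ultimately show ?thesis by blast
qed

end

text \<open>
  Passing from \<open>g(x, b x)\<close> to \<open>g(x, y)\<close> with \<open>y = b x + O(1)\<close> changes \<open>y / x\<close>, and so the value of the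
  leading form at it, only by \<open>O(1/|x|)\<close>.
\<close>

lemma ev_near_direction:
  assumes g: "tdeg_le g k" and M: "M \<ge> 0"
  shows "\<exists>C\<ge>0. \<forall>x y. 1 \<le> norm x \<longrightarrow> norm (y - b * x) \<le> M \<longrightarrow>
    norm (ev g x y - poly (form_part g k) b * x ^ k) * norm x \<le> C * norm x ^ k"
proof -
  define q where "q = synthetic_div (form_part g k) b"
  have q: "poly (form_part g k) l - poly (form_part g k) b = (l - b) * poly q l" for l
    using arg_cong[OF synthetic_div_correct'[of b "form_part g k"], of "\<lambda>p. poly p l"]
    by (simp add: q_def algebra_simps)
  obtain C1 where C1: "C1 \<ge> 0" "\<And>x l. 1 \<le> norm x \<Longrightarrow> norm l \<le> norm b + M \<Longrightarrow>
    norm (ev g x (l * x) - poly (form_part g k) l * x ^ k) * norm x \<le> C1 * norm x ^ k"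
    using ev_leading_form[OF g, of "norm b + M"] by blast
  obtain C2 where C2: "C2 > 0" "\<And>l. norm l \<le> norm b + M \<Longrightarrow> norm (poly q l) \<le> C2"
    using poly_bound_exists[of "norm b + M" q] by blast
  have "norm (ev g x y - poly (form_part g k) b * x ^ k) * norm x \<le> (C1 + M * C2) * norm x ^ k"
    if x: "1 \<le> norm x" and y: "norm (y - b * x) \<le> M" for x y
  proof -
    define l where "l = y / x"
    have x0: "x \<noteq> 0" "norm x > 0" using x by auto
    have yl: "y = l * x" using x0 by (simp add: l_def)
    have lb: "norm (l - b) * norm x \<le> M" using y by (simp add: yl flip: norm_mult left_diff_distrib)
    have "norm (l - b) * 1 \<le> norm (l - b) * norm x" using x by (intro mult_left_mono) auto
    then have "norm (l - b) \<le> M" using lb by linarith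
    then have l: "norm l \<le> norm b + M" using norm_triangle_ineq2[of l b] by linarith
    have "ev g x y - poly (form_part g k) b * x ^ k
      = (ev g x (l * x) - poly (form_part g k) l * x ^ k) + (l - b) * poly q l * x ^ k"
      unfolding yl q[symmetric] by (simp add: left_diff_distrib)
    then have "norm (ev g x y - poly (form_part g k) b * x ^ k) * norm x
      \<le> (norm (ev g x (l * x) - poly (form_part g k) l * x ^ k) + norm ((l - b) * poly q l * x ^ k)) * norm x"
      by (simp only:) (intro mult_right_mono norm_triangle_ineq norm_ge_zero)
    also have "\<dots> = norm (ev g x (l * x) - poly (form_part g k) l * x ^ k) * norm x
        + (norm (l - b) * norm x) * norm (poly q l) * norm x ^ k"
      by (simp add: norm_mult norm_power distrib_left distrib_right mult_ac)
    also have "\<dots> \<le> C1 * norm x ^ k + M * C2 * norm x ^ k"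
    proof (rule add_mono[OF C1(2)[OF x l]])
      have "(norm (l - b) * norm x) * norm (poly q l) \<le> M * C2"
        using lb C2(2)[OF l] M by (rule mult_mono) simp
      then show "(norm (l - b) * norm x) * norm (poly q l) * norm x ^ k \<le> M * C2 * norm x ^ k"
        by (rule mult_right_mono) simp
    qed
    finally show ?thesis by (simp add: distrib_right)
  qed
  moreover have "C1 + M * C2 \<ge> 0" using C1(1) C2(1) M by simp
  ultimately show ?thesis by blast
qed

lemma poly_nonzero_far:
  fixes R :: "complex poly"
  assumes "R \<noteq> 0"
  shows "\<exists>X\<ge>1. \<forall>x. X \<le> norm x \<longrightarrow> poly R x \<noteq> 0"
proof -
  have fin: "finite (norm ` {x. poly R x = 0})" using poly_roots_finite[OF assms] by simp
  define X where "X = Max (Set.insert 0 (norm ` {x. poly R x = 0})) + 1"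
  have le: "norm x \<le> X - 1" if "poly R x = 0" for x
    unfolding X_def using fin that by simp
  have "0 \<le> X - 1" unfolding X_def using fin by simp
  then show ?thesis using le by (intro exI[of _ X]) force
qed

text \<open>
  A quotient \<open>N / R(x)\<close> of linear growth on the curve, with \<open>N\<close> reduced modulo \<open>f\<close>, has a numerator
  of total degree at most \<open>deg R + 1\<close>: a form of higher degree that does not vanish at all asymptotic
  directions would grow too fast along one of the branches, and a form of \<open>y\<close>-degree below \<open>n\<close>
  cannot vanish at all \<open>n\<close> directions. Hence the quotient is linear up to a bounded term on every
  branch.
\<close>

lemma (in distinct_directions) quotient_numerator_degree:
  assumes N: "degree N < n" and R: "R \<noteq> 0"
    and M: "M \<ge> 0" "\<And>x b. X \<le> norm x \<Longrightarrow> b \<in> \<Lambda> \<Longrightarrow> \<exists>y. ev f x y = 0 \<and> norm (y - b * x) \<le> M"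
    and growth: "\<And>x y. X \<le> norm x \<Longrightarrow> ev f x y = 0 \<Longrightarrow> norm (ev N x y) \<le> B * norm x * norm (poly R x)"
  shows "tdeg_le N (Suc (degree R))"
proof (rule ccontr)
  assume neg: "\<not> ?thesis"
  then have "N \<noteq> 0" by (auto simp: tdeg_le_def)
  then obtain e where e: "tdeg_le N e" "form_part N e \<noteq> 0" using least_tdeg by blast
  have er: "Suc (Suc (degree R)) \<le> e" using neg tdeg_le_mono[OF e(1)] by (meson not_less_eq_eq)
  have "degree (form_part N e) \<le> degree N" by (rule degree_le) (simp add: coeff_form_part coeff_eq_0)
  then have "card {b. poly (form_part N e) b = 0} < card \<Lambda>"
    using card_poly_roots_bound[OF e(2)] N card by linarith
  then have "\<not> \<Lambda> \<subseteq> {b. poly (form_part N e) b = 0}"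
    using card_mono[OF poly_roots_finite[OF e(2)], of \<Lambda>] by linarith
  then obtain b where b: "b \<in> \<Lambda>" "poly (form_part N e) b \<noteq> 0" by blast
  obtain C where C: "C \<ge> 0" "\<And>x y. 1 \<le> norm x \<Longrightarrow> norm (y - b * x) \<le> M \<Longrightarrow>
    norm (ev N x y - poly (form_part N e) b * x ^ e) * norm x \<le> C * norm x ^ e"
    using ev_near_direction[OF e(1) M(1), of b] by blast
  define cR where "cR = (\<Sum>i\<le>degree R. norm (coeff R i))"
  define t where "t = 1 + \<bar>X\<bar> + (C + \<bar>B\<bar> * cR) / norm (poly (form_part N e) b)"
  have cR0: "cR \<ge> 0" by (auto simp: cR_def intro: sum_nonneg)
  have "(C + \<bar>B\<bar> * cR) / norm (poly (form_part N e) b) \<ge> 0" using C(1) cR0 by simp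
  then have t: "t \<ge> 1" "t \<ge> X" "(C + \<bar>B\<bar> * cR) / norm (poly (form_part N e) b) < t" by (auto simp: t_def)
  define x where "x = complex_of_real t"
  have nx: "norm x = t" using t by (simp add: x_def)
  obtain y where y: "ev f x y = 0" "norm (y - b * x) \<le> M" using M(2)[of x b] b t nx by auto
  have "norm (ev N x y) * t \<le> \<bar>B\<bar> * cR * t ^ e"
  proof -
    have "norm (ev N x y) * t \<le> B * norm x * norm (poly R x) * t"
      using growth[of x y] y t nx by (intro mult_right_mono) auto
    also have "\<dots> \<le> \<bar>B\<bar> * norm x * (cR * norm x ^ degree R) * t"
      using poly_growth[of R "degree R" x] t nx cR0 by (intro mult_right_mono mult_mono) (auto simp: cR_def)
    also have "\<dots> = \<bar>B\<bar> * cR * t ^ Suc (Suc (degree R))" by (simp add: nx mult_ac)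
    also have "\<dots> \<le> \<bar>B\<bar> * cR * t ^ e"
      using er t cR0 by (intro mult_left_mono power_increasing) auto
    finally show ?thesis .
  qed
  moreover have "norm (poly (form_part N e) b * x ^ e) \<le> norm (ev N x y) + norm (ev N x y - poly (form_part N e) b * x ^ e)"
    using norm_triangle_ineq4[of "ev N x y" "ev N x y - poly (form_part N e) b * x ^ e"] by simp
  then have "norm (poly (form_part N e) b * x ^ e) * t
      \<le> (norm (ev N x y) + norm (ev N x y - poly (form_part N e) b * x ^ e)) * t"
    using t by (intro mult_right_mono) auto
  moreover have "norm (ev N x y - poly (form_part N e) b * x ^ e) * t \<le> C * t ^ e" using C(2)[of x y] y t nx by simp
  ultimately have "norm (poly (form_part N e) b) * t * t ^ e \<le> (C + \<bar>B\<bar> * cR) * t ^ e"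
    by (simp add: norm_mult norm_power nx algebra_simps)
  moreover have "t ^ e > 0" using t by (intro zero_less_power) linarith
  ultimately have "norm (poly (form_part N e) b) * t \<le> C + \<bar>B\<bar> * cR" by (simp add: mult_le_cancel_right)
  then show False using t(3) b(2) by (simp add: pos_divide_less_eq mult.commute)
qed

lemma (in distinct_directions) quotient_asymptotics:
  assumes N: "tdeg_le N (Suc (degree R))" and R: "R \<noteq> 0" and M: "M \<ge> 0"
  shows "\<exists>M'\<ge>0. \<exists>X\<ge>1. \<forall>x b y. X \<le> norm x \<longrightarrow> b \<in> \<Lambda> \<longrightarrow> norm (y - b * x) \<le> M \<longrightarrow>
    norm (ev N x y - poly (form_part N (Suc (degree R))) b / lead_coeff R * x * poly R x) \<le> M' * norm (poly R x)"
proof -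
  define r where "r = degree R"
  define \<rho> where "\<rho> = lead_coeff R"
  define a where "a b = poly (form_part N (Suc r)) b / \<rho>" for b
  have \<rho>: "\<rho> \<noteq> 0" using R by (simp add: \<rho>_def)
  obtain C' where C': "C' \<ge> 0" "\<And>x. 1 \<le> norm x \<Longrightarrow> norm (poly R x - \<rho> * x ^ r) * norm x \<le> C' * norm x ^ r"
    using poly_leading_growth[of R] unfolding \<rho>_def r_def by blast
  have "\<forall>b. \<exists>C\<ge>0. \<forall>x y. 1 \<le> norm x \<longrightarrow> norm (y - b * x) \<le> M \<longrightarrow>
    norm (ev N x y - poly (form_part N (Suc r)) b * x ^ Suc r) * norm x \<le> C * norm x ^ Suc r"
    using ev_near_direction[OF N M] unfolding r_def by blast
  then obtain C where C: "\<And>b. C b \<ge> 0" "\<And>b x y. 1 \<le> norm x \<Longrightarrow> norm (y - b * x) \<le> M \<Longrightarrow>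
    norm (ev N x y - poly (form_part N (Suc r)) b * x ^ Suc r) * norm x \<le> C b * norm x ^ Suc r"
    by metis
  define M' where "M' = (\<Sum>b\<in>\<Lambda>. (C b + norm (a b) * C') * (2 / norm \<rho>))"
  define X where "X = 1 + 2 * C' / norm \<rho>"
  have "norm (ev N x y - a b * x * poly R x) \<le> M' * norm (poly R x)"
    if x: "X \<le> norm x" and b: "b \<in> \<Lambda>" and y: "norm (y - b * x) \<le> M" for x b y
  proof -
    have "2 * C' / norm \<rho> \<ge> 0" using C' by simp
    then have x1: "1 \<le> norm x" "2 * C' / norm \<rho> \<le> norm x" using x by (auto simp: X_def)
    then have x0: "norm x > 0" by linarith
    have 2: "2 * C' \<le> norm x * norm \<rho>" using x1(2) \<rho> by (simp add: pos_divide_le_eq)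
    have R1: "norm (poly R x - \<rho> * x ^ r) * norm x \<le> C' * norm x ^ r" using C'(2)[OF x1(1)] .
    have "norm (\<rho> * x ^ r) \<le> norm (poly R x) + norm (poly R x - \<rho> * x ^ r)"
      using norm_triangle_ineq4[of "poly R x" "poly R x - \<rho> * x ^ r"] by simp
    then have "norm (\<rho> * x ^ r) * norm x \<le> (norm (poly R x) + norm (poly R x - \<rho> * x ^ r)) * norm x"
      by (rule mult_right_mono) simp
    then have "norm \<rho> * norm x ^ r * norm x \<le> norm (poly R x) * norm x + C' * norm x ^ r"
      using R1 by (simp add: norm_mult norm_power distrib_right)
    also have "2 * (C' * norm x ^ r) \<le> norm x * norm \<rho> * norm x ^ r"
      using mult_right_mono[OF 2, of "norm x ^ r"] by simp
    then have "norm (poly R x) * norm x + C' * norm x ^ r \<le> norm (poly R x) * norm x + norm x * norm \<rho> * norm x ^ r / 2"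
      by simp
    finally have "(norm \<rho> * norm x ^ r) * norm x \<le> (2 * norm (poly R x)) * norm x" by (simp add: mult_ac)
    then have Rlow: "norm \<rho> * norm x ^ r \<le> 2 * norm (poly R x)" using x0 by (simp only: mult_le_cancel_right)
    have "norm (ev N x y - poly (form_part N (Suc r)) b * x ^ Suc r) * norm x \<le> (C b * norm x ^ r) * norm x"
      using C(2)[OF x1(1) y] by (simp add: mult_ac)
    then have 3: "norm (ev N x y - poly (form_part N (Suc r)) b * x ^ Suc r) \<le> C b * norm x ^ r"
      using x0 by (simp only: mult_le_cancel_right)
    have "ev N x y - a b * x * poly R x
      = (ev N x y - poly (form_part N (Suc r)) b * x ^ Suc r) - a b * ((poly R x - \<rho> * x ^ r) * x)"
      using \<rho> by (simp add: a_def field_simps)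
    then have "norm (ev N x y - a b * x * poly R x)
      \<le> norm (ev N x y - poly (form_part N (Suc r)) b * x ^ Suc r) + norm (a b * ((poly R x - \<rho> * x ^ r) * x))"
      by (simp only: norm_triangle_ineq4)
    also have "\<dots> \<le> C b * norm x ^ r + norm (a b) * (C' * norm x ^ r)"
    proof (rule add_mono[OF 3])
      show "norm (a b * ((poly R x - \<rho> * x ^ r) * x)) \<le> norm (a b) * (C' * norm x ^ r)"
        unfolding norm_mult using R1 by (intro mult_left_mono) simp_all
    qed
    also have "\<dots> = (C b + norm (a b) * C') * norm x ^ r" by (simp add: algebra_simps)
    also have "\<dots> \<le> (C b + norm (a b) * C') * (2 / norm \<rho> * norm (poly R x))"
    proof (rule mult_left_mono)
      show "norm x ^ r \<le> 2 / norm \<rho> * norm (poly R x)" using Rlow \<rho> by (simp add: field_simps)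
    qed (use C(1)[of b] C'(1) in simp)
    also have "\<dots> = (C b + norm (a b) * C') * (2 / norm \<rho>) * norm (poly R x)" by simp
    also have "\<dots> \<le> M' * norm (poly R x)"
      unfolding M'_def using b fin C(1) C'(1)
      by (intro mult_right_mono member_le_sum[of b \<Lambda> "\<lambda>b. (C b + norm (a b) * C') * (2 / norm \<rho>)"]) auto
    finally show ?thesis .
  qed
  moreover have "M' \<ge> 0" unfolding M'_def using C(1) C'(1) by (intro sum_nonneg) auto
  moreover have "X \<ge> 1" using C' by (simp add: X_def)
  ultimately show ?thesis unfolding a_def \<rho>_def r_def by blast
qed

lemma monom_eval_3: "monom_eval m (v :: 3 \<Rightarrow> complex) =
  v 1 ^ Poly_Mapping.lookup m 1 * v 2 ^ Poly_Mapping.lookup m 2 * v 3 ^ Poly_Mapping.lookup m 3"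
proof -
  have "monom_eval m v = (\<Prod>i\<in>UNIV. v i ^ Poly_Mapping.lookup m i)"
    unfolding monom_eval_def by (rule prod.mono_neutral_left) (auto simp: in_keys_iff)
  also have "\<dots> = v 1 ^ Poly_Mapping.lookup m 1 * v 2 ^ Poly_Mapping.lookup m 2 * v 3 ^ Poly_Mapping.lookup m 3"
    unfolding UNIV_3 by (simp add: mult.assoc)
  finally show ?thesis .
qed

lemma monom_deg_3: "monom_deg (m :: 3 \<Rightarrow>\<^sub>0 nat) =
  Poly_Mapping.lookup m 1 + Poly_Mapping.lookup m 2 + Poly_Mapping.lookup m 3"
proof -
  have "monom_deg m = (\<Sum>i\<in>UNIV. Poly_Mapping.lookup m i)"
    unfolding monom_deg_def by (rule sum.mono_neutral_left) (auto simp: in_keys_iff)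
  then show ?thesis by (simp only: sum_3)
qed

text \<open>
  On the zero set the term \<open>c z\<^bsup>m\<^esup>\<close> is balanced by terms of lower degree in \<open>z\<close> and of total degree at
  most \<open>m\<close>. If \<open>|z|\<close> exceeds \<open>1 + |x|\<close>, these are \<open>O((1 + |x|) |z|\<^bsup>m-1\<^esup>)\<close>, and so \<open>z\<close> is \<open>O(1 + |x|)\<close>.
\<close>

lemma third_coordinate_growth:
  fixes P :: "3 cmpoly"
  assumes c: "c \<noteq> 0" "\<And>e. Poly_Mapping.lookup e 3 = tdeg P \<Longrightarrow>
      Poly_Mapping.lookup P e = (if e = Poly_Mapping.single 3 (tdeg P) then c else 0)"
    and B: "B \<ge> 1"
  shows "\<exists>D. \<forall>v. norm (v 2) \<le> B * (1 + norm (v 1)) \<longrightarrow> mpoly_eval P v = 0 \<longrightarrow>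
    norm (v 3) \<le> D * (1 + norm (v 1))"
proof -
  define m where "m = tdeg P"
  define e0 :: "3 \<Rightarrow>\<^sub>0 nat" where "e0 = Poly_Mapping.single 3 m"
  define E where "E = Poly_Mapping.keys P - {e0}"
  define S where "S = (\<Sum>e\<in>E. norm (Poly_Mapping.lookup P e) * B ^ Poly_Mapping.lookup e 2)"
  have top: "Poly_Mapping.lookup P e0 = c" using c(2)[of e0] by (simp add: e0_def m_def)
  then have keys: "Poly_Mapping.keys P = Set.insert e0 E" "e0 \<notin> E" "finite E" using c(1) by (auto simp: E_def in_keys_iff)
  have low: "Poly_Mapping.lookup e 3 < m" "Poly_Mapping.lookup e 1 + Poly_Mapping.lookup e 2 + Poly_Mapping.lookup e 3 \<le> m"
    if "e \<in> E" for e
  proof -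
    show le: "Poly_Mapping.lookup e 1 + Poly_Mapping.lookup e 2 + Poly_Mapping.lookup e 3 \<le> m"
      using that monom_deg_le_tdeg[of e P] by (simp add: E_def monom_deg_3 m_def)
    have "Poly_Mapping.lookup e 3 \<noteq> m" using that c(2)[of e] by (auto simp: E_def in_keys_iff m_def e0_def)
    then show "Poly_Mapping.lookup e 3 < m" using le by linarith
  qed
  have "norm (v 3) \<le> (1 + S / norm c) * (1 + norm (v 1))"
    if v2: "norm (v 2) \<le> B * (1 + norm (v 1))" and vP: "mpoly_eval P v = 0" for v
  proof -
    define \<rho> where "\<rho> = 1 + norm (v 1)"
    have v: "1 \<le> \<rho>" "norm (v 2) \<le> B * \<rho>" "mpoly_eval P v = 0" "norm (v 1) \<le> \<rho>" using v2 vP by (simp_all add: \<rho>_def)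
    have \<rho>0 [simp]: "0 \<le> \<rho>" by (simp add: \<rho>_def)
    have S0: "S \<ge> 0" using B by (auto simp: S_def intro!: sum_nonneg)
    have "norm (v 3) \<le> (1 + S / norm c) * \<rho>"
    proof (cases "norm (v 3) \<le> \<rho>")
      case True
      also have "1 * \<rho> \<le> (1 + S / norm c) * \<rho>" using S0 by (intro mult_right_mono) auto
      finally show ?thesis by simp
    next
      case False
      then have v31: "\<rho> \<le> norm (v 3)" "1 \<le> norm (v 3)" using v by auto
      have "0 = c * v 3 ^ m + (\<Sum>e\<in>E. Poly_Mapping.lookup P e * monom_eval e v)"
        using v(3) keys top by (simp add: mpoly_eval_def e0_def)
      then have "c * v 3 ^ m = - (\<Sum>e\<in>E. Poly_Mapping.lookup P e * monom_eval e v)"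
        by (simp add: eq_neg_iff_add_eq_0)
      then have "norm (c * v 3 ^ m) \<le> (\<Sum>e\<in>E. norm (Poly_Mapping.lookup P e * monom_eval e v))"
        by (simp only: norm_minus_cancel norm_sum)
      also have "\<dots> \<le> (\<Sum>e\<in>E. norm (Poly_Mapping.lookup P e) * B ^ Poly_Mapping.lookup e 2 * (\<rho> * norm (v 3) ^ (m - 1)))"
      proof (rule sum_mono)
        fix e assume e: "e \<in> E"
        define i j k where "i = Poly_Mapping.lookup e 1" and "j = Poly_Mapping.lookup e 2" and "k = Poly_Mapping.lookup e 3"
        have ijk: "k < m" "i + j + k \<le> m" using low[OF e] by (simp_all add: i_def j_def k_def)
        have "norm (monom_eval e v) = norm (v 1) ^ i * norm (v 2) ^ j * norm (v 3) ^ k"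
          by (simp add: monom_eval_3 norm_mult norm_power i_def j_def k_def)
        also have "\<dots> \<le> \<rho> ^ i * (B * \<rho>) ^ j * norm (v 3) ^ k"
          using v by (intro mult_right_mono mult_mono power_mono) auto
        also have "\<dots> = B ^ j * (\<rho> ^ (i + j) * norm (v 3) ^ k)"
          by (simp add: power_mult_distrib power_add)
        also have "\<rho> ^ (i + j) * norm (v 3) ^ k \<le> \<rho> * norm (v 3) ^ (m - 1)"
        proof (cases "i + j")
          case 0
          have "norm (v 3) ^ k \<le> norm (v 3) ^ (m - 1)" using v31 ijk by (intro power_increasing) auto
          also have "1 * norm (v 3) ^ (m - 1) \<le> \<rho> * norm (v 3) ^ (m - 1)" using v(1) by (intro mult_right_mono) auto
          finally show ?thesis using 0 by simp
        next
          case (Suc s)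
          have "\<rho> ^ (i + j) * norm (v 3) ^ k = \<rho> * (\<rho> ^ s * norm (v 3) ^ k)"
            by (simp add: Suc)
          also have "\<dots> \<le> \<rho> * (norm (v 3) ^ s * norm (v 3) ^ k)"
            using v31 by (intro mult_left_mono mult_right_mono power_mono) auto
          also have "\<dots> = \<rho> * norm (v 3) ^ (s + k)" by (simp add: power_add)
          also have "\<dots> \<le> \<rho> * norm (v 3) ^ (m - 1)"
            using v31 ijk Suc by (intro mult_left_mono power_increasing) auto
          finally show ?thesis .
        qed
        then have "B ^ j * (\<rho> ^ (i + j) * norm (v 3) ^ k) \<le> B ^ j * (\<rho> * norm (v 3) ^ (m - 1))"
          using B by (intro mult_left_mono) auto
        finally have "norm (monom_eval e v) \<le> B ^ j * (\<rho> * norm (v 3) ^ (m - 1))" .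
        then have "norm (Poly_Mapping.lookup P e) * norm (monom_eval e v)
            \<le> norm (Poly_Mapping.lookup P e) * (B ^ j * (\<rho> * norm (v 3) ^ (m - 1)))"
          by (rule mult_left_mono) simp
        then show "norm (Poly_Mapping.lookup P e * monom_eval e v) \<le>
          norm (Poly_Mapping.lookup P e) * B ^ Poly_Mapping.lookup e 2 * (\<rho> * norm (v 3) ^ (m - 1))"
          by (simp add: norm_mult j_def mult.assoc)
      qed
      also have "\<dots> = S * (\<rho> * norm (v 3) ^ (m - 1))" unfolding S_def sum_distrib_right ..
      finally have le: "norm c * norm (v 3) ^ m \<le> S * \<rho> * norm (v 3) ^ (m - 1)"
        by (simp add: norm_mult norm_power mult.assoc)
      have "m \<noteq> 0"
      proof
        assume "m = 0"
        have "e \<notin> E" for e using low(1)[of e] \<open>m = 0\<close> by auto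
        then have "E = {}" by blast
        then show False using le \<open>m = 0\<close> c(1) by (simp add: S_def)
      qed
      then have "norm (v 3) ^ m = norm (v 3) * norm (v 3) ^ (m - 1)"
        using power_minus_mult[of m "norm (v 3)"] by (simp add: mult.commute)
      then have "(norm c * norm (v 3)) * norm (v 3) ^ (m - 1) \<le> (S * \<rho>) * norm (v 3) ^ (m - 1)"
        using le by (simp add: mult.assoc)
      moreover have "norm (v 3) ^ (m - 1) > 0" using v31 by (intro zero_less_power) linarith
      ultimately have "norm c * norm (v 3) \<le> S * \<rho>" by (simp only: mult_le_cancel_right)
      then have "norm (v 3) \<le> S / norm c * \<rho>" using c(1) by (simp add: field_simps)
      also have "\<dots> \<le> (1 + S / norm c) * \<rho>" by (intro mult_right_mono) auto
      finally show ?thesis .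
    qed
    then show ?thesis by (simp only: \<rho>_def)
  qed
  then show ?thesis by blast
qed

section \<open>The closure of a rational space curve\<close>

lemma param_points_affine:
  assumes F: "root_closed_subfield \<FF>" and p: "\<And>i. p $ i \<in> upolys_over \<FF>" and q: "q \<in> upolys_over \<FF>"
  shows "{\<chi> i. poly (p $ i) t / poly q t | t. t \<in> \<FF> \<and> poly q t \<noteq> 0} \<subseteq> affine_space \<FF>"
  using poly_in_subring[OF root_closed_subring[OF F]] p q
  by (auto simp: affine_space_def intro!: root_closed_divide[OF F])

text \<open>
  The closure of a rational curve is its image together with the value at infinity. If a point \<open>a\<close>
  satisfies all equations of the curve and is not the value at infinity, then the polynomials
  \<open>a\<^sub>i q - p\<^sub>i\<close> have a common root: a linear combination of them with coefficients \<open>(1, \<epsilon>, \<epsilon>\<^sup>2)\<close> that has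
  full degree shares a root with every other one, since their resultant vanishes on the curve, and one
  of its finitely many roots must serve infinitely many \<open>\<epsilon>\<close>.
\<close>

lemma rational_curve_closure:
  fixes p :: "complex poly ^ 3" and a :: "3 \<Rightarrow> complex"
  assumes F: "root_closed_subfield \<FF>" and p: "\<And>i. p $ i \<in> upolys_over \<FF>" and q: "q \<in> upolys_over \<FF>"
    and deg: "degree q = d" "d > 0" "\<And>i. degree (p $ i) \<le> d"
    and cop: "\<And>t. poly q t = 0 \<Longrightarrow> poly (p $ 1) t \<noteq> 0"
    and a: "\<And>P. P \<in> vanishing_ideal \<FF> (param_curve \<FF> p q) \<Longrightarrow> mpoly_eval P a = 0"
  shows "(\<exists>t. poly q t \<noteq> 0 \<and> (\<forall>i. a i = poly (p $ i) t / poly q t)) \<or> (\<forall>i. a i = coeff (p $ i) d / lead_coeff q)"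
proof (rule disjCI)
  assume not_inf: "\<not> (\<forall>i. a i = coeff (p $ i) d / lead_coeff q)"
  have A: "subring_set \<FF>" using F by (rule root_closed_subring)
  have q0: "lead_coeff q \<noteq> 0" using deg by auto
  define comb where "comb e x = x (1::3) + e * x 2 + e\<^sup>2 * x 3" for e :: complex and x
  define L where "L e x = (\<Sum>i\<in>{1, 2, 3::3}. Polynomial.smult (if i = 1 then 1 else if i = 2 then e else e\<^sup>2)
    (Polynomial.smult (x i) q - p $ i))" for e and x :: "3 \<Rightarrow> complex"
  have coeff_L: "coeff (L e x) k = comb e (\<lambda>i. x i * coeff q k - coeff (p $ i) k)" for e x k
    by (simp add: L_def comb_def coeff_sum)
  have poly_L: "poly (L e x) t = comb e (\<lambda>i. x i * poly q t - poly (p $ i) t)" for e x t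
    by (simp add: L_def comb_def poly_sum)
  have deg_L: "degree (L e x) \<le> d" for e x
  proof (rule degree_le, intro allI impI)
    fix k assume k: "d < k"
    have "coeff (p $ i) k = 0" for i using le_less_trans[OF deg(3) k] by (rule coeff_eq_0)
    moreover have "coeff q k = 0" using k deg(1) by (simp add: coeff_eq_0)
    ultimately show "coeff (L e x) k = 0" by (simp add: coeff_L comb_def)
  qed
  have res: "Determinant.det (sylvester d d (L e a) (L e' a)) = 0" if e: "e \<in> \<FF>" "e' \<in> \<FF>" for e e'
  proof -
    have pf: "polyfun \<FF> (\<lambda>x. coeff (L e x) k)" if "e \<in> \<FF>" for e k
      unfolding coeff_L comb_def using that A p q
      by (intro polyfun_add[OF A] polyfun_mult[OF A] polyfun_diff[OF A] polyfun_var[OF A] polyfun_const[OF A]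
          upolys_overD subring_set_power)
    obtain P where P: "P \<in> mpolys_over \<FF>" "\<And>x. mpoly_eval P x = Determinant.det (sylvester d d (L e x) (L e' x))"
      using polyfun_det_sylvester[OF A pf[OF e(1)] pf[OF e(2)], of d d] unfolding polyfun_def by blast
    have "P \<in> vanishing_ideal \<FF> {\<chi> i. poly (p $ i) t / poly q t | t. t \<in> \<FF> \<and> poly q t \<noteq> 0}"
      unfolding vanishing_ideal_def
    proof (intro CollectI conjI ballI P(1))
      fix v assume "v \<in> {\<chi> i. poly (p $ i) t / poly q t | t. t \<in> \<FF> \<and> poly q t \<noteq> 0}"
      then obtain t where t: "poly q t \<noteq> 0" "v = (\<chi> i. poly (p $ i) t / poly q t)" by blast
      have "poly (L e (($) v)) t = 0" for e using t by (simp add: poly_L comb_def)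
      then show "mpoly_eval P (($) v) = 0"
        unfolding P(2) using deg(2) by (intro det_sylvester_common_root[OF deg_L deg_L]) auto
    qed
    then have "P \<in> vanishing_ideal \<FF> (param_curve \<FF> p q)"
      unfolding param_curve_def by (subst vanishing_ideal_closure[OF param_points_affine[OF F p q]])
    from a[OF this] show ?thesis by (simp only: P(2))
  qed
  define D where "D = [:a 1 * coeff q d - coeff (p $ 1) d, a 2 * coeff q d - coeff (p $ 2) d, a 3 * coeff q d - coeff (p $ 3) d:]"
  have poly_D: "poly D e = coeff (L e a) d" for e
    by (simp add: D_def coeff_L comb_def power2_eq_square algebra_simps)
  have "D \<noteq> 0"
  proof
    assume "D = 0"
    then have "a 1 * coeff q d = coeff (p $ 1) d" "a 2 * coeff q d = coeff (p $ 2) d" "a 3 * coeff q d = coeff (p $ 3) d"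
      by (simp_all add: D_def)
    then have "\<forall>i. a i * coeff q d = coeff (p $ i) d" by (simp add: forall_3)
    then show False using not_inf q0 deg(1) by (simp add: eq_divide_eq)
  qed
  then have "\<not> \<FF> \<subseteq> {e. poly D e = 0}" using poly_roots_finite infinite_subring[OF A] finite_subset by blast
  then obtain e0 where e0: "e0 \<in> \<FF>" "coeff (L e0 a) d \<noteq> 0" using poly_D by auto
  have deg0: "degree (L e0 a) = d" using deg_L[of e0 a] le_degree[OF e0(2)] by simp
  have common: "\<exists>t. poly (L e0 a) t = 0 \<and> poly (L e a) t = 0" if "e \<in> \<FF>" for e
    using det_sylvester_eq_0_iff[OF deg0 deg(2) deg_L] res[OF e0(1) that] by blast
  define R where "R = {t. poly (L e0 a) t = 0}"
  have "L e0 a \<noteq> 0" using e0(2) by auto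
  then have "finite R" unfolding R_def by (rule poly_roots_finite)
  moreover have "\<FF> = (\<Union>t\<in>R. {e \<in> \<FF>. poly (L e a) t = 0})" using common by (auto simp: R_def)
  ultimately have "\<not> (\<forall>t\<in>R. finite {e \<in> \<FF>. poly (L e a) t = 0})"
    using infinite_subring[OF A] finite_UN_I[of R "\<lambda>t. {e \<in> \<FF>. poly (L e a) t = 0}"] by auto
  then obtain t where t: "infinite {e \<in> \<FF>. poly (L e a) t = 0}" by blast
  define E where "E = [:a 1 * poly q t - poly (p $ 1) t, a 2 * poly q t - poly (p $ 2) t, a 3 * poly q t - poly (p $ 3) t:]"
  have "poly E e = poly (L e a) t" for e by (simp add: E_def poly_L comb_def power2_eq_square algebra_simps)
  then have "{e \<in> \<FF>. poly (L e a) t = 0} \<subseteq> {e. poly E e = 0}" by auto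
  then have "infinite {e. poly E e = 0}" using t by (rule infinite_super)
  then have "E = 0" using poly_roots_finite by blast
  then have "\<forall>i. a i * poly q t = poly (p $ i) t" by (simp add: E_def forall_3)
  moreover from this have "poly q t \<noteq> 0" using cop[of t] by (metis mult_zero_right)
  ultimately show "\<exists>t. poly q t \<noteq> 0 \<and> (\<forall>i. a i = poly (p $ i) t / poly q t)" by (auto simp: eq_divide_eq)
qed

text \<open>
  A quotient \<open>u / q\<close> whose numerator cancels the pole at \<open>\<xi>\<close> is bounded on the region where \<open>\<xi>\<close> is
  the nearest pole; this includes a neighbourhood of infinity in that region, because of the degrees.
\<close>

lemma quotient_bounded_near_cancelled_pole:
  fixes q u :: "complex poly"
  assumes S: "finite S" "card S = d" and q: "degree q = d" "q \<noteq> 0" "\<And>t. t \<in> S \<Longrightarrow> poly q t = 0"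
    and \<xi>: "\<xi> \<in> S" and u: "degree u \<le> d" "poly u \<xi> = 0"
  shows "\<exists>M\<ge>0. \<forall>t. (\<forall>\<eta>\<in>S. norm (t - \<xi>) \<le> norm (t - \<eta>)) \<longrightarrow> norm (poly u t) \<le> M * norm (poly q t)"
proof -
  define c where "c = lead_coeff q"
  have c0: "c \<noteq> 0" using q(2) by (simp add: c_def)
  have qd: "coeff q d = c" using q(1) by (simp add: c_def)
  then have "coeff (Polynomial.smult (inverse c) q) d = 1" using c0 by simp
  then have "Polynomial.smult (inverse c) q = (\<Prod>a\<in>S. [:-a, 1:])"
    using S q c0 qd by (intro monic_poly_eq_prod_roots) auto
  then have "poly (Polynomial.smult (inverse c) q) t = (\<Prod>a\<in>S. t - a)" for t by (simp add: poly_prod)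
  then have pq: "poly q t = c * (\<Prod>a\<in>S. t - a)" for t using c0 by (simp add: field_simps)
  obtain s where s: "s > 0" "\<And>a b. a \<in> S \<Longrightarrow> b \<in> S \<Longrightarrow> a \<noteq> b \<Longrightarrow> 2 * s \<le> norm (a - b)"
    using separated[OF S(1)] by blast
  define b where "b = (\<Sum>a\<in>S. norm a)"
  have b: "norm a \<le> b" if "a \<in> S" for a unfolding b_def using that S(1) by (intro member_le_sum) auto
  define k where "k = 1 + (1 + b) / s"
  have b0: "b \<ge> 0" by (auto simp: b_def intro: sum_nonneg)
  then have k: "k \<ge> 1" using s(1) by (simp add: k_def)
  obtain w where w: "u = [:-\<xi>, 1:] * w" using u(2) by (metis poly_eq_0_iff_dvd dvdE)
  have dw: "degree w \<le> d - 1"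
  proof (cases "w = 0")
    case False
    then have "degree u = Suc (degree w)" unfolding w by (subst degree_mult_eq) auto
    then show ?thesis using u(1) by simp
  qed simp
  define W where "W = (\<Sum>i\<le>degree w. norm (coeff w i))"
  have W0: "W \<ge> 0" by (auto simp: W_def intro: sum_nonneg)
  define M where "M = W * k ^ (d - 1) / norm c"
  have "norm (poly u t) \<le> M * norm (poly q t)" if near: "\<forall>\<eta>\<in>S. norm (t - \<xi>) \<le> norm (t - \<eta>)" for t
  proof -
    have "1 + norm t \<le> k * norm (t - a)" if a: "a \<in> S - {\<xi>}" for a
    proof -
      have "s \<le> norm (t - a)" using separated_half[of t \<xi> a s] near s(2)[of \<xi> a] a \<xi> by auto
      then have "(1 + b) / s * s \<le> (1 + b) / s * norm (t - a)" using b0 s(1) by (intro mult_left_mono) auto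
      then have "1 + b \<le> (1 + b) / s * norm (t - a)" using s(1) by simp
      moreover have "norm t \<le> norm (t - a) + norm a" using norm_triangle_ineq[of "t - a" a] by simp
      moreover have "norm a \<le> b" using b a by simp
      ultimately show ?thesis by (simp add: k_def distrib_right)
    qed
    then have "(\<Prod>a\<in>S - {\<xi>}. 1 + norm t) \<le> (\<Prod>a\<in>S - {\<xi>}. k * norm (t - a))"
      by (intro prod_mono) auto
    then have far: "(1 + norm t) ^ (d - 1) \<le> k ^ (d - 1) * (\<Prod>a\<in>S - {\<xi>}. norm (t - a))"
      using S \<xi> by (simp add: prod.distrib)
    have "norm (poly w t) \<le> W * (1 + norm t) ^ (d - 1)" unfolding W_def by (rule poly_growth_all[OF dw])
    also have "\<dots> \<le> W * (k ^ (d - 1) * (\<Prod>a\<in>S - {\<xi>}. norm (t - a)))" using far W0 by (rule mult_left_mono)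
    finally have "norm (t - \<xi>) * norm (poly w t) \<le> norm (t - \<xi>) * (W * (k ^ (d - 1) * (\<Prod>a\<in>S - {\<xi>}. norm (t - a))))"
      by (rule mult_left_mono) simp
    also have "norm (t - \<xi>) * norm (poly w t) = norm (poly u t)" by (simp add: w flip: norm_mult add: algebra_simps)
    also have "norm (t - \<xi>) * (W * (k ^ (d - 1) * (\<Prod>a\<in>S - {\<xi>}. norm (t - a))))
      = W * k ^ (d - 1) * (\<Prod>a\<in>S. norm (t - a))"
      using S(1) \<xi> by (simp add: prod.remove[of S \<xi>])
    also have "\<dots> = M * norm (poly q t)" using c0 by (simp add: M_def pq norm_mult prod_norm)
    finally show ?thesis .
  qed
  moreover have "M \<ge> 0" using W0 k by (simp add: M_def)
  ultimately show ?thesis by blast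
qed

lemma subring_Reals: "subring_set (\<real> :: complex set)"
  unfolding subring_set_def by auto

lemma real_poly_of_real:
  fixes p :: "complex poly"
  assumes "p \<in> upolys_over \<real>"
  shows "poly p (of_real t) = of_real (Re (poly p (of_real t)))"
  using poly_in_subring[OF subring_Reals assms, of "of_real t"] by simp

text \<open>
  At the two ends of a small interval around a simple root of \<open>q\<close>, a large multiple \<open>r q\<close> has opposite
  signs and dominates \<open>p\<close>. The intermediate value theorem applies to \<open>p - r q\<close>, which has no pole.
\<close>

lemma quotient_attains_large_values:
  fixes p q :: "complex poly"
  assumes p: "p \<in> upolys_over \<real>" and q: "q \<in> upolys_over \<real>"
    and \<xi>: "poly q (of_real \<xi>) = 0" "poly (pderiv q) (of_real \<xi>) \<noteq> 0" and \<epsilon>: "\<epsilon> > 0"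
  shows "\<exists>X. \<forall>r. X \<le> \<bar>r\<bar> \<longrightarrow> (\<exists>t. \<bar>t - \<xi>\<bar> \<le> \<epsilon> \<and> poly p (of_real t) = of_real r * poly q (of_real t))"
proof -
  have xR: "complex_of_real \<xi> \<in> \<real>" by simp
  define w where "w = synthetic_div q (of_real \<xi>)"
  have w: "w \<in> upolys_over \<real>" "q = [:- of_real \<xi>, 1:] * w"
    using linear_factor_over[OF subring_Reals q xR \<xi>(1)] by (simp_all add: w_def)
  have "poly (pderiv q) (of_real \<xi>) = poly w (of_real \<xi>)" unfolding w(2) pderiv_mult by (simp add: pderiv_pCons)
  then have w0: "poly w (of_real \<xi>) \<noteq> 0" using \<xi>(2) by simp
  define W where "W t = Re (poly w (of_real t))" for t
  define p' where "p' t = Re (poly p (of_real t))" for t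
  have pr: "poly p (of_real t) = of_real (p' t)" and wr: "poly w (of_real t) = of_real (W t)" for t
    using real_poly_of_real[OF p] real_poly_of_real[OF w(1)] by (simp_all add: p'_def W_def)
  have qr: "poly q (of_real t) = of_real ((t - \<xi>) * W t)" for t unfolding w(2) by (simp add: wr algebra_simps)
  have W\<xi>: "W \<xi> \<noteq> 0" using w0 wr by simp
  have contW: "isCont W t" and contp: "isCont p' t" for t
    unfolding W_def p'_def by (intro continuous_Re isCont_o2[OF _ poly_isCont] continuous_of_real continuous_ident)+
  have "\<forall>\<^sub>F t in at \<xi>. dist (W t) (W \<xi>) < \<bar>W \<xi>\<bar> / 2"
    using contW[of \<xi>] W\<xi> unfolding isCont_def by (intro tendstoD) auto
  then obtain \<delta>0 where \<delta>0: "\<delta>0 > 0" "\<And>t. t \<noteq> \<xi> \<Longrightarrow> dist t \<xi> < \<delta>0 \<Longrightarrow> dist (W t) (W \<xi>) < \<bar>W \<xi>\<bar> / 2"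
    unfolding eventually_at by blast
  define \<delta> where "\<delta> = min \<epsilon> (\<delta>0 / 2)"
  have \<delta>: "\<delta> > 0" "\<delta> \<le> \<epsilon>" "\<delta> < \<delta>0" using \<delta>0(1) \<epsilon> by (auto simp: \<delta>_def)
  have close: "\<bar>W (\<xi> + \<delta>) - W \<xi>\<bar> < \<bar>W \<xi>\<bar> / 2" "\<bar>W (\<xi> - \<delta>) - W \<xi>\<bar> < \<bar>W \<xi>\<bar> / 2"
    using \<delta>0(2)[of "\<xi> + \<delta>"] \<delta>0(2)[of "\<xi> - \<delta>"] \<delta> by (auto simp: dist_real_def)
  define m where "m = \<delta> * (\<bar>W \<xi>\<bar> / 2)"
  have m: "m > 0" using \<delta>(1) W\<xi> by (simp add: m_def)
  define Pm where "Pm = \<bar>p' (\<xi> + \<delta>)\<bar> + \<bar>p' (\<xi> - \<delta>)\<bar>"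
  define X where "X = (Pm + 1) / m"
  have "\<exists>t. \<bar>t - \<xi>\<bar> \<le> \<epsilon> \<and> poly p (of_real t) = of_real r * poly q (of_real t)" if r: "X \<le> \<bar>r\<bar>" for r
  proof -
    define g where "g t = p' t - r * ((t - \<xi>) * W t)" for t
    have contg: "\<forall>t. \<xi> - \<delta> \<le> t \<and> t \<le> \<xi> + \<delta> \<longrightarrow> isCont g t" unfolding g_def by (auto intro!: continuous_intros contW contp)
    have big: "Pm + 1 \<le> \<bar>r\<bar> * m" using r m by (simp add: X_def pos_divide_le_eq)
    have W_ge: "\<bar>W \<xi>\<bar> / 2 \<le> \<bar>W (\<xi> + \<delta>)\<bar>" "\<bar>W \<xi>\<bar> / 2 \<le> \<bar>W (\<xi> - \<delta>)\<bar>" using close by linarith+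
    have end1: "Pm + 1 \<le> \<bar>r * (\<delta> * W (\<xi> + \<delta>))\<bar>" "Pm + 1 \<le> \<bar>r * (\<delta> * W (\<xi> - \<delta>))\<bar>"
    proof -
      have "\<bar>r\<bar> * m \<le> \<bar>r\<bar> * (\<delta> * \<bar>W (\<xi> + \<delta>)\<bar>)" "\<bar>r\<bar> * m \<le> \<bar>r\<bar> * (\<delta> * \<bar>W (\<xi> - \<delta>)\<bar>)"
        unfolding m_def using W_ge less_imp_le[OF \<delta>(1)] abs_ge_zero[of r] by (blast intro: mult_left_mono)+
      then show "Pm + 1 \<le> \<bar>r * (\<delta> * W (\<xi> + \<delta>))\<bar>" "Pm + 1 \<le> \<bar>r * (\<delta> * W (\<xi> - \<delta>))\<bar>"
        using big \<delta>(1) by (simp_all add: abs_mult)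
    qed
    have same: "0 < W (\<xi> + \<delta>) \<longleftrightarrow> 0 < W (\<xi> - \<delta>)" using close W\<xi> by linarith
    have g1: "g (\<xi> + \<delta>) = p' (\<xi> + \<delta>) - r * (\<delta> * W (\<xi> + \<delta>))" and g2: "g (\<xi> - \<delta>) = p' (\<xi> - \<delta>) + r * (\<delta> * W (\<xi> - \<delta>))"
      by (simp_all add: g_def)
    have pos_iff: "0 < r * (\<delta> * W (\<xi> + \<delta>)) \<longleftrightarrow> 0 < r * (\<delta> * W (\<xi> - \<delta>))"
    proof -
      have "W (\<xi> + \<delta>) \<noteq> 0" "W (\<xi> - \<delta>) \<noteq> 0" using W_ge W\<xi> by auto
      then show ?thesis using same \<delta>(1) by (auto simp: zero_less_mult_iff mult_less_0_iff)
    qed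
    have "\<exists>t. \<xi> - \<delta> \<le> t \<and> t \<le> \<xi> + \<delta> \<and> g t = 0"
    proof (cases "0 < r * (\<delta> * W (\<xi> + \<delta>))")
      case True
      then have "g (\<xi> + \<delta>) \<le> 0" "0 \<le> g (\<xi> - \<delta>)" unfolding g1 g2 using end1 pos_iff by (auto simp: Pm_def)
      then show ?thesis using IVT2[of g "\<xi> + \<delta>" 0 "\<xi> - \<delta>"] contg \<delta>(1) by auto
    next
      case False
      then have "0 \<le> g (\<xi> + \<delta>)" "g (\<xi> - \<delta>) \<le> 0" unfolding g1 g2 using end1 pos_iff by (auto simp: Pm_def)
      then show ?thesis using IVT[of g "\<xi> - \<delta>" 0 "\<xi> + \<delta>"] contg \<delta>(1) by auto
    qed
    then obtain t where t: "\<xi> - \<delta> \<le> t" "t \<le> \<xi> + \<delta>" "g t = 0" by blast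
    then have "\<bar>t - \<xi>\<bar> \<le> \<epsilon>" using \<delta>(2) by linarith
    moreover have "poly p (of_real t) = of_real r * poly q (of_real t)"
      using t(3) unfolding pr qr g_def by (simp flip: of_real_mult)
    ultimately show ?thesis by blast
  qed
  then show ?thesis by blast
qed

section \<open>Asymptotic lines and the Hausdorff distance\<close>

text \<open>
  The lines pass through the origin, because a translation of an asymptotic line does not matter for
  bounded distance. A direction has first coordinate \<open>1\<close>, so that \<open>a $ 1\<close> is the parameter of the point
  of the line to compare \<open>a\<close> with.
\<close>

definition follows_lines :: "(real ^ 3) set \<Rightarrow> (real ^ 3) set \<Rightarrow> bool" where
  "follows_lines A S \<longleftrightarrow>
     (\<exists>M. \<forall>a\<in>A. norm a \<le> M \<or> (\<exists>v\<in>S. norm (a - (a $ 1) *\<^sub>R v) \<le> M)) \<and>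
     (\<exists>M X. \<forall>v\<in>S. \<forall>r. X \<le> \<bar>r\<bar> \<longrightarrow> (\<exists>a\<in>A. norm (a - r *\<^sub>R v) \<le> M))"

text \<open>
  A point of \<open>A\<close> far away is close to a point of a line, and this point is close to \<open>B\<close>. The remaining
  points of \<open>A\<close> are bounded.
\<close>

lemma infdist_bounded:
  assumes A: "follows_lines A S" and B: "follows_lines B S" "B \<noteq> {}" and S: "finite S"
  shows "\<exists>K. \<forall>a\<in>A. infdist a B \<le> K"
proof -
  obtain M1 where M1: "\<And>a. a \<in> A \<Longrightarrow> norm a \<le> M1 \<or> (\<exists>v\<in>S. norm (a - (a $ 1) *\<^sub>R v) \<le> M1)"
    using A unfolding follows_lines_def by blast
  obtain M2 X where M2: "\<And>v r. v \<in> S \<Longrightarrow> X \<le> \<bar>r\<bar> \<Longrightarrow> \<exists>b\<in>B. norm (b - r *\<^sub>R v) \<le> M2"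
    using B(1) unfolding follows_lines_def by blast
  obtain b0 where b0: "b0 \<in> B" using B(2) by blast
  define V where "V = (\<Sum>v\<in>S. norm v)"
  have V: "norm v \<le> V" if "v \<in> S" for v unfolding V_def using that S by (intro member_le_sum) auto
  define K where "K = \<bar>M1\<bar> + \<bar>M2\<bar> + \<bar>X\<bar> * V + norm b0"
  have V0: "V \<ge> 0" by (auto simp: V_def intro: sum_nonneg)
  then have XV: "\<bar>X\<bar> * V \<ge> 0" by simp
  have "infdist a B \<le> K" if a: "a \<in> A" for a
  proof -
    have near0: "infdist a B \<le> norm a + norm b0"
      using infdist_le[OF b0, of a] norm_triangle_ineq4[of a b0] by (simp add: dist_norm)
    consider "norm a \<le> M1" | v where "v \<in> S" "norm (a - (a $ 1) *\<^sub>R v) \<le> M1" using M1[OF a] by blast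
    then show ?thesis
    proof cases
      case 1
      then show ?thesis using near0 XV by (simp add: K_def)
    next
      case 2
      show ?thesis
      proof (cases "X \<le> \<bar>a $ 1\<bar>")
        case True
        obtain b where b: "b \<in> B" "norm (b - (a $ 1) *\<^sub>R v) \<le> M2" using M2[OF 2(1) True] by blast
        have "dist a b \<le> norm (a - (a $ 1) *\<^sub>R v) + norm (b - (a $ 1) *\<^sub>R v)"
          using norm_triangle_ineq4[of "a - (a $ 1) *\<^sub>R v" "b - (a $ 1) *\<^sub>R v"] by (simp add: dist_norm)
        then show ?thesis unfolding K_def
          using infdist_le[OF b(1), of a] b(2) 2(2) XV norm_ge_zero[of b0] by linarith
      next
        case False
        have "norm a \<le> norm (a - (a $ 1) *\<^sub>R v) + norm ((a $ 1) *\<^sub>R v)"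
          using norm_triangle_ineq[of "a - (a $ 1) *\<^sub>R v" "(a $ 1) *\<^sub>R v"] by simp
        also have "norm ((a $ 1) *\<^sub>R v) \<le> \<bar>X\<bar> * V"
          unfolding norm_scaleR using False V[OF 2(1)] by (intro mult_mono) auto
        finally show ?thesis using 2(2) near0 by (simp add: K_def)
      qed
    qed
  qed
  then show ?thesis by blast
qed

lemma hausdorff_dist_finite:
  assumes "follows_lines A S" "follows_lines B S" "A \<noteq> {}" "B \<noteq> {}" "finite S"
  shows "hausdorff_dist A B < \<infinity>"
proof -
  obtain K1 K2 where K: "\<forall>a\<in>A. infdist a B \<le> K1" "\<forall>b\<in>B. infdist b A \<le> K2"
    using infdist_bounded[of A S B] infdist_bounded[of B S A] assms by blast
  have "(SUP a\<in>A. ereal (infdist a B)) \<le> ereal K1" "(SUP b\<in>B. ereal (infdist b A)) \<le> ereal K2"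
    using K by (auto intro!: SUP_least)
  then have "max (SUP a\<in>A. ereal (infdist a B)) (SUP b\<in>B. ereal (infdist b A)) \<le> max (ereal K1) (ereal K2)"
    by (rule max.mono)
  also have "\<dots> < \<infinity>" by (simp add: max_def)
  finally show ?thesis using assms(3,4) unfolding hausdorff_dist_def by auto
qed

section \<open>Space curves and their directions at infinity\<close>

definition point3 :: "complex \<Rightarrow> complex \<Rightarrow> complex \<Rightarrow> 3 \<Rightarrow> complex" where
  "point3 x y z = (\<lambda>i. if i = 1 then x else if i = 2 then y else z)"

lemma point3_simps [simp]: "point3 x y z 1 = x" "point3 x y z 2 = y" "point3 x y z 3 = z"
  by (simp_all add: point3_def)

lemma fun_eq_point3: "v = point3 (v 1) (v 2) (v 3)"
proof
  fix i :: 3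
  show "v i = point3 (v 1) (v 2) (v 3) i" using exhaust_3[of i] by auto
qed

lemma vector_point3 [simp]: "($) (vector [x, y, z] :: complex ^ 3) = point3 x y z"
  by (subst fun_eq_point3) simp

lemma lookup_map_cnj: "Poly_Mapping.lookup (Poly_Mapping.map cnj P) m = cnj (Poly_Mapping.lookup P m)"
  by (simp add: Poly_Mapping.map.rep_eq when_def)

lemma keys_map_cnj: "Poly_Mapping.keys (Poly_Mapping.map cnj P) = Poly_Mapping.keys P"
  by (auto simp: in_keys_iff lookup_map_cnj)

lemma hom_at_map_cnj: "hom_at k (Poly_Mapping.map cnj P) (\<lambda>i. cnj (v i)) (cnj w) = cnj (hom_at k P v w)"
  by (simp add: hom_at_def keys_map_cnj lookup_map_cnj monom_eval_def)

lemma mpoly_eval_map_cnj: "mpoly_eval (Poly_Mapping.map cnj P) (\<lambda>i. cnj (v i)) = cnj (mpoly_eval P v)"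
  using hom_at_map_cnj[of 0 P v 1] by (simp add: mpoly_eval_hom_at[of _ _ 0])

lemma polyfun_ev: "subring_set A \<Longrightarrow> g \<in> bipolys A \<Longrightarrow> polyfun A (\<lambda>x. ev g (x a) (x b))"
  using polyfun_mpoly_eval[OF to_mpoly_over[of A g a b]] unfolding polyfun_def mpoly_eval_to_mpoly by simp

text \<open>
  Polynomials in \<open>x, y\<close> as polynomials in \<open>x, y, z\<close>: the pullback along \<open>\<pi>\<^sub>z\<close>.
\<close>

definition embed :: "2 cmpoly \<Rightarrow> 3 cmpoly" where
  "embed P = (\<Sum>m\<in>Poly_Mapping.keys P. Poly_Mapping.single
     (Poly_Mapping.single 1 (Poly_Mapping.lookup m 1) + Poly_Mapping.single 2 (Poly_Mapping.lookup m 2)) (Poly_Mapping.lookup P m))"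

lemma hom_at_embed: "hom_at k (embed P) (point3 x y z) w = hom_at k P (($) (vector [x, y] :: complex ^ 2)) w"
  by (simp add: embed_def hom_at_sum hom_at_single monom_eval_add monom_deg_add
      hom_at_def[of k P] monom_eval_2 monom_deg_2)

lemma tdeg_embed_le: "tdeg (embed P) \<le> tdeg P"
proof (rule tdeg_leI)
  fix e assume "e \<in> Poly_Mapping.keys (embed P)"
  then have "(\<Sum>m\<in>Poly_Mapping.keys P. Poly_Mapping.lookup (Poly_Mapping.single
     (Poly_Mapping.single 1 (Poly_Mapping.lookup m 1) + Poly_Mapping.single 2 (Poly_Mapping.lookup m 2)) (Poly_Mapping.lookup P m)) e) \<noteq> 0"
    by (simp add: embed_def in_keys_iff lookup_sum_apply)
  then obtain m where m: "m \<in> Poly_Mapping.keys P" "Poly_Mapping.lookup (Poly_Mapping.single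
     (Poly_Mapping.single 1 (Poly_Mapping.lookup m 1) + Poly_Mapping.single 2 (Poly_Mapping.lookup m 2)) (Poly_Mapping.lookup P m)) e \<noteq> 0"
    by (rule sum.not_neutral_contains_not_neutral)
  then have "e = Poly_Mapping.single 1 (Poly_Mapping.lookup m 1) + Poly_Mapping.single 2 (Poly_Mapping.lookup m 2)"
    by (auto simp: lookup_single when_def split: if_splits)
  then show "monom_deg e \<le> tdeg P" using monom_deg_le_tdeg[OF m(1)] by (simp add: monom_deg_add monom_deg_2)
qed

lemma hom_at_eq_0_of_hom_eval:
  assumes "tdeg P \<le> k" "hom_eval P v 0 = 0"
  shows "hom_at k P v 0 = 0"
  using assms hom_at_above_tdeg[of P k v] by (cases "tdeg P = k") (auto simp: hom_eval_hom_at)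

locale space_curve =
  fixes K \<FF> :: "complex set" and S :: "3 cmpoly set" and C :: "(complex ^ 3) set"
  assumes K: "is_subfield K" "K \<subseteq> \<real>" and F_def: "\<FF> = alg_closure K"
    and S: "S \<subseteq> mpolys_over K" and C_def: "C = zero_set \<FF> S" and irred: "zariski_irreducible \<FF> C"
begin

lemma F: "root_closed_subfield \<FF>"
  unfolding F_def using K(1) by (rule root_closed_alg_closure)

lemma A: "subring_set \<FF>" using F by (rule root_closed_subring)

lemma K_sub: "K \<subseteq> \<FF>" unfolding F_def using K(1) by (rule alg_closure_superset)

lemma F_cnj: "z \<in> \<FF> \<Longrightarrow> cnj z \<in> \<FF>" unfolding F_def using K(2) by (rule alg_closure_cnj)

lemma S_F: "S \<subseteq> mpolys_over \<FF>" using S K_sub by (auto simp: mpolys_over_def)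

lemma C_affine: "C \<subseteq> affine_space \<FF>" unfolding C_def zero_set_def by auto

lemma C_coord: "v \<in> C \<Longrightarrow> v $ i \<in> \<FF>" using C_affine by (auto simp: affine_space_def)

lemma C_nonempty: "C \<noteq> {}" using irred unfolding zariski_irreducible_def by blast

text \<open>
  The points of the curve with arbitrary complex coordinates; the real part of the curve consists of
  such points.
\<close>

definition complex_pt :: "(3 \<Rightarrow> complex) \<Rightarrow> bool" where
  "complex_pt a \<longleftrightarrow> (\<forall>P\<in>S. mpoly_eval P a = 0)"

lemma complex_pt_C: "v \<in> C \<Longrightarrow> complex_pt (($) v)"
  unfolding C_def complex_pt_def zero_set_def by simp

text \<open>
  A complex point where \<open>g\<close> does not vanish could be specialized to an \<open>\<FF>\<close>-point of \<open>C\<close> with the same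
  property.
\<close>

lemma vanishes_at_complex_pt:
  assumes "polyfun \<FF> g" "\<And>v. v \<in> C \<Longrightarrow> g (($) v) = 0" "complex_pt a"
  shows "g a = 0"
proof (rule ccontr)
  assume "g a \<noteq> 0"
  moreover obtain G where G: "G \<in> mpolys_over \<FF>" "\<And>x. mpoly_eval G x = g x" using assms(1) unfolding polyfun_def by blast
  ultimately obtain b where b: "\<forall>i. b i \<in> \<FF>" "g b \<noteq> 0" "\<forall>P\<in>mpolys_over \<FF>. mpoly_eval P a = 0 \<longrightarrow> mpoly_eval P b = 0"
    using specialization[OF F G(1), of a] by auto
  have vb: "($) (\<chi> i. b i) = b" by (simp add: fun_eq_iff)
  have "(\<chi> i. b i) \<in> C"
    unfolding C_def zero_set_def using b(1,3) assms(3) S_F vb by (auto simp: affine_space_def complex_pt_def)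
  then show False using assms(2)[of "\<chi> i. b i"] b(2) vb by simp
qed

lemma C_prime:
  assumes "polyfun \<FF> g" "polyfun \<FF> h" "\<And>v. v \<in> C \<Longrightarrow> g (($) v) * h (($) v) = 0"
  shows "(\<forall>v\<in>C. g (($) v) = 0) \<or> (\<forall>v\<in>C. h (($) v) = 0)"
proof -
  obtain G H where G: "G \<in> mpolys_over \<FF>" "\<And>x. mpoly_eval G x = g x" and H: "H \<in> mpolys_over \<FF>" "\<And>x. mpoly_eval H x = h x"
    using assms(1,2) unfolding polyfun_def by blast
  define V1 V2 where "V1 = zero_set \<FF> (Set.insert G S)" and "V2 = zero_set \<FF> (Set.insert H S)"
  have V1: "V1 = {v\<in>C. g (($) v) = 0}" and V2: "V2 = {v\<in>C. h (($) v) = 0}"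
    unfolding V1_def V2_def C_def zero_set_def using G(2) H(2) by auto
  have "zariski_closed \<FF> V1" "zariski_closed \<FF> V2"
    unfolding zariski_closed_def V1_def V2_def using G(1) H(1) S_F by blast+
  moreover have "C = V1 \<union> V2" unfolding V1 V2 using assms(3) by auto
  ultimately have "C = V1 \<or> C = V2" using irred unfolding zariski_irreducible_def by blast
  then show ?thesis unfolding V1 V2 by blast
qed

lemma real_coeffs: "P \<in> S \<Longrightarrow> Poly_Mapping.map cnj P = P"
proof (rule poly_mapping_eqI)
  fix m assume "P \<in> S"
  then have "Poly_Mapping.lookup P m \<in> \<real>" using S K(2) by (auto simp: mpolys_over_def)
  then show "Poly_Mapping.lookup (Poly_Mapping.map cnj P) m = Poly_Mapping.lookup P m"
    by (simp add: lookup_map_cnj Reals_cnj_iff)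
qed

lemma complex_pt_cnj: "complex_pt a \<Longrightarrow> complex_pt (\<lambda>i. cnj (a i))"
  unfolding complex_pt_def using mpoly_eval_map_cnj[of _ a] real_coeffs by (metis complex_cnj_zero)

text \<open>
  The points at infinity outside the plane \<open>x = 0\<close>, normalized by \<open>x = 1\<close>.
\<close>

definition dirs :: "(complex \<times> complex) set" where
  "dirs = {(l, m). l \<in> \<FF> \<and> m \<in> \<FF> \<and> proj_pt \<FF> (vector [1, l, m]) 0 \<in> pts_at_infinity \<FF> C}"

lemma affine_point: "l \<in> \<FF> \<Longrightarrow> m \<in> \<FF> \<Longrightarrow> (vector [1, l, m] :: complex ^ 3) \<in> affine_space \<FF> \<and> (vector [1, l, m] :: complex ^ 3) \<noteq> 0"
proof -
  assume lm: "l \<in> \<FF>" "m \<in> \<FF>"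
  have "(vector [1, l, m] :: complex ^ 3) $ 1 \<noteq> 0 $ 1" by simp
  then have "(vector [1, l, m] :: complex ^ 3) \<noteq> 0" by metis
  then show ?thesis using lm subring_setD(2)[OF A] by (auto simp: affine_space_def forall_3)
qed

lemma dirs_iff:
  "(l, m) \<in> dirs \<longleftrightarrow> l \<in> \<FF> \<and> m \<in> \<FF> \<and> (\<forall>P\<in>vanishing_ideal \<FF> C. hom_eval P (point3 1 l m) 0 = 0)"
proof (cases "l \<in> \<FF> \<and> m \<in> \<FF>")
  case True
  then show ?thesis
    using pts_at_infinity_iff[OF A, of "vector [1, l, m]" C] affine_point[of l m]
    by (simp add: dirs_def vanishing_ideal_closure[OF C_affine])
qed (auto simp: dirs_def)

lemma dirs_cnj: "(l, m) \<in> dirs \<Longrightarrow> (cnj l, cnj m) \<in> dirs"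
proof -
  assume lm: "(l, m) \<in> dirs"
  have "hom_eval P (point3 1 (cnj l) (cnj m)) 0 = 0" if P: "P \<in> vanishing_ideal \<FF> C" for P
  proof -
    define Q where "Q = Poly_Mapping.map cnj P"
    have QP: "Poly_Mapping.map cnj Q = P" by (rule poly_mapping_eqI) (simp add: Q_def lookup_map_cnj)
    have t: "tdeg P = tdeg Q" by (simp add: tdeg_def Q_def keys_map_cnj)
    have "mpoly_eval Q (($) v) = 0" if v: "v \<in> C" for v
    proof -
      have vb: "($) (\<chi> i. cnj (v $ i)) = (\<lambda>i. cnj (v $ i))" by (simp add: fun_eq_iff)
      have "(\<chi> i. cnj (v $ i)) \<in> C"
        using complex_pt_cnj[OF complex_pt_C[OF v]] C_coord[OF v] F_cnj S_F
        by (auto simp: C_def zero_set_def affine_space_def complex_pt_def vb)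
      then have "mpoly_eval P (($) (\<chi> i. cnj (v $ i))) = 0" using P by (auto simp: vanishing_ideal_def)
      then have "mpoly_eval P (\<lambda>i. cnj (v $ i)) = 0" by (simp only: vb)
      then show ?thesis using mpoly_eval_map_cnj[of Q "($) v"] QP by simp
    qed
    moreover have "Q \<in> mpolys_over \<FF>"
      using P F_cnj by (auto simp: Q_def mpolys_over_def lookup_map_cnj vanishing_ideal_def)
    ultimately have "hom_eval Q (point3 1 l m) 0 = 0" using lm by (auto simp: dirs_iff vanishing_ideal_def)
    moreover have "(\<lambda>i. cnj (point3 1 l m i)) = point3 1 (cnj l) (cnj m)" by (auto simp: point3_def fun_eq_iff)
    ultimately show ?thesis
      using hom_at_map_cnj[of "tdeg Q" Q "point3 1 l m" 0] by (simp add: hom_eval_hom_at t QP)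
  qed
  then show ?thesis using lm F_cnj by (auto simp: dirs_iff)
qed

end

lemma vector2_nonzero: "(vector [1, l] :: complex ^ 2) \<noteq> 0"
proof -
  have "(vector [1, l] :: complex ^ 2) $ 1 \<noteq> 0 $ 1" by simp
  then show ?thesis by metis
qed

section \<open>The curve and its rational plane companion\<close>

text \<open>
  The hypotheses of the theorem, with all degrees and numbers of points expressed by \<open>deg q\<close>. The
  companion curve is represented by its parametrization, which attains all points at infinity of the
  projection of \<open>C\<close>.
\<close>

locale companion_data = space_curve K \<FF> S C for K \<FF> S C +
  fixes F1 :: "3 cmpoly" and p1 p2 q :: "complex poly"
  assumes nonplanar: "\<not> planar \<FF> C"
    and fin_inf: "finite (pts_at_infinity \<FF> C)"
    and card_inf: "card (pts_at_infinity \<FF> C) = degree q"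
    and birat: "birational_onto \<FF> \<pi>\<^sub>z C (zariski_closure \<FF> (\<pi>\<^sub>z ` C))"
    and deg_C: "curve_degree \<FF> C = degree q"
    and deg_W: "curve_degree \<FF> (zariski_closure \<FF> (\<pi>\<^sub>z ` C)) = degree q"
    and iii1: "\<And>l. l \<in> \<FF> \<Longrightarrow> proj_pt \<FF> (vector [1, 0, l]) 0 \<notin> pts_at_infinity \<FF> C"
    and iii2: "\<And>l. l \<in> \<FF> \<Longrightarrow> proj_pt \<FF> (vector [0, 1, l]) 0 \<notin> pts_at_infinity \<FF> C"
    and iii3: "proj_pt \<FF> (vector [0, 0, 1]) 0 \<notin> pts_at_infinity \<FF> C"
    and iv: "\<And>l m m'. (l, m) \<in> dirs \<Longrightarrow> (l, m') \<in> dirs \<Longrightarrow> m = m'"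
    and F1: "F1 \<in> S" "\<exists>c. c \<noteq> 0 \<and> (\<forall>e. Poly_Mapping.lookup e 3 = tdeg F1 \<longrightarrow>
      Poly_Mapping.lookup F1 e = (if e = Poly_Mapping.single 3 (tdeg F1) then c else 0))"
    and pq: "p1 \<in> upolys_over K" "p2 \<in> upolys_over K" "q \<in> upolys_over K"
    and q0: "q \<noteq> 0"
    and deg_p: "degree p1 \<le> degree q" "degree p2 \<le> degree q"
    and attained: "\<And>X. X \<in> pts_at_infinity \<FF> (\<pi>\<^sub>z ` C) \<Longrightarrow> \<exists>t\<in>\<FF>.
      X = proj_pt \<FF> (vector [poly p1 t, poly p2 t]) (poly q t)"
begin

abbreviation "N \<equiv> degree q"

definition slope :: "complex \<Rightarrow> complex" where "slope t = poly p2 t / poly p1 t"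

text \<open>
  The excluded points at infinity imply that all others have non-zero first coordinate.
\<close>

lemma dirs_bij: "bij_betw (\<lambda>(l, m). proj_pt \<FF> (vector [1, l, m]) 0) dirs (pts_at_infinity \<FF> C)"
  unfolding bij_betw_def
proof
  show "inj_on (\<lambda>(l, m). proj_pt \<FF> (vector [1, l, m] :: complex ^ 3) (0 :: complex)) dirs"
  proof (rule inj_onI, clarify)
    fix l m l' m'
    assume "proj_pt \<FF> (vector [1, l, m]) 0 = proj_pt \<FF> (vector [1, l', m'] :: complex ^ 3) 0"
    then obtain c where c: "(vector [1, l', m'] :: complex ^ 3) = c *s vector [1, l, m]"
      using proj_pt_eqD[OF subring_setD(2)[OF A]] by blast
    show "l = l' \<and> m = m'"
      using arg_cong[OF c, of "\<lambda>v. v $ 1"] arg_cong[OF c, of "\<lambda>v. v $ 2"] arg_cong[OF c, of "\<lambda>v. v $ 3"] by simp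
  qed
  show "(\<lambda>(l, m). proj_pt \<FF> (vector [1, l, m]) 0) ` dirs = pts_at_infinity \<FF> C"
  proof (intro equalityI subsetI)
    fix X assume X: "X \<in> pts_at_infinity \<FF> C"
    then obtain v where v: "v \<in> affine_space \<FF>" "v \<noteq> 0" "X = proj_pt \<FF> v 0" using pts_at_infinity_cases[OF A] by blast
    have vF: "v $ i \<in> \<FF>" for i using v(1) by (auto simp: affine_space_def)
    have v_eq: "v = vector [v $ 1, v $ 2, v $ 3]" by (simp add: Finite_Cartesian_Product.vec_eq_iff forall_3)
    have scale: "X = proj_pt \<FF> w 0" if "c \<in> \<FF>" "c \<noteq> 0" "v = c *s w" for c w
      using proj_pt_scale[OF F that(1,2), of w 0] that(3) v(3) by simp
    have div: "v $ i / v $ j \<in> \<FF>" for i j using root_closed_divide[OF F vF vF] .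
    have v1: "v $ 1 \<noteq> 0"
    proof
      assume z: "v $ 1 = 0"
      show False
      proof (cases "v $ 2 = 0")
        case True
        then have "v $ 3 \<noteq> 0" using v(2) z by (auto simp: Finite_Cartesian_Product.vec_eq_iff forall_3)
        moreover from this have "v = (v $ 3) *s vector [0, 0, 1]"
          using z True by (simp add: Finite_Cartesian_Product.vec_eq_iff forall_3)
        ultimately show False using scale[of "v $ 3"] vF iii3 X by metis
      next
        case False
        then have "v = (v $ 2) *s vector [0, 1, v $ 3 / v $ 2]"
          using z by (simp add: Finite_Cartesian_Product.vec_eq_iff forall_3)
        then show False using scale[of "v $ 2"] vF iii2[OF div] X False by metis
      qed
    qed
    then have "v = (v $ 1) *s vector [1, v $ 2 / v $ 1, v $ 3 / v $ 1]"
      by (simp add: Finite_Cartesian_Product.vec_eq_iff forall_3)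
    then have "X = proj_pt \<FF> (vector [1, v $ 2 / v $ 1, v $ 3 / v $ 1]) 0" using scale vF v1 by blast
    moreover from this have "(v $ 2 / v $ 1, v $ 3 / v $ 1) \<in> dirs" using X div by (simp add: dirs_def)
    ultimately show "X \<in> (\<lambda>(l, m). proj_pt \<FF> (vector [1, l, m]) 0) ` dirs" by force
  qed (auto simp: dirs_def)
qed

lemma dirs_card: "finite dirs" "card dirs = N"
  using bij_betw_finite[OF dirs_bij] bij_betw_same_card[OF dirs_bij] fin_inf card_inf by simp_all

lemma B_affine: "\<pi>\<^sub>z ` C \<subseteq> affine_space \<FF>"
  using C_coord by (auto simp: \<pi>\<^sub>z_def affine_space_def forall_2)

lemma embed_ideal:
  assumes "P \<in> vanishing_ideal \<FF> (\<pi>\<^sub>z ` C)"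
  shows "embed P \<in> vanishing_ideal \<FF> C"
proof -
  have "embed P \<in> mpolys_over \<FF>"
    unfolding embed_def using A assms
    by (intro mpolys_over_sum mpolys_over_single) (auto simp: vanishing_ideal_def mpolys_over_def)
  moreover have "mpoly_eval (embed P) (($) v) = 0" if "v \<in> C" for v
  proof -
    have "mpoly_eval (embed P) (point3 (v $ 1) (v $ 2) (v $ 3)) = mpoly_eval P (($) (\<pi>\<^sub>z v))"
      using hom_at_embed[of 0 P "v $ 1" "v $ 2" "v $ 3" 1] by (simp add: mpoly_eval_hom_at[of _ _ 0] \<pi>\<^sub>z_def)
    then show ?thesis using assms that fun_eq_point3[of "($) v"] by (auto simp: vanishing_ideal_def)
  qed
  ultimately show ?thesis by (simp add: vanishing_ideal_def)
qed

lemma dirs_project: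
  assumes "(l, m) \<in> dirs"
  shows "proj_pt \<FF> (vector [1, l]) 0 \<in> pts_at_infinity \<FF> (\<pi>\<^sub>z ` C)"
proof -
  have l: "l \<in> \<FF>" using assms by (auto simp: dirs_def)
  have aff: "(vector [1, l] :: complex ^ 2) \<in> affine_space \<FF>" using l subring_setD(2)[OF A] by (simp add: affine_space_def forall_2)
  have "hom_eval P (($) (vector [1, l] :: complex ^ 2)) 0 = 0" if "P \<in> vanishing_ideal \<FF> (\<pi>\<^sub>z ` C)" for P
  proof -
    have "hom_eval (embed P) (point3 1 l m) 0 = 0" using embed_ideal[OF that] assms by (simp add: dirs_iff)
    then have "hom_at (tdeg P) (embed P) (point3 1 l m) 0 = 0" using tdeg_embed_le by (intro hom_at_eq_0_of_hom_eval)
    then show ?thesis by (simp add: hom_at_embed hom_eval_hom_at)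
  qed
  then show ?thesis
    using pts_at_infinity_iff[OF A aff vector2_nonzero, of "\<pi>\<^sub>z ` C"] vanishing_ideal_closure[OF B_affine] by simp
qed

lemma pq_F: "p1 \<in> upolys_over \<FF>" "p2 \<in> upolys_over \<FF>" "q \<in> upolys_over \<FF>"
  using pq K_sub by (auto simp: upolys_over_def)

lemma roots_F: "poly q t = 0 \<Longrightarrow> t \<in> \<FF>"
  using root_closed_root[OF F pq_F(3) q0] .

text \<open>
  Counting: the directions of \<open>C\<close> inject into the points at infinity of the projection, these are
  all attained at roots of \<open>q\<close>, and there are at most \<open>deg q\<close> roots. So all three sets have
  \<open>deg q\<close> elements.
\<close>

lemma infinity_count:
  defines "\<psi> \<equiv> \<lambda>t. proj_pt \<FF> (vector [poly p1 t, poly p2 t]) (0::complex)"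
  shows "finite {t. poly q t = 0}" "card {t. poly q t = 0} = N" "inj_on \<psi> {t. poly q t = 0}"
    "\<psi> ` {t. poly q t = 0} = pts_at_infinity \<FF> (\<pi>\<^sub>z ` C)"
    "pts_at_infinity \<FF> (\<pi>\<^sub>z ` C) = (\<lambda>(l, m). proj_pt \<FF> (vector [1, l]) 0) ` dirs"
proof -
  let ?R = "{t. poly q t = 0}" and ?W = "pts_at_infinity \<FF> (\<pi>\<^sub>z ` C)"
  let ?g = "\<lambda>(l, m). proj_pt \<FF> (vector [1, l] :: complex ^ 2) (0::complex)"
  show finR: "finite ?R" using poly_roots_finite[OF q0] .
  have "?W \<subseteq> \<psi> ` ?R"
  proof
    fix X assume X: "X \<in> ?W"
    obtain t where t: "t \<in> \<FF>" "X = proj_pt \<FF> (vector [poly p1 t, poly p2 t]) (poly q t)" using attained[OF X] by blast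
    obtain v where "X = proj_pt \<FF> v 0" using pts_at_infinity_cases[OF A X] by blast
    then obtain c where "poly q t = c * 0" using proj_pt_eqD[OF subring_setD(2)[OF A], of v 0] t(2) by metis
    then show "X \<in> \<psi> ` ?R" using t by (auto simp: \<psi>_def)
  qed
  moreover have gW: "?g ` dirs \<subseteq> ?W" using dirs_project by auto
  moreover have "inj_on ?g dirs"
  proof (rule inj_onI, clarify)
    fix l m l' m' assume lm: "(l, m) \<in> dirs" "(l', m') \<in> dirs"
      and "proj_pt \<FF> (vector [1, l]) 0 = proj_pt \<FF> (vector [1, l'] :: complex ^ 2) 0"
    then obtain c where c: "(vector [1, l'] :: complex ^ 2) = c *s vector [1, l]"
      using proj_pt_eqD[OF subring_setD(2)[OF A]] by blast
    have "l = l'" using arg_cong[OF c, of "\<lambda>v. v $ 1"] arg_cong[OF c, of "\<lambda>v. v $ 2"] by simp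
    then show "l = l' \<and> m = m'" using iv lm by blast
  qed
  then have cg: "card (?g ` dirs) = N" using dirs_card by (simp add: card_image)
  moreover have cR: "card ?R \<le> N" using card_poly_roots_bound[OF q0] .
  moreover have cim: "card (\<psi> ` ?R) \<le> card ?R" using finR by (rule card_image_le)
  moreover have fW: "finite ?W" using calculation(1) finR finite_subset by blast
  moreover have "card ?W \<le> card (\<psi> ` ?R)" using calculation(1) finR by (intro card_mono) auto
  moreover have "card (?g ` dirs) \<le> card ?W" using gW fW by (intro card_mono)
  ultimately have eq: "card ?R = N" "card (\<psi> ` ?R) = card ?R" "card ?W = card (\<psi> ` ?R)" "card (?g ` dirs) = card ?W" by linarith+
  show "card ?R = N" by (rule eq(1))
  show "inj_on \<psi> ?R" using finR eq(2) by (rule eq_card_imp_inj_on)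
  show "\<psi> ` ?R = ?W" using card_subset_eq[OF _ \<open>?W \<subseteq> \<psi> ` ?R\<close> eq(3)] finR by simp
  show "?W = ?g ` dirs" using card_subset_eq[OF fW gW eq(4)] by simp
qed

lemma root_direction:
  assumes "poly q t = 0"
  shows "poly p1 t \<noteq> 0" "\<exists>m. (slope t, m) \<in> dirs"
proof -
  have "proj_pt \<FF> (vector [poly p1 t, poly p2 t]) 0 \<in> (\<lambda>(l, m). proj_pt \<FF> (vector [1, l] :: complex ^ 2) (0::complex)) ` dirs"
    using infinity_count(4,5) assms by blast
  then obtain l m where lm: "(l, m) \<in> dirs"
    and eq: "proj_pt \<FF> (vector [1, l]) 0 = proj_pt \<FF> (vector [poly p1 t, poly p2 t] :: complex ^ 2) 0" by auto
  obtain c where c: "c \<noteq> 0" "(vector [poly p1 t, poly p2 t] :: complex ^ 2) = c *s vector [1, l]"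
    using proj_pt_eqD[OF subring_setD(2)[OF A] eq] by blast
  have c1: "poly p1 t = c" "poly p2 t = c * l"
    using arg_cong[OF c(2), of "\<lambda>v. v $ 1"] arg_cong[OF c(2), of "\<lambda>v. v $ 2"] by simp_all
  then show "poly p1 t \<noteq> 0" using c(1) by simp
  have "slope t = l" using c1 c(1) by (simp add: slope_def)
  then show "\<exists>m. (slope t, m) \<in> dirs" using lm by blast
qed

lemma proj_pt_slope:
  assumes "poly q t = 0"
  shows "proj_pt \<FF> (vector [poly p1 t, poly p2 t]) 0 = proj_pt \<FF> (vector [1, slope t] :: complex ^ 2) 0"
proof -
  have p1: "poly p1 t \<noteq> 0" "poly p1 t \<in> \<FF>"
    using root_direction(1)[OF assms] poly_in_subring[OF A pq_F(1) roots_F[OF assms]] by auto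
  have "(vector [poly p1 t, poly p2 t] :: complex ^ 2) = poly p1 t *s vector [1, slope t]"
    using p1(1) by (simp add: Finite_Cartesian_Product.vec_eq_iff forall_2 slope_def)
  then show ?thesis using proj_pt_scale[OF F p1(2,1), of "vector [1, slope t]" 0] by simp
qed

lemma slope_inj:
  assumes "poly q t = 0" "poly q t' = 0" "slope t = slope t'"
  shows "t = t'"
  using inj_onD[OF infinity_count(3), of t t'] assms proj_pt_slope by simp

lemma direction_root:
  assumes "(l, m) \<in> dirs"
  shows "\<exists>t. poly q t = 0 \<and> slope t = l"
proof -
  have "proj_pt \<FF> (vector [1, l]) 0 \<in> (\<lambda>t. proj_pt \<FF> (vector [poly p1 t, poly p2 t] :: complex ^ 2) (0::complex)) ` {t. poly q t = 0}"
    unfolding infinity_count(4,5) using assms by force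
  then obtain t where t: "poly q t = 0"
    "proj_pt \<FF> (vector [1, l] :: complex ^ 2) 0 = proj_pt \<FF> (vector [1, slope t]) 0" using proj_pt_slope by auto
  then obtain c where c: "(vector [1, slope t] :: complex ^ 2) = c *s vector [1, l]"
    using proj_pt_eqD[OF subring_setD(2)[OF A]] by blast
  have "slope t = l" using arg_cong[OF c, of "\<lambda>v. v $ 1"] arg_cong[OF c, of "\<lambda>v. v $ 2"] by simp
  then show ?thesis using t by blast
qed

definition Z :: "(complex \<times> complex) set" where "Z = (\<lambda>v. (v $ 1, v $ 2)) ` C"

lemma vanishes_on_Z: "vanishes_on g Z \<longleftrightarrow> (\<forall>v\<in>C. ev g (v $ 1) (v $ 2) = 0)"
  by (auto simp: vanishes_on_def Z_def)

lemma Z_prime: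
  assumes "g \<in> bipolys \<FF>" "h \<in> bipolys \<FF>" "vanishes_on (g * h) Z"
  shows "vanishes_on g Z \<or> vanishes_on h Z"
  using C_prime[OF polyfun_ev[OF A assms(1), of 1 2] polyfun_ev[OF A assms(2), of 1 2]] assms(3)
  by (simp add: vanishes_on_Z)

text \<open>
  The projection avoids \<open>(0 : 1 : 0)\<close> at infinity, because its points at infinity come from those of \<open>C\<close>,
  and it is not a vertical line, because \<open>C\<close> is not planar.
\<close>

lemma plane_equation_Z: "\<exists>f. plane_equation \<FF> Z f"
proof -
  have aff: "(vector [0, 1] :: complex ^ 2) \<in> affine_space \<FF>" using subring_setD(1,2)[OF A] by (simp add: affine_space_def forall_2)
  have "(vector [0, 1] :: complex ^ 2) $ 2 \<noteq> 0 $ 2" by simp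
  then have nz: "(vector [0, 1] :: complex ^ 2) \<noteq> 0" by metis
  have "proj_pt \<FF> (vector [0, 1]) 0 \<notin> pts_at_infinity \<FF> (\<pi>\<^sub>z ` C)"
  proof
    assume "proj_pt \<FF> (vector [0, 1]) 0 \<in> pts_at_infinity \<FF> (\<pi>\<^sub>z ` C)"
    then obtain l m where "proj_pt \<FF> (vector [0, 1]) 0 = proj_pt \<FF> (vector [1, l] :: complex ^ 2) 0"
      unfolding infinity_count(5) by auto
    then obtain c where c: "(vector [1, l] :: complex ^ 2) = c *s vector [0, 1]"
      using proj_pt_eqD[OF subring_setD(2)[OF A]] by blast
    show False using arg_cong[OF c, of "\<lambda>v. v $ 1"] by simp
  qed
  then obtain P where P: "P \<in> vanishing_ideal \<FF> (\<pi>\<^sub>z ` C)" "hom_eval P (($) (vector [0, 1] :: complex ^ 2)) 0 \<noteq> 0"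
    using pts_at_infinity_iff[OF A aff nz, of "\<pi>\<^sub>z ` C"] vanishing_ideal_closure[OF B_affine] by auto
  have "ev (of_mpoly P) (v $ 1) (v $ 2) = 0" if "v \<in> C" for v
  proof -
    have "mpoly_eval P (($) (\<pi>\<^sub>z v)) = 0" using P(1) that by (auto simp: vanishing_ideal_def)
    then show ?thesis using ev_of_mpoly[of P "($) (\<pi>\<^sub>z v)"] by (simp add: \<pi>\<^sub>z_def)
  qed
  then have van: "vanishes_on (of_mpoly P) Z" by (simp add: vanishes_on_Z)
  show ?thesis
  proof (rule plane_equation_exists[OF F _ _ Z_prime])
    show "Z \<subseteq> \<FF> \<times> \<FF>" "Z \<noteq> {}" using C_coord C_nonempty by (auto simp: Z_def)
    show "of_mpoly P \<in> bipolys \<FF>" using P(1) by (intro of_mpoly_over[OF A]) (auto simp: vanishing_ideal_def)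
    show "vanishes_on (of_mpoly P) Z" by (rule van)
    show "tdeg_le (of_mpoly P) (tdeg P)" by (rule tdeg_le_of_mpoly)
    show "coeff (coeff (of_mpoly P) (tdeg P)) 0 \<noteq> 0"
      using P(2) hom_eval_vertical_direction[of "($) (vector [0, 1] :: complex ^ 2)" P] by simp
    fix c assume c: "c \<in> \<FF>"
    show "\<exists>p\<in>Z. fst p \<noteq> c"
    proof (rule ccontr)
      assume "\<not> (\<exists>p\<in>Z. fst p \<noteq> c)"
      then have "v $ 1 = c" if "v \<in> C" for v using that by (auto simp: Z_def)
      then have "\<forall>v\<in>C. (\<Sum>i\<in>UNIV. (vector [1, 0, 0] :: complex ^ 3) $ i * v $ i) + (- c) = 0" by (simp add: sum_3)
      moreover have "(vector [1, 0, 0] :: complex ^ 3) \<in> affine_space \<FF>" "(vector [1, 0, 0] :: complex ^ 3) \<noteq> 0"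
        using affine_point[of 0 0] subring_setD(1)[OF A] by auto
      ultimately have "planar \<FF> C" unfolding planar_def using subring_setD(5)[OF A c] by blast
      then show False using nonplanar by blast
    qed
  qed
qed

definition f :: "complex poly poly" where "f = (SOME f. plane_equation \<FF> Z f)"

lemma f: "plane_equation \<FF> Z f"
  unfolding f_def using plane_equation_Z by (rule someI_ex)

lemma f_facts: "f \<in> bipolys \<FF>" "lead_coeff f = 1" "degree f > 0" "tdeg_le f (degree f)" "vanishes_on f Z"
  "\<And>g. g \<in> bipolys \<FF> \<Longrightarrow> vanishes_on g Z \<Longrightarrow> \<exists>w\<in>bipolys \<FF>. g = f * w"
  "\<And>g. g \<in> bipolys \<FF> \<Longrightarrow> \<not> vanishes_on g Z \<Longrightarrow>
     \<exists>u\<in>bipolys \<FF>. \<exists>v\<in>bipolys \<FF>. \<exists>R\<in>upolys_over \<FF>. R \<noteq> 0 \<and> u * f + v * g = [:R:]"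
  using f unfolding plane_equation_def by blast+

lemma degree_f: "degree f = N"
proof -
  have "(\<lambda>v. (v $ 1, v $ 2)) ` \<pi>\<^sub>z ` C = Z" by (auto simp: Z_def \<pi>\<^sub>z_def image_image)
  then show ?thesis using curve_degree_plane[OF F B_affine, of f] f deg_W by simp
qed

lemma f_direction:
  assumes "(l, m) \<in> dirs"
  shows "poly (form_part f N) l = 0"
proof -
  have td: "tdeg_le f N" using f_facts(4) degree_f by simp
  have "to_mpoly 1 2 f \<in> vanishing_ideal \<FF> C"
    using to_mpoly_over[OF A f_facts(1)] f_facts(5) by (auto simp: vanishing_ideal_def mpoly_eval_to_mpoly vanishes_on_Z)
  then have "hom_eval (to_mpoly 1 2 f) (point3 1 l m) 0 = 0" using assms by (simp add: dirs_iff)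
  then have "hom_at N (to_mpoly 1 2 f) (point3 1 l m) 0 = 0"
    using tdeg_to_mpoly_le[OF td] by (intro hom_at_eq_0_of_hom_eval)
  then show ?thesis using hom_at_to_mpoly_slope[OF td, of "point3 1 l m" 1 2] by simp
qed

text \<open>
  The slopes of the \<open>N\<close> points at infinity of \<open>C\<close> are distinct, because no two of these points lie above
  the same slope. They are roots of the leading form of \<open>f\<close>, because \<open>f\<close> belongs to the ideal of \<open>C\<close>.
\<close>

sublocale distinct_directions f "fst ` dirs" N
proof
  show "finite (fst ` dirs)" using dirs_card by simp
  have "inj_on fst dirs" using iv by (auto intro!: inj_onI)
  then show "card (fst ` dirs) = N" using dirs_card by (simp add: card_image)
qed (use f_facts degree_f f_direction in auto)

end

context companion_data
begin

subsection \<open>The third coordinate as a rational function of the first two\<close>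

lemma f_at_complex_pt: "complex_pt a \<Longrightarrow> ev f (a 1) (a 2) = 0"
  using vanishes_at_complex_pt[OF polyfun_ev[OF A f_facts(1), of 1 2]] f_facts(5) by (simp add: vanishes_on_Z)

text \<open>
  Birationality provides \<open>z = \<nu>(x, y) / \<delta>(x, y)\<close>, and Bezout's identity replaces the denominator by
  a polynomial in \<open>x\<close> alone.
\<close>

lemma third_coordinate:
  "\<exists>h\<in>bipolys \<FF>. \<exists>R\<in>upolys_over \<FF>. degree h < N \<and> R \<noteq> 0 \<and>
     (\<forall>v\<in>C. v $ 3 * poly R (v $ 1) = ev h (v $ 1) (v $ 2))"
proof -
  have U: "subring_set (upolys_over \<FF>)" using A by (rule subring_upolys_over)
  have U2: "subring_set (bipolys \<FF>)" using U by (rule subring_upolys_over)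
  obtain num den :: "3 \<Rightarrow> 2 cmpoly"
    where over: "\<And>i. num i \<in> mpolys_over \<FF>" "\<And>i. den i \<in> mpolys_over \<FF>"
      and ne: "zariski_closure \<FF> (\<pi>\<^sub>z ` C) \<inter> {u. \<forall>i. mpoly_eval (den i) (($) u) \<noteq> 0} \<noteq> {}"
      and inv: "\<And>v. v \<in> C \<Longrightarrow> \<forall>i. mpoly_eval (den i) (($) (\<pi>\<^sub>z v)) \<noteq> 0 \<Longrightarrow>
        (\<chi> i. mpoly_eval (num i) (($) (\<pi>\<^sub>z v)) / mpoly_eval (den i) (($) (\<pi>\<^sub>z v))) = v"
    using birat unfolding birational_onto_def Let_def by blast
  obtain u where u: "u \<in> zariski_closure \<FF> (\<pi>\<^sub>z ` C)" "\<And>i. mpoly_eval (den i) (($) u) \<noteq> 0" using ne by blast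
  define \<delta> where "\<delta> i = of_mpoly (den i)" for i
  define \<nu> where "\<nu> = of_mpoly (num 3)"
  have \<delta>B: "\<delta> i \<in> bipolys \<FF>" for i unfolding \<delta>_def using A over(2) by (rule of_mpoly_over)
  have \<nu>B: "\<nu> \<in> bipolys \<FF>" unfolding \<nu>_def using A over(1) by (rule of_mpoly_over)
  have ev_proj: "ev (of_mpoly P) (v $ 1) (v $ 2) = mpoly_eval P (($) (\<pi>\<^sub>z v))" for P v
    using ev_of_mpoly[of P "($) (\<pi>\<^sub>z v)"] by (simp add: \<pi>\<^sub>z_def)
  have \<delta>0: "\<not> vanishes_on (\<delta> i) Z" for i
  proof
    assume "vanishes_on (\<delta> i) Z"
    then have "den i \<in> vanishing_ideal \<FF> (\<pi>\<^sub>z ` C)"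
      using over(2) by (auto simp: vanishes_on_Z \<delta>_def ev_proj vanishing_ideal_def)
    then show False using u unfolding zariski_closure_def zero_set_def by blast
  qed
  \<comment> \<open>The inverse of the projection is defined only where all three denominators are non-zero;
      irreducibility extends the relation \<open>z \<delta>\<^sub>3 = \<nu>\<close> to the whole curve.\<close>
  have prod0: "\<not> vanishes_on (\<delta> 1 * \<delta> 2 * \<delta> 3) Z"
    using Z_prime[OF subring_setD(4)[OF U2 \<delta>B \<delta>B] \<delta>B, of 1 2 3] Z_prime[OF \<delta>B \<delta>B, of 1 2] \<delta>0 by blast
  define g where "g a = a 3 * ev (\<delta> 3) (a 1) (a 2) - ev \<nu> (a 1) (a 2)" for a :: "3 \<Rightarrow> complex"
  have "polyfun \<FF> g"
    unfolding g_def by (intro polyfun_diff[OF A] polyfun_mult[OF A] polyfun_var[OF A] polyfun_ev[OF A] \<delta>B \<nu>B)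
  moreover have "polyfun \<FF> (\<lambda>a :: 3 \<Rightarrow> complex. ev (\<delta> 1 * \<delta> 2 * \<delta> 3) (a 1) (a 2))"
    by (intro polyfun_ev[OF A] subring_setD(4)[OF U2] \<delta>B)
  moreover have "g (($) v) * ev (\<delta> 1 * \<delta> 2 * \<delta> 3) (v $ 1) (v $ 2) = 0" if v: "v \<in> C" for v
  proof (cases "ev (\<delta> 1 * \<delta> 2 * \<delta> 3) (v $ 1) (v $ 2) = 0")
    case False
    then have "\<forall>i. mpoly_eval (den i) (($) (\<pi>\<^sub>z v)) \<noteq> 0" by (simp add: forall_3 \<delta>_def ev_proj)
    from arg_cong[OF inv[OF v this], of "\<lambda>v. v $ 3"] this
    have "v $ 3 * mpoly_eval (den 3) (($) (\<pi>\<^sub>z v)) = mpoly_eval (num 3) (($) (\<pi>\<^sub>z v))" by (auto simp: field_simps)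
    then have "g (($) v) = 0" by (simp add: g_def \<delta>_def \<nu>_def ev_proj)
    then show ?thesis by simp
  qed simp
  ultimately have gC: "g (($) v) = 0" if "v \<in> C" for v
    using C_prime[of g "\<lambda>a. ev (\<delta> 1 * \<delta> 2 * \<delta> 3) (a 1) (a 2)"] prod0 that unfolding vanishes_on_Z by blast
  obtain s t R where R: "t \<in> bipolys \<FF>" "R \<in> upolys_over \<FF>" "R \<noteq> 0" "s * f + t * \<delta> 3 = [:R:]"
    using f_facts(7)[OF \<delta>B \<delta>0] by blast
  have f0: "f \<noteq> 0" using f_facts(3) by auto
  obtain w h where h: "h \<in> bipolys \<FF>" "t * \<nu> = f * w + h" "h = 0 \<or> degree h < degree f"
    using pseudo_division[OF U subring_setD(4)[OF U2 R(1) \<nu>B] f_facts(1) f0] f_facts(2) by auto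
  have "v $ 3 * poly R (v $ 1) = ev h (v $ 1) (v $ 2)" if v: "v \<in> C" for v
  proof -
    have fv: "ev f (v $ 1) (v $ 2) = 0" using f_facts(5) v by (simp add: vanishes_on_Z)
    have "poly R (v $ 1) = ev [:R:] (v $ 1) (v $ 2)" by simp
    also have "\<dots> = ev t (v $ 1) (v $ 2) * ev (\<delta> 3) (v $ 1) (v $ 2)" unfolding R(4)[symmetric] using fv by simp
    finally have "v $ 3 * poly R (v $ 1) = ev t (v $ 1) (v $ 2) * (v $ 3 * ev (\<delta> 3) (v $ 1) (v $ 2))" by simp
    also have "v $ 3 * ev (\<delta> 3) (v $ 1) (v $ 2) = ev \<nu> (v $ 1) (v $ 2)" using gC[OF v] by (simp add: g_def)
    also have "ev t (v $ 1) (v $ 2) * ev \<nu> (v $ 1) (v $ 2) = ev (t * \<nu>) (v $ 1) (v $ 2)" by simp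
    also have "\<dots> = ev h (v $ 1) (v $ 2)" unfolding h(2) using fv by simp
    finally show ?thesis .
  qed
  moreover have "degree h < N" using h(3) degree_f n_pos by auto
  ultimately show ?thesis using h(1) R(2,3) by blast
qed

text \<open>
  Conversely every complex point of the plane curve with \<open>R(x) \<noteq> 0\<close> lifts: after clearing
  denominators the equations of \<open>C\<close> become polynomials in \<open>x\<close> and \<open>y\<close> that vanish on the projection.
\<close>

lemma lift_point:
  assumes h: "h \<in> bipolys \<FF>" and R: "R \<in> upolys_over \<FF>" "R \<noteq> 0"
    and hR: "\<And>v. v \<in> C \<Longrightarrow> v $ 3 * poly R (v $ 1) = ev h (v $ 1) (v $ 2)"
    and xy: "ev f x y = 0" "poly R x \<noteq> 0"
  shows "complex_pt (point3 x y (ev h x y / poly R x))"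
  unfolding complex_pt_def
proof
  fix P assume P: "P \<in> S"
  have U: "subring_set (upolys_over \<FF>)" using A by (rule subring_upolys_over)
  have U2: "subring_set (bipolys \<FF>)" using U by (rule subring_upolys_over)
  let ?k = "tdeg P"
  have le: "Poly_Mapping.lookup m 3 \<le> ?k" if "m \<in> Poly_Mapping.keys P" for m
    using monom_deg_le_tdeg[OF that] by (simp add: monom_deg_3)
  define H where "H = (\<Sum>m\<in>Poly_Mapping.keys P.
    monom (monom (Poly_Mapping.lookup P m) (Poly_Mapping.lookup m 1)) (Poly_Mapping.lookup m 2) *
      (h ^ Poly_Mapping.lookup m 3 * [:R:] ^ (?k - Poly_Mapping.lookup m 3)))"
  have ev_power: "ev (g ^ i) x y = ev g x y ^ i" for g i x y by (induction i) simp_all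
  have "P \<in> mpolys_over \<FF>" using P S_F by blast
  then have HB: "H \<in> bipolys \<FF>"
    unfolding H_def using h R(1)
    by (intro subring_set_sum[OF U2] subring_setD(4)[OF U2] subring_set_power[OF U2] upolys_over_monom[OF U]
        upolys_over_monom[OF A] upolys_over_const[OF U]) (auto simp: mpolys_over_def)
  have ev_H: "ev H x y = poly R x ^ ?k * mpoly_eval P (point3 x y z)" if z: "z * poly R x = ev h x y" for x y z
  proof -
    have "ev H x y = (\<Sum>m\<in>Poly_Mapping.keys P. Poly_Mapping.lookup P m * x ^ Poly_Mapping.lookup m 1 * y ^ Poly_Mapping.lookup m 2 *
        (ev h x y ^ Poly_Mapping.lookup m 3 * poly R x ^ (?k - Poly_Mapping.lookup m 3)))"
      by (simp add: H_def ev_sum ev_monom ev_power poly_monom)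
    also have "\<dots> = (\<Sum>m\<in>Poly_Mapping.keys P. poly R x ^ ?k * (Poly_Mapping.lookup P m * monom_eval m (point3 x y z)))"
    proof (rule sum.cong)
      fix m assume "m \<in> Poly_Mapping.keys P"
      then have "poly R x ^ ?k = poly R x ^ Poly_Mapping.lookup m 3 * poly R x ^ (?k - Poly_Mapping.lookup m 3)"
        using le by (simp flip: power_add)
      then show "Poly_Mapping.lookup P m * x ^ Poly_Mapping.lookup m 1 * y ^ Poly_Mapping.lookup m 2 *
        (ev h x y ^ Poly_Mapping.lookup m 3 * poly R x ^ (?k - Poly_Mapping.lookup m 3))
        = poly R x ^ ?k * (Poly_Mapping.lookup P m * monom_eval m (point3 x y z))"
        by (simp add: monom_eval_3 z[symmetric] power_mult_distrib mult_ac)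
    qed simp
    finally show ?thesis by (simp add: mpoly_eval_def sum_distrib_left)
  qed
  have "vanishes_on H Z"
    unfolding vanishes_on_Z
  proof
    fix v assume v: "v \<in> C"
    have "mpoly_eval P (($) v) = 0" using complex_pt_C[OF v] P by (simp add: complex_pt_def)
    then have "mpoly_eval P (point3 (v $ 1) (v $ 2) (v $ 3)) = 0" using fun_eq_point3[of "($) v"] by simp
    then show "ev H (v $ 1) (v $ 2) = 0" using ev_H[OF hR[OF v]] by simp
  qed
  then obtain w where "H = f * w" using f_facts(6)[OF HB] by blast
  then have "ev H x y = 0" using xy(1) by simp
  then show "mpoly_eval P (point3 x y (ev h x y / poly R x)) = 0"
    using ev_H[of "ev h x y / poly R x" x y] xy(2) by simp
qed

lemma coordinates_bounded:
  "\<exists>B\<ge>1. \<forall>a. complex_pt a \<longrightarrow> norm (a 2) \<le> B * (1 + norm (a 1)) \<and> norm (a 3) \<le> B * (1 + norm (a 1))"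
proof -
  obtain B where B: "B \<ge> 1" "\<And>x y. ev f x y = 0 \<Longrightarrow> norm y \<le> B * (1 + norm x)" using slope_bounded by blast
  obtain c where c: "c \<noteq> 0" "\<And>e. Poly_Mapping.lookup e 3 = tdeg F1 \<Longrightarrow>
      Poly_Mapping.lookup F1 e = (if e = Poly_Mapping.single 3 (tdeg F1) then c else 0)" using F1(2) by blast
  obtain D where D: "\<And>v. norm (v 2) \<le> B * (1 + norm (v 1)) \<Longrightarrow> mpoly_eval F1 v = 0 \<Longrightarrow> norm (v 3) \<le> D * (1 + norm (v 1))"
    using third_coordinate_growth[OF c B(1)] by blast
  have "norm (a 2) \<le> max B D * (1 + norm (a 1)) \<and> norm (a 3) \<le> max B D * (1 + norm (a 1))" if a: "complex_pt a" for a
  proof -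
    have 2: "norm (a 2) \<le> B * (1 + norm (a 1))" using B(2) f_at_complex_pt[OF a] by blast
    have 3: "norm (a 3) \<le> D * (1 + norm (a 1))" using D[OF 2] a F1(1) by (simp add: complex_pt_def)
    have "B * (1 + norm (a 1)) \<le> max B D * (1 + norm (a 1))" "D * (1 + norm (a 1)) \<le> max B D * (1 + norm (a 1))"
      by (intro mult_right_mono; simp)+
    then show ?thesis using 2 3 by linarith
  qed
  then show ?thesis using B(1) by (intro exI[of _ "max B D"]) auto
qed

subsection \<open>The branches at infinity\<close>

text \<open>
  A point of the projective closure at infinity is found as the limit of the points of \<open>C\<close> on a
  branch.
\<close>

lemma limit_direction:
  fixes x y z :: "nat \<Rightarrow> complex"
  assumes pt: "\<And>k. complex_pt (point3 (x k) (y k) (z k))" and x0: "\<And>k. x k \<noteq> 0"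
    and lim: "(\<lambda>k. 1 / x k) \<longlonglongrightarrow> 0" "(\<lambda>k. y k / x k) \<longlonglongrightarrow> l" "(\<lambda>k. z k / x k) \<longlonglongrightarrow> m"
    and lm: "l \<in> \<FF>" "m \<in> \<FF>"
  shows "(l, m) \<in> dirs"
  unfolding dirs_iff
proof (intro conjI lm ballI)
  fix P assume P: "P \<in> vanishing_ideal \<FF> C"
  have "(\<lambda>k. hom_at (tdeg P) P (point3 1 (y k / x k) (z k / x k)) (1 / x k)) \<longlonglongrightarrow> hom_at (tdeg P) P (point3 1 l m) 0"
  proof (rule hom_at_tendsto[OF _ lim(1)])
    fix i :: 3
    show "(\<lambda>k. point3 1 (y k / x k) (z k / x k) i) \<longlonglongrightarrow> point3 1 l m i"
      using lim(2,3) by (cases "i = 1"; cases "i = 2") (simp_all add: point3_def)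
  qed
  moreover have "hom_at (tdeg P) P (point3 1 (y k / x k) (z k / x k)) (1 / x k) = 0" for k
  proof -
    have "(\<lambda>i. 1 / x k * point3 (x k) (y k) (z k) i) = point3 1 (y k / x k) (z k / x k)"
      using x0[of k] by (auto simp: point3_def fun_eq_iff)
    moreover have "mpoly_eval P (point3 (x k) (y k) (z k)) = 0"
      using vanishes_at_complex_pt[OF polyfun_mpoly_eval _ pt] P by (auto simp: vanishing_ideal_def)
    ultimately show ?thesis
      using hom_at_scale[of P "tdeg P" "1 / x k" "point3 (x k) (y k) (z k)" 1]
      by (simp add: mpoly_eval_hom_at[of _ _ "tdeg P"])
  qed
  ultimately show "hom_eval P (point3 1 l m) 0 = 0"
    by (simp add: hom_eval_hom_at LIMSEQ_const_iff)
qed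

lemma quotient_tendsto:
  fixes x y :: "nat \<Rightarrow> complex"
  assumes "\<And>k. norm (y k - l * x k) \<le> M" "\<And>k. x k \<noteq> 0" "(\<lambda>k. 1 / x k) \<longlonglongrightarrow> 0"
  shows "(\<lambda>k. y k / x k) \<longlonglongrightarrow> l"
proof -
  have "(\<lambda>k. y k / x k - l) \<longlonglongrightarrow> 0"
  proof (rule Lim_null_comparison)
    show "\<forall>\<^sub>F k in sequentially. norm (y k / x k - l) \<le> M * norm (1 / x k)"
    proof (intro always_eventually allI)
      fix k
      have "y k / x k - l = (y k - l * x k) * (1 / x k)" using assms(2)[of k] by (simp add: field_simps)
      then show "norm (y k / x k - l) \<le> M * norm (1 / x k)"
        using assms(1)[of k] by (simp only: norm_mult mult_right_mono norm_ge_zero)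
    qed
    show "(\<lambda>k. M * norm (1 / x k)) \<longlonglongrightarrow> 0"
      using tendsto_mult_right_zero[OF tendsto_norm_zero[OF assms(3)], of M] by (simp add: mult.commute)
  qed
  then show ?thesis by (simp add: LIM_zero_iff)
qed

text \<open>
  The third coordinate is a quotient of linear growth, hence \<open>a x + O(1)\<close> along the branch of slope \<open>l\<close>,
  for some constant \<open>a\<close>. The limit of the points of the branch is \<open>(1 : l : a : 0)\<close>. It belongs to the
  projective closure, and there is only one point at infinity of \<open>C\<close> above \<open>l\<close>; so \<open>a\<close> is its last
  coordinate.
\<close>

theorem branches:
  "\<exists>M\<ge>0. \<exists>M'\<ge>0. \<exists>X\<ge>1.
     (\<forall>a. complex_pt a \<longrightarrow> X \<le> norm (a 1) \<longrightarrow>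
        (\<exists>(l, m)\<in>dirs. norm (a 2 - l * a 1) \<le> M \<and> norm (a 3 - m * a 1) \<le> M')) \<and>
     (\<forall>x l m. X \<le> norm x \<longrightarrow> (l, m) \<in> dirs \<longrightarrow>
        (\<exists>y z. complex_pt (point3 x y z) \<and> norm (y - l * x) \<le> M \<and> norm (z - m * x) \<le> M')) \<and>
     (\<forall>x l m y z y' z'. X \<le> norm x \<longrightarrow> (l, m) \<in> dirs \<longrightarrow> complex_pt (point3 x y z) \<longrightarrow> complex_pt (point3 x y' z') \<longrightarrow>
        norm (y - l * x) \<le> M \<longrightarrow> norm (y' - l * x) \<le> M \<longrightarrow> y = y' \<and> z = z')"
proof -
  obtain h R where h: "h \<in> bipolys \<FF>" "degree h < N" and R: "R \<in> upolys_over \<FF>" "R \<noteq> 0"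
    and hR: "\<And>v. v \<in> C \<Longrightarrow> v $ 3 * poly R (v $ 1) = ev h (v $ 1) (v $ 2)" using third_coordinate by blast
  have hR': "a 3 * poly R (a 1) = ev h (a 1) (a 2)" if "complex_pt a" for a
  proof -
    have pR: "[:R:] \<in> bipolys \<FF>" using R(1) by (intro upolys_over_const subring_upolys_over A)
    have "polyfun \<FF> (\<lambda>a :: 3 \<Rightarrow> complex. a 3 * ev [:R:] (a 1) (a 2) - ev h (a 1) (a 2))"
      by (intro polyfun_diff[OF A] polyfun_mult[OF A] polyfun_var[OF A] polyfun_ev[OF A] h(1) pR)
    from vanishes_at_complex_pt[OF this _ that] hR show ?thesis by simp
  qed
  obtain M0 where M0: "M0 \<ge> 0" "\<And>x y. 1 \<le> norm x \<Longrightarrow> ev f x y = 0 \<Longrightarrow> \<exists>l\<in>fst ` dirs. norm (y - l * x) \<le> M0"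
    using near_asymptote by blast
  obtain X1 where X1: "X1 \<ge> 1" "\<And>x l. X1 \<le> norm x \<Longrightarrow> l \<in> fst ` dirs \<Longrightarrow> \<exists>!y. ev f x y = 0 \<and> norm (y - l * x) \<le> M0"
    using unique_root_near_asymptote[OF M0] by blast
  obtain X2 where X2: "X2 \<ge> 1" "\<And>x. X2 \<le> norm x \<Longrightarrow> poly R x \<noteq> 0" using poly_nonzero_far[OF R(2)] by blast
  obtain B where B: "B \<ge> 1" "\<And>a. complex_pt a \<Longrightarrow> norm (a 3) \<le> B * (1 + norm (a 1))" using coordinates_bounded by blast
  \<comment> \<open>Every point of the plane curve with \<open>R(x) \<noteq> 0\<close> is the projection of a point of the space curve, whose
      third coordinate grows linearly.\<close>
  have growth: "norm (ev h x y) \<le> (2 * B) * norm x * norm (poly R x)" if x: "max X1 X2 \<le> norm x" and z: "ev f x y = 0" for x y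
  proof -
    have R0: "poly R x \<noteq> 0" using X2(2) x by simp
    have "norm (ev h x y / poly R x) \<le> B * (1 + norm x)"
      using B(2)[OF lift_point[OF h(1) R hR z R0]] by simp
    also have "\<dots> \<le> B * (2 * norm x)" using x X1(1) B(1) by (intro mult_left_mono) auto
    finally show ?thesis using R0 by (simp add: norm_divide pos_divide_le_eq mult_ac)
  qed
  have root: "\<exists>y. ev f x y = 0 \<and> norm (y - l * x) \<le> M0" if "max X1 X2 \<le> norm x" "l \<in> fst ` dirs" for x l
    using X1(2)[of x l] that by auto
  have td: "tdeg_le h (Suc (degree R))" by (rule quotient_numerator_degree[OF h(2) R(2) M0(1) root growth])
  define a where "a l = poly (form_part h (Suc (degree R))) l / lead_coeff R" for l
  obtain M1 X3 where M1: "M1 \<ge> 0" "X3 \<ge> 1" "\<And>x l y. X3 \<le> norm x \<Longrightarrow> l \<in> fst ` dirs \<Longrightarrow> norm (y - l * x) \<le> M0 \<Longrightarrow>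
      norm (ev h x y - a l * x * poly R x) \<le> M1 * norm (poly R x)"
    using quotient_asymptotics[OF td R(2) M0(1)] unfolding a_def by blast
  define X where "X = max (max X1 X2) X3"
  have X: "X1 \<le> X" "X2 \<le> X" "X3 \<le> X" "max X1 X2 \<le> X" "1 \<le> X" using X1(1) by (auto simp: X_def)
  have quot: "norm (ev h x y / poly R x - a l * x) \<le> M1"
    if "X \<le> norm x" "l \<in> fst ` dirs" "norm (y - l * x) \<le> M0" for x l y
  proof -
    have R0: "poly R x \<noteq> 0" using X2(2) X(2) that(1) by simp
    have "ev h x y - a l * x * poly R x = (ev h x y / poly R x - a l * x) * poly R x" using R0 by (simp add: field_simps)
    then have "norm (ev h x y / poly R x - a l * x) * norm (poly R x) \<le> M1 * norm (poly R x)"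
      using M1(3)[of x l y] that X(3) by (simp flip: norm_mult)
    then show ?thesis using R0 by (simp add: mult_le_cancel_right)
  qed
  have a_dir: "a l = m" if lm: "(l, m) \<in> dirs" for l m
  proof -
    have lF: "l \<in> \<FF>" and l: "l \<in> fst ` dirs" using lm by (auto simp: dirs_def intro: rev_image_eqI)
    have "form_part h (Suc (degree R)) \<in> upolys_over \<FF>"
      using upolys_overD[OF upolys_overD[OF h(1)]] subring_setD(1)[OF A] by (intro upolys_overI) (simp add: coeff_form_part)
    then have aF: "a l \<in> \<FF>"
      unfolding a_def using lF upolys_overD[OF R(1)] by (intro root_closed_divide[OF F] poly_in_subring[OF A])
    \<comment> \<open>A sequence of points that runs to infinity along the branch of slope \<open>l\<close>.\<close>
    define x where "x k = complex_of_real (X + real k)" for k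
    have nx: "norm (x k) = X + real k" for k using X(5) by (simp only: x_def norm_of_real)
    have xX: "X \<le> norm (x k)" for k by (simp add: nx)
    have x0: "x k \<noteq> 0" for k using nx[of k] X(5) by auto
    have "\<forall>k. \<exists>y. ev f (x k) y = 0 \<and> norm (y - l * x k) \<le> M0"
      using root[OF order_trans[OF X(4) xX] l] by blast
    then obtain y where y: "\<And>k. ev f (x k) (y k) = 0" "\<And>k. norm (y k - l * x k) \<le> M0" by metis
    define z where "z k = ev h (x k) (y k) / poly R (x k)" for k
    have "filterlim (\<lambda>k. X + real k) at_top sequentially"
      by (rule filterlim_tendsto_add_at_top[OF tendsto_const filterlim_real_sequentially])
    then have "(\<lambda>k. inverse (X + real k)) \<longlonglongrightarrow> 0" by (rule tendsto_inverse_0_at_top)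
    then have "(\<lambda>k. complex_of_real (inverse (X + real k))) \<longlonglongrightarrow> complex_of_real 0" by (rule tendsto_of_real)
    then have lim0: "(\<lambda>k. 1 / x k) \<longlonglongrightarrow> 0" by (simp add: x_def inverse_eq_divide)
    have "(l, a l) \<in> dirs"
    proof (rule limit_direction[OF _ x0 lim0 _ _ lF aF])
      show "complex_pt (point3 (x k) (y k) (z k))" for k
        unfolding z_def using lift_point[OF h(1) R hR y(1)] X2(2) order_trans[OF X(2) xX] by blast
      show "(\<lambda>k. y k / x k) \<longlonglongrightarrow> l" by (rule quotient_tendsto[OF y(2) x0 lim0])
      show "(\<lambda>k. z k / x k) \<longlonglongrightarrow> a l"
        by (rule quotient_tendsto[OF _ x0 lim0, of _ _ M1]) (unfold z_def, rule quot[OF xX l y(2)])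
    qed
    then show ?thesis using iv[OF _ lm] by blast
  qed
  have z_eq: "z = ev h x y / poly R x" if "complex_pt (point3 x y z)" "X \<le> norm x" for x y z
    using hR'[OF that(1)] X2(2)[of x] X(2) that(2) by (simp add: field_simps)
  have "\<exists>(l, m)\<in>dirs. norm (a 2 - l * a 1) \<le> M0 \<and> norm (a 3 - m * a 1) \<le> M1"
    if b: "complex_pt a" "X \<le> norm (a 1)" for a
  proof -
    have "1 \<le> norm (a 1)" using b(2) X(5) by linarith
    then obtain l where l: "l \<in> fst ` dirs" "norm (a 2 - l * a 1) \<le> M0" using M0(2) f_at_complex_pt[OF b(1)] by blast
    then obtain m where lm: "(l, m) \<in> dirs" by auto
    have "a 3 = ev h (a 1) (a 2) / poly R (a 1)" using z_eq[of "a 1" "a 2" "a 3"] b fun_eq_point3[of a] by simp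
    then have "norm (a 3 - m * a 1) \<le> M1" using quot[OF b(2) l] a_dir[OF lm] by simp
    then show ?thesis using l(2) lm by force
  qed
  moreover have "\<exists>y z. complex_pt (point3 x y z) \<and> norm (y - l * x) \<le> M0 \<and> norm (z - m * x) \<le> M1"
    if x: "X \<le> norm x" and lm: "(l, m) \<in> dirs" for x l m
  proof -
    have l: "l \<in> fst ` dirs" using lm by force
    obtain y where y: "ev f x y = 0" "norm (y - l * x) \<le> M0" using root[OF order_trans[OF X(4) x] l] by blast
    have "poly R x \<noteq> 0" using X2(2) X(2) x by simp
    then have "complex_pt (point3 x y (ev h x y / poly R x))" using lift_point[OF h(1) R hR y(1)] by blast
    moreover have "norm (ev h x y / poly R x - m * x) \<le> M1" using quot[OF x l y(2)] a_dir[OF lm] by simp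
    ultimately show ?thesis using y(2) by blast
  qed
  moreover have "y = y' \<and> z = z'"
    if x: "X \<le> norm x" and lm: "(l, m) \<in> dirs" and pts: "complex_pt (point3 x y z)" "complex_pt (point3 x y' z')"
      and near: "norm (y - l * x) \<le> M0" "norm (y' - l * x) \<le> M0" for x l m y z y' z'
  proof -
    have "l \<in> fst ` dirs" using lm by force
    then have "\<exists>!y. ev f x y = 0 \<and> norm (y - l * x) \<le> M0" using X1(2) X(1) x by simp
    moreover have "ev f x y = 0" "ev f x y' = 0"
      using f_at_complex_pt[OF pts(1)] f_at_complex_pt[OF pts(2)] by simp_all
    ultimately have "y = y'" using near by blast
    then show ?thesis using z_eq[OF pts(1) x] z_eq[OF pts(2) x] by simp
  qed
  ultimately show ?thesis using M0(1) M1(1) X(5) by blast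
qed

end

lemma param_point_on_closure:
  fixes p :: "complex poly ^ 3"
  assumes F: "root_closed_subfield \<FF>" and p: "\<And>i. p $ i \<in> upolys_over \<FF>" and q: "q \<in> upolys_over \<FF>" "q \<noteq> 0"
    and P: "P \<in> vanishing_ideal \<FF> (param_curve \<FF> p q)" and t: "poly q t \<noteq> 0"
  shows "mpoly_eval P (\<lambda>i. poly (p $ i) t / poly q t) = 0"
proof -
  have A: "subring_set \<FF>" using F by (rule root_closed_subring)
  define H where "H = (\<Sum>m\<in>Poly_Mapping.keys P. Polynomial.smult (Poly_Mapping.lookup P m)
    ((\<Prod>i\<in>Poly_Mapping.keys m. (p $ i) ^ Poly_Mapping.lookup m i) * q ^ (tdeg P - monom_deg m)))"
  have H: "poly H t = poly q t ^ tdeg P * mpoly_eval P (\<lambda>i. poly (p $ i) t / poly q t)" if "poly q t \<noteq> 0" for t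
  proof -
    have "poly H t = hom_at (tdeg P) P (\<lambda>i. poly (p $ i) t) (poly q t)"
      by (simp add: H_def poly_sum poly_prod hom_at_def monom_eval_def mult.assoc)
    moreover have "(\<lambda>i. poly q t * (poly (p $ i) t / poly q t)) = (\<lambda>i. poly (p $ i) t)" using that by simp
    ultimately show ?thesis
      using hom_at_scale[of P "tdeg P" "poly q t" "\<lambda>i. poly (p $ i) t / poly q t" 1]
      by (simp add: mpoly_eval_hom_at[of _ _ "tdeg P"])
  qed
  have "mpoly_eval P (\<lambda>i. poly (p $ i) t / poly q t) = 0" if t: "t \<in> \<FF>" "poly q t \<noteq> 0" for t
  proof -
    have "P \<in> vanishing_ideal \<FF> {\<chi> i. poly (p $ i) t / poly q t | t. t \<in> \<FF> \<and> poly q t \<noteq> 0}"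
      using P unfolding param_curve_def by (subst (asm) vanishing_ideal_closure[OF param_points_affine[OF F p q(1)]])
    moreover have "($) (\<chi> i. poly (p $ i) t / poly q t) = (\<lambda>i. poly (p $ i) t / poly q t)" by (simp add: fun_eq_iff)
    ultimately show ?thesis using t unfolding vanishing_ideal_def by fastforce
  qed
  then have "\<FF> - {t. poly q t = 0} \<subseteq> {t. poly H t = 0}" using H by auto
  moreover have "infinite (\<FF> - {t. poly q t = 0})"
    using infinite_subring[OF A] poly_roots_finite[OF q(2)] by (simp add: Diff_infinite_finite)
  ultimately have "infinite {t. poly H t = 0}" using infinite_super by blast
  then have "H = 0" using poly_roots_finite by blast
  then show ?thesis using H[OF t] t by simp
qed

lemma interpolation_exists:
  assumes F: "root_closed_subfield \<FF>" and "finite S"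
  shows "S \<subseteq> \<FF> \<Longrightarrow> y ` S \<subseteq> \<FF> \<Longrightarrow>
    \<exists>p\<in>upolys_over \<FF>. (p = 0 \<or> degree p < card S) \<and> (\<forall>x\<in>S. poly p x = y x)"
  using assms(2)
proof (induction S rule: finite_induct)
  case empty
  then show ?case using upolys_over_0[OF root_closed_subring[OF F]] by auto
next
  case (insert a S)
  have A: "subring_set \<FF>" using F by (rule root_closed_subring)
  have U: "subring_set (upolys_over \<FF>)" using A by (rule subring_upolys_over)
  obtain p where p: "p \<in> upolys_over \<FF>" "p = 0 \<or> degree p < card S" "\<forall>x\<in>S. poly p x = y x"
    using insert.IH insert.prems by auto
  define w where "w = (\<Prod>b\<in>S. [:-b, 1:])"
  have w: "w \<in> upolys_over \<FF>"
    unfolding w_def using insert.prems A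
    by (intro subring_set_prod[OF U] upolys_over_pCons upolys_over_0) (auto simp: subring_setD)
  have wa: "poly w a \<noteq> 0" using insert.hyps by (auto simp: w_def poly_prod)
  have wS: "poly w x = 0" if "x \<in> S" for x using that insert.hyps by (auto simp: w_def poly_prod)
  have dw: "degree w = card S" unfolding w_def by (subst degree_prod_eq_sum_degree) auto
  define c where "c = (y a - poly p a) / poly w a"
  have "c \<in> \<FF>"
    unfolding c_def using insert.prems p(1) w
    by (intro root_closed_divide[OF F] subring_setD(6)[OF A] poly_in_subring[OF A]) auto
  then have "p + Polynomial.smult c w \<in> upolys_over \<FF>"
    using p(1) w by (intro subring_setD(3)[OF U] upolys_over_smult[OF A])
  moreover have "degree (p + Polynomial.smult c w) < card (Set.insert a S)"
  proof -
    have "degree p \<le> card S" using p(2) by auto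
    moreover have "degree (Polynomial.smult c w) \<le> card S" using dw degree_smult_le[of c w] by simp
    ultimately have "degree (p + Polynomial.smult c w) \<le> card S" by (rule degree_add_le)
    then show ?thesis using insert.hyps by simp
  qed
  moreover have "\<forall>x\<in>Set.insert a S. poly (p + Polynomial.smult c w) x = y x"
    using p(3) wS wa by (auto simp: c_def)
  ultimately show ?case by blast
qed

lemma poly_map_cnj: "poly (map_poly cnj p) (cnj z) = cnj (poly p z)"
  by (simp add: poly_altdef degree_map_poly coeff_map_poly)

lemma map_cnj_real: "p \<in> upolys_over K \<Longrightarrow> K \<subseteq> \<real> \<Longrightarrow> map_poly cnj p = p"
  by (rule poly_eqI) (metis Reals_cnj_iff coeff_map_poly complex_cnj_zero subsetD upolys_overD)

lemma norm_le_sum_3: "norm (a :: real ^ 3) \<le> \<bar>a $ 1\<bar> + \<bar>a $ 2\<bar> + \<bar>a $ 3\<bar>"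
  using norm_le_l1_cart[of a] by (simp add: sum_3)

context companion_data
begin

section \<open>Real directions\<close>

definition real_dirs :: "(real ^ 3) set" where
  "real_dirs = (\<lambda>(l, m). vector [1, Re l, Re m]) ` {(l, m) \<in> dirs. l \<in> \<real>}"

lemma finite_real_dirs: "finite real_dirs"
  unfolding real_dirs_def using dirs_card(1) by (auto intro: finite_subset[of _ dirs])

lemma real_direction: "(l, m) \<in> dirs \<Longrightarrow> l \<in> \<real> \<Longrightarrow> m \<in> \<real>"
  using dirs_cnj[of l m] iv[of l m "cnj m"] by (simp add: Reals_cnj_iff)

lemma real_dirs_cases:
  assumes "v \<in> real_dirs"
  shows "\<exists>l m. (complex_of_real l, complex_of_real m) \<in> dirs \<and> v = vector [1, l, m]"
proof -
  obtain l m where lm: "(l, m) \<in> dirs" "l \<in> \<real>" "v = vector [1, Re l, Re m]" using assms by (auto simp: real_dirs_def)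
  then have "l = complex_of_real (Re l)" "m = complex_of_real (Re m)" using real_direction by (simp_all add: of_real_Re)
  then show ?thesis using lm by metis
qed

text \<open>
  A real point far away that is close to the line of a direction \<open>(1, l, m)\<close> forces \<open>l\<close> to be real,
  because \<open>|Im l| |x|\<close> is bounded; then \<open>m\<close> is real, too.
\<close>

lemma near_real_directions:
  assumes near: "\<And>a. a \<in> T \<Longrightarrow> norm a \<le> M \<or> (\<exists>(l, m)\<in>dirs.
      norm (complex_of_real (a $ 2) - l * complex_of_real (a $ 1)) \<le> M \<and>
      norm (complex_of_real (a $ 3) - m * complex_of_real (a $ 1)) \<le> M)"
  shows "\<exists>M'. \<forall>a\<in>T. norm a \<le> M' \<or> (\<exists>v\<in>real_dirs. norm (a - (a $ 1) *\<^sub>R v) \<le> M')"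
proof -
  define Y where "Y = (\<Sum>(l, m)\<in>dirs. \<bar>M\<bar> / \<bar>Im l\<bar>)"
  define V where "V = (\<Sum>(l, m)\<in>dirs. norm l + norm m)"
  have Y0: "Y \<ge> 0" and V0: "V \<ge> 0" by (auto simp: Y_def V_def intro!: sum_nonneg)
  define M' where "M' = Y + 2 * (\<bar>M\<bar> + V * Y)"
  have M': "\<bar>M\<bar> * 2 \<le> M'" using Y0 V0 by (simp add: M'_def)
  have "norm a \<le> M' \<or> (\<exists>v\<in>real_dirs. norm (a - (a $ 1) *\<^sub>R v) \<le> M')" if a: "a \<in> T" for a
  proof (cases "norm a \<le> M")
    case True
    then show ?thesis using M' by linarith
  next
    case False
    then obtain l m where lm: "(l, m) \<in> dirs" and 2: "norm (complex_of_real (a $ 2) - l * complex_of_real (a $ 1)) \<le> M"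
      and 3: "norm (complex_of_real (a $ 3) - m * complex_of_real (a $ 1)) \<le> M" using near[OF a] by blast
    show ?thesis
    proof (cases "l \<in> \<real>")
      case True
      define v :: "real ^ 3" where "v = vector [1, Re l, Re m]"
      have v: "v \<in> real_dirs" using lm True by (force simp: real_dirs_def v_def)
      have re: "l = complex_of_real (Re l)" "m = complex_of_real (Re m)"
        using True real_direction[OF lm True] by (simp_all add: of_real_Re)
      have "complex_of_real (a $ 2) - l * complex_of_real (a $ 1) = complex_of_real (a $ 2 - a $ 1 * Re l)"
        "complex_of_real (a $ 3) - m * complex_of_real (a $ 1) = complex_of_real (a $ 3 - a $ 1 * Re m)"
        by (subst re, simp)+
      then have "\<bar>a $ 2 - a $ 1 * Re l\<bar> \<le> M" "\<bar>a $ 3 - a $ 1 * Re m\<bar> \<le> M"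
        using 2 3 by (simp_all only: norm_of_real)
      moreover have "norm (a - (a $ 1) *\<^sub>R v) \<le> \<bar>a $ 2 - a $ 1 * Re l\<bar> + \<bar>a $ 3 - a $ 1 * Re m\<bar>"
        using norm_le_sum_3[of "a - (a $ 1) *\<^sub>R v"] by (simp add: v_def)
      ultimately have "norm (a - (a $ 1) *\<^sub>R v) \<le> M'" using M' by linarith
      then show ?thesis using v by blast
    next
      case False
      then have im: "\<bar>Im l\<bar> > 0" by (simp add: complex_is_Real_iff)
      have "\<bar>Im (complex_of_real (a $ 2) - l * complex_of_real (a $ 1))\<bar> \<le> M"
        using 2 abs_Im_le_cmod order_trans by blast
      then have "\<bar>Im l\<bar> * \<bar>a $ 1\<bar> \<le> \<bar>M\<bar>" by (simp add: abs_mult)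
      then have "\<bar>a $ 1\<bar> \<le> \<bar>M\<bar> / \<bar>Im l\<bar>" using im by (simp add: pos_le_divide_eq mult.commute)
      also have "\<dots> \<le> Y"
        unfolding Y_def using member_le_sum[OF lm, of "\<lambda>(l, m). \<bar>M\<bar> / \<bar>Im l\<bar>"] dirs_card(1) by (auto simp: case_prod_beta)
      finally have a1: "\<bar>a $ 1\<bar> \<le> Y" .
      have "norm l + norm m \<le> V"
        unfolding V_def using member_le_sum[OF lm, of "\<lambda>(l, m). norm l + norm m"] dirs_card(1) by (auto simp: case_prod_beta)
      then have lV: "norm l \<le> V" "norm m \<le> V" using norm_ge_zero[of l] norm_ge_zero[of m] by linarith+
      have coord: "\<bar>b\<bar> \<le> \<bar>M\<bar> + V * Y"
        if b: "norm (complex_of_real b - k * complex_of_real (a $ 1)) \<le> M" and k: "norm k \<le> V" for b k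
      proof -
        have "norm (complex_of_real b) \<le> norm (complex_of_real b - k * complex_of_real (a $ 1)) + norm (k * complex_of_real (a $ 1))"
          using norm_triangle_ineq[of "complex_of_real b - k * complex_of_real (a $ 1)" "k * complex_of_real (a $ 1)"] by simp
        also have "norm (k * complex_of_real (a $ 1)) \<le> V * Y"
          unfolding norm_mult norm_of_real using k a1 V0 by (intro mult_mono) auto
        finally show ?thesis using b by simp
      qed
      have "norm a \<le> M'" using norm_le_sum_3[of a] a1 coord[OF 2 lV(1)] coord[OF 3 lV(2)] by (simp add: M'_def)
      then show ?thesis by blast
    qed
  qed
  then show ?thesis by blast
qed

lemma real_zeros_complex_pt: "a \<in> real_zeros S \<longleftrightarrow> complex_pt (\<lambda>i. complex_of_real (a $ i))"
  by (simp add: real_zeros_def complex_pt_def)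

lemma real_pt_of_conj:
  assumes "complex_pt (point3 (complex_of_real x) y z)"
  shows "complex_pt (point3 (complex_of_real x) (cnj y) (cnj z))"
proof -
  have "(\<lambda>i. cnj (point3 (complex_of_real x) y z i)) = point3 (complex_of_real x) (cnj y) (cnj z)"
    by (auto simp: point3_def fun_eq_iff)
  then show ?thesis using complex_pt_cnj[OF assms] by simp
qed

text \<open>
  Over a real \<open>x\<close> far away there is exactly one point on the branch of a real direction. Conjugation
  preserves the curve and the branch, so this point is real.
\<close>

theorem real_curve_follows_lines: "follows_lines (real_zeros S) real_dirs"
proof -
  obtain M M' X where M: "M \<ge> 0" "M' \<ge> 0" and X: "X \<ge> 1"
    and near: "\<And>a. complex_pt a \<Longrightarrow> X \<le> norm (a 1) \<Longrightarrow>
        \<exists>(l, m)\<in>dirs. norm (a 2 - l * a 1) \<le> M \<and> norm (a 3 - m * a 1) \<le> M'"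
    and ex: "\<And>x l m. X \<le> norm x \<Longrightarrow> (l, m) \<in> dirs \<Longrightarrow>
        \<exists>y z. complex_pt (point3 x y z) \<and> norm (y - l * x) \<le> M \<and> norm (z - m * x) \<le> M'"
    and uniq: "\<And>x l m y z y' z'. X \<le> norm x \<Longrightarrow> (l, m) \<in> dirs \<Longrightarrow> complex_pt (point3 x y z) \<Longrightarrow>
        complex_pt (point3 x y' z') \<Longrightarrow> norm (y - l * x) \<le> M \<Longrightarrow> norm (y' - l * x) \<le> M \<Longrightarrow> y = y' \<and> z = z'"
    using branches by blast
  obtain B where B: "B \<ge> 1" "\<And>a. complex_pt a \<Longrightarrow> norm (a 2) \<le> B * (1 + norm (a 1)) \<and> norm (a 3) \<le> B * (1 + norm (a 1))"
    using coordinates_bounded by blast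
  define M1 where "M1 = max (max M M') (X + 2 * (B * (1 + X)))"
  have "norm a \<le> M1 \<or> (\<exists>(l, m)\<in>dirs.
      norm (complex_of_real (a $ 2) - l * complex_of_real (a $ 1)) \<le> M1 \<and>
      norm (complex_of_real (a $ 3) - m * complex_of_real (a $ 1)) \<le> M1)" if "a \<in> real_zeros S" for a
  proof -
    have pt: "complex_pt (\<lambda>i. complex_of_real (a $ i))" using that real_zeros_complex_pt by simp
    show ?thesis
    proof (cases "X \<le> \<bar>a $ 1\<bar>")
      case True
      then obtain l m where "(l, m) \<in> dirs" "norm (complex_of_real (a $ 2) - l * complex_of_real (a $ 1)) \<le> M"
        "norm (complex_of_real (a $ 3) - m * complex_of_real (a $ 1)) \<le> M'"
        using near[OF pt] by auto
      then show ?thesis by (intro disjI2 bexI[of _ "(l, m)"]) (auto simp: M1_def)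
    next
      case False
      have "\<bar>a $ 2\<bar> \<le> B * (1 + \<bar>a $ 1\<bar>)" "\<bar>a $ 3\<bar> \<le> B * (1 + \<bar>a $ 1\<bar>)" using B(2)[OF pt] by simp_all
      moreover have "B * (1 + \<bar>a $ 1\<bar>) \<le> B * (1 + X)" using False B(1) by (intro mult_left_mono) auto
      ultimately have "norm a \<le> X + 2 * (B * (1 + X))" using norm_le_sum_3[of a] False by linarith
      then have "norm a \<le> M1" unfolding M1_def by (rule max.coboundedI2)
      then show ?thesis ..
    qed
  qed
  from near_real_directions[OF this]
  have 1: "\<exists>M. \<forall>a\<in>real_zeros S. norm a \<le> M \<or> (\<exists>v\<in>real_dirs. norm (a - (a $ 1) *\<^sub>R v) \<le> M)" by blast
  have 2: "\<exists>a\<in>real_zeros S. norm (a - r *\<^sub>R v) \<le> M + M'" if v: "v \<in> real_dirs" and r: "X \<le> \<bar>r\<bar>" for v r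
  proof -
    obtain l m where lm: "(complex_of_real l, complex_of_real m) \<in> dirs" "v = vector [1, l, m]"
      using real_dirs_cases[OF v] by blast
    have rX: "X \<le> norm (complex_of_real r)" using r by simp
    obtain y z where yz: "complex_pt (point3 (complex_of_real r) y z)"
      "norm (y - complex_of_real l * complex_of_real r) \<le> M" "norm (z - complex_of_real m * complex_of_real r) \<le> M'"
      using ex[OF rX lm(1)] by blast
    have "cnj (y - complex_of_real l * complex_of_real r) = cnj y - complex_of_real l * complex_of_real r" by simp
    then have "norm (cnj y - complex_of_real l * complex_of_real r) \<le> M" using yz(2) by (metis complex_mod_cnj)
    then have "y = cnj y \<and> z = cnj z" using uniq[OF rX lm(1) yz(1) real_pt_of_conj[OF yz(1)] yz(2)] by blast
    then have "y \<in> \<real>" "z \<in> \<real>" by (simp_all add: Reals_cnj_iff)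
    then obtain y' z' where yz': "y = complex_of_real y'" "z = complex_of_real z'" by (auto elim!: Reals_cases)
    define a :: "real ^ 3" where "a = vector [r, y', z']"
    have "(\<lambda>i. complex_of_real (a $ i)) = point3 (complex_of_real r) y z"
      by (subst fun_eq_point3) (simp add: a_def yz')
    then have "a \<in> real_zeros S" using yz(1) by (simp add: real_zeros_complex_pt)
    moreover have "\<bar>y' - l * r\<bar> \<le> M" "\<bar>z' - m * r\<bar> \<le> M'"
      using yz(2,3) unfolding yz' by (simp_all only: norm_of_real flip: of_real_mult of_real_diff)
    then have "norm (a - r *\<^sub>R v) \<le> M + M'"
      using norm_le_sum_3[of "a - r *\<^sub>R v"] by (simp add: a_def lm(2) mult.commute)
    ultimately show ?thesis by blast
  qed
  show ?thesis unfolding follows_lines_def using 1 2 by blast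
qed

section \<open>The output curve\<close>

text \<open>
  The description of \<open>lift_coord\<close> is definite, because no two points at infinity of \<open>C\<close> lie above
  the same slope.
\<close>

lemma lift_coord_dirs:
  assumes "poly q t = 0"
  shows "(slope t, lift_coord \<FF> C p1 p2 t) \<in> dirs"
proof -
  obtain m where m: "(slope t, m) \<in> dirs" using root_direction(2)[OF assms] by blast
  have "lift_coord \<FF> C p1 p2 t = m"
    unfolding lift_coord_def
  proof (rule the_equality)
    show "m \<in> \<FF> \<and> proj_pt \<FF> (vector [1, poly p2 t / poly p1 t, m]) 0 \<in> pts_at_infinity \<FF> C"
      using m by (simp add: dirs_def slope_def)
    fix m' assume "m' \<in> \<FF> \<and> proj_pt \<FF> (vector [1, poly p2 t / poly p1 t, m']) 0 \<in> pts_at_infinity \<FF> C"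
    then have "(slope t, m') \<in> dirs" using m by (simp add: dirs_def slope_def)
    then show "m' = m" using iv m by blast
  qed
  then show ?thesis using m by simp
qed

definition p3 :: "complex poly" where "p3 = interp_numerator \<FF> C p1 p2 q"

definition interpolates :: "complex poly \<Rightarrow> bool" where
  "interpolates p \<longleftrightarrow> p \<in> upolys_over \<FF> \<and> degree p < curve_degree \<FF> C \<and>
     (\<forall>t\<in>\<FF>. poly q t = 0 \<longrightarrow> poly p t = poly p1 t * lift_coord \<FF> C p1 p2 t)"

lemma interpolates_unique:
  assumes "interpolates p" "interpolates p'"
  shows "p = p'"
proof (rule ccontr)
  assume "p \<noteq> p'"
  then have nz: "p - p' \<noteq> 0" by simp
  have "{t. poly q t = 0} \<subseteq> {t. poly (p - p') t = 0}" using assms roots_F by (auto simp: interpolates_def)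
  then have "N \<le> card {t. poly (p - p') t = 0}"
    using infinity_count(2) card_mono[OF poly_roots_finite[OF nz]] by metis
  moreover have "degree (p - p') < N" using assms deg_C by (intro degree_diff_less) (auto simp: interpolates_def)
  ultimately show False using card_poly_roots_bound[OF nz] by linarith
qed

lemma interpolates_p3: "interpolates p3"
proof -
  have "{t. poly q t = 0} \<subseteq> \<FF>" using roots_F by blast
  moreover have "(\<lambda>t. poly p1 t * lift_coord \<FF> C p1 p2 t) ` {t. poly q t = 0} \<subseteq> \<FF>"
  proof clarify
    fix t assume t: "poly q t = 0"
    have "lift_coord \<FF> C p1 p2 t \<in> \<FF>" using lift_coord_dirs[OF t] by (simp add: dirs_def)
    then show "poly p1 t * lift_coord \<FF> C p1 p2 t \<in> \<FF>"
      by (intro subring_setD(4)[OF A] poly_in_subring[OF A] pq_F(1) roots_F[OF t])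
  qed
  ultimately obtain p where p: "p \<in> upolys_over \<FF>" "p = 0 \<or> degree p < card {t. poly q t = 0}"
    "\<forall>t\<in>{t. poly q t = 0}. poly p t = poly p1 t * lift_coord \<FF> C p1 p2 t"
    using interpolation_exists[OF F infinity_count(1), of "\<lambda>t. poly p1 t * lift_coord \<FF> C p1 p2 t"] by blast
  then have int: "interpolates p" using infinity_count(2) n_pos deg_C by (auto simp: interpolates_def)
  have "p3 = p"
    unfolding p3_def interp_numerator_def
    by (rule the_equality) (use int interpolates_unique in \<open>auto simp: interpolates_def\<close>)
  then show ?thesis using int by simp
qed

lemma real_pq: "p1 \<in> upolys_over \<real>" "p2 \<in> upolys_over \<real>" "q \<in> upolys_over \<real>"
  using pq K(2) by (auto simp: upolys_over_def)

lemma cnj_poly: "poly p1 (cnj t) = cnj (poly p1 t)" "poly p2 (cnj t) = cnj (poly p2 t)" "poly q (cnj t) = cnj (poly q t)"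
  using poly_map_cnj[of p1 t] poly_map_cnj[of p2 t] poly_map_cnj[of q t] map_cnj_real[OF pq(1) K(2)]
    map_cnj_real[OF pq(2) K(2)] map_cnj_real[OF pq(3) K(2)] by simp_all

lemma slope_cnj: "slope (cnj t) = cnj (slope t)"
  by (simp add: slope_def cnj_poly)

text \<open>The interpolation data are invariant under conjugation, hence so is the interpolant.\<close>

lemma p3_real: "p3 \<in> upolys_over \<real>"
proof -
  have "interpolates (map_poly cnj p3)"
    unfolding interpolates_def
  proof (intro conjI ballI impI)
    have p3F: "p3 \<in> upolys_over \<FF>" and dp3: "degree p3 < curve_degree \<FF> C" using interpolates_p3 by (auto simp: interpolates_def)
    show "map_poly cnj p3 \<in> upolys_over \<FF>"
      using F_cnj upolys_overD[OF p3F] by (intro upolys_overI) (simp add: coeff_map_poly)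
    show "degree (map_poly cnj p3) < curve_degree \<FF> C" using dp3 by (simp add: degree_map_poly)
    fix t assume t: "t \<in> \<FF>" "poly q t = 0"
    have ct: "poly q (cnj t) = 0" using t(2) by (simp add: cnj_poly)
    have "(cnj (slope (cnj t)), cnj (lift_coord \<FF> C p1 p2 (cnj t))) \<in> dirs" by (rule dirs_cnj[OF lift_coord_dirs[OF ct]])
    then have "(slope t, cnj (lift_coord \<FF> C p1 p2 (cnj t))) \<in> dirs" by (simp add: slope_cnj)
    then have lift: "cnj (lift_coord \<FF> C p1 p2 (cnj t)) = lift_coord \<FF> C p1 p2 t" using iv lift_coord_dirs[OF t(2)] by blast
    have "poly (map_poly cnj p3) t = cnj (poly p3 (cnj t))" using poly_map_cnj[of p3 "cnj t"] by simp
    also have "poly p3 (cnj t) = poly p1 (cnj t) * lift_coord \<FF> C p1 p2 (cnj t)"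
      using interpolates_p3 F_cnj[OF t(1)] ct by (auto simp: interpolates_def)
    finally show "poly (map_poly cnj p3) t = poly p1 t * lift_coord \<FF> C p1 p2 t"
      by (simp add: cnj_poly lift)
  qed
  then have eq: "map_poly cnj p3 = p3" using interpolates_unique interpolates_p3 by blast
  have "cnj (coeff p3 i) = coeff p3 i" for i
    using arg_cong[OF eq, of "\<lambda>p. coeff p i"] by (simp add: coeff_map_poly)
  then show ?thesis by (intro upolys_overI) (simp add: Reals_cnj_iff)
qed

definition pvec :: "complex poly ^ 3" where "pvec = vector [p1, p2, p3]"

lemma pvec_simps [simp]: "pvec $ 1 = p1" "pvec $ 2 = p2" "pvec $ 3 = p3"
  by (simp_all add: pvec_def)

lemma pvec_F: "pvec $ i \<in> upolys_over \<FF>"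
  using pq_F interpolates_p3 exhaust_3[of i] by (auto simp: interpolates_def)

lemma pvec_real: "pvec $ i \<in> upolys_over \<real>"
  using real_pq p3_real exhaust_3[of i] by auto

lemma pvec_degree: "degree (pvec $ i) \<le> N"
  using deg_p interpolates_p3 deg_C exhaust_3[of i] by (auto simp: interpolates_def)

abbreviation "output \<equiv> real_zeros (vanishing_ideal \<FF> (param_curve \<FF> pvec q))"

lemma real_param_point:
  assumes "poly q (complex_of_real t) \<noteq> 0"
  shows "\<exists>b\<in>output. \<forall>i. complex_of_real (b $ i) = poly (pvec $ i) (complex_of_real t) / poly q (complex_of_real t)"
proof -
  define b :: "real ^ 3" where "b = (\<chi> i. Re (poly (pvec $ i) (complex_of_real t) / poly q (complex_of_real t)))"
  have "poly (pvec $ i) (complex_of_real t) / poly q (complex_of_real t) \<in> \<real>" for i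
    by (intro Reals_divide poly_in_subring[OF subring_Reals] pvec_real real_pq(3) Reals_of_real)
  then have b: "complex_of_real (b $ i) = poly (pvec $ i) (complex_of_real t) / poly q (complex_of_real t)" for i
    by (simp only: b_def vec_lambda_beta of_real_Re)
  have "b \<in> output"
    unfolding real_zeros_def using param_point_on_closure[OF F pvec_F pq_F(3) q0 _ assms] by (simp add: b)
  then show ?thesis using b by blast
qed

lemma output_nonempty: "output \<noteq> {}"
proof -
  have "infinite (range complex_of_real)"
    using finite_imageD[of complex_of_real UNIV] infinite_UNIV_char_0[where 'a=real] by (auto simp: inj_on_def)
  then have "\<not> range complex_of_real \<subseteq> {t. poly q t = 0}" using infinity_count(1) finite_subset by blast
  then obtain t where "poly q (complex_of_real t) \<noteq> 0" by blast
  then show ?thesis using real_param_point by blast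
qed

text \<open>
  The numerators of \<open>p\<^sub>2/q - l p\<^sub>1/q\<close> and \<open>p\<^sub>3/q - \<chi> p\<^sub>1/q\<close> vanish at \<open>r\<close>; for the second one this is the
  interpolation condition.
\<close>

lemma parametrization_near_lines:
  "\<exists>M\<ge>0. \<forall>r t. poly q r = 0 \<longrightarrow> (\<forall>r'. poly q r' = 0 \<longrightarrow> norm (t - r) \<le> norm (t - r')) \<longrightarrow>
     norm (poly p2 t - slope r * poly p1 t) \<le> M * norm (poly q t) \<and>
     norm (poly p3 t - lift_coord \<FF> C p1 p2 r * poly p1 t) \<le> M * norm (poly q t)"
proof -
  let ?R = "{t. poly q t = 0}"
  have b: "\<exists>M\<ge>0. \<forall>t. (\<forall>r'\<in>?R. norm (t - r) \<le> norm (t - r')) \<longrightarrow> norm (poly p t - c * poly p1 t) \<le> M * norm (poly q t)"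
    if r: "poly q r = 0" and p: "degree p \<le> N" "poly p r = c * poly p1 r" for r c p
  proof -
    have "degree (p - Polynomial.smult c p1) \<le> N"
      using p(1) deg_p(1) degree_smult_le[of c p1] by (intro degree_diff_le) auto
    from quotient_bounded_near_cancelled_pole[OF infinity_count(1,2) refl q0 _ _ this, of r] show ?thesis
      using r p(2) by simp
  qed
  have "\<forall>r\<in>?R. \<exists>M. M \<ge> 0 \<and> (\<forall>t. (\<forall>r'\<in>?R. norm (t - r) \<le> norm (t - r')) \<longrightarrow>
     norm (poly p2 t - slope r * poly p1 t) \<le> M * norm (poly q t) \<and>
     norm (poly p3 t - lift_coord \<FF> C p1 p2 r * poly p1 t) \<le> M * norm (poly q t))"
  proof
    fix r assume "r \<in> ?R"
    then have r: "poly q r = 0" by simp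
    have s: "poly p2 r = slope r * poly p1 r" using root_direction(1)[OF r] by (simp add: slope_def)
    have l: "poly p3 r = lift_coord \<FF> C p1 p2 r * poly p1 r"
      using interpolates_p3 roots_F[OF r] r by (simp add: interpolates_def mult.commute)
    have d3: "degree p3 \<le> N" using pvec_degree[of 3] by simp
    obtain M2 where M2: "M2 \<ge> 0" "\<And>t. (\<forall>r'\<in>?R. norm (t - r) \<le> norm (t - r')) \<Longrightarrow>
      norm (poly p2 t - slope r * poly p1 t) \<le> M2 * norm (poly q t)" using b[OF r deg_p(2) s] by blast
    obtain M3 where M3: "M3 \<ge> 0" "\<And>t. (\<forall>r'\<in>?R. norm (t - r) \<le> norm (t - r')) \<Longrightarrow>
      norm (poly p3 t - lift_coord \<FF> C p1 p2 r * poly p1 t) \<le> M3 * norm (poly q t)" using b[OF r d3 l] by blast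
    have le: "M2 * norm (poly q t) \<le> (M2 + M3) * norm (poly q t)" "M3 * norm (poly q t) \<le> (M2 + M3) * norm (poly q t)" for t
      using M2(1) M3(1) by (auto intro: mult_right_mono)
    then show "\<exists>M. M \<ge> 0 \<and> (\<forall>t. (\<forall>r'\<in>?R. norm (t - r) \<le> norm (t - r')) \<longrightarrow>
     norm (poly p2 t - slope r * poly p1 t) \<le> M * norm (poly q t) \<and>
     norm (poly p3 t - lift_coord \<FF> C p1 p2 r * poly p1 t) \<le> M * norm (poly q t))"
      using add_nonneg_nonneg[OF M2(1) M3(1)] order_trans[OF M2(2) le(1)] order_trans[OF M3(2) le(2)]
      by (intro exI[of _ "M2 + M3"] conjI allI impI) assumption+
  qed
  from bchoice[OF this] obtain Mf where Mf: "\<And>r. r \<in> ?R \<Longrightarrow> Mf r \<ge> 0" "\<And>r t. r \<in> ?R \<Longrightarrow> (\<forall>r'\<in>?R. norm (t - r) \<le> norm (t - r')) \<Longrightarrow>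
     norm (poly p2 t - slope r * poly p1 t) \<le> Mf r * norm (poly q t) \<and>
     norm (poly p3 t - lift_coord \<FF> C p1 p2 r * poly p1 t) \<le> Mf r * norm (poly q t)" by blast
  define M where "M = (\<Sum>r\<in>?R. Mf r)"
  have le: "Mf r * norm (poly q t) \<le> M * norm (poly q t)" if "r \<in> ?R" for r t
    unfolding M_def using that infinity_count(1) Mf(1) by (intro mult_right_mono member_le_sum) auto
  have M0: "M \<ge> 0" unfolding M_def using Mf(1) by (intro sum_nonneg)
  have "norm (poly p2 t - slope r * poly p1 t) \<le> M * norm (poly q t) \<and>
     norm (poly p3 t - lift_coord \<FF> C p1 p2 r * poly p1 t) \<le> M * norm (poly q t)"
    if "poly q r = 0" "\<forall>r'. poly q r' = 0 \<longrightarrow> norm (t - r) \<le> norm (t - r')" for r t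
  proof -
    have r: "r \<in> ?R" and near: "\<forall>r'\<in>?R. norm (t - r) \<le> norm (t - r')" using that by simp_all
    from Mf(2)[OF this] le[OF r, of t] show ?thesis by (blast intro: order_trans)
  qed
  then show ?thesis using M0 by blast
qed

text \<open>
  \<open>q\<close> has as many roots as its degree.
\<close>

lemma root_simple:
  assumes "poly q r = 0"
  shows "poly (pderiv q) r \<noteq> 0"
proof
  assume z: "poly (pderiv q) r = 0"
  obtain w where w: "q = [:-r, 1:] * w" using assms by (metis poly_eq_0_iff_dvd dvdE)
  have w0: "w \<noteq> 0" using w q0 by auto
  have "poly (pderiv q) r = poly w r" unfolding w pderiv_mult by (simp add: pderiv_pCons)
  then have "{t. poly q t = 0} \<subseteq> {t. poly w t = 0}" using z by (auto simp: w)
  then have "N \<le> card {t. poly w t = 0}" using infinity_count(2) card_mono[OF poly_roots_finite[OF w0]] by metis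
  moreover have "N = Suc (degree w)" unfolding w using w0 by (subst degree_mult_eq) auto
  ultimately show False using card_poly_roots_bound[OF w0] by simp
qed

text \<open>
  Each parameter value lies in the region of its nearest root of \<open>q\<close>, and the corresponding point is
  near the line of that root. Conversely, a real direction belongs to a real root, since slopes of
  distinct roots are distinct, and near this root \<open>p\<^sub>1/q\<close> attains every large value \<open>r\<close> at a real
  parameter.
\<close>

theorem output_follows_lines: "follows_lines output real_dirs"
proof -
  let ?R = "{t. poly q t = 0}"
  obtain M where M: "M \<ge> 0" "\<And>r t. poly q r = 0 \<Longrightarrow> (\<forall>r'. poly q r' = 0 \<longrightarrow> norm (t - r) \<le> norm (t - r')) \<Longrightarrow>
     norm (poly p2 t - slope r * poly p1 t) \<le> M * norm (poly q t) \<and>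
     norm (poly p3 t - lift_coord \<FF> C p1 p2 r * poly p1 t) \<le> M * norm (poly q t)"
    using parametrization_near_lines by blast
  have quot: "norm (poly p2 t / poly q t - slope r * (poly p1 t / poly q t)) \<le> M \<and>
      norm (poly p3 t / poly q t - lift_coord \<FF> C p1 p2 r * (poly p1 t / poly q t)) \<le> M"
    if "poly q t \<noteq> 0" "poly q r = 0" "\<forall>r'. poly q r' = 0 \<longrightarrow> norm (t - r) \<le> norm (t - r')" for r t
  proof -
    have "poly p2 t / poly q t - slope r * (poly p1 t / poly q t) = (poly p2 t - slope r * poly p1 t) / poly q t"
      "poly p3 t / poly q t - lift_coord \<FF> C p1 p2 r * (poly p1 t / poly q t) = (poly p3 t - lift_coord \<FF> C p1 p2 r * poly p1 t) / poly q t"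
      by (simp_all add: diff_divide_distrib)
    then show ?thesis using M(2)[OF that(2,3)] that(1) by (simp add: norm_divide pos_divide_le_eq)
  qed
  define c where "c i = coeff (pvec $ i) N / lead_coeff q" for i
  define M1 where "M1 = max M (norm (c 1) + norm (c 2) + norm (c 3))"
  have "norm b \<le> M1 \<or> (\<exists>(l, m)\<in>dirs.
      norm (complex_of_real (b $ 2) - l * complex_of_real (b $ 1)) \<le> M1 \<and>
      norm (complex_of_real (b $ 3) - m * complex_of_real (b $ 1)) \<le> M1)" if b: "b \<in> output" for b
  proof -
    have "(\<exists>t. poly q t \<noteq> 0 \<and> (\<forall>i. complex_of_real (b $ i) = poly (pvec $ i) t / poly q t)) \<or>
        (\<forall>i. complex_of_real (b $ i) = coeff (pvec $ i) N / lead_coeff q)"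
      using b by (intro rational_curve_closure[OF F pvec_F pq_F(3) refl n_pos pvec_degree])
        (auto simp: root_direction(1) real_zeros_def)
    then show ?thesis
    proof
      assume "\<forall>i. complex_of_real (b $ i) = coeff (pvec $ i) N / lead_coeff q"
      then have "\<bar>b $ i\<bar> = norm (c i)" for i unfolding c_def by (metis norm_of_real)
      then have "norm b \<le> norm (c 1) + norm (c 2) + norm (c 3)" using norm_le_sum_3[of b] by simp
      then have "norm b \<le> M1" unfolding M1_def by (rule max.coboundedI2)
      then show ?thesis ..
    next
      assume "\<exists>t. poly q t \<noteq> 0 \<and> (\<forall>i. complex_of_real (b $ i) = poly (pvec $ i) t / poly q t)"
      then obtain t where t: "poly q t \<noteq> 0" "\<And>i. complex_of_real (b $ i) = poly (pvec $ i) t / poly q t" by blast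
      have "?R \<noteq> {}" using infinity_count(2) n_pos by (metis card.empty less_irrefl)
      then obtain r where r: "poly q r = 0" "\<forall>r'. poly q r' = 0 \<longrightarrow> norm (t - r) \<le> norm (t - r')"
        using nearest_exists[OF infinity_count(1), of t] by blast
      from quot[OF t(1) r] show ?thesis
        using t(2)[of 1] t(2)[of 2] t(2)[of 3] lift_coord_dirs[OF r(1)]
        by (intro disjI2 bexI[of _ "(slope r, lift_coord \<FF> C p1 p2 r)"]) (auto simp: M1_def)
    qed
  qed
  from near_real_directions[OF this]
  have 1: "\<exists>M. \<forall>b\<in>output. norm b \<le> M \<or> (\<exists>v\<in>real_dirs. norm (b - (b $ 1) *\<^sub>R v) \<le> M)" by blast
  obtain s where s: "s > 0" "\<And>a b. a \<in> ?R \<Longrightarrow> b \<in> ?R \<Longrightarrow> a \<noteq> b \<Longrightarrow> 2 * s \<le> norm (a - b)"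
    using separated[OF infinity_count(1)] by blast
  have "\<forall>v\<in>real_dirs. \<exists>X. \<forall>r. X \<le> \<bar>r\<bar> \<longrightarrow> (\<exists>b\<in>output. norm (b - r *\<^sub>R v) \<le> 2 * M)"
  proof
    fix v assume "v \<in> real_dirs"
    then obtain l m where lm: "(complex_of_real l, complex_of_real m) \<in> dirs" "v = vector [1, l, m]"
      using real_dirs_cases by blast
    obtain \<xi> where \<xi>: "poly q \<xi> = 0" "slope \<xi> = complex_of_real l" using direction_root[OF lm(1)] by blast
    have "poly q (cnj \<xi>) = 0" "slope (cnj \<xi>) = slope \<xi>" using \<xi> by (simp_all add: cnj_poly slope_cnj)
    then have "cnj \<xi> = \<xi>" using slope_inj \<xi>(1) by blast
    then have "\<xi> \<in> \<real>" by (simp add: Reals_cnj_iff)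
    then obtain x where x: "\<xi> = complex_of_real x" by (auto elim: Reals_cases)
    have lift: "lift_coord \<FF> C p1 p2 \<xi> = complex_of_real m" using lift_coord_dirs[OF \<xi>(1)] \<xi>(2) lm(1) iv by simp
    obtain X where X: "\<And>r. X \<le> \<bar>r\<bar> \<Longrightarrow> \<exists>t. \<bar>t - x\<bar> \<le> s \<and> poly p1 (complex_of_real t) = complex_of_real r * poly q (complex_of_real t)"
      using quotient_attains_large_values[OF real_pq(1,3) _ _ s(1), of x] \<xi>(1) root_simple[OF \<xi>(1)] unfolding x by blast
    have "\<exists>b\<in>output. norm (b - r *\<^sub>R v) \<le> 2 * M" if r: "X \<le> \<bar>r\<bar>" for r
    proof -
      obtain t where t: "\<bar>t - x\<bar> \<le> s" "poly p1 (complex_of_real t) = complex_of_real r * poly q (complex_of_real t)"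
        using X[OF r] by blast
      have qt: "poly q (complex_of_real t) \<noteq> 0" using t(2) root_direction(1)[of "complex_of_real t"] by auto
      have tx: "norm (complex_of_real t - \<xi>) \<le> s" using t(1) unfolding x by (simp only: norm_of_real flip: of_real_diff)
      have near: "\<forall>r'. poly q r' = 0 \<longrightarrow> norm (complex_of_real t - \<xi>) \<le> norm (complex_of_real t - r')"
      proof (intro allI impI)
        fix r' assume r': "poly q r' = 0"
        show "norm (complex_of_real t - \<xi>) \<le> norm (complex_of_real t - r')"
        proof (cases "r' = \<xi>")
          case False
          then have "2 * s \<le> norm (r' - \<xi>)" using s(2)[of r' \<xi>] r' \<xi>(1) by simp
          also have "\<dots> \<le> norm (complex_of_real t - r') + norm (complex_of_real t - \<xi>)"
            using norm_triangle_ineq4[of "complex_of_real t - \<xi>" "complex_of_real t - r'"] by simp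
          finally show ?thesis using tx by linarith
        qed simp
      qed
      obtain b where b: "b \<in> output" "\<And>i. complex_of_real (b $ i) = poly (pvec $ i) (complex_of_real t) / poly q (complex_of_real t)"
        using real_param_point[OF qt] by blast
      have b1: "complex_of_real (b $ 1) = complex_of_real r" using b(2)[of 1] t(2) qt by simp
      have "norm (complex_of_real (b $ 2) - complex_of_real l * complex_of_real (b $ 1)) \<le> M"
        "norm (complex_of_real (b $ 3) - complex_of_real m * complex_of_real (b $ 1)) \<le> M"
        using quot[OF qt \<xi>(1) near] b(2)[of 1] b(2)[of 2] b(2)[of 3] \<xi>(2) lift by simp_all
      then have "\<bar>b $ 2 - l * b $ 1\<bar> \<le> M" "\<bar>b $ 3 - m * b $ 1\<bar> \<le> M"
        by (simp_all only: norm_of_real flip: of_real_mult of_real_diff)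
      moreover have "b $ 1 = r" using b1 by (simp only: of_real_eq_iff)
      ultimately have "norm (b - r *\<^sub>R v) \<le> 2 * M"
        using norm_le_sum_3[of "b - r *\<^sub>R v"] by (simp add: lm(2) mult.commute)
      then show ?thesis using b(1) by blast
    qed
    then show "\<exists>X. \<forall>r. X \<le> \<bar>r\<bar> \<longrightarrow> (\<exists>b\<in>output. norm (b - r *\<^sub>R v) \<le> 2 * M)" by blast
  qed
  from bchoice[OF this] obtain Xf where Xf: "\<And>v r. v \<in> real_dirs \<Longrightarrow> Xf v \<le> \<bar>r\<bar> \<Longrightarrow> \<exists>b\<in>output. norm (b - r *\<^sub>R v) \<le> 2 * M"
    by blast
  have "Xf v \<le> (\<Sum>v\<in>real_dirs. \<bar>Xf v\<bar>)" if "v \<in> real_dirs" for v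
    using member_le_sum[OF that, of "\<lambda>v. \<bar>Xf v\<bar>"] finite_real_dirs by simp
  then have 2: "\<exists>b\<in>output. norm (b - r *\<^sub>R v) \<le> 2 * M" if "v \<in> real_dirs" "(\<Sum>v\<in>real_dirs. \<bar>Xf v\<bar>) \<le> \<bar>r\<bar>" for v r
    using Xf[OF that(1)] that by (meson order_trans)
  show ?thesis unfolding follows_lines_def using 1 2 by blast
qed

end

text \<open>
  A parametrization with zero denominator has no points. This excludes \<open>q = 0\<close>, as the companion curve
  is irreducible and so not empty.
\<close>

lemma empty_param_curve:
  fixes p :: "complex poly ^ 'n::finite"
  assumes "subring_set \<FF>"
  shows "param_curve \<FF> p 0 = {}"
proof -
  have "polyfun \<FF> (\<lambda>v :: 'n \<Rightarrow> complex. 1)" using assms by (intro polyfun_const subring_setD)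
  then obtain P :: "'n cmpoly" where P: "P \<in> mpolys_over \<FF>" "\<And>v. mpoly_eval P v = 1"
    unfolding polyfun_def by blast
  then have "P \<in> vanishing_ideal \<FF> {}" by (simp add: vanishing_ideal_def)
  then have "v \<notin> zero_set \<FF> (vanishing_ideal \<FF> {})" for v :: "complex ^ 'n"
    using P(2)[of "($) v"] by (auto simp: zero_set_def intro!: bexI[of _ P])
  then have "zero_set \<FF> (vanishing_ideal \<FF> {} :: 'n cmpoly set) = {}" by blast
  then show ?thesis by (simp add: param_curve_def zariski_closure_def)
qed

theorem corollary5p5:
  fixes K \<FF> :: "complex set"
    and s :: nat and F :: "nat \<Rightarrow> 3 cmpoly" and C :: "(complex ^ 3) set"
    and p1 p2 q :: "complex poly" and D :: "(complex ^ 2) set"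
  assumes K: "computable_subfield K" "K \<subseteq> \<real>"
    and \<FF>: "\<FF> = alg_closure K"
    and F: "s \<ge> 2" "\<forall>i\<in>{1..s}. F i \<in> mpolys_over K"
    and C: "C = zero_set \<FF> (F ` {1..s})" "irreducible_curve \<FF> C"
      "infinite (real_zeros (F ` {1..s}))" "\<not> planar \<FF> C"
    and i: "finite (pts_at_infinity \<FF> C)" "card (pts_at_infinity \<FF> C) = curve_degree \<FF> C"
    and ii: "birational_onto \<FF> \<pi>\<^sub>z C (zariski_closure \<FF> (\<pi>\<^sub>z ` C))"
      "curve_degree \<FF> C = curve_degree \<FF> (zariski_closure \<FF> (\<pi>\<^sub>z ` C))"
    and iii: "\<forall>l\<in>\<FF>. proj_pt \<FF> (vector [1, 0, l]) 0 \<notin> pts_at_infinity \<FF> C"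
      "\<forall>m\<in>\<FF>. proj_pt \<FF> (vector [0, 1, m]) 0 \<notin> pts_at_infinity \<FF> C"
      "proj_pt \<FF> (vector [0, 0, 1]) 0 \<notin> pts_at_infinity \<FF> C"
    and iv: "\<forall>l\<in>\<FF>. \<forall>m\<in>\<FF>. \<forall>m'\<in>\<FF>.
      proj_pt \<FF> (vector [1, l, m]) 0 \<in> pts_at_infinity \<FF> C \<and>
      proj_pt \<FF> (vector [1, l, m']) 0 \<in> pts_at_infinity \<FF> C \<longrightarrow> m = m'"
    and v: "\<exists>c. c \<noteq> 0 \<and> (\<forall>e. Poly_Mapping.lookup e 3 = tdeg (F 1) \<longrightarrow>
      Poly_Mapping.lookup (F 1) e = (if e = Poly_Mapping.single 3 (tdeg (F 1)) then c else 0))"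
    and pq: "p1 \<in> upolys_over K" "p2 \<in> upolys_over K" "q \<in> upolys_over K"
    and D: "D = param_curve \<FF> (vector [p1, p2]) q" "irreducible_curve \<FF> D"
      "curve_degree \<FF> D = curve_degree \<FF> (zariski_closure \<FF> (\<pi>\<^sub>z ` C))"
      "pts_at_infinity \<FF> D = pts_at_infinity \<FF> (\<pi>\<^sub>z ` C)"
    and deg: "degree p1 \<le> degree q" "degree p2 \<le> degree q" "degree q = curve_degree \<FF> D"
    and cop: "coprime p1 q" "coprime p2 q"
    and attained: "\<forall>X \<in> pts_at_infinity \<FF> D. \<exists>t\<in>\<FF>.
      X = proj_pt \<FF> (vector [poly p1 t, poly p2 t]) (poly q t)"
  shows "hausdorff_dist (real_zeros (F ` {1..s}))
    (real_zeros (vanishing_ideal \<FF> (output_curve \<FF> C p1 p2 q))) < \<infinity>"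
proof -
  interpret space_curve K \<FF> "F ` {1..s}" C
  proof
    show "is_subfield K" using K(1) by (simp add: computable_subfield_def)
    show "zariski_irreducible \<FF> C" using C(2) by (simp add: irreducible_curve_def)
  qed (use K(2) \<FF> F C(1) in auto)
  interpret companion_data K \<FF> "F ` {1..s}" C "F 1" p1 p2 q
  proof
    show "card (pts_at_infinity \<FF> C) = degree q" "curve_degree \<FF> C = degree q"
      "curve_degree \<FF> (zariski_closure \<FF> (\<pi>\<^sub>z ` C)) = degree q" using i(2) ii(2) D(3) deg(3) by simp_all
    show "m = m'" if "(l, m) \<in> dirs" "(l, m') \<in> dirs" for l m m' using iv that unfolding dirs_def by blast
    have "1 \<in> {1..s}" using \<open>2 \<le> s\<close> by simp
    then show "F 1 \<in> F ` {1..s}" by (rule imageI)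
    have "D \<noteq> {}" using D(2) unfolding irreducible_curve_def zariski_irreducible_def by blast
    then show "q \<noteq> 0" using D(1) empty_param_curve[OF A] by auto
    show "\<exists>t\<in>\<FF>. X = proj_pt \<FF> (vector [poly p1 t, poly p2 t]) (poly q t)" if "X \<in> pts_at_infinity \<FF> (\<pi>\<^sub>z ` C)" for X
      using attained that D(4) by blast
    show "proj_pt \<FF> (vector [1, 0, l]) 0 \<notin> pts_at_infinity \<FF> C"
      "proj_pt \<FF> (vector [0, 1, l]) 0 \<notin> pts_at_infinity \<FF> C" if "l \<in> \<FF>" for l
      using bspec[OF iii(1) that] bspec[OF iii(2) that] by this+
  qed (fact C(4) i(1) ii(1) iii(3) v pq(1) pq(2) pq(3) deg(1) deg(2))+
  have "real_zeros (F ` {1..s}) \<noteq> {}" using C(3) by auto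
  from hausdorff_dist_finite[OF real_curve_follows_lines output_follows_lines this output_nonempty finite_real_dirs]
  show ?thesis unfolding output_curve_def pvec_def p3_def .
qed

end
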